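(* Let $T>0$, let $\mathbb T=\mathbb R/\mathbb Z$ and $\Pi_T=(0,T)\times\mathbb T$. Let $\mathbf h_0=(h_{10},h_{20})\in C^\alpha(\mathbb T)$ with $\alpha\in(0,1)$, $u_0\in W^1_2(\mathbb T)$ and $u_1\in L_2(\mathbb T)$. Assume that: (a) $r=r(z)$, $\nu=\nu(z)$, $\mathbf j=\mathbf j(t,z)=(j_1,j_2)$ and $f=f(t,z)$ are functions that are 1-periodic in $z$, piecewise smooth, bounded, and discontinuous at each point $z=z_k+\kappa$ ($k=1,\dots,M$; $M\in\mathbb N$; $\kappa\in\mathbb Z$), where $0<z_1<z_2<\dots<z_M<1$; (b) $p$ is a positive number and there exist constants $0<r_0,\nu_0,r_1,\nu_1<\infty$ such that $r_0\le r\le r_1$ and $\nu_0\le\nu\le\nu_1$. Then the periodically Cauchy diffraction problem $$\mathbf h_t=(r\,\mathbf h_z-\mathbf h\,u_t-r\,\mathbf j)_z,\qquad u_{tt}=(\nu^2u_z-p\,\mathbf h^2)_z+f\quad\text{in }\Pi_T,$$ $$\mathbf h=\mathbf h_0,\quad u=u_0,\quad u_t=u_1\quad\text{on }\{0\}\times\mathbb T,$$ with the compatibility conditions $[\mathbf h]=\mathbf 0$, $[u]=0$, $[r(\mathbf h_z-\mathbf j)]=\mathbf 0$, $[\nu^2u_z]=0$ at the points $z_k+\kappa$, has a weak solution $(\mathbf h,u)$ with $\mathbf h\in V_2(\Pi_T)$ and $u\in W^{1,1}_2(\Pi_T)$.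
   Context: Functions on $\mathbb T$ are identified with 1-periodic functions on $\mathbb R$. The unknowns are $\mathbf h=(h_1,h_2):\Pi_T\to\mathbb R^2$ and $u:\Pi_T\to\mathbb R$; $\mathbf h^2=h_1^2+h_2^2$; membership of a vector function in a space is componentwise. "Piecewise smooth" means smooth on each of the pieces into which the points $z_k+\kappa$ divide the $z$-line (respectively on $(0,T)$ times each such piece), with at most jump discontinuities at those points. $[v]$ denotes the jump of $v$ across a point of discontinuity. Spaces. $W^1_2(\mathbb T)$ is the usual Sobolev space of $L_2(\mathbb T)$ functions with weak derivative in $L_2(\mathbb T)$; $C^\alpha(\mathbb T)$ is the space of $\alpha$-Hölder continuous 1-periodic functions. For $k=0,1$, $W^{1,k}_2(\Pi_T)$ is the Hilbert space with scalar product $\iint_{\Pi_T}(uv+u_zv_z+k\,u_tv_t)\,dz\,dt$. $V_2(\Pi_T)$ is the space of all $v\in W^{1,0}_2(\Pi_T)$ with finite norm $|v|_{\Pi_T}=\operatorname{ess\,sup}_{t\in[0,T]}\|v(t)\|_{L_2(\mathbb T)}+\|v_z\|_{L_2(\Pi_T)}$. Weak solution. A pair $\mathbf h\in V_2(\Pi_T)$, $u\in W^{1,1}_2(\Pi_T)$ (1-periodic in $z$) is a weak solution of the problem if $u(0)=u_0$ and, for all $\eta,\zeta\in W^{1,1}_2(\Pi_T)$ vanishing at $t=T$, $$-\iint_{\Pi_T}h_l\eta_t+\iint_{\Pi_T}r\,h_{lz}\eta_z-\iint_{\Pi_T}h_lu_t\eta_z=\iint_{\Pi_T}r\,j_l\eta_z+\int_{\mathbb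 T}h_{l0}\,\eta(0)\,dz\quad(l=1,2),$$ $$-\iint_{\Pi_T}u_t\zeta_t+\iint_{\Pi_T}\nu^2u_z\zeta_z+\iint_{\Pi_T}p\,(\mathbf h^2)_z\,\zeta=\iint_{\Pi_T}f\zeta+\int_{\mathbb T}u_1\,\zeta(0)\,dz,$$ the double integrals being with respect to $dz\,dt$. The conditions $[r(\mathbf h_z-\mathbf j)]=\mathbf 0$, $[\nu^2u_z]=0$ are understood in the sense of these identities. *)

theory Defs
  imports "HOL-Analysis.Analysis"
begin

section \<open>Functions on the circle and on the space-time cylinder\<close>

text \<open>
  Functions on the circle are 1-periodic functions on the real line; functions on the cylinder
  \<open>(0,T) \<times> circle\<close> are functions of a pair \<open>(t, z)\<close> that are 1-periodic in \<open>z\<close> for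
  \<open>0 < t < T\<close> (their values for other \<open>t\<close> are irrelevant). All integrals are taken over one period.
\<close>

abbreviation circle :: "real set" where
  "circle \<equiv> {0..<1}"

abbreviation cylinder :: "real \<Rightarrow> (real \<times> real) set" where
  "cylinder T \<equiv> {0<..<T} \<times> circle"

definition periodic_z :: "real \<Rightarrow> (real \<times> real \<Rightarrow> 'b) \<Rightarrow> bool" where
  "periodic_z T v \<longleftrightarrow> (\<forall>t\<in>{0<..<T}. periodic_fun_simple' (\<lambda>z. v (t, z)))"


section \<open>Smoothness\<close>

text \<open>Continuous partial derivatives up to order \<open>k\<close> on a set \<open>S\<close>, which is open in all uses.\<close>

primrec Ck_on :: "nat \<Rightarrow> 'a::euclidean_space set \<Rightarrow> ('a \<Rightarrow> 'b::real_normed_vector) \<Rightarrow> bool" where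
  "Ck_on 0 S g \<longleftrightarrow> continuous_on S g"
| "Ck_on (Suc k) S g \<longleftrightarrow>
     (\<forall>x\<in>S. g differentiable (at x)) \<and>
     (\<forall>i\<in>Basis. Ck_on k S (\<lambda>x. frechet_derivative g (at x) i))"

definition smooth_on :: "'a::euclidean_space set \<Rightarrow> ('a \<Rightarrow> 'b::real_normed_vector) \<Rightarrow> bool" where
  "smooth_on S g \<longleftrightarrow> (\<forall>k. Ck_on k S g)"

definition break_points :: "nat \<Rightarrow> (nat \<Rightarrow> real) \<Rightarrow> real set" where
  "break_points M zs = {zs k + of_int \<kappa> | k \<kappa>. k \<in> {1..M}}"

definition at_most_jump :: "(real \<Rightarrow> 'b::real_normed_vector) \<Rightarrow> real \<Rightarrow> bool" where
  "at_most_jump g x \<longleftrightarrow>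
     (\<exists>a. (g \<longlongrightarrow> a) (at_left x)) \<and> (\<exists>b. (g \<longlongrightarrow> b) (at_right x))"

text \<open>
  The pieces are the connected components of the complement of the (closed, discrete) set \<open>P\<close>;
  smoothness on each of these open pieces is smoothness on \<open>- P\<close>.
\<close>

definition piecewise_smooth :: "real set \<Rightarrow> (real \<Rightarrow> 'b::real_normed_vector) \<Rightarrow> bool" where
  "piecewise_smooth P g \<longleftrightarrow> smooth_on (- P) g \<and> (\<forall>x\<in>P. at_most_jump g x)"

definition piecewise_smooth_z ::
    "real \<Rightarrow> real set \<Rightarrow> (real \<times> real \<Rightarrow> 'b::real_normed_vector) \<Rightarrow> bool" where
  "piecewise_smooth_z T P g \<longleftrightarrow>
     smooth_on ({0<..<T} \<times> (- P)) g \<and>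
     (\<forall>t\<in>{0<..<T}. \<forall>x\<in>P. at_most_jump (\<lambda>z. g (t, z)) x)"


section \<open>Function spaces\<close>

definition L2_on :: "'a::euclidean_space set \<Rightarrow> ('a \<Rightarrow> real) \<Rightarrow> bool" where
  "L2_on S g \<longleftrightarrow> g \<in> borel_measurable (lebesgue_on S) \<and>
     integrable (lebesgue_on S) (\<lambda>x. (g x)\<^sup>2)"

definition L2_norm :: "'a::euclidean_space set \<Rightarrow> ('a \<Rightarrow> real) \<Rightarrow> real" where
  "L2_norm S g = sqrt (LINT x|lebesgue_on S. (g x)\<^sup>2)"

definition L2_circle :: "(real \<Rightarrow> real) \<Rightarrow> bool" where
  "L2_circle g \<longleftrightarrow> periodic_fun_simple' g \<and> L2_on circle g"

definition holder_circle :: "real \<Rightarrow> (real \<Rightarrow> real) \<Rightarrow> bool" where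
  "holder_circle \<alpha> g \<longleftrightarrow> periodic_fun_simple' g \<and>
     (\<exists>C. \<forall>x y. \<bar>g x - g y\<bar> \<le> C * \<bar>x - y\<bar> powr \<alpha>)"

text \<open>
  Weak derivatives on the circle and on the cylinder are tested against \<^emph>\<open>periodic\<close> smooth
  functions, so that periodicity (and absence of jumps in \<open>z\<close>) is built into the spaces.
\<close>

definition has_weak_deriv_circle :: "(real \<Rightarrow> real) \<Rightarrow> (real \<Rightarrow> real) \<Rightarrow> bool" where
  "has_weak_deriv_circle g w \<longleftrightarrow>
     integrable (lebesgue_on circle) g \<and> integrable (lebesgue_on circle) w \<and>
     (\<forall>\<phi>. smooth_on UNIV \<phi> \<and> periodic_fun_simple' \<phi> \<longrightarrow>
        (LINT z|lebesgue_on circle. g z * deriv \<phi> z)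
        = - (LINT z|lebesgue_on circle. w z * \<phi> z))"

definition W12_circle :: "(real \<Rightarrow> real) \<Rightarrow> bool" where
  "W12_circle g \<longleftrightarrow> L2_circle g \<and> (\<exists>w. has_weak_deriv_circle g w \<and> L2_on circle w)"

definition test_function :: "real \<Rightarrow> (real \<times> real \<Rightarrow> real) \<Rightarrow> bool" where
  "test_function T \<phi> \<longleftrightarrow> smooth_on UNIV \<phi> \<and> periodic_z T \<phi> \<and>
     (\<exists>a b. 0 < a \<and> b < T \<and> (\<forall>t z. t \<notin> {a..b} \<longrightarrow> \<phi> (t, z) = 0))"

definition has_weak_dt :: "real \<Rightarrow> (real \<times> real \<Rightarrow> real) \<Rightarrow> (real \<times> real \<Rightarrow> real) \<Rightarrow> bool" where
  "has_weak_dt T v w \<longleftrightarrow>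
     integrable (lebesgue_on (cylinder T)) v \<and> integrable (lebesgue_on (cylinder T)) w \<and>
     (\<forall>\<phi>. test_function T \<phi> \<longrightarrow>
        (LINT (t, z)|lebesgue_on (cylinder T). v (t, z) * deriv (\<lambda>s. \<phi> (s, z)) t)
        = - (LINT x|lebesgue_on (cylinder T). w x * \<phi> x))"

definition has_weak_dz :: "real \<Rightarrow> (real \<times> real \<Rightarrow> real) \<Rightarrow> (real \<times> real \<Rightarrow> real) \<Rightarrow> bool" where
  "has_weak_dz T v w \<longleftrightarrow>
     integrable (lebesgue_on (cylinder T)) v \<and> integrable (lebesgue_on (cylinder T)) w \<and>
     (\<forall>\<phi>. test_function T \<phi> \<longrightarrow>
        (LINT (t, z)|lebesgue_on (cylinder T). v (t, z) * deriv (\<lambda>y. \<phi> (t, y)) z)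
        = - (LINT x|lebesgue_on (cylinder T). w x * \<phi> x))"

text \<open>
  Weak derivatives are unique up to null sets; \<open>weak_dt\<close> and \<open>weak_dz\<close> pick a representative and
  are used only where a weak derivative exists.
\<close>

definition weak_dt :: "real \<Rightarrow> (real \<times> real \<Rightarrow> real) \<Rightarrow> real \<times> real \<Rightarrow> real" where
  "weak_dt T v = (SOME w. has_weak_dt T v w)"

definition weak_dz :: "real \<Rightarrow> (real \<times> real \<Rightarrow> real) \<Rightarrow> real \<times> real \<Rightarrow> real" where
  "weak_dz T v = (SOME w. has_weak_dz T v w)"

text \<open>The spaces \<open>W\<^sub>2\<close> with exponents \<open>(1,0)\<close> and \<open>(1,1)\<close>, and \<open>V\<^sub>2\<close>, on the cylinder.\<close>

definition W12_10 :: "real \<Rightarrow> (real \<times> real \<Rightarrow> real) \<Rightarrow> bool" where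
  "W12_10 T v \<longleftrightarrow> periodic_z T v \<and> L2_on (cylinder T) v \<and>
     (\<exists>w. has_weak_dz T v w \<and> L2_on (cylinder T) w)"

definition W12_11 :: "real \<Rightarrow> (real \<times> real \<Rightarrow> real) \<Rightarrow> bool" where
  "W12_11 T v \<longleftrightarrow> W12_10 T v \<and> (\<exists>w. has_weak_dt T v w \<and> L2_on (cylinder T) w)"

text \<open>
  Finiteness of the essential supremum in the norm of \<open>V\<^sub>2\<close> is written out as an almost everywhere
  bound; the other summand of the norm is finite on the whole space \<open>W12_10\<close>.
\<close>

definition V2 :: "real \<Rightarrow> (real \<times> real \<Rightarrow> real) \<Rightarrow> bool" where
  "V2 T v \<longleftrightarrow> W12_10 T v \<and>
     (\<exists>C. AE t in lebesgue_on {0<..<T}.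
        L2_on circle (\<lambda>z. v (t, z)) \<and> L2_norm circle (\<lambda>z. v (t, z)) \<le> C)"

text \<open>
  The value \<open>v(s)\<close> at a single time \<open>s\<close>, \<open>0 \<le> s \<le> T\<close>, is that of the representative of \<open>v\<close> which is
  continuous on \<open>[0,T]\<close> with values in \<open>L\<^sub>2\<close>; such a representative exists for all \<open>v\<close> in \<open>W12_11\<close>.
\<close>

definition has_time_trace ::
    "real \<Rightarrow> (real \<times> real \<Rightarrow> real) \<Rightarrow> real \<Rightarrow> (real \<Rightarrow> real) \<Rightarrow> bool" where
  "has_time_trace T v s g \<longleftrightarrow>
     (\<exists>w. (AE x in lebesgue_on (cylinder T). w x = v x) \<and>
          (\<forall>t\<in>{0..T}. L2_on circle (\<lambda>z. w (t, z))) \<and>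
          (\<forall>t\<in>{0..T}. ((\<lambda>\<tau>. L2_norm circle (\<lambda>z. w (\<tau>, z) - w (t, z))) \<longlongrightarrow> 0)
                        (at t within {0..T})) \<and>
          (AE z in lebesgue_on circle. w (s, z) = g z))"

definition time_trace :: "real \<Rightarrow> (real \<times> real \<Rightarrow> real) \<Rightarrow> real \<Rightarrow> real \<Rightarrow> real" where
  "time_trace T v s = (SOME g. has_time_trace T v s g)"


section \<open>Weak solutions of the diffraction problem\<close>

text \<open>
  The compatibility conditions \<open>[h] = 0\<close> and \<open>[u] = 0\<close> are contained in the membership in \<open>V2\<close> and
  \<open>W12_11\<close>, the conditions \<open>[r (h_z - j)] = 0\<close> and \<open>[\<nu>\<^sup>2 u_z] = 0\<close> in the integral identities (whose
  test functions do not vanish at the points of discontinuity).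
\<close>

definition test_space :: "real \<Rightarrow> (real \<times> real \<Rightarrow> real) \<Rightarrow> bool" where
  "test_space T \<eta> \<longleftrightarrow> W12_11 T \<eta> \<and> has_time_trace T \<eta> T (\<lambda>_. 0)"

definition sq_norm2 :: "(real \<times> real \<Rightarrow> real ^ 2) \<Rightarrow> real \<times> real \<Rightarrow> real" where
  "sq_norm2 h x = (h x $ 1)\<^sup>2 + (h x $ 2)\<^sup>2"

definition h_identity ::
    "real \<Rightarrow> (real \<Rightarrow> real) \<Rightarrow> (real \<times> real \<Rightarrow> real) \<Rightarrow> (real \<Rightarrow> real) \<Rightarrow>
     (real \<times> real \<Rightarrow> real) \<Rightarrow> (real \<times> real \<Rightarrow> real) \<Rightarrow> (real \<times> real \<Rightarrow> real) \<Rightarrow> bool" where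
  "h_identity T r jl hl0 hl u \<eta> \<longleftrightarrow>
     - (LINT x|lebesgue_on (cylinder T). hl x * weak_dt T \<eta> x)
     + (LINT x|lebesgue_on (cylinder T). r (snd x) * weak_dz T hl x * weak_dz T \<eta> x)
     - (LINT x|lebesgue_on (cylinder T). hl x * weak_dt T u x * weak_dz T \<eta> x)
     = (LINT x|lebesgue_on (cylinder T). r (snd x) * jl x * weak_dz T \<eta> x)
     + (LINT z|lebesgue_on circle. hl0 z * time_trace T \<eta> 0 z)"

definition u_identity ::
    "real \<Rightarrow> (real \<Rightarrow> real) \<Rightarrow> real \<Rightarrow> (real \<times> real \<Rightarrow> real) \<Rightarrow> (real \<Rightarrow> real) \<Rightarrow>
     (real \<times> real \<Rightarrow> real ^ 2) \<Rightarrow> (real \<times> real \<Rightarrow> real) \<Rightarrow> (real \<times> real \<Rightarrow> real) \<Rightarrow> bool" where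
  "u_identity T \<nu> p f u1 h u \<zeta> \<longleftrightarrow>
     - (LINT x|lebesgue_on (cylinder T). weak_dt T u x * weak_dt T \<zeta> x)
     + (LINT x|lebesgue_on (cylinder T). (\<nu> (snd x))\<^sup>2 * weak_dz T u x * weak_dz T \<zeta> x)
     + (LINT x|lebesgue_on (cylinder T). p * weak_dz T (sq_norm2 h) x * \<zeta> x)
     = (LINT x|lebesgue_on (cylinder T). f x * \<zeta> x)
     + (LINT z|lebesgue_on circle. u1 z * time_trace T \<zeta> 0 z)"

text \<open>
  All integrands are integrable for \<open>h\<close> in \<open>V2\<close> and \<open>u\<close>, \<open>\<eta>\<close>, \<open>\<zeta>\<close> in \<open>W12_11\<close> (and bounded
  measurable coefficients). The existence of the weak derivative of \<open>sq_norm2 h\<close>, which also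
  follows from \<open>h\<close> being in \<open>V2\<close>, is required explicitly because \<open>weak_dz\<close> is total.
\<close>

definition weak_solution ::
    "real \<Rightarrow> (real \<Rightarrow> real) \<Rightarrow> (real \<Rightarrow> real) \<Rightarrow> real \<Rightarrow> (real \<times> real \<Rightarrow> real ^ 2) \<Rightarrow>
     (real \<times> real \<Rightarrow> real) \<Rightarrow> (real \<Rightarrow> real ^ 2) \<Rightarrow> (real \<Rightarrow> real) \<Rightarrow> (real \<Rightarrow> real) \<Rightarrow>
     (real \<times> real \<Rightarrow> real ^ 2) \<Rightarrow> (real \<times> real \<Rightarrow> real) \<Rightarrow> bool" where
  "weak_solution T r \<nu> p j f h0 u0 u1 h u \<longleftrightarrow>
     (\<forall>l. V2 T (\<lambda>x. h x $ l)) \<and> W12_11 T u \<and>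
     (\<exists>w. has_weak_dz T (sq_norm2 h) w) \<and>
     has_time_trace T u 0 u0 \<and>
     (\<forall>\<eta>. test_space T \<eta> \<longrightarrow>
        (\<forall>l. h_identity T r (\<lambda>x. j x $ l) (\<lambda>z. h0 z $ l) (\<lambda>x. h x $ l) u \<eta>)) \<and>
     (\<forall>\<zeta>. test_space T \<zeta> \<longrightarrow> u_identity T \<nu> p f u1 h u \<zeta>)"

end

theory Submission
  imports Defs "HOL-Computational_Algebra.Polynomial"
begin

text \<open>
  The problem is discretised by difference quotients of step \<open>d\<close> in \<open>z\<close> and by explicit Euler steps
  \<open>tau\<close> in \<open>t\<close>, with \<open>tau\<close> tiny compared with \<open>d\<close>. If \<open>D\<close> is the forward difference quotient and \<open>A\<close> the
  average over \<open>[z, z + d]\<close>, then \<open>(A g)' = D g\<close>; with the nonlinear terms written through \<open>A h\<close> and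
  \<open>D h\<close> as below, they cancel exactly in the balance of the discrete energy
  \<open>p |h|^2 + |v|^2 / 2 + |\<nu> D u|^2 / 2\<close>, \<open>v = u_t\<close>, and the Euler scheme adds only an error of order
  \<open>tau^2\<close>. This bounds \<open>h\<close>, \<open>v\<close> and \<open>D u\<close> in \<open>L\<^sub>2\<close> uniformly in time, and \<open>D h\<close> in \<open>L\<^sub>2\<close> of the cylinder.

  Read as step functions of \<open>t\<close>, the approximations have weak limits in \<open>L\<^sub>2\<close> along an ultrafilter.
  The increments of \<open>h\<close> in time are \<open>z\<close>-derivatives of functions bounded in \<open>L\<^sub>2\<close>, so averages of \<open>A h\<close>
  over a fixed length are equicontinuous in \<open>(t, z)\<close>; since \<open>D h\<close> is bounded, \<open>A h\<close> is close to its
  averages and hence converges strongly. Therefore the products \<open>A h v\<close> and \<open>(A h)^2\<close> pass to the limit.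
\<close>

section \<open>Square integrable functions and weak limits\<close>

text \<open>The limit has to be tested with functions whose \<open>z\<close>-derivative is merely
  square integrable. Convergence of \<open>A h v\<close> and \<open>(A h)^2\<close> against bounded
  tests is therefore not enough: the products must themselves be bounded in \<open>L2\<close> of the
  cylinder. In one space dimension they are. On a time slice the square of \<open>sup |A h|\<close>
  is at most twice the sum of the squared \<open>L2\<close> norms of \<open>A h\<close> and
  \<open>D h\<close>, which is integrable in time by the dissipation, while the other factor is
  bounded in \<open>L2\<close> uniformly in time. Test functions are not approximated by smooth
  ones: integration by parts is done with primitives, for which it is Fubini's theorem. The Euler
  error is controlled by constants that blow up as \<open>d\<close> tends to 0, since each discrete
  derivative costs \<open>1/d\<close>. They depend on \<open>d\<close>, on bounds of the data and on
  the energy bound \<open>B\<close> but not on \<open>tau\<close>; so \<open>B\<close> is fixed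
  first and \<open>tau\<close> is then chosen for each \<open>d\<close>. Jumps of the data are
  handled by averaging: averages converge at every point of continuity, hence almost everywhere, and
  the transmission conditions are part of the integral identities.\<close>

abbreviation Borel :: "('a::topological_space \<Rightarrow> 'b::topological_space) set" where
  "Borel \<equiv> borel_measurable borel"

definition sqi :: "'a measure \<Rightarrow> ('a \<Rightarrow> real) \<Rightarrow> bool" where
  "sqi M f \<longleftrightarrow> f \<in> borel_measurable M \<and> integrable M (\<lambda>x. (f x)^2)"

lemma sqiD [dest]: "sqi M f \<Longrightarrow> f \<in> borel_measurable M" "sqi M f \<Longrightarrow> integrable M (\<lambda>x. (f x)^2)"
  by (auto simp: sqi_def)

lemma sqi_mult_integrable:
  assumes "sqi M f" "sqi M g" shows "integrable M (\<lambda>x. f x * g x)"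
proof (rule Bochner_Integration.integrable_bound)
  show "integrable M (\<lambda>x. (f x)^2 + (g x)^2)" using assms by (auto simp: sqi_def)
  show "(\<lambda>x. f x * g x) \<in> borel_measurable M" using assms by (auto simp: sqi_def)
  have "\<bar>a * b\<bar> \<le> a^2 + b^2" for a b :: real
  proof -
    have "2 * \<bar>a * b\<bar> \<le> a^2 + b^2"
      using sum_squares_bound[of "\<bar>a\<bar>" "\<bar>b\<bar>"] by (simp add: abs_mult)
    then show ?thesis using abs_ge_zero[of "a * b"] by linarith
  qed
  then show "AE x in M. norm (f x * g x) \<le> norm ((f x)^2 + (g x)^2)" by auto
qed

lemma sqi_bounded_mult:
  assumes "sqi M f" "b \<in> borel_measurable M" "AE x in M. \<bar>b x\<bar> \<le> C"
  shows "sqi M (\<lambda>x. b x * f x)"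
proof -
  have m: "(\<lambda>x. b x * f x) \<in> borel_measurable M" using assms by (auto simp: sqi_def)
  have "integrable M (\<lambda>x. (b x * f x)^2)"
  proof (rule Bochner_Integration.integrable_bound)
    show "integrable M (\<lambda>x. C^2 * (f x)^2)" using assms by (auto simp: sqi_def)
    show "(\<lambda>x. (b x * f x)^2) \<in> borel_measurable M" using m by measurable
    show "AE x in M. norm ((b x * f x)^2) \<le> norm (C^2 * (f x)^2)"
      using assms(3)
    proof eventually_elim
      case (elim x)
      then have "(b x)^2 \<le> C^2" by (metis abs_ge_zero order_trans power2_abs power_mono)
      then show ?case by (simp add: power_mult_distrib mult_right_mono)
    qed
  qed
  with m show ?thesis by (simp add: sqi_def)
qed

lemma sqi_cmult: "sqi M f \<Longrightarrow> sqi M (\<lambda>x. c * f x)" for c :: real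
  by (rule sqi_bounded_mult[where C="\<bar>c\<bar>"]) auto

lemma sqi_add:
  assumes "sqi M f" "sqi M g" shows "sqi M (\<lambda>x. f x + g x)"
  using assms sqi_mult_integrable[OF assms] unfolding sqi_def
  by (auto simp: power2_sum mult.assoc)

lemma sqi_minus: "sqi M f \<Longrightarrow> sqi M (\<lambda>x. - f x)" by (auto simp: sqi_def)

lemma sqi_diff: "sqi M f \<Longrightarrow> sqi M g \<Longrightarrow> sqi M (\<lambda>x. f x - g x)"
  using sqi_add[of M f "\<lambda>x. - g x"] sqi_minus[of M g] by auto

lemma sqi_zero [simp]: "sqi M (\<lambda>x. 0)" by (simp add: sqi_def)

lemma (in finite_measure) sqi_bounded:
  assumes "b \<in> borel_measurable M" "AE x in M. \<bar>b x\<bar> \<le> C" shows "sqi M b"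
proof -
  have "sqi M (\<lambda>_. 1)" by (auto simp: sqi_def)
  from sqi_bounded_mult[OF this assms] show ?thesis by simp
qed

lemma (in finite_measure) sqi_const [simp]: "sqi M (\<lambda>_. c)" by (auto simp: sqi_def)

lemma (in finite_measure) sqi_integrable: "sqi M f \<Longrightarrow> integrable M f"
  using sqi_mult_integrable[of M f "\<lambda>_. 1"] by simp

lemma sqi_cong_AE:
  assumes "sqi M f" "g \<in> borel_measurable M" "AE x in M. f x = g x" shows "sqi M g"
proof -
  have "integrable M (\<lambda>x. (g x)^2) \<longleftrightarrow> integrable M (\<lambda>x. (f x)^2)"
    using assms by (intro integrable_cong_AE) (auto simp: sqi_def)
  then show ?thesis using assms by (auto simp: sqi_def)
qed

text \<open>A quadratic polynomial in \<open>s\<close> that never becomes negative has a nonpositive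
  discriminant; for \<open>D = 0\<close> it is affine and must be constant. This gives the
  Cauchy-Schwarz inequality and, with \<open>A = 0\<close>, the vanishing of the first variation in
  \<open>L2_Riesz\<close>.\<close>

lemma discriminant_bound:
  fixes A B D :: real
  assumes "\<And>s. 0 \<le> A + 2 * s * B + s^2 * D" "0 \<le> D"
  shows "B^2 \<le> A * D"
proof (cases "D = 0")
  case True
  have "B = 0"
  proof (rule ccontr)
    assume "B \<noteq> 0"
    \<comment> \<open>At this \<open>s\<close> the affine function takes the value -1.\<close>
    then show False using assms(1)[of "- (A + 1) / (2 * B)"] True by (auto simp: field_simps)
  qed
  then show ?thesis using True by simp
next
  case False
  have "0 \<le> (A + 2 * (- B / D) * B + (- B / D)^2 * D) * D"
    by (rule mult_nonneg_nonneg[OF assms(1)[of "- B / D"] assms(2)])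
  also have "\<dots> = A * D - B^2" using False by (auto simp: field_simps power2_eq_square)
  finally show ?thesis by simp
qed

lemma integral_square_add:
  assumes "sqi M f" "sqi M g"
  shows "(LINT x|M. (f x + s * g x)^2)
    = (LINT x|M. (f x)^2) + 2 * s * (LINT x|M. f x * g x) + s^2 * (LINT x|M. (g x)^2)"
proof -
  note [simp] = sqi_mult_integrable[OF assms] sqiD(2)[OF assms(1)] sqiD(2)[OF assms(2)]
  have "(LINT x|M. (f x + s * g x)^2) = (LINT x|M. (f x)^2 + (2 * s) * (f x * g x) + s^2 * (g x)^2)"
    by (intro Bochner_Integration.integral_cong) (auto simp: power2_sum power_mult_distrib algebra_simps)
  then show ?thesis by simp
qed

lemma Cauchy_Schwarz_integral:
  assumes "sqi M f" "sqi M g"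
  shows "(LINT x|M. f x * g x)^2 \<le> (LINT x|M. (f x)^2) * (LINT x|M. (g x)^2)"
proof (rule discriminant_bound)
  show "0 \<le> (LINT x|M. (f x)^2) + 2 * s * (LINT x|M. f x * g x) + s^2 * (LINT x|M. (g x)^2)" for s
    unfolding integral_square_add[OF assms, symmetric] by simp
qed simp

lemma Cauchy_Schwarz_abs:
  assumes "sqi M f" "sqi M g" "(LINT x|M. (f x)^2) \<le> a" "(LINT x|M. (g x)^2) \<le> b"
  shows "\<bar>LINT x|M. f x * g x\<bar> \<le> sqrt (a * b)"
proof -
  have "(LINT x|M. f x * g x)^2 \<le> (LINT x|M. (f x)^2) * (LINT x|M. (g x)^2)"
    by (rule Cauchy_Schwarz_integral[OF assms(1,2)])
  also have "\<dots> \<le> a * b" by (intro mult_mono assms) (auto intro: order_trans[OF _ assms(3)])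
  finally show ?thesis by (metis real_sqrt_abs real_sqrt_le_iff)
qed

lemma sqi_abs: "sqi M f \<Longrightarrow> sqi M (\<lambda>x. \<bar>f x\<bar>)" by (auto simp: sqi_def)

lemma Cauchy_Schwarz_abs':
  assumes "sqi M f" "sqi M g" "(LINT x|M. (f x)^2) \<le> a" "(LINT x|M. (g x)^2) \<le> b"
  shows "(LINT x|M. \<bar>f x * g x\<bar>) \<le> sqrt (a * b)"
  using Cauchy_Schwarz_abs[of M "\<lambda>x. \<bar>f x\<bar>" "\<lambda>x. \<bar>g x\<bar>" a b] assms by (auto simp: sqi_abs abs_mult)

lemma (in finite_measure) integral_abs_le:
  assumes "sqi M f"
  shows "(LINT x|M. \<bar>f x\<bar>) \<le> sqrt (measure M (space M) * (LINT x|M. (f x)^2))"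
  using Cauchy_Schwarz_abs'[of M f "\<lambda>_. 1" "LINT x|M. (f x)^2" "measure M (space M)"] assms
  by (auto simp: mult.commute)

lemma integral_square_sum_le:
  assumes "sqi M f" "sqi M g"
  shows "(LINT x|M. (f x + g x)^2) \<le> 2 * (LINT x|M. (f x)^2) + 2 * (LINT x|M. (g x)^2)"
proof -
  have "(LINT x|M. (f x + g x)^2) \<le> (LINT x|M. 2 * (f x)^2 + 2 * (g x)^2)"
  proof (rule integral_mono)
    show "integrable M (\<lambda>x. (f x + g x)^2)" using sqi_add[OF assms] by auto
    show "integrable M (\<lambda>x. 2 * (f x)^2 + 2 * (g x)^2)" using assms by (auto simp: sqi_def)
    show "(f x + g x)^2 \<le> 2 * (f x)^2 + 2 * (g x)^2" for x
      using sum_squares_bound[of "f x" "g x"] unfolding power2_sum by linarith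
  qed
  then show ?thesis using assms by (auto simp: sqi_def)
qed

text \<open>Along a subsequence whose successive differences have \<open>L2\<close> norm at most
  \<open>(1/2)^k\<close> the sum of these differences is integrable, because the measure is finite,
  so the subsequence converges almost everywhere. Fatou's lemma carries the Cauchy estimate of the
  whole sequence over to the pointwise limit.\<close>

proposition (in finite_measure) L2_complete:
  assumes f: "\<And>n. sqi M (f n)"
    and cauchy: "\<And>e. 0 < e \<Longrightarrow> \<exists>N. \<forall>m\<ge>N. \<forall>n\<ge>N. (LINT x|M. (f m x - f n x)^2) \<le> e"
  shows "\<exists>g. sqi M g \<and> (\<lambda>n. LINT x|M. (f n x - g x)^2) \<longlonglongrightarrow> 0"
proof -
  have [measurable]: "f n \<in> borel_measurable M" for n using f by auto
  have "\<exists>N. \<forall>k. \<forall>m\<ge>N k. \<forall>n\<ge>N k. (LINT x|M. (f m x - f n x)^2) \<le> (1/4::real)^k"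
    by (rule choice) (auto intro!: cauchy)
  then obtain N where N: "\<And>k m n. m \<ge> N k \<Longrightarrow> n \<ge> N k \<Longrightarrow> (LINT x|M. (f m x - f n x)^2) \<le> (1/4::real)^k"
    by blast
  \<comment> \<open>Partial sums of \<open>N\<close> give one nondecreasing sequence of indices that
    dominates every \<open>N k\<close>.\<close>
  define s where "s k = (\<Sum>i\<le>k. N i)" for k
  have sN: "N k \<le> s k" for k unfolding s_def by (rule member_le_sum) auto
  have s_mono: "s k \<le> s (Suc k)" for k by (simp add: s_def)
  have s_mono': "k \<le> l \<Longrightarrow> s k \<le> s l" for k l by (rule lift_Suc_mono_le[of s, OF s_mono])
  define d where "d k x = f (s (Suc k)) x - f (s k) x" for k x
  have d: "sqi M (d k)" for k unfolding d_def by (intro sqi_diff f)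
  have [measurable]: "d k \<in> borel_measurable M" for k using d by auto
  define c where "c = sqrt (measure M (space M))"
  have dle: "(LINT x|M. \<bar>d k x\<bar>) \<le> c * (1/2)^k" for k
  proof -
    have "(LINT x|M. \<bar>d k x\<bar>) \<le> sqrt (measure M (space M) * (LINT x|M. (d k x)^2))"
      by (rule integral_abs_le[OF d])
    also have "\<dots> \<le> sqrt (measure M (space M) * (1/4)^k)"
      unfolding d_def by (intro real_sqrt_le_mono mult_left_mono N) (auto intro: order_trans[OF sN s_mono] sN)
    also have "\<dots> = c * (1/2)^k"
      by (simp add: c_def real_sqrt_mult real_sqrt_power real_sqrt_divide)
    finally show ?thesis .
  qed
  have "(\<integral>\<^sup>+x. (\<Sum>k. ennreal \<bar>d k x\<bar>) \<partial>M) = (\<Sum>k. \<integral>\<^sup>+x. ennreal \<bar>d k x\<bar> \<partial>M)"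
    by (rule nn_integral_suminf) simp
  also have "\<dots> = (\<Sum>k. ennreal (LINT x|M. \<bar>d k x\<bar>))"
    by (intro suminf_cong nn_integral_eq_integral) (auto intro!: sqi_integrable[OF sqi_abs[OF d]])
  also have "\<dots> \<le> (\<Sum>k. ennreal (c * (1/2)^k))"
    by (intro suminf_le summableI ennreal_leI dle)
  also have "\<dots> = ennreal (\<Sum>k. c * (1/2)^k)"
    by (intro suminf_ennreal2) (auto simp: c_def intro!: summable_mult summable_geometric)
  also have "\<dots> < \<infinity>" by simp
  finally have "AE x in M. (\<Sum>k. ennreal \<bar>d k x\<bar>) \<noteq> \<infinity>"
    by (intro nn_integral_PInf_AE) auto
  then have conv: "AE x in M. convergent (\<lambda>k. f (s k) x)"
  proof eventually_elim
    case (elim x)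
    then have "summable (\<lambda>k. \<bar>d k x\<bar>)" by (intro summable_suminf_not_top) (auto simp: top_ennreal_def infinity_ennreal_def)
    then have "summable (\<lambda>k. d k x)" by (rule summable_rabs_cancel)
    then obtain l where l: "(\<lambda>n. \<Sum>k<n. d k x) \<longlonglongrightarrow> l" by (auto simp: summable_def sums_def)
    have "(\<Sum>k<n. d k x) = f (s n) x - f (s 0) x" for n
      unfolding d_def by (rule sum_lessThan_telescope)
    with l have "(\<lambda>n. f (s n) x - f (s 0) x + f (s 0) x) \<longlonglongrightarrow> l + f (s 0) x" by (intro tendsto_intros) simp
    then show ?case by (auto simp: convergent_def)
  qed
  define g where "g x = lim (\<lambda>k. f (s k) x)" for x
  have g_meas [measurable]: "g \<in> borel_measurable M" unfolding g_def by (rule borel_measurable_lim_metric) simp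
  have lim: "AE x in M. (\<lambda>k. f (s k) x) \<longlonglongrightarrow> g x"
    using conv by eventually_elim (simp add: g_def convergent_LIMSEQ_iff)
  have est: "(\<integral>\<^sup>+x. ennreal ((f n x - g x)^2) \<partial>M) \<le> ennreal ((1/4)^k)" if "n \<ge> N k" for n k
  proof -
    have "(\<integral>\<^sup>+x. ennreal ((f n x - g x)^2) \<partial>M) = (\<integral>\<^sup>+x. liminf (\<lambda>l. ennreal ((f n x - f (s l) x)^2)) \<partial>M)"
      using lim
    proof (intro nn_integral_cong_AE, eventually_elim)
      case (elim x)
      then have "(\<lambda>l. ennreal ((f n x - f (s l) x)^2)) \<longlonglongrightarrow> ennreal ((f n x - g x)^2)"
        by (intro tendsto_intros)
      then show ?case by (rule lim_imp_Liminf[symmetric, rotated]) simp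
    qed
    also have "\<dots> \<le> liminf (\<lambda>l. \<integral>\<^sup>+x. ennreal ((f n x - f (s l) x)^2) \<partial>M)"
      by (rule nn_integral_liminf) simp
    also have "\<dots> \<le> limsup (\<lambda>l. \<integral>\<^sup>+x. ennreal ((f n x - f (s l) x)^2) \<partial>M)" by (rule Liminf_le_Limsup) simp
    also have "\<dots> \<le> ennreal ((1/4)^k)"
    proof (rule Limsup_bounded, rule eventually_sequentiallyI)
      fix l assume "k \<le> l"
      then have "N k \<le> s l" using sN[of k] s_mono' order_trans by blast
      then have "(LINT x|M. (f n x - f (s l) x)^2) \<le> (1/4)^k" using that N by blast
      moreover have "(\<integral>\<^sup>+x. ennreal ((f n x - f (s l) x)^2) \<partial>M) = ennreal (LINT x|M. (f n x - f (s l) x)^2)"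
        by (rule nn_integral_eq_integral) (use sqi_diff[OF f f, of n "s l"] in auto)
      ultimately show "(\<integral>\<^sup>+x. ennreal ((f n x - f (s l) x)^2) \<partial>M) \<le> ennreal ((1/4)^k)"
        by (simp add: ennreal_leI)
    qed
    finally show ?thesis .
  qed
  have fg: "sqi M (\<lambda>x. f n x - g x)" if "n \<ge> N 0" for n
    using est[OF that] by (auto simp: sqi_def integrable_iff_bounded intro: order.strict_trans1)
  \<comment> \<open>Membership of \<open>g\<close> in \<open>L2\<close> is read off from the
    estimate of the difference \<open>f n - g\<close>.\<close>
  have "sqi M (\<lambda>x. f (N 0) x - (f (N 0) x - g x))" by (intro sqi_diff f fg) simp
  then have g: "sqi M g" by simp
  have "(\<lambda>n. LINT x|M. (f n x - g x)^2) \<longlonglongrightarrow> 0"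
  proof (rule LIMSEQ_I)
    fix e :: real assume "0 < e"
    then obtain k where k: "(1/4::real)^k < e" using real_arch_pow_inv[of e "1/4"] by auto
    show "\<exists>n0. \<forall>n\<ge>n0. norm ((LINT x|M. (f n x - g x)^2) - 0) < e"
    proof (intro exI allI impI)
      fix n assume n: "N k \<le> n"
      have "ennreal (LINT x|M. (f n x - g x)^2) = (\<integral>\<^sup>+x. ennreal ((f n x - g x)^2) \<partial>M)"
        by (rule nn_integral_eq_integral[symmetric]) (use sqi_diff[OF f g] in auto)
      also have "\<dots> \<le> ennreal ((1/4)^k)" by (rule est[OF n])
      finally have "(LINT x|M. (f n x - g x)^2) \<le> (1/4)^k" by (simp add: ennreal_le_iff)
      then show "norm ((LINT x|M. (f n x - g x)^2) - 0) < e" using k by simp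
    qed
  qed
  with g show ?thesis by blast
qed

text \<open>Here \<open>A\<close> and \<open>B\<close> are the squared norms of two functions,
  \<open>P\<close> is their inner product, and \<open>x\<close>, \<open>y\<close> are the values of
  the functional. The first hypothesis says that \<open>J\<close> at the midpoint is at least
  \<open>m\<close>; the conclusion says that two functions nearly minimising \<open>J\<close> are
  close to each other.\<close>

lemma parallelogram_arith:
  fixes A B P AB AB' x y m :: real
  assumes "m \<le> 1/4 * AB' - 2 * ((x + y) / 2)" "AB = A + 2 * (-1) * P + (-1)^2 * B"
    "AB' = A + 2 * 1 * P + 1^2 * B"
  shows "AB \<le> 2 * (A - 2 * x - m) + 2 * (B - 2 * y - m)"
  using assms by (simp add: field_simps)

text \<open>The representing function minimises \<open>\<integral>f^2 - 2 L f\<close>.\<close>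

proposition (in finite_measure) L2_Riesz:
  assumes add: "\<And>f g. sqi M f \<Longrightarrow> sqi M g \<Longrightarrow> L (\<lambda>x. f x + g x) = L f + L g"
    and scale: "\<And>c f. sqi M f \<Longrightarrow> L (\<lambda>x. c * f x) = c * L f"
    and bound: "\<And>f. sqi M f \<Longrightarrow> \<bar>L f\<bar> \<le> C * sqrt (LINT x|M. (f x)^2)"
  shows "\<exists>g. sqi M g \<and> (\<forall>f. sqi M f \<longrightarrow> L f = (LINT x|M. g x * f x))"
proof -
  define J where "J f = (LINT x|M. (f x)^2) - 2 * L f" for f
  \<comment> \<open>With \<open>n\<close> the norm of \<open>f\<close>, the bound on
    \<open>L\<close> gives \<open>J f \<ge> n^2 - 2 C n\<close>, and completing the square bounds
    this from below.\<close>
  have Jlow: "- (C^2) \<le> J f" if "sqi M f" for f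
  proof -
    let ?n = "sqrt (LINT x|M. (f x)^2)"
    have "?n^2 = (LINT x|M. (f x)^2)" by simp
    moreover have "2 * L f \<le> 2 * C * ?n" using bound[OF that] by simp
    moreover have "0 \<le> (?n - C)^2" by simp
    ultimately show ?thesis unfolding J_def by (simp add: power2_diff algebra_simps)
  qed
  define m where "m = Inf (J ` {f. sqi M f})"
  have bdd: "bdd_below (J ` {f. sqi M f})" using Jlow by (auto intro!: bdd_belowI2)
  have m_le: "m \<le> J f" if "sqi M f" for f unfolding m_def using that bdd by (intro cInf_lower) auto
  have "\<exists>f. sqi M f \<and> J f < m + 1 / real (Suc n)" for n
  proof -
    have ne: "J ` {f. sqi M f} \<noteq> {}" using sqi_zero by blast
    show ?thesis using cInf_lessD[OF ne, of "m + 1 / real (Suc n)"] by (auto simp: m_def)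
  qed
  then obtain f where f: "\<And>n. sqi M (f n)" and fm: "\<And>n. J (f n) < m + 1 / real (Suc n)" by metis
  have para: "(LINT x|M. (a x - b x)^2) \<le> 2 * (J a - m) + 2 * (J b - m)" if a: "sqi M a" and b: "sqi M b" for a b
  proof -
    let ?c = "\<lambda>x. (1/2) * (a x + b x)"
    have c: "sqi M ?c" by (intro sqi_cmult sqi_add a b)
    have Lc: "L ?c = (L a + L b) / 2" using scale[OF sqi_add[OF a b], of "1/2"] add[OF a b] by simp
    have e1: "(LINT x|M. (a x + (-1) * b x)^2)
      = (LINT x|M. (a x)^2) + 2 * (-1) * (LINT x|M. a x * b x) + (-1)^2 * (LINT x|M. (b x)^2)"
      by (rule integral_square_add[OF a b])
    have e2: "(LINT x|M. (a x + 1 * b x)^2)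
      = (LINT x|M. (a x)^2) + 2 * 1 * (LINT x|M. a x * b x) + 1^2 * (LINT x|M. (b x)^2)"
      by (rule integral_square_add[OF a b])
    have e3: "(LINT x|M. (?c x)^2) = (1/4) * (LINT x|M. (a x + 1 * b x)^2)"
      by (simp add: power_mult_distrib power_divide)
    show ?thesis using parallelogram_arith[OF _ e1 e2] m_le[OF c] unfolding J_def Lc e3 by simp
  qed
  have "\<exists>N. \<forall>m\<ge>N. \<forall>n\<ge>N. (LINT x|M. (f m x - f n x)^2) \<le> e" if "0 < e" for e
  proof -
    obtain N where N: "inverse (real (Suc N)) < e * inverse 4"
      using \<open>0 < e\<close> reals_Archimedean[of "e * inverse 4"] by auto
    have J: "4 * (J (f n) - m) \<le> e" if "n \<ge> N" for n
    proof -
      have "1 / real (Suc n) \<le> 1 / real (Suc N)" using that by (intro divide_left_mono) auto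
      moreover have "4 * (1 / real (Suc N)) < e" using N by (simp add: inverse_eq_divide field_simps)
      ultimately show ?thesis using fm[of n] by argo
    qed
    have "(LINT x|M. (f k x - f n x)^2) \<le> e" if "k \<ge> N" "n \<ge> N" for k n
      using para[OF f f, of k n] J[OF that(1)] J[OF that(2)] by argo
    then show ?thesis by blast
  qed
  from L2_complete[OF f this]
  obtain g where g: "sqi M g" and lim: "(\<lambda>n. LINT x|M. (f n x - g x)^2) \<longlonglongrightarrow> 0" by blast
  \<comment> \<open>The right side is \<open>J (g + s \<phi>) - J g\<close>; it is nonnegative for
    every \<open>s\<close> because \<open>g\<close> minimises \<open>J\<close>.\<close>
  have key: "0 \<le> 2 * s * ((LINT x|M. g x * \<phi> x) - L \<phi>) + s^2 * (LINT x|M. (\<phi> x)^2)" if \<phi>: "sqi M \<phi>" for s \<phi>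
  proof -
    have lower: "J (\<lambda>x. g x + s * \<phi> x) \<ge> m" by (intro m_le sqi_add g sqi_cmult \<phi>)
    \<comment> \<open>\<open>J\<close> is continuous in the \<open>L2\<close> norm, so its value at
      the limit of the minimising sequence is at most the infimum.\<close>
    have Jg: "J g \<le> m"
    proof -
      let ?N = "\<lambda>h. sqrt (LINT x|M. (h x)^2)"
      let ?d = "\<lambda>n x. f n x - g x"
      have d: "sqi M (?d n)" for n by (intro sqi_diff f g)
      have "J g \<le> (m + 1 / real (Suc n)) + (2 * ?N g + 2 * C) * ?N (?d n)" for n
      proof -
        have eq: "(LINT x|M. (f n x)^2) = (LINT x|M. (g x)^2) + 2 * (LINT x|M. g x * ?d n x) + (LINT x|M. (?d n x)^2)"
          using integral_square_add[OF g d, of 1 n] by simp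
        have 1: "\<bar>LINT x|M. g x * ?d n x\<bar> \<le> ?N g * ?N (?d n)"
          using Cauchy_Schwarz_abs[OF g d order_refl order_refl] by (simp only: real_sqrt_mult)
        have 2: "L (f n) = L g + L (?d n)" using add[OF g d, of n] by simp
        have 3: "\<bar>L (?d n)\<bar> \<le> C * ?N (?d n)" by (rule bound[OF d])
        have 4: "0 \<le> (LINT x|M. (?d n x)^2)" by simp
        have 5: "J g = J (f n) - 2 * (LINT x|M. g x * ?d n x) - (LINT x|M. (?d n x)^2) + 2 * L (?d n)"
          unfolding J_def eq 2 by (simp only: algebra_simps)
        show ?thesis using 1 3 4 fm[of n] unfolding 5 distrib_right mult.assoc abs_le_iff by argo
      qed
      moreover have "(\<lambda>n. (m + 1 / real (Suc n)) + (2 * ?N g + 2 * C) * ?N (?d n)) \<longlonglongrightarrow> (m + 0) + (2 * ?N g + 2 * C) * sqrt 0"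
        by (intro tendsto_intros lim) (rule LIMSEQ_inverse_real_of_nat[unfolded inverse_eq_divide])
      ultimately show ?thesis by (intro LIMSEQ_le_const[where X = "\<lambda>n. (m + 1 / real (Suc n)) + (2 * ?N g + 2 * C) * ?N (?d n)"]) auto
    qed
    have "J (\<lambda>x. g x + s * \<phi> x) = J g + 2 * s * ((LINT x|M. g x * \<phi> x) - L \<phi>) + s^2 * (LINT x|M. (\<phi> x)^2)"
      unfolding J_def integral_square_add[OF g \<phi>] add[OF g sqi_cmult[OF \<phi>]] scale[OF \<phi>] by (simp add: algebra_simps)
    with lower Jg show ?thesis by simp
  qed
  have "L \<phi> = (LINT x|M. g x * \<phi> x)" if "sqi M \<phi>" for \<phi>
    using discriminant_bound[of 0 "(LINT x|M. g x * \<phi> x) - L \<phi>" "LINT x|M. (\<phi> x)^2"] key[OF that] by auto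
  with g show ?thesis by blast
qed

text \<open>Limits along an ultrafilter of sequences of naturals replace the passage to subsequences.\<close>

definition ultra :: "nat filter \<Rightarrow> bool" where
  "ultra F \<longleftrightarrow> F \<noteq> bot \<and> F \<le> sequentially \<and> (\<forall>P. eventually P F \<or> eventually (\<lambda>x. \<not> P x) F)"

text \<open>Zorn's lemma for the families of eventually true predicates: a finer filter has a larger
  family, so a maximal family belongs to an ultrafilter. The union of a chain of families belongs to
  the infimum of the filters, which is proper because a chain is directed. Starting below
  \<open>sequentially\<close> makes all ordinary limits available.\<close>

lemma ex_ultra: "\<exists>F. ultra F"
proof -
  define S where "S = {F :: nat filter. F \<noteq> bot \<and> F \<le> sequentially}"
  define ev where "ev F = {P :: nat \<Rightarrow> bool. eventually P F}" for F
  have le_ev: "F \<le> G \<longleftrightarrow> ev G \<subseteq> ev F" for F G by (auto simp: ev_def le_filter_def)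
  have inj_ev: "ev F = ev G \<Longrightarrow> F = G" for F G by (simp add: le_ev order_antisym)
  have "\<exists>U\<in>ev ` S. \<forall>X\<in>ev ` S. U \<subseteq> X \<longrightarrow> X = U"
  proof (rule subset_Zorn_nonempty)
    have "sequentially \<in> S" by (auto simp: S_def)
    then show "ev ` S \<noteq> {}" by blast
    fix C assume C: "C \<noteq> {}" "subset.chain (ev ` S) C"
    define B where "B = {F \<in> S. ev F \<in> C}"
    have CB: "C = ev ` B" using C(2) by (auto simp: B_def subset_chain_def)
    have B: "B \<noteq> {}" using C(1) CB by auto
    have dir: "\<exists>x\<in>B. x \<le> inf F G" if "F \<in> B" "G \<in> B" for F G
    proof -
      have "ev F \<subseteq> ev G \<or> ev G \<subseteq> ev F" using C(2) that by (auto simp: B_def subset_chain_def)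
      then show ?thesis using that by (auto simp: le_ev[symmetric])
    qed
    have evInf: "eventually P (Inf B) \<longleftrightarrow> (\<exists>b\<in>B. eventually P b)" for P
      by (rule eventually_Inf_base[OF B dir])
    have "Inf B \<noteq> bot"
    proof
      assume "Inf B = bot"
      then obtain b where "b \<in> B" "eventually (\<lambda>_. False) b" using evInf[of "\<lambda>_. False"] by auto
      then show False by (auto simp: B_def S_def eventually_False)
    qed
    moreover have "Inf B \<le> sequentially" using B by (auto simp: B_def S_def intro: Inf_lower2)
    moreover have "ev (Inf B) = \<Union>C" unfolding CB by (auto simp: ev_def evInf)
    ultimately show "\<Union>C \<in> ev ` S" by (auto simp: S_def intro!: image_eqI[of _ _ "Inf B"])
  qed
  then obtain F where F: "F \<in> S" and max: "\<And>G. G \<in> S \<Longrightarrow> G \<le> F \<Longrightarrow> G = F"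
    using inj_ev unfolding le_ev by (smt (verit) imageE imageI)
  have "eventually P F \<or> eventually (\<lambda>x. \<not> P x) F" for P
  proof (cases "inf F (principal {x. P x}) = bot")
    case True
    then show ?thesis by (auto simp: eventually_inf_principal eventually_False[symmetric])
  next
    case False
    \<comment> \<open>If \<open>P\<close> does not contradict \<open>F\<close>, adding it gives a
      filter in \<open>S\<close>, and by maximality \<open>P\<close> was already eventually
      true.\<close>
    have "inf F (principal {x. P x}) = F"
      using F False by (intro max) (auto simp: S_def intro: le_infI1)
    then have "F \<le> principal {x. P x}" by (metis inf.cobounded2)
    then show ?thesis by (simp add: le_principal)
  qed
  then show ?thesis using F by (auto simp: ultra_def S_def)
qed

text \<open>Compactness of the interval gives a cluster point, and along an ultrafilter a cluster
  point is a limit: otherwise the sequence would eventually avoid one of its neighbourhoods.\<close>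

lemma ultra_convergent:
  fixes a :: "nat \<Rightarrow> real"
  assumes F: "ultra F" and a: "\<And>k. \<bar>a k\<bar> \<le> C"
  shows "\<exists>l. (a \<longlongrightarrow> l) F"
proof -
  have "\<exists>x\<in>{-C..C}. inf (nhds x) (filtermap a F) \<noteq> bot"
    using compact_Icc[of "-C" C] F a unfolding compact_filter
    by (auto simp: ultra_def filtermap_bot_iff eventually_filtermap abs_le_iff minus_le_iff)
  then obtain l where l: "inf (nhds l) (filtermap a F) \<noteq> bot" by blast
  have "(a \<longlongrightarrow> l) F"
    unfolding tendsto_def
  proof (intro allI impI)
    fix S assume S: "open S" "l \<in> S"
    show "eventually (\<lambda>x. a x \<in> S) F"
    proof (rule ccontr)
      assume "\<not> ?thesis"
      then have "eventually (\<lambda>x. a x \<notin> S) F" using F by (auto simp: ultra_def)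
      then have "eventually (\<lambda>y. y \<notin> S) (filtermap a F)" by (simp add: eventually_filtermap)
      moreover have "eventually (\<lambda>y. y \<in> S) (nhds l)" using S by (rule eventually_nhds_in_open)
      ultimately have "eventually (\<lambda>y. False) (inf (nhds l) (filtermap a F))"
        by (auto simp: eventually_inf)
      then show False using l by (simp add: eventually_False)
    qed
  qed
  then show ?thesis by blast
qed

lemma ultra_not_bot: "ultra F \<Longrightarrow> F \<noteq> bot" by (simp add: ultra_def)

lemma ultra_tendsto: "ultra F \<Longrightarrow> a \<longlonglongrightarrow> l \<Longrightarrow> (a \<longlongrightarrow> l) F"
  by (auto simp: ultra_def intro: tendsto_mono)

definition wconv :: "nat filter \<Rightarrow> 'a measure \<Rightarrow> (nat \<Rightarrow> 'a \<Rightarrow> real) \<Rightarrow> ('a \<Rightarrow> real) \<Rightarrow> bool" where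
  "wconv F M x X \<longleftrightarrow> sqi M X \<and>
     (\<forall>\<phi>. sqi M \<phi> \<longrightarrow> ((\<lambda>k. LINT z|M. x k z * \<phi> z) \<longlongrightarrow> (LINT z|M. X z * \<phi> z)) F)"

definition bddL2 :: "'a measure \<Rightarrow> (nat \<Rightarrow> 'a \<Rightarrow> real) \<Rightarrow> bool" where
  "bddL2 M x \<longleftrightarrow> (\<forall>k. sqi M (x k)) \<and> (\<exists>C. \<forall>k. (LINT z|M. (x k z)^2) \<le> C)"

lemma bddL2_bound: "bddL2 M x \<Longrightarrow> \<exists>C\<ge>0. \<forall>k. (LINT z|M. (x k z)^2) \<le> C"
  unfolding bddL2_def by (metis abs_ge_self abs_ge_zero order_trans)

lemma bddL2_sqi: "bddL2 M x \<Longrightarrow> sqi M (x k)"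
  by (auto simp: bddL2_def)

lemma sqi_CS_sqrt:
  assumes "sqi M f" "sqi M g" "(LINT z|M. (f z)^2) \<le> C"
  shows "\<bar>LINT z|M. f z * g z\<bar> \<le> sqrt C * sqrt (LINT z|M. (g z)^2)"
  using Cauchy_Schwarz_abs[OF assms order_refl] by (simp add: real_sqrt_mult)

text \<open>Weak compactness of bounded sets. Along an ultrafilter the scalar sequences for all
  tests converge at once, which replaces a diagonal argument over a dense set of tests. The limits
  form a bounded linear functional, and Riesz representation turns it into a function.\<close>

theorem (in finite_measure) weak_limit_exists:
  assumes F: "ultra F" and x: "bddL2 M x"
  shows "\<exists>X. wconv F M x X"
proof -
  obtain C where C: "\<And>k. (LINT z|M. (x k z)^2) \<le> C" using bddL2_bound[OF x] by blast
  note x = bddL2_sqi[OF x]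
  note CS = sqi_CS_sqrt[OF x _ C]
  define L where "L \<phi> = Lim F (\<lambda>k. LINT z|M. x k z * \<phi> z)" for \<phi>
  have L: "((\<lambda>k. LINT z|M. x k z * \<phi> z) \<longlongrightarrow> L \<phi>) F" if \<phi>: "sqi M \<phi>" for \<phi>
  proof -
    obtain l where "((\<lambda>k. LINT z|M. x k z * \<phi> z) \<longlongrightarrow> l) F"
      using ultra_convergent[OF F, of "\<lambda>k. LINT z|M. x k z * \<phi> z", OF CS[OF \<phi>]] by blast
    moreover from tendsto_Lim[OF ultra_not_bot[OF F] this] have "L \<phi> = l" unfolding L_def .
    ultimately show ?thesis by simp
  qed
  note uniq = tendsto_unique[OF ultra_not_bot[OF F]]
  have a1: "L (\<lambda>x. f x + g x) = L f + L g" if f: "sqi M f" and g: "sqi M g" for f g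
    proof (rule uniq[OF L[OF sqi_add[OF f g]]])
      have "((\<lambda>k. (LINT z|M. x k z * f z) + (LINT z|M. x k z * g z)) \<longlongrightarrow> L f + L g) F"
        by (intro tendsto_intros L f g)
      then show "((\<lambda>k. LINT z|M. x k z * (f z + g z)) \<longlongrightarrow> L f + L g) F"
        using sqi_mult_integrable[OF x f] sqi_mult_integrable[OF x g] by (simp add: distrib_left)
    qed
  have a2: "L (\<lambda>x. c * f x) = c * L f" if f: "sqi M f" for c f
    proof (rule uniq[OF L[OF sqi_cmult[OF f]]])
      have "((\<lambda>k. c * (LINT z|M. x k z * f z)) \<longlongrightarrow> c * L f) F" by (intro tendsto_intros L f)
      then show "((\<lambda>k. LINT z|M. x k z * (c * f z)) \<longlongrightarrow> c * L f) F"
        by (simp add: mult.left_commute)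
    qed
  have a3: "\<bar>L f\<bar> \<le> sqrt C * sqrt (LINT x|M. (f x)^2)" if f: "sqi M f" for f
      using tendsto_rabs[OF L[OF f]] by (rule tendsto_upperbound) (simp_all add: CS[OF f] ultra_not_bot[OF F])
  from L2_Riesz[of L "sqrt C", OF a1 a2 a3]
  obtain X where X: "sqi M X" "\<forall>\<phi>. sqi M \<phi> \<longrightarrow> L \<phi> = (LINT z|M. X z * \<phi> z)" by blast
  have "wconv F M x X" unfolding wconv_def using X L by simp
  then show ?thesis by blast
qed

section \<open>Smooth functions\<close>

text \<open>\<open>Ck_on\<close> speaks about \<open>frechet_derivative\<close>; this rule accepts
  any derivative, and uniqueness identifies the two.\<close>

lemma Ck_on_SucI:
  assumes "\<And>x. (g has_derivative g' x) (at x)" "\<And>i. i \<in> Basis \<Longrightarrow> Ck_on k UNIV (\<lambda>x. g' x i)"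
  shows "Ck_on (Suc k) UNIV g"
proof -
  have "frechet_derivative g (at x) = g' x" for x using frechet_derivative_at[OF assms(1)] by simp
  then show ?thesis using assms by (auto simp: differentiable_def)
qed

lemma Ck_on_Suc_deriv:
  "Ck_on (Suc k) UNIV g \<Longrightarrow> (g has_derivative frechet_derivative g (at x)) (at x)"
  by (simp add: frechet_derivative_works[symmetric])

lemma Ck_on_Suc_imp: "Ck_on (Suc k) UNIV g \<Longrightarrow> Ck_on k UNIV g"
proof (induction k arbitrary: g)
  case 0
  then show ?case by (auto intro!: differentiable_imp_continuous_on simp: differentiable_on_def)
next
  case (Suc k)
  then show ?case unfolding Ck_on.simps(2)[of "Suc k"] Ck_on.simps(2)[of k UNIV g] by blast
qed

lemma Ck_const: "Ck_on k UNIV (\<lambda>x. c)"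
  by (induction k arbitrary: c) (auto intro!: Ck_on_SucI derivative_eq_intros simp del: Ck_on.simps(2))

lemma Ck_add:
  "Ck_on k UNIV f \<Longrightarrow> Ck_on k UNIV g \<Longrightarrow> Ck_on k UNIV (\<lambda>x. f x + g x)"
proof (induction k arbitrary: f g)
  case 0 then show ?case by (auto intro: continuous_intros)
next
  case (Suc k)
  note d = Ck_on_Suc_deriv[OF Suc.prems(1)] Ck_on_Suc_deriv[OF Suc.prems(2)]
  show ?case
    by (rule Ck_on_SucI[OF has_derivative_add[OF d]], rule Suc.IH) (use Suc.prems in auto)
qed

lemma Ck_mult:
  fixes f g :: "'a::euclidean_space \<Rightarrow> real"
  shows "Ck_on k UNIV f \<Longrightarrow> Ck_on k UNIV g \<Longrightarrow> Ck_on k UNIV (\<lambda>x. f x * g x)"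
proof (induction k arbitrary: f g)
  case 0 then show ?case by (auto intro: continuous_intros)
next
  case (Suc k)
  note d = Ck_on_Suc_deriv[OF Suc.prems(1)] Ck_on_Suc_deriv[OF Suc.prems(2)]
  show ?case
    by (rule Ck_on_SucI[OF has_derivative_mult[OF d]], intro Ck_add Suc.IH)
       (use Suc.prems in \<open>auto dest: Ck_on_Suc_imp simp del: Ck_on.simps(2)\<close>, use Suc.prems in auto)
qed

text \<open>The chain rule has to produce a product of real functions, so that the induction can use
  \<open>Ck_mult\<close>. Since \<open>g\<close> has one real argument, its derivative is
  multiplication by the value at 1.\<close>

lemma Ck_compose:
  fixes g :: "real \<Rightarrow> real" and a :: "'a::euclidean_space \<Rightarrow> real"
  shows "Ck_on k UNIV g \<Longrightarrow> Ck_on k UNIV a \<Longrightarrow> Ck_on k UNIV (\<lambda>x. g (a x))"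
proof (induction k arbitrary: g)
  case 0
  then show ?case by (auto intro: continuous_on_compose2)
next
  case (Suc k)
  note d = Ck_on_Suc_deriv[OF Suc.prems(1)] Ck_on_Suc_deriv[OF Suc.prems(2)]
  have D: "((\<lambda>x. g (a x)) has_derivative
      (\<lambda>h. frechet_derivative a (at x) h * frechet_derivative g (at (a x)) 1)) (at x)" for x
  proof -
    have "((\<lambda>x. g (a x)) has_derivative (\<lambda>h. frechet_derivative g (at (a x)) (frechet_derivative a (at x) h))) (at x)"
      by (rule has_derivative_compose[OF d(2) d(1)])
    moreover have "(\<lambda>h. frechet_derivative g (at (a x)) (frechet_derivative a (at x) h))
        = (\<lambda>h. frechet_derivative a (at x) h * frechet_derivative g (at (a x)) 1)"
    proof
      fix h
      show "frechet_derivative g (at (a x)) (frechet_derivative a (at x) h)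
        = frechet_derivative a (at x) h * frechet_derivative g (at (a x)) 1"
        using linear_scale[OF has_derivative_linear[OF d(1)[of "a x"]], of "frechet_derivative a (at x) h" 1]
        by simp
    qed
    ultimately show ?thesis by (rule has_derivative_eq_rhs)
  qed
  show ?case
  proof (rule Ck_on_SucI[where g'="\<lambda>x h. frechet_derivative a (at x) h * frechet_derivative g (at (a x)) 1"])
    show "((\<lambda>x. g (a x)) has_derivative
      (\<lambda>h. frechet_derivative a (at x) h * frechet_derivative g (at (a x)) 1)) (at x)" for x by (rule D)
    fix i :: 'a assume "i \<in> Basis"
    then have "Ck_on k UNIV (\<lambda>x. frechet_derivative a (at x) i)" using Suc.prems by auto
    moreover have "Ck_on k UNIV (\<lambda>x. frechet_derivative g (at (a x)) 1)"
    proof (rule Suc.IH[of "\<lambda>x. frechet_derivative g (at x) 1"])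
      show "Ck_on k UNIV a" by (rule Ck_on_Suc_imp[OF Suc.prems(2)])
      show "Ck_on k UNIV (\<lambda>x. frechet_derivative g (at x) 1)" using Suc.prems(1) by simp
    qed
    ultimately show "Ck_on k UNIV (\<lambda>x. frechet_derivative a (at x) i * frechet_derivative g (at (a x)) 1)"
      by (rule Ck_mult)
  qed
qed

lemma Ck_linear:
  fixes f :: "'a::euclidean_space \<Rightarrow> real"
  assumes "bounded_linear f" shows "Ck_on k UNIV f"
proof (cases k)
  case 0 then show ?thesis using assms by (auto intro: linear_continuous_on)
next
  case (Suc k)
  show ?thesis unfolding Suc
    by (rule Ck_on_SucI[OF bounded_linear_imp_has_derivative[OF assms]]) (rule Ck_const)
qed

lemma Ck_real_SucI:
  fixes f f' :: "real \<Rightarrow> real"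
  assumes "\<And>x. (f has_real_derivative f' x) (at x)" "Ck_on k UNIV f'"
  shows "Ck_on (Suc k) UNIV f"
proof (rule Ck_on_SucI[of f "\<lambda>x. (*) (f' x)"])
  show "(f has_derivative (*) (f' x)) (at x)" for x
    using assms(1)[of x] by (simp only: has_field_derivative_def)
  show "Ck_on k UNIV (\<lambda>x. f' x * i)" if "i \<in> Basis" for i using assms(2) that by simp
qed

text \<open>Serves to prove smoothness by exhibiting all derivatives at once: for \<open>sin\<close>
  the sequence has period 4, for \<open>bump\<close> it stays in the class
  \<open>bump_poly\<close>.\<close>

lemma Ck_real_family:
  fixes F :: "nat \<Rightarrow> real \<Rightarrow> real"
  assumes "\<And>i x. (F i has_real_derivative F (Suc i) x) (at x)"
  shows "Ck_on k UNIV (F i)"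
proof (induction k arbitrary: i)
  case 0
  then show ?case using assms by (auto intro: DERIV_continuous_on)
next
  case (Suc k)
  show ?case by (rule Ck_real_SucI[OF assms Suc.IH])
qed

lemma smooth_const: "smooth_on UNIV (\<lambda>x. c)" by (simp add: smooth_on_def Ck_const)
lemma smooth_add: "smooth_on UNIV f \<Longrightarrow> smooth_on UNIV g \<Longrightarrow> smooth_on UNIV (\<lambda>x. f x + g x)"
  by (simp add: smooth_on_def Ck_add)
lemma smooth_mult:
  fixes f g :: "'a::euclidean_space \<Rightarrow> real"
  shows "smooth_on UNIV f \<Longrightarrow> smooth_on UNIV g \<Longrightarrow> smooth_on UNIV (\<lambda>x. f x * g x)"
  by (simp add: smooth_on_def Ck_mult)
lemma smooth_compose:
  fixes g :: "real \<Rightarrow> real" and a :: "'a::euclidean_space \<Rightarrow> real"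
  shows "smooth_on UNIV g \<Longrightarrow> smooth_on UNIV a \<Longrightarrow> smooth_on UNIV (\<lambda>x. g (a x))"
  by (simp add: smooth_on_def Ck_compose)
lemma smooth_linear:
  fixes f :: "'a::euclidean_space \<Rightarrow> real" shows "bounded_linear f \<Longrightarrow> smooth_on UNIV f"
  by (simp add: smooth_on_def Ck_linear)
lemma smooth_diff:
  fixes f g :: "'a::euclidean_space \<Rightarrow> real"
  assumes "smooth_on UNIV f" "smooth_on UNIV g" shows "smooth_on UNIV (\<lambda>x. f x - g x)"
  using smooth_add[OF assms(1) smooth_mult[OF smooth_const[of "-1"] assms(2)]] by simp

lemma smooth_sin: "smooth_on UNIV (sin :: real \<Rightarrow> real)"
proof -
  define F where "F i x = (if i mod 4 = 0 then sin x else if i mod 4 = 1 then cos x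
      else if i mod 4 = 2 then - sin x else - cos x)" for i :: nat and x :: real
  have "(F i has_real_derivative F (Suc i) x) (at x)" for i x
  proof -
    have "i mod 4 = 0 \<or> i mod 4 = 1 \<or> i mod 4 = 2 \<or> i mod 4 = 3" by linarith
    then show ?thesis unfolding F_def
      by (elim disjE) (auto simp: mod_Suc intro!: derivative_eq_intros)
  qed
  from Ck_real_family[of F, OF this, of _ 0] have "smooth_on UNIV (F 0)" by (simp add: smooth_on_def)
  moreover have "F 0 = sin" by (auto simp: F_def)
  ultimately show ?thesis by simp
qed

lemma smooth_antideriv:
  fixes \<psi> g :: "real \<Rightarrow> real"
  assumes "\<And>x. (\<psi> has_real_derivative g x) (at x)" "smooth_on UNIV g"
  shows "smooth_on UNIV \<psi>"
proof -
  have "Ck_on k UNIV \<psi>" for k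
    using Ck_real_SucI[OF assms(1), of k] assms(2) Ck_on_Suc_imp unfolding smooth_on_def by blast
  then show ?thesis by (simp add: smooth_on_def)
qed

lemma smooth_continuous: "smooth_on UNIV g \<Longrightarrow> continuous_on UNIV g"
  unfolding smooth_on_def using Ck_on.simps(1) by blast

lemma smooth_deriv:
  fixes g :: "real \<Rightarrow> real" assumes "smooth_on UNIV g"
  shows "(g has_real_derivative deriv g x) (at x)" "smooth_on UNIV (deriv g)"
proof -
  have C: "Ck_on (Suc k) UNIV g" for k using assms smooth_on_def by blast
  have D: "(g has_derivative frechet_derivative g (at x)) (at x)" for x by (rule Ck_on_Suc_deriv[OF C])
  have lin: "frechet_derivative g (at x) = (\<lambda>h. frechet_derivative g (at x) 1 * h)" for x
  proof
    fix h show "frechet_derivative g (at x) h = frechet_derivative g (at x) 1 * h"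
      using linear_scale[OF has_derivative_linear[OF D[of x]], of h 1] by simp
  qed
  have A: "(g has_real_derivative frechet_derivative g (at x) 1) (at x)" for x
    unfolding has_field_derivative_def by (rule has_derivative_eq_rhs[OF D lin])
  have d: "deriv g x = frechet_derivative g (at x) 1" for x by (rule DERIV_imp_deriv[OF A])
  show "(g has_real_derivative deriv g x) (at x)" unfolding d by (rule A)
  have "deriv g = (\<lambda>x. frechet_derivative g (at x) 1)" using d by blast
  then show "smooth_on UNIV (deriv g)" using C unfolding smooth_on_def by auto
qed

text \<open>A class of functions that is closed under differentiation and contains \<open>exp (- 1 / x)\<close>.\<close>

definition bump_poly :: "real poly \<Rightarrow> real \<Rightarrow> real" where
  "bump_poly p x = (if 0 < x then poly p (1/x) * exp (- (1/x)) else 0)"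

lemma poly_times_exp_minus_tendsto_0:
  fixes p :: "real poly" shows "((\<lambda>y. poly p y * exp (- y)) \<longlongrightarrow> 0) at_top"
proof -
  have "((\<lambda>y. \<Sum>i\<le>degree p. coeff p i * (y ^ i / exp y)) \<longlongrightarrow> (\<Sum>i\<le>degree p. coeff p i * 0)) at_top"
    by (intro tendsto_intros tendsto_power_div_exp_0)
  then show ?thesis by (simp add: poly_altdef exp_minus divide_inverse sum_distrib_right mult.assoc)
qed

text \<open>For \<open>x > 0\<close> the derivative of \<open>p(1/x) exp(-1/x)\<close> is
  \<open>x^(-2) (p - p')(1/x) exp(-1/x)\<close>, and \<open>x^(-2)\<close> is the polynomial
  \<open>X^2\<close> at \<open>1/x\<close>. At 0 the difference quotient from the right becomes
  \<open>y p(y) exp(-y)\<close> with \<open>y = 1/x\<close>, which tends to 0 as \<open>y\<close>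
  tends to infinity.\<close>

lemma bump_poly_deriv:
  "(bump_poly p has_real_derivative bump_poly ([:0, 0, 1:] * (p - pderiv p)) x) (at x)"
proof -
  consider "x > 0" | "x < 0" | "x = 0" by linarith
  then show ?thesis
  proof cases
    case 1
    have "((\<lambda>x. poly p (1/x) * exp (- (1/x))) has_real_derivative
        bump_poly ([:0, 0, 1:] * (p - pderiv p)) x) (at x)"
      using 1 by (auto intro!: derivative_eq_intros DERIV_chain'[where g="poly p"] poly_DERIV
          simp: bump_poly_def field_simps power2_eq_square)
    then show ?thesis
      by (rule has_field_derivative_transform_within_open[where S="{0<..}"]) (use 1 in \<open>auto simp: bump_poly_def\<close>)
  next
    case 2
    have "((\<lambda>x. 0) has_real_derivative bump_poly ([:0, 0, 1:] * (p - pderiv p)) x) (at x)"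
      using 2 by (auto simp: bump_poly_def)
    then show ?thesis
      by (rule has_field_derivative_transform_within_open[where S="{..<0}"]) (use 2 in \<open>auto simp: bump_poly_def\<close>)
  next
    case 3
    have "((\<lambda>h. (bump_poly p (0 + h) - bump_poly p 0) / h) \<longlongrightarrow> 0) (at 0)"
    proof (rule filterlim_split_at)
      show "((\<lambda>h. (bump_poly p (0 + h) - bump_poly p 0) / h) \<longlongrightarrow> 0) (at_left 0)"
        by (rule tendsto_eventually) (auto simp: eventually_at_filter bump_poly_def)
      have "((\<lambda>y. poly ([:0, 1:] * p) y * exp (- y)) \<longlongrightarrow> 0) at_top"
        by (rule poly_times_exp_minus_tendsto_0)
      then have "((\<lambda>y. (bump_poly p (0 + inverse y) - bump_poly p 0) / inverse y) \<longlongrightarrow> 0) at_top"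
        by (rule filterlim_cong[THEN iffD1, OF refl refl, rotated])
           (auto intro!: eventually_mono[OF eventually_gt_at_top[of 0]] simp: bump_poly_def field_simps)
      then show "((\<lambda>h. (bump_poly p (0 + h) - bump_poly p 0) / h) \<longlongrightarrow> 0) (at_right 0)"
        by (simp only: filterlim_at_right_to_top)
    qed
    then have "(bump_poly p has_real_derivative 0) (at 0)" unfolding DERIV_def by simp
    then show ?thesis using 3 by (simp add: bump_poly_def)
  qed
qed

definition bump :: "real \<Rightarrow> real" where
  "bump x = (if 0 < x then exp (- (1/x)) else 0)"

lemma smooth_bump: "smooth_on UNIV bump"
proof -
  define F where "F i = bump_poly (((\<lambda>p. [:0, 0, 1:] * (p - pderiv p)) ^^ i) 1)" for i
  have "(F i has_real_derivative F (Suc i) x) (at x)" for i x unfolding F_def using bump_poly_deriv by simp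
  from Ck_real_family[of F, OF this, of _ 0] have "smooth_on UNIV (F 0)" by (simp add: smooth_on_def)
  moreover have "F 0 = bump" by (auto simp: F_def bump_def bump_poly_def)
  ultimately show ?thesis by simp
qed

lemma bump_range: "0 \<le> bump x" "bump x \<le> 1" by (auto simp: bump_def)
lemma bump_nonpos: "x \<le> 0 \<Longrightarrow> bump x = 0" by (simp add: bump_def)

text \<open>Together with \<open>bump_nonpos\<close> this makes \<open>bump (n y)\<close> a smooth
  approximation of the indicator of \<open>y > 0\<close>.\<close>

lemma bump_scaled_tendsto:
  assumes "y \<longlonglongrightarrow> (c::real)" "c > 0"
  shows "(\<lambda>n. bump (real n * y n)) \<longlonglongrightarrow> 1"
proof -
  have "filterlim (\<lambda>n. real n * y n) at_top sequentially"
    by (rule filterlim_at_top_mult_tendsto_pos[OF assms(1,2) filterlim_real_sequentially, THEN filterlim_cong[THEN iffD1, OF refl refl, rotated]])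
       (simp add: mult.commute)
  moreover have "(bump \<longlongrightarrow> 1) at_top"
  proof -
    have "((\<lambda>x::real. exp (- (1/x))) \<longlongrightarrow> exp (- 0)) at_top"
      by (intro tendsto_intros tendsto_divide_0[OF tendsto_const] filterlim_at_top_imp_at_infinity filterlim_ident)
    then have "((\<lambda>x::real. exp (- (1/x))) \<longlongrightarrow> 1) at_top" by simp
    then show ?thesis
      by (rule Lim_transform_eventually)
         (auto intro!: eventually_mono[OF eventually_gt_at_top[of 0]] simp: bump_def)
  qed
  ultimately show ?thesis by (rule filterlim_compose[rotated])
qed

section \<open>The circle, the cylinder and primitives\<close>

text \<open>
  Circle, time interval and cylinder as measures on all Borel sets: other than for \<^const>\<open>lebesgue_on\<close>,
  the measure on the cylinder is then a product measure.
\<close>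

definition cm :: "real measure" where "cm = density lborel (indicator {0..<1})"
definition tm :: "real \<Rightarrow> real measure" where "tm T = density lborel (indicator {0<..<T})"
definition MM :: "real \<Rightarrow> (real \<times> real) measure" where "MM T = tm T \<Otimes>\<^sub>M cm"

lemma sets_cm [simp, measurable_cong]: "sets cm = sets borel" by (simp add: cm_def)
lemma sets_tm [simp, measurable_cong]: "sets (tm T) = sets borel" by (simp add: tm_def)
lemma sets_MM [simp, measurable_cong]: "sets (MM T) = sets borel"
proof -
  have "sets (MM T) = sets (borel \<Otimes>\<^sub>M borel :: (real \<times> real) measure)"
    unfolding MM_def by (intro sets_pair_measure_cong sets_cm sets_tm)
  then show ?thesis unfolding borel_prod .
qed
lemma space_cm [simp]: "space cm = UNIV" by (simp add: cm_def)
lemma space_tm [simp]: "space (tm T) = UNIV" by (simp add: tm_def)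
lemma space_MM [simp]: "space (MM T) = UNIV" by (simp add: MM_def space_pair_measure)

lemma emeasure_cm: "A \<in> sets borel \<Longrightarrow> emeasure cm A = emeasure lborel (A \<inter> {0..<1})"
  unfolding cm_def by (subst emeasure_density)
    (auto simp: nn_integral_indicator[symmetric] indicator_inter_arith mult.commute simp del: nn_integral_indicator)
lemma emeasure_tm: "A \<in> sets borel \<Longrightarrow> emeasure (tm T) A = emeasure lborel (A \<inter> {0<..<T})"
  unfolding tm_def by (subst emeasure_density)
    (auto simp: nn_integral_indicator[symmetric] indicator_inter_arith mult.commute simp del: nn_integral_indicator)

interpretation cm: finite_measure cm
  by standard (simp add: emeasure_cm)
interpretation tm: finite_measure "tm T" for T
  by standard (cases "0 \<le> T"; simp add: emeasure_tm)
interpretation MM: pair_sigma_finite "tm T" cm for T ..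

lemma finite_measure_MM: "finite_measure (MM T)"
  unfolding MM_def by (rule finite_measure_pair_measure) unfold_locales

lemma borel_cmI: "g \<in> Borel \<Longrightarrow> g \<in> borel_measurable cm" for g :: "real \<Rightarrow> real"
  by (subst measurable_cong_sets[OF sets_cm refl])

lemma borel_tmI: "g \<in> Borel \<Longrightarrow> g \<in> borel_measurable (tm T)" for g :: "real \<Rightarrow> real"
  by (subst measurable_cong_sets[OF sets_tm refl])

lemma borel_MMI: "g \<in> Borel \<Longrightarrow> g \<in> borel_measurable (MM T)" for g :: "real \<times> real \<Rightarrow> real"
  by (subst measurable_cong_sets[OF sets_MM refl])

lemma sqi_cm_borel: "sqi cm w \<Longrightarrow> w \<in> Borel"
  by (simp add: sqi_def measurable_cong_sets[OF sets_cm refl])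

interpretation MMf: finite_measure "MM T" for T by (rule finite_measure_MM)

lemma measure_cm [simp]: "measure cm UNIV = 1" by (simp add: measure_def emeasure_cm)
lemma measure_tm: "0 \<le> T \<Longrightarrow> measure (tm T) UNIV = T"
  by (simp add: measure_def emeasure_tm)

lemma AE_cm: "(AE z in cm. P z) \<longleftrightarrow> (AE z in lborel. 0 \<le> z \<and> z < 1 \<longrightarrow> P z)"
  unfolding cm_def by (subst AE_density) (auto simp: indicator_def intro!: AE_cong)
lemma AE_tm: "(AE z in tm T. P z) \<longleftrightarrow> (AE z in lborel. 0 < z \<and> z < T \<longrightarrow> P z)"
  unfolding tm_def by (subst AE_density) (auto simp: indicator_def intro!: AE_cong)
lemma AE_cm_range: "AE z in cm. 0 \<le> z \<and> z < 1" by (simp add: AE_cm)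
lemma AE_tm_range: "AE t in tm T. 0 < t \<and> t < T" by (simp add: AE_tm)
lemma AE_cm_neq: "AE z in cm. z \<noteq> c"
  unfolding AE_cm using AE_lborel_singleton[of c] by eventually_elim simp
lemma AE_tm_neq: "AE z in tm T. z \<noteq> c"
  unfolding AE_tm using AE_lborel_singleton[of c] by eventually_elim simp

lemma AE_MM_fst:
  assumes "AE t in tm T. P t" shows "AE x in MM T. P (fst x)"
proof -
  obtain N where N: "N \<in> sets (tm T)" "emeasure (tm T) N = 0" "{t. \<not> P t} \<subseteq> N"
    using assms unfolding eventually_ae_filter null_sets_def by auto
  have "emeasure (MM T) (N \<times> UNIV) = emeasure (tm T) N * emeasure cm UNIV"
    unfolding MM_def by (rule cm.emeasure_pair_measure_Times) (use N in auto)
  then have "N \<times> UNIV \<in> null_sets (MM T)" using N by (auto simp: null_sets_def borel_Times)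
  then show ?thesis by (rule AE_I') (use N in auto)
qed

lemma AE_MM_snd:
  assumes "AE t in cm. P t" shows "AE x in MM T. P (snd x)"
proof -
  obtain N where N: "N \<in> sets cm" "emeasure cm N = 0" "{t. \<not> P t} \<subseteq> N"
    using assms unfolding eventually_ae_filter null_sets_def by auto
  have "emeasure (MM T) (UNIV \<times> N) = emeasure (tm T) UNIV * emeasure cm N"
    unfolding MM_def by (rule cm.emeasure_pair_measure_Times) (use N in auto)
  then have "UNIV \<times> N \<in> null_sets (MM T)" using N by (auto simp: null_sets_def borel_Times)
  then show ?thesis by (rule AE_I') (use N in auto)
qed

lemma AE_MM_D: "AE x in MM T. P x \<Longrightarrow> AE t in tm T. AE z in cm. P (t, z)"
  unfolding MM_def by (rule MM.AE_pair)

lemma MM_density: "MM T = density lborel (indicator (cylinder T))"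
proof -
  have "sigma_finite_measure (density lborel (indicator {0..<1::real}))"
    unfolding cm_def[symmetric] by unfold_locales
  then have "MM T = density (lborel \<Otimes>\<^sub>M lborel) (\<lambda>(x, y). indicator {0<..<T} x * indicator {0..<1} y)"
    unfolding MM_def cm_def tm_def by (intro pair_measure_density) (auto intro: lborel.sigma_finite_measure_axioms)
  also have "\<dots> = density lborel (indicator (cylinder T))"
    unfolding lborel_prod by (rule arg_cong[where f="density lborel"]) (auto simp: fun_eq_iff indicator_def)
  finally show ?thesis .
qed

lemma AE_lebesgue_on_density:
  assumes "S \<in> sets borel"
  shows "(AE x in lebesgue_on S. P x) \<longleftrightarrow> (AE x in density lborel (indicator S). P x)"
proof -
  have "(AE x in lebesgue_on S. P x) \<longleftrightarrow> (AE x in lborel. x \<in> S \<longrightarrow> P x)"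
    using assms by (subst AE_restrict_space_iff) (auto simp: AE_completion_iff)
  also have "\<dots> \<longleftrightarrow> (AE x in density lborel (indicator S). P x)"
    using assms by (subst AE_density) (auto simp: indicator_def intro!: AE_cong)
  finally show ?thesis .
qed

lemma
  fixes f :: "'a::euclidean_space \<Rightarrow> real"
  assumes S: "S \<in> sets borel" and f: "f \<in> Borel"
  shows integrable_lebesgue_on_density: "integrable (lebesgue_on S) f \<longleftrightarrow> integrable (density lborel (indicator S)) f"
    and integral_lebesgue_on_density: "(LINT x|lebesgue_on S. f x) = (LINT x|density lborel (indicator S). f x)"
proof -
  have 1: "density lborel (indicator S) = density lborel (\<lambda>x. ennreal (indicator S x :: real))"
    by (simp add: ennreal_indicator)
  have m: "(\<lambda>x. indicator S x * f x) \<in> borel_measurable lborel" using assms by auto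
  show "integrable (lebesgue_on S) f \<longleftrightarrow> integrable (density lborel (indicator S)) f"
    unfolding 1 using S f by (subst integrable_restrict_space) (auto simp: integrable_completion[OF m] integrable_density)
  show "(LINT x|lebesgue_on S. f x) = (LINT x|density lborel (indicator S). f x)"
    unfolding 1 using S f by (subst integral_restrict_space) (auto simp: integral_completion[OF m] integral_density)
qed

text \<open>The spaces of the statement consist of Lebesgue measurable functions, whereas
  \<open>tm\<close>, \<open>cm\<close> and \<open>MM\<close> know Borel sets only. The passage from
  the former to the latter goes through such representatives.\<close>

lemma borel_rep_lebesgue_on:
  fixes f :: "'a::euclidean_space \<Rightarrow> real"
  assumes S: "S \<in> sets borel" and f: "f \<in> borel_measurable (lebesgue_on S)"
  shows "\<exists>g\<in>Borel. AE x in lebesgue_on S. f x = g x"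
proof -
  have "(\<lambda>x. indicator S x *\<^sub>R f x) \<in> borel_measurable lebesgue"
    using borel_measurable_restrict_space_iff[of S lebesgue f] S f by simp
  from completion_ex_borel_measurable_real[OF this]
  obtain g where g: "g \<in> borel_measurable lborel" and eq: "AE x in lborel. indicator S x *\<^sub>R f x = g x" by blast
  have "AE x in lebesgue_on S. f x = g x"
    using S eq by (subst AE_restrict_space_iff) (auto simp: AE_completion_iff elim!: eventually_mono)
  then show ?thesis using g by auto
qed

lemma cylinder_borel [simp]: "cylinder T \<in> sets borel" by (simp add: borel_Times)

lemma AE_cyl: "(AE x in lebesgue_on (cylinder T). P x) \<longleftrightarrow> (AE x in MM T. P x)"
  unfolding MM_density by (rule AE_lebesgue_on_density) simp
lemma AE_circle: "(AE x in lebesgue_on circle. P x) \<longleftrightarrow> (AE x in cm. P x)"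
  unfolding cm_def by (rule AE_lebesgue_on_density) simp
lemma AE_time: "(AE x in lebesgue_on {0<..<T}. P x) \<longleftrightarrow> (AE x in tm T. P x)"
  unfolding tm_def by (rule AE_lebesgue_on_density) simp

lemma circle_borel: "circle \<in> sets borel" by simp

lemmas integrable_cyl = integrable_lebesgue_on_density[of "cylinder T", folded MM_density, OF cylinder_borel] for T
lemmas integral_cyl = integral_lebesgue_on_density[of "cylinder T", folded MM_density, OF cylinder_borel] for T

lemma
  fixes f f' :: "'a::euclidean_space \<Rightarrow> real"
  assumes S: "S \<in> sets borel" and f: "f \<in> borel_measurable (lebesgue_on S)" "f' \<in> Borel"
    and e: "AE x in density lborel (indicator S). f x = f' x"
  shows integrable_lebesgue_on_AE: "integrable (lebesgue_on S) f \<longleftrightarrow> integrable (density lborel (indicator S)) f'"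
    and integral_lebesgue_on_AE: "(LINT x|lebesgue_on S. f x) = (LINT x|density lborel (indicator S). f' x)"
proof -
  have m: "f' \<in> borel_measurable (lebesgue_on S)" using f(2) by (intro measurable_restrict_space1 measurable_completion) simp
  have ae: "AE x in lebesgue_on S. f x = f' x" using e by (simp add: AE_lebesgue_on_density[OF S])
  show "integrable (lebesgue_on S) f \<longleftrightarrow> integrable (density lborel (indicator S)) f'"
    using integrable_cong_AE[OF f(1) m ae] integrable_lebesgue_on_density[OF S f(2)] by simp
  show "(LINT x|lebesgue_on S. f x) = (LINT x|density lborel (indicator S). f' x)"
    using integral_cong_AE[OF f(1) m ae] integral_lebesgue_on_density[OF S f(2)] by simp
qed

lemmas integrable_cyl_AE = integrable_lebesgue_on_AE[of "cylinder T", folded MM_density, OF cylinder_borel] for T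
lemmas integral_cyl_AE = integral_lebesgue_on_AE[of "cylinder T", folded MM_density, OF cylinder_borel] for T

lemma borel_lebesgue_on: "f \<in> Borel \<Longrightarrow> f \<in> borel_measurable (lebesgue_on S)"
  for f :: "'a::euclidean_space \<Rightarrow> real"
  by (intro measurable_restrict_space1 measurable_completion) simp

section \<open>Smooth test functions and the fundamental lemma of the calculus of variations\<close>

definition tbump :: "real \<Rightarrow> (real \<Rightarrow> real) \<Rightarrow> bool" where
  "tbump T g \<longleftrightarrow> smooth_on UNIV g \<and> (\<exists>a b. 0 < a \<and> b < T \<and> (\<forall>t. t \<notin> {a..b} \<longrightarrow> g t = 0))"

text \<open>There is no support condition: constants belong to this class, and they are what forces
  the mean of a weak \<open>z\<close>-derivative to vanish.\<close>

definition cbump :: "(real \<Rightarrow> real) \<Rightarrow> bool" where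
  "cbump g \<longleftrightarrow> smooth_on UNIV g \<and> (\<forall>z. g (z + 1) = g z)"

text \<open>Smooth approximation of the indicator of \<open>(0, b)\<close>; the shifts by
  \<open>1 / Suc n\<close> keep the support away from both ends.\<close>

definition tb :: "real \<Rightarrow> nat \<Rightarrow> real \<Rightarrow> real" where
  "tb b n t = bump (real n * (t - 1 / real (Suc n))) * bump (real n * (b - 1 / real (Suc n) - t))"
text \<open>For \<open>0 < b \<le> 1\<close> the product of sines is, within the period
  \<open>[0, 1)\<close>, positive exactly on \<open>(0, b)\<close>. It has period 1 because both
  factors change sign under a shift by 1.\<close>

definition cb :: "real \<Rightarrow> nat \<Rightarrow> real \<Rightarrow> real" where
  "cb b n z = bump (real n * (sin (pi * z) * sin (pi * (b - z))))"

lemma smooth_affine: "smooth_on UNIV (\<lambda>t::real. c * t + d)"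
  by (intro smooth_add smooth_const smooth_linear) (rule bounded_linear_mult_right)

lemma tbump_tb:
  assumes "0 < b" "b \<le> T" shows "tbump T (tb b n)"
proof -
  have "smooth_on UNIV (\<lambda>t. bump (real n * t + (- real n / real (Suc n))) * bump ((- real n) * t + real n * (b - 1 / real (Suc n))))"
    by (intro smooth_mult smooth_compose[OF smooth_bump] smooth_affine)
  also have "(\<lambda>t. bump (real n * t + (- real n / real (Suc n))) * bump ((- real n) * t + real n * (b - 1 / real (Suc n)))) = tb b n"
    by (auto simp: tb_def fun_eq_iff algebra_simps)
  finally have "smooth_on UNIV (tb b n)" .
  moreover have "tb b n t = 0" if "t \<notin> {1 / real (Suc n)..b - 1 / real (Suc n)}" for t
    using that by (auto simp: tb_def mult_le_0_iff intro!: bump_nonpos)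
  moreover have "0 < 1 / real (Suc n)" "b - 1 / real (Suc n) < T" using assms by (auto intro: less_le_trans[of _ b])
  ultimately show ?thesis unfolding tbump_def by blast
qed

lemma cbump_cb: "cbump (cb b n)"
proof -
  have "smooth_on UNIV (\<lambda>z. bump (real n * (sin (pi * z + 0) * sin ((- pi) * z + pi * b))))"
    by (intro smooth_mult smooth_const smooth_compose[OF smooth_bump] smooth_compose[OF smooth_sin] smooth_affine)
  also have "(\<lambda>z. bump (real n * (sin (pi * z + 0) * sin ((- pi) * z + pi * b)))) = cb b n"
    by (auto simp: cb_def fun_eq_iff algebra_simps)
  finally have "smooth_on UNIV (cb b n)" .
  moreover have "cb b n (z + 1) = cb b n z" for z
  proof -
    have "sin (pi * (z + 1)) = - sin (pi * z)" by (simp add: distrib_left)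
    moreover have "sin (pi * (b - (z + 1))) = - sin (pi * (b - z))"
      using sin_minus_pi[of "pi * (b - z)"] by (simp add: algebra_simps)
    ultimately show ?thesis by (simp add: cb_def)
  qed
  ultimately show ?thesis by (simp add: cbump_def)
qed

lemma tb_range: "\<bar>tb b n t\<bar> \<le> 1"
  using bump_range by (auto simp: tb_def abs_mult intro!: mult_le_one)
lemma cb_range: "\<bar>cb b n t\<bar> \<le> 1" using bump_range by (auto simp: cb_def)

lemma tb_tendsto:
  assumes "t > 0" shows "(\<lambda>n. tb b n t) \<longlonglongrightarrow> (if t < b then 1 else 0)"
proof -
  have z: "(\<lambda>n. 1 / real (Suc n)) \<longlonglongrightarrow> 0" using LIMSEQ_inverse_real_of_nat by (simp add: inverse_eq_divide)
  show ?thesis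
  proof (cases "t < b")
    case True
    have "(\<lambda>n. tb b n t) \<longlonglongrightarrow> 1 * 1" unfolding tb_def
    proof (intro tendsto_mult bump_scaled_tendsto)
      show "(\<lambda>n. t - 1 / real (Suc n)) \<longlonglongrightarrow> t - 0" by (intro tendsto_intros z)
      show "(\<lambda>n. b - 1 / real (Suc n) - t) \<longlonglongrightarrow> b - 0 - t" by (intro tendsto_intros z)
    qed (use assms True in auto)
    then show ?thesis using True by simp
  next
    case False
    have "tb b n t = 0" for n
    proof -
      have "0 \<le> 1 / real (Suc n)" by simp
      then have "b - 1 / real (Suc n) - t \<le> 0" using False by argo
      then have "real n * (b - 1 / real (Suc n) - t) \<le> 0" by (rule mult_nonneg_nonpos[OF of_nat_0_le_iff])
      then show ?thesis by (simp add: tb_def bump_nonpos)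
    qed
    then show ?thesis using False by simp
  qed
qed

lemma cb_tendsto:
  assumes b: "0 < b" "b \<le> 1" and z: "0 \<le> z" "z < 1"
  shows "(\<lambda>n. cb b n z) \<longlonglongrightarrow> (if 0 < z \<and> z < b then 1 else 0)"
proof (cases "0 < z \<and> z < b")
  case True
  have "0 < sin (pi * z)" "0 < sin (pi * (b - z))"
    using True z b by (auto intro!: sin_gt_zero mult_pos_pos simp: mult_less_cancel_left1)
  then have "(\<lambda>n. cb b n z) \<longlonglongrightarrow> 1" unfolding cb_def by (intro bump_scaled_tendsto[OF tendsto_const]) auto
  then show ?thesis using True by simp
next
  case nb: False
  have "sin (pi * z) * sin (pi * (b - z)) \<le> 0"
  proof (cases "z = 0")
    case False
    then have "z \<ge> b" using nb z by auto
    have "0 \<le> sin (pi * z)" using z by (intro sin_ge_zero) (auto simp: mult_le_cancel_left1)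
    moreover have "0 \<le> sin (pi * (z - b))" using z b \<open>z \<ge> b\<close> by (intro sin_ge_zero) (auto simp: mult_le_cancel_left1)
    moreover have "sin (pi * (b - z)) = - sin (pi * (z - b))" by (metis minus_diff_eq mult_minus_right sin_minus)
    ultimately show ?thesis by simp
  qed simp
  then have "cb b n z = 0" for n by (auto simp: cb_def intro!: bump_nonpos mult_nonneg_nonpos)
  moreover have "(if 0 < z \<and> z < b then 1 else 0 :: real) = 0" using nb by simp
  ultimately show ?thesis by (simp only: tendsto_const)
qed

lemma smooth_borel: "smooth_on UNIV (g :: 'a::euclidean_space \<Rightarrow> real) \<Longrightarrow> g \<in> Borel"
  by (intro borel_measurable_continuous_onI smooth_continuous)

lemma integrable_times_bounded:
  fixes w b :: "'a \<Rightarrow> real"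
  assumes "integrable M w" "b \<in> borel_measurable M" "AE x in M. \<bar>b x\<bar> \<le> C"
  shows "integrable M (\<lambda>x. w x * b x)"
proof (rule Bochner_Integration.integrable_bound)
  show "integrable M (\<lambda>x. C * w x)" using assms by simp
  show "(\<lambda>x. w x * b x) \<in> borel_measurable M" using assms by auto
  show "AE x in M. norm (w x * b x) \<le> norm (C * w x)"
    using assms(3) by eventually_elim (auto simp: abs_mult mult.commute[of C] intro!: mult_left_mono)
qed

text \<open>Products of \<open>tb\<close> and \<open>cb\<close> approximate indicators of boxes
  boundedly, so \<open>w\<close> integrates to 0 over every box at the corner of the cylinder. Up to
  null sets these boxes are the traces of the quadrants \<open>{..(b, c)}\<close>, which are stable
  under intersection and generate the Borel sets; Dynkin's argument extends the vanishing to all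
  Borel sets.\<close>

theorem fundamental_lemma:
  fixes w :: "real \<times> real \<Rightarrow> real"
  assumes w: "integrable (MM T) w"
    and test: "\<And>f g. tbump T f \<Longrightarrow> cbump g \<Longrightarrow> (LINT x|MM T. w x * (f (fst x) * g (snd x))) = 0"
  shows "AE x in MM T. w x = 0"
proof -
  have [measurable]: "w \<in> Borel" using w borel_measurable_integrable by fastforce
  have box: "(LINT x|MM T. w x * indicator {..(b, c)} x) = 0" if b: "0 < b" "b \<le> T" and c: "0 < c" "c \<le> 1" for b c
  proof -
    have m: "tb b n \<in> Borel" "cb c n \<in> Borel" for n
      using smooth_borel tbump_tb[OF b] cbump_cb unfolding tbump_def cbump_def by blast+
    have [measurable]: "(\<lambda>x. tb b n (fst x)) \<in> borel_measurable (borel :: (real \<times> real) measure)"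
       "(\<lambda>x. cb c n (snd x)) \<in> borel_measurable (borel :: (real \<times> real) measure)" for n
      using m[of n] by (auto simp: borel_prod[symmetric])
    have "(\<lambda>n. LINT x|MM T. w x * (tb b n (fst x) * cb c n (snd x))) \<longlonglongrightarrow> (LINT x|MM T. w x * indicator {..(b, c)} x)"
    proof (rule integral_dominated_convergence[where w="\<lambda>x. \<bar>w x\<bar>"])
      show "AE x in MM T. (\<lambda>n. w x * (tb b n (fst x) * cb c n (snd x))) \<longlonglongrightarrow> w x * indicator {..(b, c)} x"
        using AE_MM_fst[OF AE_tm_range] AE_MM_snd[OF AE_cm_range] AE_MM_fst[OF AE_tm_neq[of b]]
          AE_MM_snd[OF AE_cm_neq[of c]] AE_MM_snd[OF AE_cm_neq[of 0]]
      proof eventually_elim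
        case (elim x)
        have "(\<lambda>n. w x * (tb b n (fst x) * cb c n (snd x))) \<longlonglongrightarrow>
          w x * ((if fst x < b then 1 else 0) * (if 0 < snd x \<and> snd x < c then 1 else 0))"
          using elim by (intro tendsto_intros tb_tendsto cb_tendsto c) auto
        also have "w x * ((if fst x < b then 1 else 0) * (if 0 < snd x \<and> snd x < c then 1 else 0)) = w x * indicator {..(b, c)} x"
          using elim by (cases x) (auto simp: indicator_def)
        finally show ?case .
      qed
      show "AE x in MM T. norm (w x * (tb b n (fst x) * cb c n (snd x))) \<le> \<bar>w x\<bar>" for n
        using tb_range cb_range by (auto simp: abs_mult mult_left_le intro!: AE_I2 mult_le_one mult_left_le)
    qed (use w in \<open>auto simp: borel_Times\<close>)
    moreover have "(LINT x|MM T. w x * (tb b n (fst x) * cb c n (snd x))) = 0" for n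
      by (rule test[OF tbump_tb[OF b] cbump_cb])
    ultimately show ?thesis by (simp add: LIMSEQ_const_iff)
  qed
  have all: "(LINT x|MM T. w x * indicator {..(b, c)} x) = 0" for b c
  proof (cases "0 < min b T \<and> 0 < min c 1")
    case True
    have "(LINT x|MM T. w x * indicator {..(b, c)} x) = (LINT x|MM T. w x * indicator {..(min b T, min c 1)} x)"
    proof (rule integral_cong_AE)
      show "AE x in MM T. w x * indicator {..(b, c)} x = w x * indicator {..(min b T, min c 1)} x"
        using AE_MM_fst[OF AE_tm_range] AE_MM_snd[OF AE_cm_range]
        by eventually_elim (auto simp: indicator_def)
    qed (auto)
    then show ?thesis using box[of "min b T" "min c 1"] True by simp
  next
    case False
    have "AE x in MM T. w x * indicator {..(b, c)} x = 0"
      using AE_MM_fst[OF AE_tm_range] AE_MM_snd[OF AE_cm_range] AE_MM_snd[OF AE_cm_neq[of 0]]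
      by eventually_elim (use False in \<open>auto simp: indicator_def\<close>)
    then show ?thesis by (rule integral_eq_zero_AE)
  qed
  have wA: "integrable (MM T) (\<lambda>x. w x * indicator A x)" if "A \<in> sets borel" for A
    by (rule integrable_times_bounded[OF w, of _ 1]) (use that in \<open>auto simp: indicator_def\<close>)
  \<comment> \<open>Complements in the Dynkin argument need the integral over the whole space, which
    is that over the quadrant of the far corner.\<close>
  have tot: "(LINT x|MM T. w x) = 0"
  proof -
    have "(LINT x|MM T. w x) = (LINT x|MM T. w x * indicator {..(T, 1)} x)"
    proof (rule integral_cong_AE)
      show "AE x in MM T. w x = w x * indicator {..(T, 1)} x"
        using AE_MM_fst[OF AE_tm_range] AE_MM_snd[OF AE_cm_range] by eventually_elim (auto simp: indicator_def less_eq_prod_def)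
    qed auto
    then show ?thesis by (simp add: all)
  qed
  have "(LINT x|MM T. w x * indicator A x) = 0" if "A \<in> sets borel" for A
  proof -
    have I: "Int_stable (range (\<lambda>a. {..a::real\<times>real}))"
    proof (rule Int_stableI)
      fix a b assume "a \<in> range (\<lambda>a. {..a::real\<times>real})" "b \<in> range (\<lambda>a. {..a::real\<times>real})"
      then obtain a1 a2 b1 b2 where "a = {..(a1, a2)}" "b = {..(b1, b2)}" by (auto simp: image_def)
      then have "a \<inter> b = {..(min a1 b1, min a2 b2)}" by auto
      then show "a \<inter> b \<in> range (\<lambda>a. {..a::real\<times>real})" by blast
    qed
    have S: "sigma_sets UNIV (range (\<lambda>a. {..a::real\<times>real})) = sets borel" by (simp add: borel_eq_atMost)
    show ?thesis
    proof (rule sigma_sets_induct_disjoint[OF I])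
      show "A \<in> sigma_sets UNIV (range (\<lambda>a. {..a::real\<times>real}))" using that S by simp
      show "(LINT x|MM T. w x * indicator (UNIV - A) x) = 0"
        if "A \<in> sigma_sets UNIV (range (\<lambda>a. {..a::real\<times>real}))" "(LINT x|MM T. w x * indicator A x) = 0" for A
      proof -
        have "(LINT x|MM T. w x * indicator (UNIV - A) x) = (LINT x|MM T. w x - w x * indicator A x)"
          by (rule Bochner_Integration.integral_cong) (auto simp: indicator_def)
        then show ?thesis using that S w wA tot by simp
      qed
      show "(LINT x|MM T. w x * indicator (\<Union> (range A)) x) = 0"
        if A: "disjoint_family A" "range A \<subseteq> sigma_sets UNIV (range (\<lambda>a. {..a::real\<times>real}))" "\<And>i. (LINT x|MM T. w x * indicator (A i) x) = 0" for A :: "nat \<Rightarrow> _"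
        using lebesgue_integral_countable_add[of A "MM T" w] A S wA[of "\<Union> (range A)"]
        by (auto simp: set_integrable_def set_lebesgue_integral_def disjoint_family_on_def mult.commute)
    qed (auto simp: all)
  qed
  then have "(LINT x:A|MM T. w x) = (LINT x:A|MM T. 0)" if "A \<in> sets (MM T)" for A
    using that by (simp add: set_lebesgue_integral_def mult.commute)
  from density_unique_real[OF w _ this] show ?thesis by simp
qed

text \<open>The two intervals differ by the null set \<open>{0}\<close>. Hence the calculus
  developed for \<open>tm T\<close> also serves on the circle.\<close>

lemma cm_eq_tm: "cm = tm 1"
  unfolding cm_def tm_def
proof (rule density_cong)
  show "AE x in lborel. indicator {0..<1::real} x = (indicator {0<..<1} x :: ennreal)"
    using AE_lborel_singleton[of 0] by eventually_elim (auto simp: indicator_def)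
qed auto

lemma AE_cm_const: "(AE z in cm. Q) \<longleftrightarrow> Q"
proof
  assume *: "AE z in cm. Q"
  show Q
  proof (rule ccontr)
    assume "\<not> Q"
    then have "AE z in cm. False" using * by simp
    then have "emeasure cm UNIV = 0" by (auto simp: eventually_ae_filter null_sets_def top.extremum_unique)
    then show False by (simp add: emeasure_cm)
  qed
qed simp

lemma AE_MM_fst_D: "AE x in MM T. P (fst x) \<Longrightarrow> AE t in tm T. P t"
  using AE_MM_D[where T=T and P="\<lambda>x. P (fst x)"] by (simp add: AE_cm_const)

section \<open>Primitives and integration by parts on an interval\<close>

lemma integrable_prod:
  fixes f :: "'a \<Rightarrow> real" and g :: "'b \<Rightarrow> real"
  assumes "finite_measure M1" "finite_measure M2" "integrable M1 f" "integrable M2 g"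
  shows "integrable (M1 \<Otimes>\<^sub>M M2) (\<lambda>x. f (fst x) * g (snd x))"
proof -
  interpret M1: finite_measure M1 by fact
  interpret M2: finite_measure M2 by fact
  interpret pair_sigma_finite M1 M2 ..
  have [measurable]: "f \<in> borel_measurable M1" "g \<in> borel_measurable M2" using assms by auto
  show ?thesis
  proof (rule Fubini_integrable)
    have "integrable M1 (\<lambda>x. \<bar>f x\<bar> * (LINT y|M2. \<bar>g y\<bar>))" using assms by auto
    then show "integrable M1 (\<lambda>x. LINT y|M2. norm (f (fst (x, y)) * g (snd (x, y))))"
      by (simp add: abs_mult)
    show "AE x in M1. integrable M2 (\<lambda>y. f (fst (x, y)) * g (snd (x, y)))" using assms by auto
  qed measurable
qed

lemma tm_triangle_integrable:
  fixes a k :: "real \<Rightarrow> real"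
  assumes "integrable (tm T) a" "integrable (tm T) k"
  shows "integrable (tm T \<Otimes>\<^sub>M tm T) (\<lambda>(z, y). indicator {..<z} y * (k z * a y))"
proof -
  have [measurable]: "a \<in> Borel" "k \<in> Borel"
    using assms[THEN borel_measurable_integrable] by auto
  have i: "integrable (tm T \<Otimes>\<^sub>M tm T) (\<lambda>x. k (fst x) * a (snd x))"
    by (rule integrable_prod) (use assms in \<open>auto intro: tm.finite_measure_axioms\<close>)
  have "integrable (tm T \<Otimes>\<^sub>M tm T) (\<lambda>x. (k (fst x) * a (snd x)) * (if snd x < fst x then 1 else 0))"
    by (rule integrable_times_bounded[where C=1, OF i]) auto
  also have "(\<lambda>x. (k (fst x) * a (snd x)) * (if snd x < fst x then 1 else 0)) =
      (\<lambda>x. (k (fst x) * a (snd x)) * indicator {..<fst x} (snd x))" by (auto simp: indicator_def)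
  finally have "integrable (tm T \<Otimes>\<^sub>M tm T) (\<lambda>x. (k (fst x) * a (snd x)) * indicator {..<fst x} (snd x))" .
  then show ?thesis by (simp add: case_prod_beta' mult.commute)
qed

lemma tm_triangle_Fubini:
  fixes a k :: "real \<Rightarrow> real"
  assumes "integrable (tm T) a" "integrable (tm T) k"
  shows "(LINT z|tm T. k z * (LINT y|tm T. indicator {..<z} y * a y))
       = (LINT y|tm T. a y * (LINT z|tm T. indicator {y<..} z * k z))"
proof -
  interpret P: pair_sigma_finite "tm T" "tm T" ..
  have [measurable]: "a \<in> Borel" "k \<in> Borel"
    using assms[THEN borel_measurable_integrable] by auto
  have eq: "indicator {..<z} y = (indicator {y<..} z :: real)" for y z :: real by (simp add: indicator_def)
  have "(LINT z|tm T. k z * (LINT y|tm T. indicator {..<z} y * a y))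
      = (LINT z|tm T. LINT y|tm T. indicator {..<z} y * (k z * a y))"
    by (simp add: mult.left_commute[of _ "k _"])
  also have "\<dots> = (LINT y|tm T. LINT z|tm T. indicator {..<z} y * (k z * a y))"
    by (rule P.Fubini_integral[symmetric]) (rule tm_triangle_integrable[OF assms])
  also have "\<dots> = (LINT y|tm T. a y * (LINT z|tm T. indicator {y<..} z * k z))"
    unfolding eq mult.commute[of "k _"] by (simp add: mult.left_commute[of _ "a _"])
  finally show ?thesis .
qed

lemma integrable_indicator_mult:
  fixes f :: "'a \<Rightarrow> real"
  shows "integrable M f \<Longrightarrow> A \<in> sets M \<Longrightarrow> integrable M (\<lambda>y. indicator A y * f y)"
  using integrable_mult_indicator[of A M f] by simp

lemma tm_integral: "f \<in> Borel \<Longrightarrow> (LINT t|tm T. f t) = (LINT t|lborel. indicator {0<..<T} t * f t)"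
  for f :: "real \<Rightarrow> real"
proof -
  assume "f \<in> Borel"
  moreover have "tm T = density lborel (\<lambda>t. ennreal (indicator {0<..<T} t :: real))"
    by (simp add: tm_def ennreal_indicator)
  ultimately show ?thesis by (simp add: integral_density)
qed

lemma tm_FTC:
  fixes F f :: "real \<Rightarrow> real"
  assumes "\<And>x. (F has_real_derivative f x) (at x)" "continuous_on UNIV f" "0 \<le> y" "y \<le> T"
  shows "(LINT t|tm T. indicator {y<..} t * f t) = F T - F y"
    and "(LINT t|tm T. indicator {..<y} t * f t) = F y - F 0"
proof -
  have [measurable]: "f \<in> Borel" using assms(2) by (rule borel_measurable_continuous_onI)
  have c: "isCont f x" for x using assms(2) by (simp add: continuous_on_eq_continuous_at)
  have I: "(LINT t|tm T. indicator A t * f t) = F b - F a"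
    if "a \<le> b" and [measurable]: "A \<in> sets borel" and e: "AE t in lborel. indicator {0<..<T} t * (indicator A t * f t) = f t * indicator {a..b} t" for A a b
  proof -
    have "(LINT t|tm T. indicator A t * f t) = (LINT t|lborel. indicator {0<..<T} t * (indicator A t * f t))"
      by (rule tm_integral) measurable
    also have "\<dots> = (LINT t|lborel. f t * indicator {a..b} t)" by (rule integral_cong_AE[OF _ _ e]) measurable
    also have "\<dots> = F b - F a" by (rule integral_FTC_Icc_real) (use assms c that in auto)
    finally show ?thesis .
  qed
  show "(LINT t|tm T. indicator {y<..} t * f t) = F T - F y"
    by (rule I) (use AE_lborel_singleton[of y] AE_lborel_singleton[of T] assms in \<open>auto simp: indicator_def elim!: eventually_elim2\<close>)
  show "(LINT t|tm T. indicator {..<y} t * f t) = F y - F 0"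
    by (rule I) (use AE_lborel_singleton[of y] AE_lborel_singleton[of 0] assms in \<open>auto simp: indicator_def elim!: eventually_elim2\<close>)
qed

lemma continuous_antideriv:
  fixes g :: "real \<Rightarrow> real" assumes "continuous_on UNIV g"
  shows "\<exists>G. \<forall>x. (G has_real_derivative g x) (at x)"
  using einterval_antiderivative[of "- \<infinity>" \<infinity> g] assms
  by (simp add: continuous_on_eq_continuous_at has_real_derivative_iff_has_vector_derivative)

lemma borel_tail_integral:
  fixes k :: "real \<Rightarrow> real"
  assumes [measurable]: "k \<in> Borel"
  shows "(\<lambda>y. LINT z|tm T. indicator {y<..} z * k z) \<in> Borel"
proof -
  have [measurable]: "Measurable.pred (borel \<Otimes>\<^sub>M tm T) (\<lambda>(x :: real, y). x < y)" by measurable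
  have "(\<lambda>x. LINT y|tm T. (if x < y then 1 else 0) * k y) \<in> Borel" by measurable
  then show ?thesis by (simp add: indicator_def of_bool_def)
qed

lemma tm_integral_drop:
  fixes f :: "real \<Rightarrow> real" assumes [measurable]: "f \<in> Borel"
  shows "(LINT s|tm d. indicator {0<..} s * f s) = (LINT s|tm d. f s)"
proof (rule integral_cong_AE)
  show "AE s in tm d. indicator {0<..} s * f s = f s"
    using AE_tm_range by eventually_elim (auto simp: indicator_def)
qed measurable

lemma abs_indicator_integral_le:
  fixes w :: "'a \<Rightarrow> real"
  assumes "integrable M w" "A \<in> sets M"
  shows "\<bar>LINT y|M. indicator A y * w y\<bar> \<le> (LINT y|M. \<bar>w y\<bar>)"
proof -
  have "\<bar>LINT y|M. indicator A y * w y\<bar> \<le> (LINT y|M. \<bar>indicator A y * w y\<bar>)" by (rule integral_abs_bound)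
  also have "\<dots> \<le> (LINT y|M. \<bar>w y\<bar>)"
    using assms integrable_real_mult_indicator[OF assms(2,1)]
    by (intro integral_mono) (auto simp: indicator_def mult.commute)
  finally show ?thesis .
qed

lemma integral_complement:
  fixes k :: "real \<Rightarrow> real" assumes k: "integrable (tm T) k"
  shows "(LINT z|tm T. indicator {y<..} z * k z) = (LINT z|tm T. k z) - (LINT z|tm T. indicator {..<y} z * k z)"
proof -
  have i: "integrable (tm T) (\<lambda>z. indicator A z * k z)" if "A \<in> sets borel" for A
    using integrable_real_mult_indicator[OF _ k, of A] that by (simp add: mult.commute)
  have [measurable]: "k \<in> Borel" using borel_measurable_integrable[OF k] by simp
  have "(LINT z|tm T. k z) = (LINT z|tm T. indicator {y<..} z * k z + indicator {..<y} z * k z)"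
  proof (rule integral_cong_AE)
    show "AE z in tm T. k z = indicator {y<..} z * k z + indicator {..<y} z * k z"
      using AE_tm_neq[of y] by eventually_elim (auto simp: indicator_def)
  qed measurable
  then show ?thesis using i[of "{y<..}"] i[of "{..<y}"] by simp
qed

lemma borel_primitive:
  fixes k :: "real \<Rightarrow> real"
  assumes k: "integrable (tm T) k"
  shows "(\<lambda>z. LINT y|tm T. indicator {..<z} y * k y) \<in> Borel"
proof -
  have kb: "k \<in> Borel" using borel_measurable_integrable[OF k] by simp
  have "(\<lambda>y. (LINT x|tm T. k x) - (LINT x|tm T. indicator {y<..} x * k x)) \<in> Borel"
    by (intro borel_measurable_diff borel_measurable_const borel_tail_integral kb)
  moreover have "(\<lambda>y. (LINT x|tm T. k x) - (LINT x|tm T. indicator {y<..} x * k x)) = (\<lambda>z. LINT y|tm T. indicator {..<z} y * k y)"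
    using integral_complement[OF k] by (auto simp: fun_eq_iff)
  ultimately show ?thesis by simp
qed

lemma integrable_mult_primitive:
  fixes a k :: "real \<Rightarrow> real"
  assumes a: "integrable (tm T) a" and k: "integrable (tm T) k"
  shows "integrable (tm T) (\<lambda>z. a z * (LINT y|tm T. indicator {..<z} y * k y))"
  by (rule integrable_times_bounded[OF a borel_tmI[OF borel_primitive[OF k]]]) (rule AE_I2, rule abs_indicator_integral_le[OF k], simp)

text \<open>Fubini on the triangle \<open>y < z\<close>. The zero mean of \<open>a\<close> removes
  the constant \<open>c\<close> and the boundary term. The last hypothesis removes \<open>d\<close>;
  it is stated as a product in order to cover both \<open>d = 0\<close> and a factor
  \<open>k\<close> of mean 0.\<close>

lemma prim_IBP:
  fixes a k :: "real \<Rightarrow> real"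
  assumes a: "integrable (tm T) a" and k: "integrable (tm T) k"
    and "(LINT z|tm T. a z) = 0" "d * (LINT z|tm T. k z) = 0"
  defines "P \<equiv> \<lambda>k z. LINT y|tm T. indicator {..<z} y * k y"
  shows "(LINT z|tm T. a z * (c + P k z)) = - (LINT z|tm T. (d + P a z) * k z)"
proof -
  have i: "integrable (tm T) (\<lambda>z. a z * P k z)" if "integrable (tm T) a" "integrable (tm T) k" for a k
    unfolding P_def by (rule integrable_mult_primitive[OF that])
  have "(LINT z|tm T. a z * (c + P k z)) = (LINT z|tm T. a z * P k z)"
    using i[OF a k] a assms(3) by (simp add: distrib_left)
  also have "\<dots> = (LINT y|tm T. k y * (LINT z|tm T. indicator {y<..} z * a z))"
    unfolding P_def by (rule tm_triangle_Fubini[OF k a])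
  also have "\<dots> = (LINT y|tm T. - (k y * P a y))"
    unfolding integral_complement[OF a] assms(3) P_def by simp
  also have "\<dots> = - (LINT z|tm T. (d + P a z) * k z)"
    using i[OF k a] k assms(4) by (simp add: distrib_right mult.commute[of "P a _"])
  finally show ?thesis .
qed

text \<open>The product rule for absolutely continuous functions, in integrated form. Cutting
  \<open>a\<close> and \<open>b\<close> off beyond \<open>z\<close> turns it into Fubini's theorem
  on the triangle over the whole interval, and the cut-off does not change a primitive at points
  \<open>y < z\<close>.\<close>

lemma tm_product_rule:
  fixes a b :: "real \<Rightarrow> real"
  assumes a: "integrable (tm T) a" and b: "integrable (tm T) b"
  defines "P \<equiv> \<lambda>k z. LINT y|tm T. indicator {..<z} y * k y"
  shows "P a z * P b z = (LINT y|tm T. indicator {..<z} y * (P a y * b y)) + (LINT y|tm T. indicator {..<z} y * (a y * P b y))"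
proof -
  define r where "r k y = indicator {..<z} y * k y" for k :: "real \<Rightarrow> real" and y
  have ir: "integrable (tm T) (r a)" "integrable (tm T) (r b)" unfolding r_def[abs_def] by (rule integrable_indicator_mult, rule a b, simp)+
  have Pr: "r k y * P (r k') y = r k y * P k' y" for k k' y
  proof (cases "y < z")
    case True
    then have "P (r k') y = P k' y" unfolding P_def r_def
      by (intro Bochner_Integration.integral_cong) (auto simp: indicator_def)
    then show ?thesis by simp
  qed (simp add: r_def)
  have i: "integrable (tm T) (\<lambda>y. r a y * P (r b) y)" unfolding P_def by (rule integrable_mult_primitive[OF ir])
  have "(LINT y|tm T. r b y * P (r a) y) = (LINT y|tm T. r a y * (LINT x|tm T. indicator {y<..} x * r b x))"
    unfolding P_def by (rule tm_triangle_Fubini[OF ir])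
  also have "\<dots> = (LINT y|tm T. r a y * (LINT x|tm T. r b x) - r a y * P (r b) y)"
    unfolding integral_complement[OF ir(2)] right_diff_distrib P_def ..
  also have "\<dots> = (LINT y|tm T. r a y) * (LINT y|tm T. r b y) - (LINT y|tm T. r a y * P (r b) y)" using i ir by simp
  finally show ?thesis unfolding Pr by (simp add: P_def r_def ac_simps)
qed

text \<open>The version of \<open>prim_IBP\<close> with a classical antiderivative \<open>K\<close>.
  The second part of \<open>b\<close> is a product so that one rule covers the circle, where
  \<open>w\<close> has mean 0, and the time interval, where \<open>K\<close> vanishes at both
  ends.\<close>

lemma tm_IBP:
  fixes K k w :: "real \<Rightarrow> real"
  assumes K: "\<And>x. (K has_real_derivative k x) (at x)" "continuous_on UNIV k" "integrable (tm T) k" and w: "integrable (tm T) w"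
    and T: "0 \<le> T" and b: "K T = K 0" "K 0 * (LINT t|tm T. w t) = 0"
  shows "(LINT t|tm T. k t * (LINT s|tm T. indicator {..<t} s * w s)) = - (LINT t|tm T. w t * K t)"
proof -
  have kb: "k \<in> Borel" and wb: "w \<in> Borel"
    using K(3) w borel_measurable_integrable by fastforce+
  have "(LINT t|tm T. k t) = 0" using tm_FTC(1)[OF K(1,2) order_refl T] tm_integral_drop[OF kb] b by simp
  from prim_IBP[OF K(3) w this b(2), of 0]
  have "(LINT t|tm T. k t * (LINT s|tm T. indicator {..<t} s * w s)) = - (LINT t|tm T. (K 0 + (LINT s|tm T. indicator {..<t} s * k s)) * w t)"
    by simp
  also have "(LINT t|tm T. (K 0 + (LINT s|tm T. indicator {..<t} s * k s)) * w t) = (LINT t|tm T. w t * K t)"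
  proof (rule integral_cong_AE)
    show "AE t in tm T. (K 0 + (LINT s|tm T. indicator {..<t} s * k s)) * w t = w t * K t"
      using AE_tm_range by eventually_elim (simp add: tm_FTC(2)[OF K(1,2)])
    have "K \<in> Borel" by (intro borel_measurable_continuous_onI continuous_at_imp_continuous_on ballI DERIV_isCont[OF K(1)])
    then show "(\<lambda>t. w t * K t) \<in> borel_measurable (tm T)" by (intro borel_tmI borel_measurable_times wb)
  qed (rule borel_tmI, intro borel_measurable_times borel_measurable_add borel_measurable_const borel_primitive[OF K(3)] wb)
  finally show ?thesis .
qed

lemma cbump_bounded:
  assumes "continuous_on UNIV g" "\<And>z. g (z + 1) = g (z :: real)"
  shows "\<exists>C. \<forall>z. \<bar>g z :: real\<bar> \<le> C"
proof -
  have "compact (g ` {0..1})"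
    by (rule compact_continuous_image) (auto intro: continuous_on_subset[OF assms(1)])
  then obtain C where C: "\<And>z. z \<in> {0..1} \<Longrightarrow> \<bar>g z\<bar> \<le> C"
    using compact_imp_bounded bounded_iff by (metis imageI real_norm_def)
  have i: "g (z + of_int n) = g z" for z n
  proof (induction n rule: int_induct[of _ 0])
    case (step1 n) then show ?case using assms(2)[of "z + of_int n"] by (simp add: ac_simps)
  next
    case (step2 n) then show ?case using assms(2)[of "z + of_int (n - 1)"] by (simp add: ac_simps)
  qed simp
  have "\<bar>g z\<bar> \<le> C" for z
  proof -
    have "g z = g (frac z)" using i[of "frac z" "\<lfloor>z\<rfloor>"] by (simp add: frac_def)
    then show ?thesis using C[of "frac z"] frac_lt_1[of z] by (simp add: less_imp_le)
  qed
  then show ?thesis by blast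
qed

lemma tbump_bounded: assumes "tbump T f" shows "\<exists>C. \<forall>t. \<bar>f t\<bar> \<le> C"
proof -
  obtain a b where ab: "\<And>t. t \<notin> {a..b} \<Longrightarrow> f t = 0" and s: "smooth_on UNIV f" using assms by (auto simp: tbump_def)
  have "compact (f ` {a..b})"
    by (rule compact_continuous_image) (auto intro: continuous_on_subset[OF smooth_continuous[OF s]])
  then obtain C where C: "\<And>z. z \<in> {a..b} \<Longrightarrow> \<bar>f z\<bar> \<le> C"
    using compact_imp_bounded bounded_iff by (metis imageI real_norm_def)
  have "\<bar>f t\<bar> \<le> max C 0" for t using C[of t] ab[of t] by (cases "t \<in> {a..b}") auto
  then show ?thesis by blast
qed

lemma tbump_borel [measurable_dest]: "tbump T f \<Longrightarrow> f \<in> Borel"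
  by (auto simp: tbump_def intro: smooth_borel)
lemma cbump_borel [measurable_dest]: "cbump f \<Longrightarrow> f \<in> Borel"
  by (auto simp: cbump_def intro: smooth_borel)

lemma cbump_bdd: "cbump g \<Longrightarrow> \<exists>C. \<forall>z. \<bar>g z\<bar> \<le> C"
  by (rule cbump_bounded) (auto simp: cbump_def smooth_continuous)

lemma cbump_integrable: "cbump g \<Longrightarrow> integrable cm g"
  using cbump_bdd[of g] by (auto intro!: cm.integrable_const_bound AE_I2 simp: cbump_borel)
lemma tbump_integrable: "tbump T g \<Longrightarrow> integrable (tm S) g"
  using tbump_bounded[of T g] by (auto intro!: tm.integrable_const_bound AE_I2 simp: tbump_borel)

lemma borel_fst_snd [measurable]:
  "fst \<in> borel_measurable (borel :: (real \<times> real) measure)" "snd \<in> borel_measurable (borel :: (real \<times> real) measure)"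
  by (auto simp: borel_prod[symmetric])

lemma borel_pair_section:
  assumes "w \<in> borel_measurable (borel :: (real \<times> real) measure)"
    "f \<in> borel_measurable M" "g \<in> borel_measurable M"
  shows "(\<lambda>x. w (f x, g x)) \<in> borel_measurable M"
proof -
  have "(\<lambda>x. (f x, g x)) \<in> M \<rightarrow>\<^sub>M borel" using assms(2,3) by (rule borel_measurable_Pair)
  from measurable_compose[OF this assms(1)] show ?thesis .
qed

section \<open>Primitives on the cylinder and functions with weak derivatives\<close>

definition zprim :: "(real \<times> real \<Rightarrow> real) \<Rightarrow> real \<times> real \<Rightarrow> real" where
  "zprim w x = (LINT y|cm. indicator {..<snd x} y * w (fst x, y))"
definition tprim :: "real \<Rightarrow> (real \<times> real \<Rightarrow> real) \<Rightarrow> real \<times> real \<Rightarrow> real" where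
  "tprim T w x = (LINT s|tm T. indicator {..<fst x} s * w (s, snd x))"

lemma borel_zprim [measurable]:
  assumes [measurable]: "w \<in> Borel" shows "zprim w \<in> Borel"
proof -
  have [measurable]: "Measurable.pred (borel \<Otimes>\<^sub>M cm) (\<lambda>(x :: real \<times> real, y). y < snd x)" by measurable
  have "(\<lambda>x. LINT y|cm. (if y < snd x then 1 else 0) * w (fst x, y)) \<in> Borel"
    by measurable
  then show ?thesis by (simp add: zprim_def[abs_def] indicator_def of_bool_def)
qed

lemma borel_tprim [measurable]:
  assumes [measurable]: "w \<in> Borel" shows "tprim T w \<in> Borel"
proof -
  have [measurable]: "Measurable.pred (borel \<Otimes>\<^sub>M tm T) (\<lambda>(x :: real \<times> real, y). y < fst x)" by measurable
  have "(\<lambda>x. LINT y|tm T. (if y < fst x then 1 else 0) * w (y, snd x)) \<in> Borel"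
    by measurable
  then show ?thesis by (simp add: tprim_def[abs_def] indicator_def of_bool_def)
qed

lemma MM_integral:
  fixes f :: "real \<times> real \<Rightarrow> real"
  assumes "integrable (MM T) f"
  shows "(LINT x|MM T. f x) = (LINT t|tm T. LINT z|cm. f (t, z))"
  using MM.integral_fst'[of T f] assms unfolding MM_def by simp

lemma MM_integral':
  fixes f :: "real \<times> real \<Rightarrow> real"
  assumes "integrable (MM T) f"
  shows "(LINT x|MM T. f x) = (LINT z|cm. LINT t|tm T. f (t, z))"
  using MM.integral_snd[where T=T and f="\<lambda>t z. f (t, z)"] assms unfolding MM_def by simp

lemma AE_MM_section: "integrable (MM T) f \<Longrightarrow> AE t in tm T. integrable cm (\<lambda>z. f (t, z))"
  for f :: "real \<times> real \<Rightarrow> real"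
  unfolding MM_def by (rule MM.AE_integrable_fst')
lemma AE_MM_section': "integrable (MM T) f \<Longrightarrow> AE z in cm. integrable (tm T) (\<lambda>t. f (t, z))"
  for f :: "real \<times> real \<Rightarrow> real"
  unfolding MM_def by (rule MM.AE_integrable_snd[of _ "\<lambda>t z. f (t, z)"]) simp
lemma integrable_MM_fst: "integrable (MM T) f \<Longrightarrow> integrable (tm T) (\<lambda>t. LINT z|cm. f (t, z))"
  for f :: "real \<times> real \<Rightarrow> real"
  unfolding MM_def by (rule MM.integrable_fst')
lemma integrable_MM_snd: "integrable (MM T) f \<Longrightarrow> integrable cm (\<lambda>z. LINT t|tm T. f (t, z))"
  for f :: "real \<times> real \<Rightarrow> real"
  unfolding MM_def by (rule MM.integrable_snd[of _ "\<lambda>t z. f (t, z)"]) simp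

lemma integrable_MM_prod: "integrable (tm T) f \<Longrightarrow> integrable cm g \<Longrightarrow> integrable (MM T) (\<lambda>x. f (fst x) * g (snd x))"
  for f g :: "real \<Rightarrow> real"
  unfolding MM_def by (rule integrable_prod[OF tm.finite_measure_axioms cm.finite_measure_axioms])
lemma MM_prod_integral:
  fixes a b :: "real \<Rightarrow> real"
  assumes "integrable (tm T) a" "integrable cm b"
  shows "(LINT x|MM T. a (fst x) * b (snd x)) = (LINT t|tm T. a t) * (LINT z|cm. b z)"
  unfolding MM_integral[OF integrable_MM_prod[OF assms]] by simp

lemma integrable_MM_of_fst: "integrable (tm T) f \<Longrightarrow> integrable (MM T) (\<lambda>x. f (fst x) :: real)"
  using integrable_MM_prod[of T f "\<lambda>_. 1"] by simp
lemma integrable_MM_of_snd: "integrable cm f \<Longrightarrow> integrable (MM T) (\<lambda>x. f (snd x) :: real)"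
  using integrable_MM_prod[of T "\<lambda>_. 1" f] by simp

lemma integrable_zprim:
  assumes w: "integrable (MM T) w"
  shows "integrable (MM T) (zprim w)"
proof (rule Bochner_Integration.integrable_bound)
  have [measurable]: "w \<in> Borel" using borel_measurable_integrable[OF w] by simp
  show "integrable (MM T) (\<lambda>x. LINT y|cm. \<bar>w (fst x, y)\<bar>)"
    by (rule integrable_MM_of_fst, rule integrable_MM_fst) (use w in auto)
  show "zprim w \<in> borel_measurable (MM T)" by measurable
  show "AE x in MM T. norm (zprim w x) \<le> norm (LINT y|cm. \<bar>w (fst x, y)\<bar>)"
    using AE_MM_fst[OF AE_MM_section[OF w]]
  proof eventually_elim
    case (elim x)
    from abs_indicator_integral_le[OF elim, of "{..<snd x}"] show ?case by (simp add: zprim_def)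
  qed
qed

lemma integrable_tprim:
  assumes w: "integrable (MM T) w"
  shows "integrable (MM T) (tprim T w)"
proof (rule Bochner_Integration.integrable_bound)
  have [measurable]: "w \<in> Borel" using borel_measurable_integrable[OF w] by simp
  show "integrable (MM T) (\<lambda>x. LINT y|tm T. \<bar>w (y, snd x)\<bar>)"
    by (rule integrable_MM_of_snd, rule integrable_MM_snd) (use w in auto)
  show "tprim T w \<in> borel_measurable (MM T)" by measurable
  show "AE x in MM T. norm (tprim T w x) \<le> norm (LINT y|tm T. \<bar>w (y, snd x)\<bar>)"
    using AE_MM_snd[OF AE_MM_section'[OF w]]
  proof eventually_elim
    case (elim x)
    from abs_indicator_integral_le[OF elim, of "{..<fst x}"] show ?case by (simp add: tprim_def)
  qed
qed

lemma integrable_MM_test: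
  fixes f g :: "real \<Rightarrow> real" and v :: "real \<times> real \<Rightarrow> real"
  assumes "integrable (MM T) v" "f \<in> Borel" "g \<in> Borel"
    "\<And>t. \<bar>f t\<bar> \<le> C" "\<And>z. \<bar>g z\<bar> \<le> D"
  shows "integrable (MM T) (\<lambda>x. v x * (f (fst x) * g (snd x)))"
proof (rule integrable_times_bounded[OF assms(1)])
  note [measurable] = assms(2,3)
  show "(\<lambda>x. f (fst x) * g (snd x)) \<in> borel_measurable (MM T)" by measurable
  show "AE x in MM T. \<bar>f (fst x) * g (snd x)\<bar> \<le> C * D"
    using assms(4,5) by (auto simp: abs_mult intro!: AE_I2 mult_mono order_trans[OF abs_ge_zero])
qed

text \<open>The lemma of du Bois-Reymond, slice by slice. Testing with \<open>g = 1\<close> shows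
  that \<open>w\<close> has mean 0 on almost every slice, so that integration by parts around the
  circle applies to \<open>zprim w\<close>. Then \<open>v - zprim w\<close> is orthogonal to all
  products \<open>f k\<close> with \<open>k\<close> of mean 0, and hence equals its own mean in
  \<open>z\<close>.\<close>

theorem zrep:
  assumes v: "integrable (MM T) v" and w: "integrable (MM T) w" and T: "0 < T"
    and H: "\<And>f g. tbump T f \<Longrightarrow> cbump g \<Longrightarrow>
      (LINT x|MM T. v x * (f (fst x) * deriv g (snd x))) = - (LINT x|MM T. w x * (f (fst x) * g (snd x)))"
  shows "AE t in tm T. (LINT z|cm. w (t, z)) = 0"
    and "\<exists>c\<in>Borel. AE x in MM T. v x = c (fst x) + zprim w x"
proof -
  have [measurable]: "v \<in> Borel" "w \<in> Borel"
    using borel_measurable_integrable[OF v] borel_measurable_integrable[OF w] by auto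
  note v' = AE_MM_section[OF v] and w' = AE_MM_section[OF w]
  have one: "cbump (\<lambda>_. 1)" by (simp add: cbump_def smooth_const)
  have iw: "integrable (MM T) (\<lambda>x. LINT z|cm. w (fst x, z))"
    by (rule integrable_MM_of_fst[OF integrable_MM_fst[OF w]])
  have "AE x in MM T. (LINT z|cm. w (fst x, z)) = 0"
  proof (rule fundamental_lemma[OF iw])
    fix f g assume f: "tbump T f" and g: "cbump g"
    obtain C where C: "\<And>t. \<bar>f t\<bar> \<le> C" using tbump_bounded[OF f] by blast
    obtain D where D: "\<And>t. \<bar>g t\<bar> \<le> D" using cbump_bdd[OF g] by blast
    note [measurable] = tbump_borel[OF f] cbump_borel[OF g]
    have "(LINT x|MM T. w x * (f (fst x) * 1)) = 0" using H[OF f one] by simp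
    then have z: "(LINT t|tm T. f t * (LINT z|cm. w (t, z))) = 0"
      using integrable_MM_test[OF w, of f "\<lambda>_. 1" C 1] C by (subst (asm) MM_integral) (auto simp: mult.commute)
    have "(LINT x|MM T. (LINT z|cm. w (fst x, z)) * (f (fst x) * g (snd x)))
       = (LINT t|tm T. LINT z|cm. (LINT z|cm. w (t, z)) * (f t * g z))"
      by (subst MM_integral) (auto intro!: integrable_MM_test[OF iw, of _ _ C D] C D)
    also have "\<dots> = (LINT t|tm T. (f t * (LINT z|cm. w (t, z))) * (LINT z|cm. g z))"
      by (simp add: mult.assoc[symmetric] mult.commute)
    also have "\<dots> = 0" using z by simp
    finally show "(LINT x|MM T. (LINT z|cm. w (fst x, z)) * (f (fst x) * g (snd x))) = 0" .
  qed
  from AE_MM_fst_D[OF this] show a: "AE t in tm T. (LINT z|cm. w (t, z)) = 0" .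
  define u where "u x = v x - zprim w x" for x
  have u: "integrable (MM T) u" unfolding u_def using v integrable_zprim[OF w] by simp
  have [measurable]: "u \<in> Borel" using borel_measurable_integrable[OF u] by simp
  define c where "c t = (LINT z|cm. u (t, z))" for t
  have ci: "integrable (tm T) c" unfolding c_def by (rule integrable_MM_fst[OF u])
  have cM: "integrable (MM T) (\<lambda>x. c (fst x))" by (rule integrable_MM_of_fst[OF ci])
  have [measurable]: "c \<in> Borel" using borel_measurable_integrable[OF ci] by simp
  have uc: "integrable (MM T) (\<lambda>x. u x - c (fst x))" using u cM by simp
  have "AE x in MM T. u x - c (fst x) = 0"
  proof (rule fundamental_lemma[OF uc])
    fix f g assume f: "tbump T f" and g: "cbump g"
    obtain C where C: "\<And>t. \<bar>f t\<bar> \<le> C" using tbump_bounded[OF f] by blast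
    obtain D where D: "\<And>t. \<bar>g t\<bar> \<le> D" using cbump_bdd[OF g] by blast
    note [measurable] = tbump_borel[OF f] cbump_borel[OF g]
    \<comment> \<open>Only after its mean has been subtracted does \<open>g\<close> have a periodic
      antiderivative, that is, an admissible test function \<open>G\<close>.\<close>
    define m where "m = (LINT z|cm. g z)"
    define k where "k z = g z - m" for z
    have sk: "smooth_on UNIV k" unfolding k_def using g by (intro smooth_diff smooth_const) (simp add: cbump_def)
    have kp: "k (z + 1) = k z" for z using g by (simp add: k_def cbump_def)
    obtain G where G: "\<And>x. (G has_real_derivative k x) (at x)"
      using continuous_antideriv[OF smooth_continuous[OF sk]] by blast
    have sG: "smooth_on UNIV G" by (rule smooth_antideriv[OF G sk])
    have ck: "cbump k" using sk kp by (simp add: cbump_def)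
    then obtain E where E: "\<And>t. \<bar>k t\<bar> \<le> E" using cbump_bdd by blast
    have [measurable]: "k \<in> Borel" "G \<in> Borel"
      using cbump_borel[OF ck] smooth_borel[OF sG] by auto
    have ik: "integrable cm k" by (rule cbump_integrable[OF ck])
    have "(LINT z|cm. k z) = 0" unfolding k_def m_def using cbump_integrable[OF g] by simp
    then have G01: "G 1 = G 0" using tm_FTC(1)[OF G smooth_continuous[OF sk], of 0 1] tm_integral_drop[of k 1] by (simp add: cm_eq_tm)
    have Gp: "G (z + 1) = G z" for z
    proof -
      have "((\<lambda>z. G (z + 1) - G z) has_real_derivative k (z + 1) - k z) (at z)" for z
        by (intro DERIV_diff G DERIV_shift[THEN iffD1])
      then have "((\<lambda>z. G (z + 1) - G z) has_real_derivative 0) (at z)" for z by (simp add: kp)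
      from DERIV_isconst_all[OF allI[OF this], of z 0] show ?thesis using G01 by simp
    qed
    have cG: "cbump G" using sG Gp by (simp add: cbump_def)
    then obtain E' where E': "\<And>t. \<bar>G t\<bar> \<le> E'" using cbump_bdd by blast
    have dG: "deriv G z = k z" for z by (rule DERIV_imp_deriv[OF G])
    have 1: "(LINT x|MM T. v x * (f (fst x) * k (snd x))) = - (LINT x|MM T. w x * (f (fst x) * G (snd x)))"
      using H[OF f cG] unfolding dG .
    have "(LINT x|MM T. zprim w x * (f (fst x) * k (snd x)))
       = (LINT t|tm T. LINT z|cm. zprim w (t, z) * (f t * k z))"
      by (subst MM_integral) (auto intro!: integrable_MM_test[OF integrable_zprim[OF w], of _ _ C E] C E)
    also have "\<dots> = (LINT t|tm T. LINT z|cm. - (w (t, z) * (f t * G z)))"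
    proof (rule integral_cong_AE)
      show "AE t in tm T. (LINT z|cm. zprim w (t, z) * (f t * k z)) = (LINT z|cm. - (w (t, z) * (f t * G z)))"
        using w' a
      proof eventually_elim
        case (elim t)
        have P: "(LINT z|cm. k z * zprim w (t, z)) = - (LINT z|cm. w (t, z) * G z)"
          unfolding zprim_def fst_conv snd_conv cm_eq_tm
          by (rule tm_IBP[OF G smooth_continuous[OF sk]]) (use elim ik G01 in \<open>auto simp: cm_eq_tm\<close>)
        have e1: "(LINT z|cm. zprim w (t, z) * (f t * k z)) = f t * (LINT z|cm. k z * zprim w (t, z))"
          by (subst integral_mult_right_zero[symmetric]) (simp add: ac_simps)
        have e2: "(LINT z|cm. - (w (t, z) * (f t * G z))) = - f t * (LINT z|cm. w (t, z) * G z)"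
          by (subst integral_mult_right_zero[symmetric]) (simp add: ac_simps)
        show ?case unfolding e1 e2 P by simp
      qed
    qed measurable
    also have "\<dots> = - (LINT x|MM T. w x * (f (fst x) * G (snd x)))"
      by (subst MM_integral) (auto intro!: integrable_MM_test[OF w, of _ _ C E'] C E')
    finally have 2: "(LINT x|MM T. zprim w x * (f (fst x) * k (snd x))) = - (LINT x|MM T. w x * (f (fst x) * G (snd x)))" .
    have i1: "integrable (MM T) (\<lambda>x. v x * (f (fst x) * k (snd x)))" by (rule integrable_MM_test[OF v, of _ _ C E]) (auto intro: C E)
    have i2: "integrable (MM T) (\<lambda>x. zprim w x * (f (fst x) * k (snd x)))"
      by (rule integrable_MM_test[OF integrable_zprim[OF w], of _ _ C E]) (auto intro: C E)
    have 3: "(LINT x|MM T. u x * (f (fst x) * k (snd x))) = 0"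
      unfolding u_def left_diff_distrib using i1 i2 1 2 by simp
    have iu: "integrable (MM T) (\<lambda>x. u x * (f (fst x) * g (snd x)))" by (rule integrable_MM_test[OF u, of _ _ C D]) (auto intro: C D)
    have iu1: "integrable (MM T) (\<lambda>x. u x * (f (fst x) * 1))" by (rule integrable_MM_test[OF u, of _ _ C 1]) (auto intro: C)
    have ic: "integrable (MM T) (\<lambda>x. c (fst x) * (f (fst x) * g (snd x)))" by (rule integrable_MM_test[OF cM, of _ _ C D]) (auto intro: C D)
    have icf: "integrable (tm T) (\<lambda>t. c t * f t)" by (rule integrable_times_bounded[OF ci, of _ C]) (use C in auto)
    have "(LINT x|MM T. c (fst x) * (f (fst x) * g (snd x))) = (LINT t|tm T. c t * f t) * m"
      using MM_prod_integral[OF icf cbump_integrable[OF g]] by (simp add: m_def mult.assoc)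
    moreover have "(LINT x|MM T. u x * (f (fst x) * 1)) = (LINT t|tm T. c t * f t)"
      by (subst MM_integral[OF iu1]) (simp add: c_def)
    ultimately have 4: "(LINT x|MM T. c (fst x) * (f (fst x) * g (snd x))) = m * (LINT x|MM T. u x * (f (fst x) * 1))" by simp
    have "(LINT x|MM T. u x * (f (fst x) * k (snd x)))
        = (LINT x|MM T. u x * (f (fst x) * g (snd x)) - m * (u x * (f (fst x) * 1)))"
      by (rule Bochner_Integration.integral_cong) (auto simp: k_def algebra_simps)
    also have "\<dots> = (LINT x|MM T. u x * (f (fst x) * g (snd x))) - m * (LINT x|MM T. u x * (f (fst x) * 1))"
      using iu iu1 by simp
    finally have 5: "(LINT x|MM T. u x * (f (fst x) * g (snd x))) = m * (LINT x|MM T. u x * (f (fst x) * 1))" using 3 by simp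
    show "(LINT x|MM T. (u x - c (fst x)) * (f (fst x) * g (snd x))) = 0"
      unfolding left_diff_distrib using iu ic 4 5 by simp
  qed
  then have "AE x in MM T. v x = c (fst x) + zprim w x" by eventually_elim (simp add: u_def)
  then show "\<exists>c\<in>Borel. AE x in MM T. v x = c (fst x) + zprim w x" by (intro bexI[of _ c]) simp_all
qed

lemma tbump_normalized: assumes "0 < T" shows "\<exists>f. tbump T f \<and> (LINT t|tm T. f t) = 1"
proof -
  have [measurable]: "tb T n \<in> Borel" for n by (rule tbump_borel[OF tbump_tb[OF assms order_refl]])
  have "(\<lambda>n. LINT t|tm T. tb T n t) \<longlonglongrightarrow> (LINT t|tm T. 1)"
  proof (rule integral_dominated_convergence[where w="\<lambda>_. 1"])
    show "AE t in tm T. (\<lambda>n. tb T n t) \<longlonglongrightarrow> 1"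
      using AE_tm_range
    proof eventually_elim
      case (elim t) then show ?case using tb_tendsto[of t T] by simp
    qed
    show "tb T n \<in> borel_measurable (tm T)" for n by measurable
  qed (auto simp: tb_range)
  moreover have "(LINT t|tm T. 1) = T" using assms by (simp add: measure_tm)
  ultimately have "\<exists>n. 0 < (LINT t|tm T. tb T n t)"
    using assms by (auto dest!: order_tendstoD(1)[where a=0] dest: eventually_happens)
  then obtain n where n: "0 < (LINT t|tm T. tb T n t)" by blast
  let ?c = "LINT t|tm T. tb T n t"
  have "tbump T (\<lambda>t. (1 / ?c) * tb T n t)"
  proof -
    have "smooth_on UNIV (\<lambda>t. (1 / ?c) * tb T n t)"
      using tbump_tb[OF assms order_refl, of n] by (intro smooth_mult smooth_const) (simp add: tbump_def)
    then show ?thesis using tbump_tb[OF assms order_refl, of n] unfolding tbump_def by auto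
  qed
  moreover have "(LINT t|tm T. (1 / ?c) * tb T n t) = 1" using n by simp
  ultimately show ?thesis by blast
qed

text \<open>The analogue of \<open>zrep\<close> in time, where nonzero constants are not admissible
  tests. The mean is replaced by the weighted mean against a fixed bump \<open>b\<close> of integral
  1: for a bump \<open>f\<close> of integral \<open>m\<close>, the function \<open>f - m b\<close>
  has integral 0, so its antiderivative is again supported inside the interval.\<close>

theorem trep:
  assumes v: "integrable (MM T) v" and w: "integrable (MM T) w" and T: "0 < T"
    and H: "\<And>f g. tbump T f \<Longrightarrow> cbump g \<Longrightarrow>
      (LINT x|MM T. v x * (deriv f (fst x) * g (snd x))) = - (LINT x|MM T. w x * (f (fst x) * g (snd x)))"
  shows "\<exists>d\<in>Borel. integrable cm d \<and> (AE x in MM T. v x = d (snd x) + tprim T w x)"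
proof -
  have [measurable]: "v \<in> Borel" "w \<in> Borel"
    using borel_measurable_integrable[OF v] borel_measurable_integrable[OF w] by auto
  note w' = AE_MM_section'[OF w]
  obtain b where b: "tbump T b" and b1: "(LINT t|tm T. b t) = 1" using tbump_normalized[OF T] by blast
  obtain B where B: "\<And>t. \<bar>b t\<bar> \<le> B" using tbump_bounded[OF b] by blast
  note [measurable] = tbump_borel[OF b]
  define u where "u x = v x - tprim T w x" for x
  have u: "integrable (MM T) u" unfolding u_def using v integrable_tprim[OF w] by simp
  have [measurable]: "u \<in> Borel" using borel_measurable_integrable[OF u] by simp
  have ub: "integrable (MM T) (\<lambda>x. u x * (b (fst x) * 1))" by (rule integrable_MM_test[OF u, of _ _ B 1]) (auto intro: B)
  define d where "d z = (LINT t|tm T. u (t, z) * b t)" for z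
  have di: "integrable cm d" unfolding d_def using integrable_MM_snd[OF ub] by simp
  have dM: "integrable (MM T) (\<lambda>x. d (snd x))" by (rule integrable_MM_of_snd[OF di])
  have [measurable]: "d \<in> Borel" using borel_measurable_integrable[OF di] by simp
  have ud: "integrable (MM T) (\<lambda>x. u x - d (snd x))" using u dM by simp
  have "AE x in MM T. u x - d (snd x) = 0"
  proof (rule fundamental_lemma[OF ud])
    fix f g assume f: "tbump T f" and g: "cbump g"
    obtain C where C: "\<And>t. \<bar>f t\<bar> \<le> C" using tbump_bounded[OF f] by blast
    obtain D where D: "\<And>t. \<bar>g t\<bar> \<le> D" using cbump_bdd[OF g] by blast
    note [measurable] = tbump_borel[OF f] cbump_borel[OF g]
    define m where "m = (LINT t|tm T. f t)"
    define k where "k t = f t - m * b t" for t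
    have sk: "smooth_on UNIV k" unfolding k_def
      using f b by (intro smooth_diff smooth_mult smooth_const) (auto simp: tbump_def)
    obtain a1 b1' where ab1: "0 < a1" "b1' < T" "\<And>t. t \<notin> {a1..b1'} \<Longrightarrow> f t = 0" using f by (auto simp: tbump_def)
    obtain a2 b2 where ab2: "0 < a2" "b2 < T" "\<And>t. t \<notin> {a2..b2} \<Longrightarrow> b t = 0" using b by (auto simp: tbump_def)
    define a0 where "a0 = min a1 a2"
    define b0 where "b0 = max b1' b2"
    have a0: "0 < a0" "b0 < T" using ab1 ab2 by (auto simp: a0_def b0_def)
    have k0: "k t = 0" if "t \<notin> {a0..b0}" for t
    proof -
      have "t \<notin> {a1..b1'}" "t \<notin> {a2..b2}" using that by (auto simp: a0_def b0_def)
      then show ?thesis using ab1(3) ab2(3) by (simp add: k_def)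
    qed
    obtain K0 where K0: "\<And>x. (K0 has_real_derivative k x) (at x)"
      using continuous_antideriv[OF smooth_continuous[OF sk]] by blast
    define K where "K t = K0 t - K0 0" for t
    have K: "(K has_real_derivative k x) (at x)" for x
      unfolding K_def using DERIV_diff[OF K0 DERIV_const] by fastforce
    have sK: "smooth_on UNIV K" by (rule smooth_antideriv[OF K sk])
    have tk: "tbump T k" unfolding tbump_def using sk k0 a0 by blast
    have mk: "(LINT t|tm T. k t) = 0" unfolding k_def m_def
      using tbump_integrable[OF f] tbump_integrable[OF b] b1 by simp
    have KT: "K T = 0"
      using tm_FTC(1)[OF K smooth_continuous[OF sk], of 0 T] T mk tm_integral_drop[OF tbump_borel[OF tk]] by (simp add: K_def)
    \<comment> \<open>\<open>K\<close> is constant on each side of the support of \<open>k\<close>;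
      the constants are 0 because \<open>K 0 = 0\<close> and \<open>K T = 0\<close>.\<close>
    have const: "K x = K y" if "convex S" "x \<in> S" "y \<in> S" "S \<inter> {a0..b0} = {}" for S x y
    proof -
      have "(K has_field_derivative 0) (at x within S)" if "x \<in> S" for x
      proof -
        have "k x = 0" using \<open>S \<inter> {a0..b0} = {}\<close> that by (intro k0) auto
        then show ?thesis using has_field_derivative_at_within[OF K, of x S] by simp
      qed
      from has_field_derivative_zero_constant[OF \<open>convex S\<close> this] show ?thesis using that by auto
    qed
    have Kout: "K t = 0" if "t \<notin> {a0..b0}" for t
    proof -
      have "{..<a0} \<inter> {a0..b0} = {}" "{b0<..} \<inter> {a0..b0} = {}" by auto
      then show ?thesis using that const[of "{..<a0}" t 0] const[of "{b0<..}" t T] KT a0 by (auto simp: K_def)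
    qed
    have tK: "tbump T K" unfolding tbump_def using sK Kout a0 by blast
    obtain E where E: "\<And>t. \<bar>k t\<bar> \<le> E" using tbump_bounded[OF tk] by blast
    obtain E' where E': "\<And>t. \<bar>K t\<bar> \<le> E'" using tbump_bounded[OF tK] by blast
    note [measurable] = tbump_borel[OF tk] tbump_borel[OF tK]
    have dK: "deriv K z = k z" for z by (rule DERIV_imp_deriv[OF K])
    have 1: "(LINT x|MM T. v x * (k (fst x) * g (snd x))) = - (LINT x|MM T. w x * (K (fst x) * g (snd x)))"
      using H[OF tK g] unfolding dK .
    have ik: "integrable (tm T) k" by (rule tbump_integrable[OF tk])
    have "(LINT x|MM T. tprim T w x * (k (fst x) * g (snd x)))
       = (LINT z|cm. LINT t|tm T. tprim T w (t, z) * (k t * g z))"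
      by (subst MM_integral') (auto intro!: integrable_MM_test[OF integrable_tprim[OF w], of _ _ E D] E D)
    also have "\<dots> = (LINT z|cm. LINT t|tm T. - (w (t, z) * (K t * g z)))"
    proof (rule integral_cong_AE)
      show "AE z in cm. (LINT t|tm T. tprim T w (t, z) * (k t * g z)) = (LINT t|tm T. - (w (t, z) * (K t * g z)))"
        using w'
      proof eventually_elim
        case (elim z)
        have P: "(LINT t|tm T. k t * tprim T w (t, z)) = - (LINT t|tm T. w (t, z) * K t)"
          unfolding tprim_def fst_conv snd_conv
          by (rule tm_IBP[OF K smooth_continuous[OF sk]]) (use elim ik KT T in \<open>auto simp: K_def\<close>)
        have e1: "(LINT t|tm T. tprim T w (t, z) * (k t * g z)) = g z * (LINT t|tm T. k t * tprim T w (t, z))"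
          by (subst integral_mult_right_zero[symmetric]) (simp add: ac_simps)
        have e2: "(LINT t|tm T. - (w (t, z) * (K t * g z))) = - g z * (LINT t|tm T. w (t, z) * K t)"
          by (subst integral_mult_right_zero[symmetric]) (simp add: ac_simps)
        show ?case unfolding e1 e2 P by simp
      qed
    qed measurable
    also have "\<dots> = - (LINT x|MM T. w x * (K (fst x) * g (snd x)))"
      by (subst MM_integral') (auto intro!: integrable_MM_test[OF w, of _ _ E' D] D E')
    finally have 2: "(LINT x|MM T. tprim T w x * (k (fst x) * g (snd x))) = - (LINT x|MM T. w x * (K (fst x) * g (snd x)))" .
    have i1: "integrable (MM T) (\<lambda>x. v x * (k (fst x) * g (snd x)))" by (rule integrable_MM_test[OF v, of _ _ E D]) (auto intro: D E)
    have i2: "integrable (MM T) (\<lambda>x. tprim T w x * (k (fst x) * g (snd x)))"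
      by (rule integrable_MM_test[OF integrable_tprim[OF w], of _ _ E D]) (auto intro: D E)
    have 3: "(LINT x|MM T. u x * (k (fst x) * g (snd x))) = 0"
      unfolding u_def left_diff_distrib using i1 i2 1 2 by simp
    have iu: "integrable (MM T) (\<lambda>x. u x * (f (fst x) * g (snd x)))" by (rule integrable_MM_test[OF u, of _ _ C D]) (auto intro: C D)
    have iu1: "integrable (MM T) (\<lambda>x. u x * (b (fst x) * g (snd x)))" by (rule integrable_MM_test[OF u, of _ _ B D]) (auto intro: B D)
    have ic: "integrable (MM T) (\<lambda>x. d (snd x) * (f (fst x) * g (snd x)))" by (rule integrable_MM_test[OF dM, of _ _ C D]) (auto intro: C D)
    have idg: "integrable cm (\<lambda>z. d z * g z)" by (rule integrable_times_bounded[OF di, of _ D]) (use D in auto)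
    have 40: "(LINT x|MM T. d (snd x) * (f (fst x) * g (snd x))) = m * (LINT z|cm. d z * g z)"
      using MM_prod_integral[OF tbump_integrable[OF f] idg] by (simp add: m_def mult.left_commute)
    have "(LINT z|cm. d z * g z) = (LINT x|MM T. u x * (b (fst x) * g (snd x)))"
      by (subst MM_integral'[OF iu1]) (simp add: d_def mult.assoc[symmetric])
    with 40 have 4: "(LINT x|MM T. d (snd x) * (f (fst x) * g (snd x))) = m * (LINT x|MM T. u x * (b (fst x) * g (snd x)))" by (simp only:)
    have "(LINT x|MM T. u x * (k (fst x) * g (snd x)))
        = (LINT x|MM T. u x * (f (fst x) * g (snd x)) - m * (u x * (b (fst x) * g (snd x))))"
      by (rule Bochner_Integration.integral_cong) (auto simp: k_def algebra_simps)
    also have "\<dots> = (LINT x|MM T. u x * (f (fst x) * g (snd x))) - m * (LINT x|MM T. u x * (b (fst x) * g (snd x)))"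
      using iu iu1 by simp
    finally have 5: "(LINT x|MM T. u x * (f (fst x) * g (snd x))) = m * (LINT x|MM T. u x * (b (fst x) * g (snd x)))" using 3 by simp
    show "(LINT x|MM T. (u x - d (snd x)) * (f (fst x) * g (snd x))) = 0"
      unfolding left_diff_distrib using iu ic 4 5 by simp
  qed
  then have "AE x in MM T. v x = d (snd x) + tprim T w x" by eventually_elim (simp add: u_def)
  then show ?thesis using di by (intro bexI[of _ d]) simp_all
qed

text \<open>The Sobolev embedding in one dimension: a primitive oscillates by at most the
  \<open>L1\<close> norm of \<open>k\<close>, so its square at \<open>z\<close> is compared with its
  square at \<open>y\<close>, and the comparison is averaged over \<open>y\<close>. The bound holds
  at every \<open>z\<close>, since it concerns the continuous representative of
  \<open>\<zeta>\<close>.\<close>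

lemma prim_sup_bound:
  fixes k :: "real \<Rightarrow> real"
  assumes k: "sqi cm k" and \<zeta>: "sqi cm \<zeta>" "AE z in cm. \<zeta> z = c + (LINT y|cm. indicator {..<z} y * k y)"
  shows "(c + (LINT y|cm. indicator {..<z} y * k y))^2 \<le> 2 * (LINT z|cm. (\<zeta> z)^2) + 2 * (LINT z|cm. (k z)^2)"
proof -
  define P where "P z = (LINT y|cm. indicator {..<z} y * k y)" for z
  have ki: "integrable cm k" by (rule cm.sqi_integrable[OF k])
  define I where "I = (LINT y|cm. \<bar>k y\<bar>)"
  have I0: "0 \<le> I" by (simp add: I_def)
  have "I \<le> sqrt (LINT z|cm. (k z)^2)" unfolding I_def using cm.integral_abs_le[OF k] by simp
  then have "I^2 \<le> (sqrt (LINT z|cm. (k z)^2))^2" by (rule power_mono[OF _ I0])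
  then have I2: "I^2 \<le> (LINT z|cm. (k z)^2)" by simp
  have ii: "integrable cm (\<lambda>y. indicator A y * k y)" if "A \<in> sets borel" for A
    using integrable_real_mult_indicator[OF _ ki, of A] that by (simp add: mult.commute)
  have mono: "\<bar>P z - P y\<bar> \<le> I" for z y
  proof -
    have "P z - P y = (LINT x|cm. (indicator {..<z} x - indicator {..<y} x) * k x)"
      unfolding P_def left_diff_distrib using ii[of "{..<z}"] ii[of "{..<y}"] by simp
    also have "\<bar>\<dots>\<bar> \<le> (LINT x|cm. \<bar>(indicator {..<z} x - indicator {..<y} x) * k x\<bar>)" by (rule integral_abs_bound)
    also have "\<dots> \<le> I" unfolding I_def left_diff_distrib
      using ii[of "{..<z}"] ii[of "{..<y}"] ki by (intro integral_mono) (auto simp: indicator_def)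
    finally show ?thesis .
  qed
  have "AE y in cm. (c + P z)^2 \<le> 2 * (\<zeta> y)^2 + 2 * (LINT z|cm. (k z)^2)"
    using \<zeta>(2)
  proof eventually_elim
    case (elim y)
    have "(c + P z)^2 = (\<zeta> y + (P z - P y))^2" using elim by (simp add: P_def)
    also have "\<dots> \<le> 2 * (\<zeta> y)^2 + 2 * (P z - P y)^2"
      using sum_squares_bound[of "\<zeta> y" "P z - P y"] unfolding power2_sum by linarith
    also have "(P z - P y)^2 \<le> I^2" using mono[of z y] I0 by (simp add: abs_le_square_iff[symmetric])
    finally show ?case using I2 by linarith
  qed
  then have "(LINT y|cm. (c + P z)^2) \<le> (LINT y|cm. 2 * (\<zeta> y)^2 + 2 * (LINT z|cm. (k z)^2))"
    by (intro integral_mono_AE) (use \<zeta>(1) in auto)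
  also have "\<dots> = 2 * (LINT z|cm. (\<zeta> z)^2) + 2 * (LINT z|cm. (k z)^2)" using \<zeta>(1) by (simp add: sqi_def)
  finally show ?thesis by (simp add: P_def)
qed

section \<open>Difference quotients and averages\<close>

definition periodic1 :: "(real \<Rightarrow> 'a) \<Rightarrow> bool" where
  "periodic1 g \<longleftrightarrow> (\<forall>z. g (z + 1) = g z)"

lemma periodic1_int: assumes "periodic1 g" shows "g (z + of_int n) = g z"
proof (induction n rule: int_induct[of _ 0])
  case (step1 n) then show ?case using assms[unfolded periodic1_def, rule_format, of "z + of_int n"] by (simp add: ac_simps)
next
  case (step2 n) then show ?case using assms[unfolded periodic1_def, rule_format, of "z + of_int (n - 1)"] by (simp add: ac_simps)
qed simp

lemma periodic1_frac: "periodic1 g \<Longrightarrow> g (z + s) = g (z + frac s)"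
  using periodic1_int[of g "z + frac s" "\<lfloor>s\<rfloor>"] by (simp add: frac_def)

lemma nn_integral_cm: "f \<in> Borel \<Longrightarrow> (\<integral>\<^sup>+z. f z \<partial>cm) = (\<integral>\<^sup>+z. indicator {0..<1} z * f z \<partial>lborel)"
  unfolding cm_def by (rule nn_integral_density) auto

lemma nn_integral_lborel_shift:
  fixes f :: "real \<Rightarrow> ennreal" assumes "f \<in> Borel"
  shows "(\<integral>\<^sup>+z. f (z + s) \<partial>lborel) = (\<integral>\<^sup>+z. f z \<partial>lborel)"
  using nn_integral_real_affine[OF assms, of 1 s] by (simp add: add.commute)

text \<open>After reduction of \<open>s\<close> modulo 1 the shifted period sticks out beyond 1 by
  \<open>r\<close>, and periodicity moves that piece back to the start. Nonnegative functions come
  first because the integrability of shifted functions also has to be derived.\<close>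

lemma nn_integral_cm_shift:
  fixes g :: "real \<Rightarrow> ennreal"
  assumes [measurable]: "g \<in> Borel" and p: "periodic1 g"
  shows "(\<integral>\<^sup>+z. g (z + s) \<partial>cm) = (\<integral>\<^sup>+z. g z \<partial>cm)"
proof -
  define r where "r = frac s"
  have r: "0 \<le> r" "r < 1" by (auto simp: r_def frac_lt_1)
  have B: "(\<integral>\<^sup>+z. indicator {1..<1+r} z * g z \<partial>lborel) = (\<integral>\<^sup>+z. indicator {0..<r} z * g z \<partial>lborel)"
  proof -
    have "(\<integral>\<^sup>+z. indicator {1..<1+r} z * g z \<partial>lborel) = (\<integral>\<^sup>+z. indicator {1..<1+r} (z + 1) * g (z + 1) \<partial>lborel)"
      by (rule nn_integral_lborel_shift[symmetric]) simp
    also have "\<dots> = (\<integral>\<^sup>+z. indicator {0..<r} z * g z \<partial>lborel)"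
      using p by (intro nn_integral_cong) (auto simp: indicator_def periodic1_def)
    finally show ?thesis .
  qed
  have "(\<integral>\<^sup>+z. g (z + s) \<partial>cm) = (\<integral>\<^sup>+z. g (z + r) \<partial>cm)" using periodic1_frac[OF p] by (simp add: r_def)
  also have "\<dots> = (\<integral>\<^sup>+z. indicator {0..<1} z * g (z + r) \<partial>lborel)" by (rule nn_integral_cm) simp
  also have "\<dots> = (\<integral>\<^sup>+z. indicator {r..<1+r} (z + r) * g (z + r) \<partial>lborel)"
    by (intro nn_integral_cong) (auto simp: indicator_def)
  also have "\<dots> = (\<integral>\<^sup>+z. indicator {r..<1+r} z * g z \<partial>lborel)"
    by (rule nn_integral_lborel_shift) simp
  also have "\<dots> = (\<integral>\<^sup>+z. indicator {r..<1} z * g z + indicator {1..<1+r} z * g z \<partial>lborel)"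
    using r by (intro nn_integral_cong) (auto simp: indicator_def)
  also have "\<dots> = (\<integral>\<^sup>+z. indicator {r..<1} z * g z \<partial>lborel) + (\<integral>\<^sup>+z. indicator {0..<r} z * g z \<partial>lborel)"
    by (subst nn_integral_add) (auto simp: B)
  also have "\<dots> = (\<integral>\<^sup>+z. indicator {r..<1} z * g z + indicator {0..<r} z * g z \<partial>lborel)"
    by (rule nn_integral_add[symmetric]) auto
  also have "\<dots> = (\<integral>\<^sup>+z. indicator {0..<1} z * g z \<partial>lborel)"
    using r by (intro nn_integral_cong) (auto simp: indicator_def)
  also have "\<dots> = (\<integral>\<^sup>+z. g z \<partial>cm)" by (rule nn_integral_cm[symmetric]) simp
  finally show ?thesis .
qed

lemma
  fixes g :: "real \<Rightarrow> real"
  assumes [measurable]: "g \<in> Borel" and p: "periodic1 g"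
  shows integrable_cm_shift: "integrable cm (\<lambda>z. g (z + s)) \<longleftrightarrow> integrable cm g"
    and integral_cm_shift: "(LINT z|cm. g (z + s)) = (LINT z|cm. g z)"
proof -
  have nn: "(\<integral>\<^sup>+z. ennreal (h (g (z + s))) \<partial>cm) = (\<integral>\<^sup>+z. ennreal (h (g z)) \<partial>cm)"
    if [measurable]: "h \<in> Borel" for h :: "real \<Rightarrow> real"
    by (rule nn_integral_cm_shift[of "\<lambda>z. ennreal (h (g z))"]) (use p in \<open>auto simp: periodic1_def\<close>)
  show 1: "integrable cm (\<lambda>z. g (z + s)) \<longleftrightarrow> integrable cm g"
    unfolding integrable_iff_bounded using nn[of abs] by simp
  show "(LINT z|cm. g (z + s)) = (LINT z|cm. g z)"
  proof (cases "integrable cm g")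
    case True
    then show ?thesis using 1 nn[of "\<lambda>x. x"] nn[of "\<lambda>x. - x"] by (simp add: real_lebesgue_integral_def)
  next
    case False
    then show ?thesis using 1 by (simp add: not_integrable_integral_eq)
  qed
qed

text \<open>The iterates of the scheme stay in this class: it is closed under products, shifts and
  averages, and its members are automatically integrable.\<close>

definition cper :: "(real \<Rightarrow> real) \<Rightarrow> bool" where
  "cper g \<longleftrightarrow> continuous_on UNIV g \<and> periodic1 g"

lemma cper_const [simp]: "cper (\<lambda>_. c)" by (simp add: cper_def periodic1_def)
lemma cper_add: "cper f \<Longrightarrow> cper g \<Longrightarrow> cper (\<lambda>z. f z + g z)"
  by (auto simp: cper_def periodic1_def intro: continuous_intros)
lemma cper_diff: "cper f \<Longrightarrow> cper g \<Longrightarrow> cper (\<lambda>z. f z - g z)"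
  by (auto simp: cper_def periodic1_def intro: continuous_intros)
lemma cper_mult: "cper f \<Longrightarrow> cper g \<Longrightarrow> cper (\<lambda>z. f z * g z)"
  by (auto simp: cper_def periodic1_def intro: continuous_intros)
lemma cper_minus: "cper f \<Longrightarrow> cper (\<lambda>z. - f z)"
  by (auto simp: cper_def periodic1_def intro: continuous_intros)
lemma cper_sum: "finite I \<Longrightarrow> (\<And>i. i \<in> I \<Longrightarrow> cper (f i)) \<Longrightarrow> cper (\<lambda>z. \<Sum>i\<in>I. f i z)"
  by (induction I rule: finite_induct) (auto intro: cper_add)
lemma cper_power: "cper f \<Longrightarrow> cper (\<lambda>z. (f z)^2)"
  unfolding power2_eq_square by (rule cper_mult)
lemma cper_shift: "cper f \<Longrightarrow> cper (\<lambda>z. f (z + s))"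
  by (auto simp: cper_def periodic1_def add.commute add.left_commute
      intro!: continuous_on_compose2[of UNIV f] continuous_intros)
     (metis add.assoc add.commute)
lemma cper_borel: "cper g \<Longrightarrow> g \<in> Borel"
  by (auto simp: cper_def intro: borel_measurable_continuous_onI)
lemma cper_bounded: "cper g \<Longrightarrow> \<exists>C. \<forall>z. \<bar>g z\<bar> \<le> C"
  by (rule cbump_bounded) (auto simp: cper_def periodic1_def)
lemma cper_sqi: "cper g \<Longrightarrow> sqi cm g"
  using cper_bounded[of g] by (auto intro!: cm.sqi_bounded AE_I2 borel_cmI cper_borel)
lemma cper_integrable: "cper g \<Longrightarrow> integrable cm g"
  by (rule cm.sqi_integrable[OF cper_sqi])
lemma cper_periodic: "cper g \<Longrightarrow> periodic1 g" by (simp add: cper_def)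
lemma cper_continuous: "cper g \<Longrightarrow> continuous_on UNIV g" by (simp add: cper_def)

definition ip :: "(real \<Rightarrow> real) \<Rightarrow> (real \<Rightarrow> real) \<Rightarrow> real" where
  "ip f g = (LINT z|cm. f z * g z)"

abbreviation "nsq f \<equiv> ip f f"

lemma ip_sym: "ip f g = ip g f" by (simp add: ip_def mult.commute)
lemma ip_self: "nsq f = (LINT z|cm. (f z)^2)" by (simp add: ip_def power2_eq_square)
lemma ip_nonneg: "0 \<le> nsq f" by (simp add: ip_self)
lemma ip_add: "cper f \<Longrightarrow> cper g \<Longrightarrow> cper h \<Longrightarrow> ip f (\<lambda>z. g z + h z) = ip f g + ip f h"
  unfolding ip_def distrib_left by (simp add: cper_integrable cper_mult)
lemma ip_diff: "cper f \<Longrightarrow> cper g \<Longrightarrow> cper h \<Longrightarrow> ip f (\<lambda>z. g z - h z) = ip f g - ip f h"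
  unfolding ip_def right_diff_distrib by (simp add: cper_integrable cper_mult)
lemma ip_cmult: "ip f (\<lambda>z. c * g z) = c * ip f g"
  unfolding ip_def by (simp add: mult.left_commute)
lemma ip_minus: "ip f (\<lambda>z. - g z) = - ip f g"
  unfolding ip_def by simp
lemma ip_sum: "finite I \<Longrightarrow> cper f \<Longrightarrow> (\<And>i. i \<in> I \<Longrightarrow> cper (g i)) \<Longrightarrow> ip f (\<lambda>z. \<Sum>i\<in>I. g i z) = (\<Sum>i\<in>I. ip f (g i))"
proof (induction I rule: finite_induct)
  case empty then show ?case by (simp add: ip_def)
next
  case (insert x F)
  then show ?case by (simp add: ip_add cper_sum)
qed
lemma ip_add_scaled:
  "cper f \<Longrightarrow> cper g \<Longrightarrow> nsq (\<lambda>z. f z + c * g z) = nsq f + 2 * c * ip f g + c^2 * nsq g"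
  using integral_square_add[OF cper_sqi cper_sqi, of f g c] by (simp add: ip_def power2_eq_square mult.assoc)
lemma ip_CS: "cper f \<Longrightarrow> cper g \<Longrightarrow> nsq f \<le> a \<Longrightarrow> nsq g \<le> b \<Longrightarrow> \<bar>ip f g\<bar> \<le> sqrt (a * b)"
  unfolding ip_self using Cauchy_Schwarz_abs[OF cper_sqi cper_sqi, of f g a b] by (simp add: ip_def)
lemma ip_square_sum_le: "cper f \<Longrightarrow> cper g \<Longrightarrow> nsq (\<lambda>z. f z + g z) \<le> 2 * nsq f + 2 * nsq g"
  unfolding ip_self by (intro integral_square_sum_le cper_sqi)
lemma ip_square_diff_le: "cper f \<Longrightarrow> cper g \<Longrightarrow> nsq (\<lambda>z. f z - g z) \<le> 2 * nsq f + 2 * nsq g"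
  using ip_square_sum_le[of f "\<lambda>z. - g z"] by (simp add: cper_minus) (simp add: ip_def)
lemma ip_bounded_mult_le:
  assumes "cper b" "cper f" "\<And>z. \<bar>b z\<bar> \<le> C"
  shows "nsq (\<lambda>z. b z * f z) \<le> C^2 * nsq f"
proof -
  have "(LINT z|cm. (b z * f z)^2) \<le> (LINT z|cm. C^2 * (f z)^2)"
  proof (rule integral_mono)
    fix z
    have "(b z)^2 \<le> C^2" using assms(3)[of z] by (metis abs_ge_zero order_trans power2_abs power_mono)
    then show "(b z * f z)^2 \<le> C^2 * (f z)^2" by (simp add: power_mult_distrib mult_right_mono)
  qed (use assms in \<open>auto intro!: cper_integrable cper_power cper_mult\<close>)
  then show ?thesis by (simp add: ip_self)
qed

definition Dp :: "real \<Rightarrow> (real \<Rightarrow> real) \<Rightarrow> real \<Rightarrow> real" where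
  "Dp d g z = (g (z + d) - g z) / d"
text \<open>Minus the backward difference quotient, so that it is the adjoint of \<open>Dp\<close>
  without a change of sign. Likewise \<open>Am\<close> below is the adjoint of \<open>Av\<close>,
  and the derivative of \<open>Am d g\<close> is \<open>- Dm d g\<close>.\<close>

definition Dm :: "real \<Rightarrow> (real \<Rightarrow> real) \<Rightarrow> real \<Rightarrow> real" where
  "Dm d g z = (g (z - d) - g z) / d"
definition Av :: "real \<Rightarrow> (real \<Rightarrow> real) \<Rightarrow> real \<Rightarrow> real" where
  "Av d g z = (LINT s|tm d. g (z + s)) / d"
definition Am :: "real \<Rightarrow> (real \<Rightarrow> real) \<Rightarrow> real \<Rightarrow> real" where
  "Am d g z = (LINT s|tm d. g (z - s)) / d"

lemma cper_Dp: "cper g \<Longrightarrow> cper (Dp d g)"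
  using cper_mult[OF cper_const[of "1/d"] cper_diff[OF cper_shift[of g d]], of g]
  by (simp add: Dp_def[abs_def] divide_inverse mult.commute)
lemma cper_Dm: "cper g \<Longrightarrow> cper (Dm d g)"
  using cper_mult[OF cper_const[of "1/d"] cper_diff[OF cper_shift[of g "-d"]], of g]
  by (simp add: Dm_def[abs_def] divide_inverse mult.commute)

lemma ip_Dp: assumes "cper f" "cper g" shows "ip (Dp d f) g = ip f (Dm d g)"
proof -
  have c: "cper (\<lambda>z. f z * g (z - d))" using cper_mult[OF assms(1) cper_shift[OF assms(2), of "-d"]] by simp
  have e: "(LINT z|cm. f (z + d) * g z) = (LINT z|cm. f z * g (z - d))"
    using integral_cm_shift[OF cper_borel[OF c] cper_periodic[OF c], of d] by simp
  have "ip (Dp d f) g = (LINT z|cm. (1/d) * (f (z + d) * g z - f z * g z))"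
    unfolding ip_def Dp_def by (rule Bochner_Integration.integral_cong) (auto simp: algebra_simps diff_divide_distrib)
  also have "\<dots> = (1/d) * ((LINT z|cm. f (z + d) * g z) - (LINT z|cm. f z * g z))"
    using cper_integrable[OF cper_mult[OF cper_shift[OF assms(1), of d] assms(2)]] cper_integrable[OF cper_mult[OF assms]]
    by simp
  also have "\<dots> = (1/d) * ((LINT z|cm. f z * g (z - d)) - (LINT z|cm. f z * g z))" unfolding e ..
  also have "\<dots> = (LINT z|cm. (1/d) * (f z * g (z - d) - f z * g z))"
    using cper_integrable[OF c] cper_integrable[OF cper_mult[OF assms]] by simp
  also have "\<dots> = ip f (Dm d g)"
    unfolding ip_def Dm_def by (rule Bochner_Integration.integral_cong) (auto simp: algebra_simps diff_divide_distrib)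
  finally show ?thesis .
qed

lemma ip_shift: assumes "cper g" shows "nsq (\<lambda>z. g (z + s)) = nsq g"
  using integral_cm_shift[OF cper_borel[OF cper_power[OF assms]] cper_periodic[OF cper_power[OF assms]], of s]
  by (simp add: ip_self)

text \<open>An inverse estimate: such bounds degenerate as \<open>d\<close> tends to 0. They enter
  the error of the Euler step, where \<open>tau\<close> compensates them, and the compactness
  argument, where the width is held fixed.\<close>

lemma ip_Dp_le: assumes g: "cper g" and d: "0 < d" shows "nsq (Dp d g) \<le> 4 / d^2 * nsq g"
proof -
  have "nsq (Dp d g) = (1/d)^2 * nsq (\<lambda>z. g (z + d) - g z)"
    unfolding ip_self Dp_def power_divide by simp
  also have "\<dots> \<le> (1/d)^2 * (2 * nsq g + 2 * nsq g)"
    using ip_square_diff_le[OF cper_shift[OF g, of d] g] by (intro mult_left_mono) (simp_all add: ip_shift[OF g])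
  finally show ?thesis by (simp add: power_divide)
qed

lemma ip_Dm_le: assumes g: "cper g" and d: "0 < d" shows "nsq (Dm d g) \<le> 4 / d^2 * nsq g"
proof -
  have "nsq (Dm d g) = (1/d)^2 * nsq (\<lambda>z. g (z + (-d)) - g z)"
    unfolding ip_self Dm_def power_divide by simp
  also have "\<dots> \<le> (1/d)^2 * (2 * nsq g + 2 * nsq g)"
    using ip_square_diff_le[OF cper_shift[OF g, of "-d"] g] ip_shift[OF g, of "-d"] by (intro mult_left_mono) simp_all
  finally show ?thesis by (simp add: power_divide)
qed

lemma Av_antideriv:
  assumes G: "\<And>x. (G has_real_derivative g x) (at x)" and g: "continuous_on UNIV g" and d: "0 < d"
  shows "Av d g z = (G (z + d) - G z) / d" "Am d g z = (G z - G (z - d)) / d"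
proof -
  have c1: "continuous_on UNIV (\<lambda>s. g (z + s))" by (rule continuous_on_compose2[OF g]) (auto intro: continuous_intros)
  have c2: "continuous_on UNIV (\<lambda>s. g (z - s))" by (rule continuous_on_compose2[OF g]) (auto intro: continuous_intros)
  have 1: "((\<lambda>s. G (z + s)) has_real_derivative g (z + s)) (at s)" for s
  proof -
    have "((\<lambda>s. z + s) has_real_derivative 1) (at s)" by (auto intro!: derivative_eq_intros)
    from DERIV_chain2[OF G this] show ?thesis by simp
  qed
  have 2: "((\<lambda>s. - G (z - s)) has_real_derivative g (z - s)) (at s)" for s
  proof -
    have "((\<lambda>s. z - s) has_real_derivative -1) (at s)" by (auto intro!: derivative_eq_intros)
    from DERIV_minus[OF DERIV_chain2[OF G this]] show ?thesis by simp
  qed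
  show "Av d g z = (G (z + d) - G z) / d"
    using tm_FTC(1)[OF 1 c1, of 0 d] d tm_integral_drop[OF borel_measurable_continuous_onI[OF c1]] by (simp add: Av_def)
  show "Am d g z = (G z - G (z - d)) / d"
    using tm_FTC(1)[OF 2 c2, of 0 d] d tm_integral_drop[OF borel_measurable_continuous_onI[OF c2]] by (simp add: Am_def)
qed

lemma Av_deriv:
  assumes g: "continuous_on UNIV g" and d: "0 < d"
  shows "(Av d g has_real_derivative Dp d g z) (at z)" "(Am d g has_real_derivative - Dm d g z) (at z)"
proof -
  obtain G where G: "\<And>x. (G has_real_derivative g x) (at x)" using continuous_antideriv[OF g] by blast
  have 1: "Av d g = (\<lambda>z. (G (z + d) - G z) / d)" "Am d g = (\<lambda>z. (G z - G (z - d)) / d)"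
    using Av_antideriv[OF G g d] by auto
  show "(Av d g has_real_derivative Dp d g z) (at z)" unfolding 1 Dp_def
    by (intro DERIV_cdivide DERIV_diff G DERIV_shift[THEN iffD1])
  have "((\<lambda>z. (G z - G (z - d)) / d) has_real_derivative (g z - g (z - d)) / d) (at z)"
    using DERIV_shift[of G "g (z - d)" z "- d"] G[of "z - d"] by (intro DERIV_cdivide DERIV_diff G) simp
  then show "(Am d g has_real_derivative - Dm d g z) (at z)" unfolding 1 Dm_def by (simp add: minus_divide_left)
qed

lemma Av_periodic: assumes "periodic1 g" shows "periodic1 (Av d g)" "periodic1 (Am d g)"
proof -
  have "g (z + 1 + s) = g (z + s)" "g (z + 1 - s) = g (z - s)" for z s
    using assms[unfolded periodic1_def, rule_format, of "z + s"]
      assms[unfolded periodic1_def, rule_format, of "z - s"] by (simp_all add: algebra_simps)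
  then show "periodic1 (Av d g)" "periodic1 (Am d g)" by (simp_all add: periodic1_def Av_def Am_def)
qed

lemma cper_Av: assumes "cper g" "0 < d" shows "cper (Av d g)"
  using Av_deriv(1)[OF cper_continuous[OF assms(1)] assms(2)] Av_periodic(1)[OF cper_periodic[OF assms(1)]]
  by (auto simp: cper_def intro!: continuous_at_imp_continuous_on DERIV_isCont)
lemma cper_Am: assumes "cper g" "0 < d" shows "cper (Am d g)"
  using Av_deriv(2)[OF cper_continuous[OF assms(1)] assms(2)] Av_periodic(2)[OF cper_periodic[OF assms(1)]]
  by (auto simp: cper_def intro!: continuous_at_imp_continuous_on DERIV_isCont)

section \<open>Averages of square integrable periodic functions\<close>

definition pL2 :: "(real \<Rightarrow> real) \<Rightarrow> bool" where
  "pL2 g \<longleftrightarrow> g \<in> Borel \<and> periodic1 g \<and> sqi cm g"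

lemma cper_pL2: "cper g \<Longrightarrow> pL2 g" by (simp add: pL2_def cper_borel cper_periodic cper_sqi)

text \<open>The window of length \<open>d \<le> 1\<close> is contained in one period, and a shift
  does not change the integral over a period.\<close>

lemma pL2_section:
  assumes g: "pL2 g" and d: "0 < d" "d \<le> 1"
  shows "sqi (tm d) (\<lambda>s. g (z + s))" "(LINT s|tm d. (g (z + s))^2) \<le> (LINT z|cm. (g z)^2)"
proof -
  have [measurable]: "g \<in> Borel" and p: "periodic1 g" and s: "sqi cm g" using g by (auto simp: pL2_def)
  have p2: "periodic1 (\<lambda>z. (g z)^2)" using p by (simp add: periodic1_def)
  have i1: "integrable (tm 1) (\<lambda>s. (g (z + s))^2)"
    using integrable_cm_shift[OF _ p2, of z] s by (simp add: cm_eq_tm[symmetric] sqi_def add.commute)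
  have e: "tm d = density (tm 1) (\<lambda>s. ennreal (indicator {..<d} s))"
    unfolding tm_def by (subst density_density_eq) (use d in \<open>auto intro!: density_cong simp: indicator_def\<close>)
  have i2: "integrable (tm 1) (\<lambda>s. indicator {..<d} s * (g (z + s))^2)"
    using integrable_real_mult_indicator[OF _ i1, of "{..<d}"] by (simp add: mult.commute)
  show "sqi (tm d) (\<lambda>s. g (z + s))" unfolding sqi_def
  proof
    show "(\<lambda>s. g (z + s)) \<in> borel_measurable (tm d)" by measurable
    show "integrable (tm d) (\<lambda>s. (g (z + s))^2)"
      unfolding e using i2 by (subst integrable_density) auto
  qed
  have "(LINT s|tm d. (g (z + s))^2) = (LINT s|tm 1. indicator {..<d} s * (g (z + s))^2)"
    unfolding e by (subst integral_density) auto
  also have "\<dots> \<le> (LINT s|tm 1. (g (z + s))^2)"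
    by (rule integral_mono[OF i2 i1]) (auto simp: indicator_def)
  also have "\<dots> = (LINT z|cm. (g z)^2)"
    using integral_cm_shift[OF _ p2, of z] by (simp add: cm_eq_tm[symmetric] add.commute)
  finally show "(LINT s|tm d. (g (z + s))^2) \<le> (LINT z|cm. (g z)^2)" .
qed

lemma Av_square_le:
  assumes g: "pL2 g" and d: "0 < d" "d \<le> 1"
  shows "(Av d g z)^2 \<le> (LINT s|tm d. (g (z + s))^2) / d"
    and "(Av d g z)^2 \<le> (LINT z|cm. (g z)^2) / d"
proof -
  have "(LINT s|tm d. g (z + s) * 1)^2 \<le> (LINT s|tm d. (g (z + s))^2) * (LINT s|tm d. 1^2)"
    by (rule Cauchy_Schwarz_integral[OF pL2_section(1)[OF g d]]) simp
  then have "(LINT s|tm d. g (z + s))^2 \<le> (LINT s|tm d. (g (z + s))^2) * d" using d by (simp add: measure_tm)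
  then have "(Av d g z)^2 \<le> (LINT s|tm d. (g (z + s))^2) * d / d^2"
    unfolding Av_def power_divide by (rule divide_right_mono) simp
  then show 1: "(Av d g z)^2 \<le> (LINT s|tm d. (g (z + s))^2) / d" using d by (simp add: power2_eq_square)
  also have "\<dots> \<le> (LINT z|cm. (g z)^2) / d" using pL2_section(2)[OF g d] d by (simp add: divide_right_mono)
  finally show "(Av d g z)^2 \<le> (LINT z|cm. (g z)^2) / d" .
qed

lemma borel_Av [measurable]:
  assumes [measurable]: "g \<in> Borel" shows "Av d g \<in> Borel"
  unfolding Av_def[abs_def] by measurable

lemma pL2_shift_prod:
  assumes g: "pL2 g" shows "integrable (cm \<Otimes>\<^sub>M tm d) (\<lambda>(z, s). (g (z + s))^2)"
    "(LINT z|cm. LINT s|tm d. (g (z + s))^2) = measure (tm d) UNIV * (LINT z|cm. (g z)^2)"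
proof -
  interpret Q: pair_sigma_finite cm "tm d" ..
  have [measurable]: "g \<in> Borel" and p: "periodic1 g" and s: "sqi cm g" using g by (auto simp: pL2_def)
  have p2: "periodic1 (\<lambda>z. (g z)^2)" using p by (simp add: periodic1_def)
  have sh: "integrable cm (\<lambda>z. (g (z + s))^2)" "(LINT z|cm. (g (z + s))^2) = (LINT z|cm. (g z)^2)" for s
    using integrable_cm_shift[OF _ p2, of s] integral_cm_shift[OF _ p2, of s] s by (auto simp: sqi_def)
  have i: "integrable (tm d \<Otimes>\<^sub>M cm) (\<lambda>(s, z). (g (z + s))^2)"
  proof (rule MM.Fubini_integrable)
    show "integrable (tm d) (\<lambda>x. LINT y|cm. norm (case (x, y) of (s, z) \<Rightarrow> (g (z + s))^2))" by (simp add: sh)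
    show "AE x in tm d. integrable cm (\<lambda>y. case (x, y) of (s, z) \<Rightarrow> (g (z + s))^2)" using sh by simp
  qed measurable
  then show i': "integrable (cm \<Otimes>\<^sub>M tm d) (\<lambda>(z, s). (g (z + s))^2)"
    using MM.integrable_product_swap_iff[where T=d and f="\<lambda>(s, z). (g (z + s))^2"] by simp
  have "(LINT z|cm. LINT s|tm d. (g (z + s))^2) = (LINT s|tm d. LINT z|cm. (g (z + s))^2)"
    by (rule Q.Fubini_integral[symmetric]) (use i' in simp)
  then show "(LINT z|cm. LINT s|tm d. (g (z + s))^2) = measure (tm d) UNIV * (LINT z|cm. (g z)^2)"
    by (simp add: sh)
qed

text \<open>Cauchy-Schwarz in each window, followed by Fubini and translation invariance; the length
  \<open>d\<close> of the window cancels the factor \<open>1/d\<close>.\<close>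

lemma Av_contract:
  assumes g: "pL2 g" and d: "0 < d" "d \<le> 1"
  shows "pL2 (Av d g)" "(LINT z|cm. (Av d g z)^2) \<le> (LINT z|cm. (g z)^2)"
proof -
  interpret Q: pair_sigma_finite cm "tm d" ..
  have [measurable]: "g \<in> Borel" and p: "periodic1 g" using g by (auto simp: pL2_def)
  have i: "integrable cm (\<lambda>z. (LINT s|tm d. (g (z + s))^2) / d)"
    using Q.integrable_fst'[OF pL2_shift_prod(1)[OF g]] by simp
  have i2: "integrable cm (\<lambda>z. (Av d g z)^2)"
    by (rule Bochner_Integration.integrable_bound[OF i])
       (use Av_square_le(1)[OF g d] d in \<open>auto intro!: AE_I2\<close>)
  then show "pL2 (Av d g)" using Av_periodic(1)[OF p] by (simp add: pL2_def sqi_def borel_Av)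
  have "(LINT z|cm. (Av d g z)^2) \<le> (LINT z|cm. (LINT s|tm d. (g (z + s))^2) / d)"
    by (rule integral_mono[OF i2 i]) (rule Av_square_le(1)[OF g d])
  also have "\<dots> = (LINT z|cm. (g z)^2)" using d by (simp add: pL2_shift_prod(2)[OF g] measure_tm)
  finally show "(LINT z|cm. (Av d g z)^2) \<le> (LINT z|cm. (g z)^2)" .
qed

lemma Av_adjoint:
  assumes g: "pL2 g" and k: "cper k" and d: "0 < d" "d \<le> 1"
  shows "(LINT z|cm. Av d g z * k z) = (LINT z|cm. g z * Am d k z)"
proof -
  interpret Q: pair_sigma_finite cm "tm d" ..
  have [measurable]: "g \<in> Borel" "k \<in> Borel"
    using g cper_borel[OF k] by (auto simp: pL2_def)
  obtain C where C: "\<And>z. \<bar>k z\<bar> \<le> C" using cper_bounded[OF k] by blast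
  have fin: "finite_measure (cm \<Otimes>\<^sub>M tm d)" by (rule finite_measure_pair_measure) unfold_locales
  have s: "sqi (cm \<Otimes>\<^sub>M tm d) (\<lambda>x. g (fst x + snd x))"
    unfolding sqi_def using pL2_shift_prod(1)[OF g, of d] by (simp add: case_prod_beta')
  have i1: "integrable (cm \<Otimes>\<^sub>M tm d) (\<lambda>x. g (fst x + snd x) * k (fst x))"
    by (rule integrable_times_bounded[OF finite_measure.sqi_integrable[OF fin s], of _ C]) (use C in auto)
  have per: "periodic1 (\<lambda>z. g z * k (z - s))" for s
  proof -
    have "k (z + 1 - s) = k (z - s)" for z
      using cper_periodic[OF k, unfolded periodic1_def, rule_format, of "z - s"] by (simp add: algebra_simps)
    then show ?thesis using g by (simp add: pL2_def periodic1_def)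
  qed
  have gi: "integrable cm g" using g by (auto simp: pL2_def intro: cm.sqi_integrable)
  have i2: "integrable (cm \<Otimes>\<^sub>M tm d) (\<lambda>x. (g (fst x) * 1) * k (fst x - snd x))"
    by (rule integrable_times_bounded[OF integrable_prod[OF cm.finite_measure_axioms tm.finite_measure_axioms gi], of _ "\<lambda>_. 1" _ C])
       (use C in auto)
  have "(LINT z|cm. Av d g z * k z) = (LINT z|cm. LINT s|tm d. g (z + s) * k z) / d" by (simp add: Av_def)
  also have "(LINT z|cm. LINT s|tm d. g (z + s) * k z) = (LINT s|tm d. LINT z|cm. g (z + s) * k z)"
    by (rule Q.Fubini_integral[symmetric]) (use i1 in \<open>simp add: case_prod_beta'\<close>)
  also have "\<dots> = (LINT s|tm d. LINT z|cm. g z * k (z - s))"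
  proof (rule Bochner_Integration.integral_cong[OF refl])
    fix s show "(LINT z|cm. g (z + s) * k z) = (LINT z|cm. g z * k (z - s))"
      using integral_cm_shift[OF _ per[of s], of s] by simp
  qed
  also have "\<dots> = (LINT z|cm. LINT s|tm d. g z * k (z - s))"
    by (rule Q.Fubini_integral) (use i2 in \<open>simp add: case_prod_beta'\<close>)
  also have "\<dots> / d = (LINT z|cm. g z * Am d k z)" by (simp add: Am_def)
  finally show ?thesis .
qed

lemma tm_integrable_lborel:
  fixes f :: "real \<Rightarrow> real" assumes "f \<in> Borel"
  shows "integrable (tm T) f \<longleftrightarrow> integrable lborel (\<lambda>t. indicator {0<..<T} t * f t)"
proof -
  have "tm T = density lborel (\<lambda>x. ennreal (indicator {0<..<T} x))" by (simp add: tm_def ennreal_indicator)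
  then show ?thesis using integrable_density[of f lborel "indicator {0<..<T}"] assms by simp
qed

text \<open>Integrals over intervals of the line instead of one period: they are additive, so that
  increments of averages are expressed by short intervals even where a window crosses 1.\<close>

definition seg :: "(real \<Rightarrow> real) \<Rightarrow> real \<Rightarrow> real \<Rightarrow> real" where
  "seg g a b = (LINT y|lborel. indicator {a<..<b} y * g y)"

lemma
  assumes g: "g \<in> Borel"
  shows seg_shift: "(LINT s|tm d. g (z + s)) = seg g z (z + d)"
    and seg_integrable: "integrable (tm d) (\<lambda>s. g (z + s)) \<Longrightarrow> integrable lborel (\<lambda>y. indicator {z<..<z + d} y * g y)"
proof -
  have m: "(\<lambda>s. g (z + s)) \<in> Borel" by (rule measurable_compose[OF _ g]) simp
  have e: "(\<lambda>x. indicator {z<..<z + d} (z + 1 * x) * g (z + 1 * x)) = (\<lambda>t. indicator {0<..<d} t * g (z + t))"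
    by (auto simp: fun_eq_iff indicator_def)
  show "(LINT s|tm d. g (z + s)) = seg g z (z + d)"
    unfolding tm_integral[OF m] seg_def
    using lborel_integral_real_affine[of 1 "\<lambda>y. indicator {z<..<z + d} y * g y" z] unfolding e by simp
  assume "integrable (tm d) (\<lambda>s. g (z + s))"
  then have "integrable lborel (\<lambda>t. indicator {0<..<d} t * g (z + t))" unfolding tm_integrable_lborel[OF m] .
  then show "integrable lborel (\<lambda>y. indicator {z<..<z + d} y * g y)"
    using lborel_integrable_real_affine_iff[of 1 "\<lambda>y. indicator {z<..<z + d} y * g y" z] unfolding e by simp
qed

lemma seg_add:
  assumes g: "pL2 g" and ab: "a \<le> b" "b \<le> c" "c \<le> a + 1"
  shows "seg g a c = seg g a b + seg g b c"
proof (cases "a < c")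
  case False
  then have "a = b" "b = c" using ab by auto
  then show ?thesis by (simp add: seg_def)
next
  case True
  have gb: "g \<in> Borel" using g by (simp add: pL2_def)
  have i: "integrable lborel (\<lambda>y. indicator {a<..<c} y * g y)"
    using seg_integrable[OF gb tm.sqi_integrable[OF pL2_section(1)[OF g, of "c - a"]], of a] True ab by simp
  have s: "integrable lborel (\<lambda>y. indicator A y * (indicator {a<..<c} y * g y))" if "A \<in> sets borel" for A
    by (rule integrable_indicator_mult[OF i]) (use that in simp)
  have "seg g a b + seg g b c = (LINT y|lborel. indicator {..<b} y * (indicator {a<..<c} y * g y)) + (LINT y|lborel. indicator {b<..} y * (indicator {a<..<c} y * g y))"
    unfolding seg_def by (intro arg_cong2[where f="(+)"] Bochner_Integration.integral_cong) (use ab in \<open>auto simp: indicator_def\<close>)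
  also have "\<dots> = (LINT y|lborel. indicator {..<b} y * (indicator {a<..<c} y * g y) + indicator {b<..} y * (indicator {a<..<c} y * g y))"
    by (rule Bochner_Integration.integral_add[symmetric]; rule s) simp_all
  also have "\<dots> = seg g a c"
    unfolding seg_def
  proof (rule integral_cong_AE)
    show "AE y in lborel. indicator {..<b} y * (indicator {a<..<c} y * g y) + indicator {b<..} y * (indicator {a<..<c} y * g y) = indicator {a<..<c} y * g y"
      using AE_lborel_singleton[of b] by eventually_elim (auto simp: indicator_def)
  qed (use gb in measurable)
  finally show ?thesis by simp
qed

lemma continuous_of_sqrt_modulus:
  fixes U :: "real \<Rightarrow> real"
  assumes U: "\<And>z e. 0 < e \<Longrightarrow> e \<le> d \<Longrightarrow> \<bar>U (z + e) - U z\<bar> \<le> sqrt (e * K)" and d: "0 < d"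
  shows "continuous_on UNIV U"
proof -
  have near: "\<bar>U y - U z\<bar> \<le> sqrt (\<bar>y - z\<bar> * K)" if "\<bar>y - z\<bar> \<le> d" for y z
    using U[of "y - z" z] U[of "z - y" y] that by (cases y z rule: linorder_cases) (auto simp: abs_minus_commute)
  have "isCont U z" for z
    unfolding continuous_at Lim_null[of U]
  proof (rule Lim_null_comparison)
    show "\<forall>\<^sub>F y in at z. norm (U y - U z) \<le> sqrt (\<bar>y - z\<bar> * K)"
      unfolding eventually_at by (rule exI[of _ d]) (auto simp: dist_real_def d intro!: near)
    have "((\<lambda>y. sqrt (\<bar>y - z\<bar> * K)) \<longlongrightarrow> sqrt (\<bar>z - z\<bar> * K)) (at z)" by (intro tendsto_intros)
    then show "((\<lambda>y. sqrt (\<bar>y - z\<bar> * K)) \<longlongrightarrow> 0) (at z)" by simp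
  qed
  then show ?thesis by (simp add: continuous_at_imp_continuous_on)
qed

text \<open>Moving the window by \<open>e\<close> adds one interval of length \<open>e\<close> and
  removes another; by Cauchy-Schwarz each contributes at most \<open>sqrt (e K)\<close>. A single
  average thus makes square integrable data admissible for the scheme.\<close>

lemma continuous_Av:
  assumes g: "pL2 g" and d: "0 < d" "d \<le> 1"
  shows "cper (Av d g)"
proof -
  let ?K = "LINT z|cm. (g z)^2"
  have gb: "g \<in> Borel" and p: "periodic1 g" using g by (auto simp: pL2_def)
  have A: "seg g z (z + e) = e * Av e g z" if "0 < e" for z e using that by (simp add: Av_def seg_shift[OF gb])
  have s: "\<bar>seg g z (z + e)\<bar> \<le> sqrt (e * ?K)" if e: "0 < e" "e \<le> 1" for z e
  proof -
    have "(seg g z (z + e))^2 = e^2 * (Av e g z)^2" unfolding A[OF e(1)] by (simp add: power_mult_distrib)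
    also have "\<dots> \<le> e^2 * (?K / e)" by (rule mult_left_mono[OF Av_square_le(2)[OF g e]]) simp
    also have "\<dots> = e * ?K" using e by (simp add: power2_eq_square)
    finally show ?thesis by (rule real_le_rsqrt[of "\<bar>_\<bar>", unfolded power2_abs])
  qed
  have "continuous_on UNIV (\<lambda>z. seg g z (z + d))"
  proof (rule continuous_of_sqrt_modulus[OF _ d(1), where K="4 * ?K"])
    fix z e assume e: "0 < e" "e \<le> d"
    have "seg g z (z + d) = seg g z (z + e) + seg g (z + e) (z + d)"
      "seg g (z + e) (z + d + e) = seg g (z + e) (z + d) + seg g (z + d) (z + d + e)"
      by (rule seg_add[OF g]; use e d in simp)+
    then have "\<bar>seg g (z + e) (z + e + d) - seg g z (z + d)\<bar> \<le> sqrt (e * ?K) + sqrt (e * ?K)"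
      using s[of e z] s[of e "z + d"] e d by (simp add: add.commute add.left_commute)
    also have "\<dots> = sqrt (e * (4 * ?K))" by (simp add: real_sqrt_mult)
    finally show "\<bar>seg g (z + e) (z + e + d) - seg g z (z + d)\<bar> \<le> sqrt (e * (4 * ?K))" .
  qed
  then have "continuous_on UNIV (\<lambda>z. seg g z (z + d) / d)" by (intro continuous_intros) (use d in auto)
  also have "(\<lambda>z. seg g z (z + d) / d) = Av d g" using d by (simp add: A[OF d(1)] fun_eq_iff)
  finally show ?thesis using Av_periodic(1)[OF p] by (simp add: cper_def)
qed

lemma Av_bounds:
  assumes [measurable]: "g \<in> Borel" and "\<And>z. a \<le> g z" "\<And>z. g z \<le> b" and d: "0 < d"
  shows "a \<le> Av d g z" "Av d g z \<le> b"
proof -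
  have bd: "\<bar>g z\<bar> \<le> \<bar>a\<bar> + \<bar>b\<bar>" for z using assms(2)[of z] assms(3)[of z] by linarith
  have i: "integrable (tm d) (\<lambda>s. g (z + s))"
    by (rule tm.integrable_const_bound[where B="\<bar>a\<bar> + \<bar>b\<bar>"]) (use bd in auto)
  have "(LINT s|tm d. a) \<le> (LINT s|tm d. g (z + s))" by (rule integral_mono) (use i assms in auto)
  then show "a \<le> Av d g z" using d by (simp add: Av_def measure_tm pos_le_divide_eq mult.commute)
  have "(LINT s|tm d. g (z + s)) \<le> (LINT s|tm d. b)" by (rule integral_mono) (use i assms in auto)
  then show "Av d g z \<le> b" using d by (simp add: Av_def measure_tm pos_divide_le_eq mult.commute)
qed

lemma Dp_add_scaled: "Dp d (\<lambda>z. u z + c * v z) = (\<lambda>z. Dp d u z + c * Dp d v z)"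
  by (auto simp: Dp_def fun_eq_iff add_divide_distrib diff_divide_distrib algebra_simps)

section \<open>The discrete scheme and its energy\<close>

text \<open>One scheme with fixed step sizes. The data are already regularised to continuous
  periodic functions, and the sources are given separately for each time step \<open>n\<close>. The
  bounds are parameters of their own, so that a sequence of regularisations can share them.\<close>

locale scheme =
  fixes d tau p r0 r1 \<nu>0 \<nu>1 J F :: real
    and r \<nu> :: "real \<Rightarrow> real" and j :: "nat \<Rightarrow> 2 \<Rightarrow> real \<Rightarrow> real" and f :: "nat \<Rightarrow> real \<Rightarrow> real"
    and h0 :: "2 \<Rightarrow> real \<Rightarrow> real" and v0 u0 :: "real \<Rightarrow> real"
  assumes d: "0 < d" "d \<le> 1" and p: "0 < p" and r0: "0 < r0" and \<nu>0: "0 < \<nu>0"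
    and cr: "cper r" and c\<nu>: "cper \<nu>" and cj: "\<And>n l. cper (j n l)" and cf: "\<And>n. cper (f n)"
    and ch0: "\<And>l. cper (h0 l)" and cv0: "cper v0" and cu0: "cper u0"
    and rb: "\<And>z. r0 \<le> r z" "\<And>z. r z \<le> r1" and \<nu>b: "\<And>z. \<nu>0 \<le> \<nu> z" "\<And>z. \<nu> z \<le> \<nu>1"
    and jb: "\<And>n l z. \<bar>j n l z\<bar> \<le> J" and fb: "\<And>n z. \<bar>f n z\<bar> \<le> F"
    and tau: "0 < tau"
begin

text \<open>The discrete flux \<open>r h_z - h u_t - r j\<close>. With \<open>Dp\<close> inside and
  \<open>- Dm\<close> outside, the diffusion becomes a symmetric nonpositive operator. The factor of
  \<open>v\<close> is \<open>A h\<close> in order to match the product \<open>A h D h\<close> in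
  \<open>NL\<close>.\<close>

definition G where "G n h v l z = r z * Dp d (h l) z - Av d (h l) z * v z - r z * j n l z"
definition YH where "YH n h v l z = - Dm d (G n h v l) z"
text \<open>Half of the exact \<open>z\<close>-derivative of \<open>|A h|^2\<close>, since
  \<open>(A h)' = D h\<close>. So \<open>2 p NL\<close>, the discretisation of
  \<open>(p h^2)_z\<close>, is itself an exact derivative.\<close>

definition NL where "NL h z = (\<Sum>l\<in>(UNIV :: 2 set). Av d (h l) z * Dp d (h l) z)"
definition YV where "YV n h u z = - Dm d (\<lambda>z. (\<nu> z)^2 * Dp d u z) z - 2 * p * NL h z + f n z"

text \<open>The state \<open>(h, u_t, u)\<close> after \<open>n\<close> Euler steps.\<close>

primrec st :: "nat \<Rightarrow> (2 \<Rightarrow> real \<Rightarrow> real) \<times> (real \<Rightarrow> real) \<times> (real \<Rightarrow> real)" where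
  "st 0 = (h0, v0, u0)"
| "st (Suc n) = (\<lambda>l z. fst (st n) l z + tau * YH n (fst (st n)) (fst (snd (st n))) l z,
     \<lambda>z. fst (snd (st n)) z + tau * YV n (fst (st n)) (snd (snd (st n))) z,
     \<lambda>z. snd (snd (st n)) z + tau * fst (snd (st n)) z)"

definition "H n = fst (st n)"
definition "V n = fst (snd (st n))"
definition "U n = snd (snd (st n))"
definition "yH n = YH n (H n) (V n)"
definition "yV n = YV n (H n) (U n)"
definition "gG n = G n (H n) (V n)"

abbreviation "AH n l \<equiv> Av d (H n l)"
abbreviation "DH n l \<equiv> Dp d (H n l)"
abbreviation "DU n \<equiv> Dp d (U n)"

abbreviation "DV n \<equiv> Dp d (V n)"
abbreviation "FU n \<equiv> \<lambda>z. (\<nu> z)^2 * DU n z"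
abbreviation "WU n \<equiv> \<lambda>z. \<nu> z * DU n z"

lemma zero: "H 0 = h0" "V 0 = v0" "U 0 = u0" by (simp_all add: H_def V_def U_def)
lemma step: "H (Suc n) l = (\<lambda>z. H n l z + tau * yH n l z)" "V (Suc n) = (\<lambda>z. V n z + tau * yV n z)"
    "U (Suc n) = (\<lambda>z. U n z + tau * V n z)"
  by (simp_all add: H_def V_def U_def yH_def yV_def)

lemma cper_G: "cper (h l) \<Longrightarrow> cper v \<Longrightarrow> cper (G n h v l)"
  unfolding G_def[abs_def] by (intro cper_diff cper_mult cr cper_Dp cper_Av d cj)
lemma cper_YH: "cper (h l) \<Longrightarrow> cper v \<Longrightarrow> cper (YH n h v l)"
  unfolding YH_def[abs_def] by (intro cper_minus cper_Dm cper_G)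
lemma cper_NL: "(\<And>l. cper (h l)) \<Longrightarrow> cper (NL h)"
  unfolding NL_def[abs_def] by (intro cper_sum cper_mult cper_Dp cper_Av d) auto
lemma cper_YV: "(\<And>l. cper (h l)) \<Longrightarrow> cper u \<Longrightarrow> cper (YV n h u)"
  unfolding YV_def[abs_def] by (intro cper_add cper_diff cper_minus cper_Dm cper_mult cper_power cper_const cper_Dp cper_NL c\<nu> cf)

lemma cper_st: "cper (H n l)" "cper (V n)" "cper (U n)"
proof -
  have "(\<forall>l. cper (H n l)) \<and> cper (V n) \<and> cper (U n)"
  proof (induction n)
    case 0 then show ?case by (simp add: zero ch0 cv0 cu0)
  next
    case (Suc n)
    then show ?case unfolding step yH_def yV_def
      by (intro conjI allI cper_add cper_mult cper_const cper_YH cper_YV) auto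
  qed
  then show "cper (H n l)" "cper (V n)" "cper (U n)" by auto
qed

lemma cper_y: "cper (yH n l)" "cper (yV n)" "cper (gG n l)"
  unfolding yH_def yV_def gG_def by (intro cper_YH cper_YV cper_G cper_st)+

lemma cper_D: "cper (DH n l)" "cper (DV n)" "cper (DU n)" "cper (AH n l)"
  "cper (WU n)" "cper (\<lambda>z. \<nu> z * DV n z)" "cper (FU n)"
  by (intro cper_Dp cper_Av cper_st d cper_mult c\<nu> cper_power)+

definition E where "E n = p * (\<Sum>l\<in>UNIV. nsq (H n l)) + (1/2) * nsq (V n)
    + (1/2) * nsq (WU n)"
definition Q where "Q n = (\<Sum>l\<in>(UNIV :: 2 set). nsq (DH n l))"
text \<open>\<open>R\<close> is the quadratic form \<open>E\<close> at the increments of one step,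
  and \<open>X\<close> is twice the corresponding bilinear form, that is, the derivative of
  \<open>E\<close> along the scheme.\<close>

definition R where "R n = p * (\<Sum>l\<in>UNIV. nsq (yH n l)) + (1/2) * nsq (yV n)
    + (1/2) * nsq (\<lambda>z. \<nu> z * DV n z)"
definition X where "X n = 2 * p * (\<Sum>l\<in>UNIV. ip (H n l) (yH n l)) + ip (V n) (yV n)
    + ip (WU n) (\<lambda>z. \<nu> z * DV n z)"

text \<open>Exact, because \<open>E\<close> is a quadratic form and an Euler step is affine in
  \<open>tau\<close>.\<close>

lemma E_step: "E (Suc n) = E n + tau * X n + tau^2 * R n"
proof -
  have 1: "nsq (H (Suc n) l) = nsq (H n l) + 2 * tau * ip (H n l) (yH n l) + tau^2 * nsq (yH n l)" for l
    unfolding step by (rule ip_add_scaled[OF cper_st(1) cper_y(1)])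
  have 2: "nsq (V (Suc n)) = nsq (V n) + 2 * tau * ip (V n) (yV n) + tau^2 * nsq (yV n)"
    unfolding step by (rule ip_add_scaled[OF cper_st(2) cper_y(2)])
  have e: "(\<lambda>z. \<nu> z * Dp d (U (Suc n)) z) = (\<lambda>z. \<nu> z * DU n z + tau * (\<nu> z * DV n z))"
    unfolding step Dp_add_scaled by (auto simp: algebra_simps)
  note 3 = ip_add_scaled[OF cper_D(5)[of n] cper_D(6)[of n], of tau]
  show ?thesis unfolding E_def X_def R_def 1 2 e 3 sum.distrib sum_distrib_left[symmetric] by algebra
qed

lemma UNIV2: "(\<Sum>l\<in>(UNIV :: 2 set). a l) = a 1 + a 2" for a :: "2 \<Rightarrow> real" by (simp add: sum_2)

text \<open>The nonlinear terms of the two equations cancel in the sum.\<close>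

lemma X_eq: "X n = 2 * p * (\<Sum>l\<in>UNIV. ip (\<lambda>z. r z * j n l z - r z * DH n l z) (DH n l)) + ip (V n) (f n)"
proof -
  have 1: "ip (H n l) (yH n l) = ip (\<lambda>z. r z * j n l z - r z * DH n l z) (DH n l)
      + ip (V n) (\<lambda>z. AH n l z * DH n l z)" for l
  proof -
    have c1: "cper (\<lambda>z. r z * j n l z - r z * DH n l z)" by (intro cper_diff cper_mult cr cj cper_D)
    have c2: "cper (\<lambda>z. AH n l z * V n z)" by (intro cper_mult cper_D cper_st)
    have "ip (H n l) (yH n l) = - ip (H n l) (Dm d (gG n l))"
      unfolding yH_def YH_def[abs_def] gG_def by (rule ip_minus)
    also have "\<dots> = - ip (DH n l) (gG n l)" using ip_Dp[OF cper_st(1) cper_y(3)] by simp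
    also have "\<dots> = ip (DH n l) (\<lambda>z. - gG n l z)" by (rule ip_minus[symmetric])
    also have "(\<lambda>z. - gG n l z) = (\<lambda>z. (r z * j n l z - r z * DH n l z) + AH n l z * V n z)"
      by (auto simp: gG_def G_def)
    also have "ip (DH n l) \<dots> = ip (DH n l) (\<lambda>z. r z * j n l z - r z * DH n l z)
        + ip (DH n l) (\<lambda>z. AH n l z * V n z)" by (rule ip_add[OF cper_D(1) c1 c2])
    also have "ip (DH n l) (\<lambda>z. AH n l z * V n z) = ip (V n) (\<lambda>z. AH n l z * DH n l z)"
      by (simp add: ip_def mult.commute mult.left_commute)
    finally show ?thesis by (simp add: ip_sym)
  qed
  have cN: "cper (NL (H n))" by (intro cper_NL cper_st)
  have cD: "cper (Dm d (FU n))" by (intro cper_Dm cper_D)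
  have "ip (V n) (yV n) = ip (V n) (\<lambda>z. ((- Dm d (FU n) z) - (2 * p) * NL (H n) z) + f n z)"
    by (simp add: yV_def YV_def[abs_def])
  also have "\<dots> = ip (V n) (\<lambda>z. (- Dm d (FU n) z) - (2 * p) * NL (H n) z) + ip (V n) (f n)"
    by (rule ip_add) (intro cper_st cf cper_diff cper_minus cD cper_mult cper_const cN)+
  also have "ip (V n) (\<lambda>z. (- Dm d (FU n) z) - (2 * p) * NL (H n) z)
    = ip (V n) (\<lambda>z. - Dm d (FU n) z) - ip (V n) (\<lambda>z. (2 * p) * NL (H n) z)"
    by (rule ip_diff) (intro cper_st cper_minus cD cper_mult cper_const cN)+
  also have "ip (V n) (\<lambda>z. - Dm d (FU n) z) = - ip (DV n) (FU n)"
    unfolding ip_minus using ip_Dp[OF cper_st(2) cper_D(7)] by simp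
  also have "ip (V n) (\<lambda>z. (2 * p) * NL (H n) z) = 2 * p * ip (V n) (NL (H n))" by (rule ip_cmult)
  also have "ip (V n) (NL (H n)) = (\<Sum>l\<in>UNIV. ip (V n) (\<lambda>z. AH n l z * DH n l z))"
    unfolding NL_def[abs_def] by (rule ip_sum) (auto intro!: cper_st cper_mult cper_D)
  finally have 2: "ip (V n) (yV n) = - ip (DV n) (FU n)
     - 2 * p * (\<Sum>l\<in>UNIV. ip (V n) (\<lambda>z. AH n l z * DH n l z)) + ip (V n) (f n)" .
  \<comment> \<open>The rate of the elastic energy; it cancels the term that summation by parts
    produced in \<open>2\<close>.\<close>
  have 3: "ip (WU n) (\<lambda>z. \<nu> z * DV n z) = ip (DV n) (FU n)"
    unfolding ip_def by (rule Bochner_Integration.integral_cong) (auto simp: power2_eq_square)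
  show ?thesis unfolding X_def 1 2 3 sum.distrib by algebra
qed

lemma ip_const_le: "cper g \<Longrightarrow> (\<And>z. \<bar>g z\<bar> \<le> C) \<Longrightarrow> nsq g \<le> C^2"
  using ip_bounded_mult_le[of g "\<lambda>_. 1" C] by (simp add: ip_def)

text \<open>Half of the dissipation absorbs the term with \<open>j\<close> by completing a square;
  the other half, at least \<open>p r0 Q\<close>, survives. The work of \<open>f\<close> is bounded
  by the kinetic part of \<open>E\<close>. The factor 2 in \<open>2 p r1 J^2\<close> counts the
  components of \<open>h\<close>.\<close>

lemma X_le: "X n \<le> E n + (2 * p * r1 * J^2 + F^2) - p * r0 * Q n"
proof -
  have r1: "0 \<le> r1" using r0 rb[of 0] by linarith
  have 1: "2 * ip (\<lambda>z. r z * j n l z - r z * DH n l z) (DH n l) \<le> r1 * J^2 - r0 * nsq (DH n l)" for l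
  proof -
    have "(LINT z|cm. 2 * ((r z * j n l z - r z * DH n l z) * DH n l z)) \<le> (LINT z|cm. r1 * J^2 - r0 * (DH n l z)^2)"
    proof (rule integral_mono)
      fix z
      let ?D = "DH n l z" and ?j = "j n l z"
      have "2 * ((r z * ?j - r z * ?D) * ?D) = r z * ?j^2 - r z * ?D^2 - r z * (?j - ?D)^2" by algebra
      also have "\<dots> \<le> r z * ?j^2 - r z * ?D^2" using rb(1)[of z] r0 by simp
      also have "\<dots> \<le> r1 * J^2 - r0 * ?D^2"
      proof (rule diff_mono)
        have "?j^2 \<le> J^2" using jb[of n l z] by (metis abs_ge_zero order_trans power2_abs power_mono)
        then show "r z * ?j^2 \<le> r1 * J^2" using rb(2)[of z] r1 by (intro mult_mono) auto
        show "r0 * ?D^2 \<le> r z * ?D^2" using rb(1)[of z] by (intro mult_right_mono) auto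
      qed
      finally show "2 * ((r z * ?j - r z * ?D) * ?D) \<le> r1 * J^2 - r0 * ?D^2" .
    qed (intro cper_integrable cper_mult cper_diff cper_const cr cj cper_D cper_power)+
    also have "\<dots> = r1 * J^2 - r0 * nsq (DH n l)"
      using cper_integrable[OF cper_power[OF cper_D(1)]] by (simp add: ip_self)
    finally show ?thesis by (simp add: ip_def)
  qed
  have 2: "ip (V n) (f n) \<le> (1/2) * nsq (V n) + F^2"
  proof -
    have "0 \<le> nsq (\<lambda>z. V n z + (-1) * f n z)" by (rule ip_nonneg)
    then have "2 * ip (V n) (f n) \<le> nsq (V n) + nsq (f n)"
      unfolding ip_add_scaled[OF cper_st(2) cf] by simp
    moreover have "nsq (f n) \<le> F^2" by (rule ip_const_le[OF cf fb])
    moreover have "0 \<le> F^2" by simp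
    ultimately show ?thesis by argo
  qed
  have "(\<Sum>l\<in>(UNIV :: 2 set). 2 * ip (\<lambda>z. r z * j n l z - r z * DH n l z) (DH n l))
      \<le> (\<Sum>l\<in>(UNIV :: 2 set). r1 * J^2 - r0 * nsq (DH n l))" by (rule sum_mono) (rule 1)
  also have "\<dots> = 2 * r1 * J^2 - r0 * Q n" by (simp add: Q_def UNIV2 algebra_simps)
  finally have "p * (\<Sum>l\<in>(UNIV :: 2 set). 2 * ip (\<lambda>z. r z * j n l z - r z * DH n l z) (DH n l)) \<le> p * (2 * r1 * J^2 - r0 * Q n)"
    using p by (intro mult_left_mono) auto
  then have 3: "2 * p * (\<Sum>l\<in>(UNIV :: 2 set). ip (\<lambda>z. r z * j n l z - r z * DH n l z) (DH n l)) \<le> 2 * p * r1 * J^2 - p * r0 * Q n"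
    unfolding sum_distrib_left[symmetric] by (simp add: algebra_simps)
  have "0 \<le> p * (\<Sum>l\<in>UNIV. nsq (H n l))" using p by (intro mult_nonneg_nonneg sum_nonneg ip_nonneg) auto
  moreover have "0 \<le> nsq (WU n)" by (rule ip_nonneg)
  ultimately have "(1/2) * nsq (V n) \<le> E n" unfolding E_def by argo
  with 2 3 show ?thesis unfolding X_eq by argo
qed

lemma E_parts:
  assumes "E n \<le> B"
  shows "nsq (H n l) \<le> B / p" "nsq (V n) \<le> 2 * B"
    "nsq (WU n) \<le> 2 * B" "nsq (DU n) \<le> 2 * B / \<nu>0^2" "0 \<le> B"
proof -
  have h: "0 \<le> nsq (H n l)" for l by (rule ip_nonneg)
  have v: "0 \<le> nsq (V n)" by (rule ip_nonneg)
  have u: "0 \<le> nsq (WU n)" by (rule ip_nonneg)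
  have s: "0 \<le> p * (\<Sum>l\<in>UNIV. nsq (H n l))" using p by (intro mult_nonneg_nonneg sum_nonneg ip_nonneg) auto
  have hl: "nsq (H n l) \<le> (\<Sum>l\<in>UNIV. nsq (H n l))" by (rule member_le_sum) (auto simp: ip_nonneg)
  have "p * (\<Sum>l\<in>UNIV. nsq (H n l)) \<le> B" using assms v u unfolding E_def by argo
  from order_trans[OF mult_left_mono[OF hl less_imp_le[OF p]] this] have "p * nsq (H n l) \<le> B" .
  then show "nsq (H n l) \<le> B / p" using p by (simp add: pos_le_divide_eq mult.commute)
  show "nsq (V n) \<le> 2 * B" using assms s u unfolding E_def by argo
  show 3: "nsq (WU n) \<le> 2 * B" using assms s v unfolding E_def by argo
  show "0 \<le> B" using 3 u by simp
  have "(LINT z|cm. \<nu>0^2 * (DU n z)^2) \<le> (LINT z|cm. (\<nu> z * DU n z)^2)"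
  proof (rule integral_mono)
    show "\<nu>0^2 * (DU n z)^2 \<le> (\<nu> z * DU n z)^2" for z
      using power_mono[OF \<nu>b(1)[of z], of 2] \<nu>0 by (simp add: power_mult_distrib mult_right_mono)
  qed (intro cper_integrable cper_mult cper_const cper_power cper_D c\<nu>)+
  then have "\<nu>0^2 * nsq (DU n) \<le> 2 * B" using 3 by (simp add: ip_self)
  then show "nsq (DU n) \<le> 2 * B / \<nu>0^2" using \<nu>0 by (simp add: pos_le_divide_eq mult.commute)
qed

lemma Av_sup: "cper h \<Longrightarrow> nsq h \<le> a \<Longrightarrow> \<bar>Av d h z\<bar> \<le> sqrt (a / d)"
proof -
  assume h: "cper h" and a: "nsq h \<le> a"
  have "(Av d h z)^2 \<le> nsq h / d" using Av_square_le(2)[OF cper_pL2[OF h] d] by (simp add: ip_self)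
  also have "\<dots> \<le> a / d" using a d by (simp add: divide_right_mono)
  finally show ?thesis by (metis real_sqrt_abs real_sqrt_le_iff)
qed

text \<open>\<open>KH\<close>, \<open>KN\<close> and \<open>KV\<close> bound the squared norms of
  \<open>yH\<close>, \<open>NL\<close> and \<open>yV\<close>, and \<open>KR\<close> bounds the form
  \<open>R\<close>, while \<open>E \<le> B\<close>. Each discrete derivative costs a factor
  \<open>4 / d^2\<close>, each squared supremum of \<open>A h\<close> a factor \<open>1 / d\<close>.
  None of them depends on \<open>tau\<close>, which can therefore be chosen after them.\<close>

definition KH where "KH B = 4 / d^2 * (4 * (r1^2 * (4 / d^2 * (B / p))) + 4 * (B / p / d * (2 * B)) + 2 * (r1 * J)^2)"
definition KN where "KN B = 4 * (B / p / d * (4 / d^2 * (B / p)))"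
definition KV where "KV B = 4 * (4 / d^2 * (\<nu>1^2 * (2 * B))) + 4 * ((2 * p)^2 * KN B) + 2 * F^2"
definition KR where "KR B = p * (2 * KH B) + (1/2) * KV B + (1/2) * (\<nu>1^2 * (4 / d^2 * (2 * B)))"

lemma residual_bounds:
  assumes B: "E n \<le> B"
  shows "nsq (yH n l) \<le> KH B" "nsq (yV n) \<le> KV B" "R n \<le> KR B"
proof -
  note b = E_parts[OF B]
  have B0: "0 \<le> B" by (rule b(5))
  have Bp: "0 \<le> B / p" using B0 p by simp
  have rz: "\<bar>r z\<bar> \<le> r1" for z using rb[of z] r0 by simp
  have nz: "\<bar>\<nu> z\<bar> \<le> \<nu>1" for z using \<nu>b[of z] \<nu>0 by simp
  have dd: "0 \<le> 4 / d^2" by simp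
  have DH: "nsq (DH n l) \<le> 4 / d^2 * (B / p)" for l
    by (rule order_trans[OF ip_Dp_le[OF cper_st(1) d(1)] mult_left_mono[OF b(1) dd]])
  have AH: "\<bar>AH n l z\<bar> \<le> sqrt (B / p / d)" for l z by (rule Av_sup[OF cper_st(1) b(1)])
  have sq: "(sqrt (B / p / d))^2 = B / p / d" by (rule real_sqrt_pow2[OF divide_nonneg_pos[OF Bp d(1)]])
  have yH: "nsq (yH n l) \<le> KH B" for l
  proof -
    have c1: "cper (\<lambda>z. r z * DH n l z)" "cper (\<lambda>z. AH n l z * V n z)" "cper (\<lambda>z. r z * j n l z)"
      by (intro cper_mult cr cj cper_D cper_st)+
    have 1: "nsq (\<lambda>z. r z * DH n l z) \<le> r1^2 * (4 / d^2 * (B / p))"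
      by (rule order_trans[OF ip_bounded_mult_le[OF cr cper_D(1) rz] mult_left_mono[OF DH]]) simp
    have 2: "nsq (\<lambda>z. AH n l z * V n z) \<le> B / p / d * (2 * B)"
      using ip_bounded_mult_le[OF cper_D(4)[of n l] cper_st(2)[of n] AH[of l]] unfolding sq
      by (rule order_trans[OF _ mult_left_mono[OF b(2) divide_nonneg_pos[OF Bp d(1)]]])
    have "\<bar>r z * j n l z\<bar> \<le> r1 * J" for z
      unfolding abs_mult by (intro mult_mono rz jb) (use order_trans[OF abs_ge_zero rz[of z]] in auto)
    then have 3: "nsq (\<lambda>z. r z * j n l z) \<le> (r1 * J)^2" by (rule ip_const_le[OF c1(3)])
    have "nsq (gG n l) \<le> 2 * nsq (\<lambda>z. r z * DH n l z - AH n l z * V n z)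
      + 2 * nsq (\<lambda>z. r z * j n l z)"
      unfolding gG_def G_def[abs_def] by (rule ip_square_diff_le[OF cper_diff[OF c1(1,2)] c1(3)])
    also have "\<dots> \<le> 4 * (r1^2 * (4 / d^2 * (B / p))) + 4 * (B / p / d * (2 * B)) + 2 * (r1 * J)^2"
      using ip_square_diff_le[OF c1(1,2)] 1 2 3 by argo
    finally have G: "nsq (gG n l) \<le> 4 * (r1^2 * (4 / d^2 * (B / p))) + 4 * (B / p / d * (2 * B)) + 2 * (r1 * J)^2" .
    have "nsq (yH n l) = nsq (Dm d (gG n l))"
      by (simp add: yH_def YH_def[abs_def] gG_def ip_def)
    also have "\<dots> \<le> KH B" unfolding KH_def
      by (rule order_trans[OF ip_Dm_le[OF cper_y(3) d(1)] mult_left_mono[OF G dd]])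
    finally show ?thesis .
  qed
  then show "nsq (yH n l) \<le> KH B" .
  have NLb: "nsq (NL (H n)) \<le> KN B"
  proof -
    have c: "cper (\<lambda>z. AH n l z * DH n l z)" for l by (intro cper_mult cper_D)
    have 1: "nsq (\<lambda>z. AH n l z * DH n l z) \<le> B / p / d * (4 / d^2 * (B / p))" for l
      using ip_bounded_mult_le[OF cper_D(4)[of n l] cper_D(1)[of n l] AH[of l]] unfolding sq
      by (rule order_trans[OF _ mult_left_mono[OF DH divide_nonneg_pos[OF Bp d(1)]]])
    have "NL (H n) = (\<lambda>z. Av d (H n 1) z * Dp d (H n 1) z + Av d (H n 2) z * Dp d (H n 2) z)"
      by (simp add: NL_def[abs_def] UNIV2)
    then show ?thesis using ip_square_sum_le[OF c[of 1] c[of 2]] 1[of 1] 1[of 2] unfolding KN_def by simp argo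
  qed
  show yV: "nsq (yV n) \<le> KV B"
  proof -
    let ?a = "\<lambda>z. - Dm d (FU n) z" and ?b = "\<lambda>z. (2 * p) * NL (H n) z"
    have ca: "cper ?a" by (intro cper_minus cper_Dm cper_D)
    have cb: "cper ?b" by (intro cper_mult cper_const cper_NL cper_st)
    have e: "(FU n) = (\<lambda>z. \<nu> z * (\<nu> z * DU n z))"
      by (auto simp: power2_eq_square)
    have "nsq (FU n) \<le> \<nu>1^2 * (2 * B)"
      unfolding e by (rule order_trans[OF ip_bounded_mult_le[OF c\<nu> cper_D(5) nz] mult_left_mono[OF b(3)]]) simp
    note Dme = order_trans[OF ip_Dm_le[OF cper_D(7) d(1)] mult_left_mono[OF this dd]]
    have "nsq ?a = nsq (Dm d (FU n))"
      by (simp add: ip_def)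
    with Dme have 1: "nsq ?a \<le> 4 / d^2 * (\<nu>1^2 * (2 * B))" by (simp only:)
    have 2: "nsq ?b \<le> (2 * p)^2 * KN B"
      by (rule order_trans[OF ip_bounded_mult_le[OF cper_const cper_NL[OF cper_st(1)], of "2 * p" "2 * p"] mult_left_mono[OF NLb]]) (use p in auto)
    have "nsq (yV n) \<le> 2 * nsq (\<lambda>z. ?a z - ?b z) + 2 * nsq (f n)"
      unfolding yV_def YV_def[abs_def] by (rule ip_square_sum_le[OF cper_diff[OF ca cb] cf])
    then show ?thesis using ip_square_diff_le[OF ca cb] 1 2 ip_const_le[OF cf fb, of n] unfolding KV_def by argo
  qed
  have "nsq (\<lambda>z. \<nu> z * DV n z) \<le> \<nu>1^2 * nsq (DV n)"
    by (rule ip_bounded_mult_le[OF c\<nu> cper_D(2) nz])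
  also have "\<dots> \<le> \<nu>1^2 * (4 / d^2 * (2 * B))"
    by (rule mult_left_mono[OF order_trans[OF ip_Dp_le[OF cper_st(2) d(1)] mult_left_mono[OF b(2) dd]]]) simp
  finally have vV: "nsq (\<lambda>z. \<nu> z * DV n z) \<le> \<nu>1^2 * (4 / d^2 * (2 * B))" .
  have "p * (\<Sum>l\<in>UNIV. nsq (yH n l)) \<le> p * (2 * KH B)"
    using yH[of 1] yH[of 2] p by (intro mult_left_mono) (auto simp: UNIV2)
  with yV vV show "R n \<le> KR B" unfolding R_def KR_def by argo
qed

text \<open>A bootstrap with Gronwall's inequality. As long as the energy is at most
  \<open>B\<close>, the form \<open>R\<close> is at most \<open>KR B\<close>, and the Euler error
  \<open>tau^2 R\<close> is at most \<open>tau\<close>; the summand 1 in \<open>c\<close> pays for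
  it. The growth factor of one step is \<open>1 + tau\<close>, hence at most \<open>exp T\<close>
  altogether, and the resulting bound is \<open>B\<close> again.\<close>

theorem energy_bound:
  assumes E0: "E 0 \<le> e0" and T: "real N * tau = T"
  defines "c \<equiv> 2 * p * r1 * J^2 + F^2 + 1"
  defines "B \<equiv> exp T * (e0 + T * c)"
  assumes small: "tau * KR B \<le> 1" and n: "n \<le> N"
  shows "E n + p * r0 * (tau * (\<Sum>i<n. Q i)) \<le> B"
proof -
  define S where "S n = E n + p * r0 * (tau * (\<Sum>i<n. Q i))" for n
  have Q0: "0 \<le> Q i" for i unfolding Q_def by (intro sum_nonneg ip_nonneg)
  have ES: "E n \<le> S n" for n unfolding S_def using p r0 tau by (simp add: sum_nonneg Q0)
  have r1: "0 \<le> r1" using r0 rb[of 0] by linarith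
  have c0: "0 \<le> c" unfolding c_def using p r1 by simp
  have e00: "0 \<le> e0" using E_parts(5)[OF E0] .
  \<comment> \<open>Both inequalities are carried through the induction: the second one keeps the
    iterate below \<open>B\<close> and thereby justifies the residual bound in the next
    step.\<close>
  have "S n \<le> (1 + tau) ^ n * (e0 + real n * tau * c) \<and> (1 + tau) ^ n * (e0 + real n * tau * c) \<le> B" if "n \<le> N" for n
    using that
  proof (induction n)
    case 0
    have "e0 \<le> B" unfolding B_def T[symmetric] using e00 c0 tau mult_mono[of 1 "exp (real N * tau)" e0 "e0 + real N * tau * c"] by simp
    then show ?case using E0 by (simp add: S_def)
  next
    case (Suc n)
    then have IH: "S n \<le> (1 + tau) ^ n * (e0 + real n * tau * c)" and SB: "S n \<le> B" by auto
    have "R n \<le> KR B" by (rule residual_bounds(3)) (use ES[of n] SB in linarith)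
    from order_trans[OF mult_left_mono[OF this less_imp_le[OF tau]] small] have "tau * R n \<le> 1" .
    then have t2: "tau^2 * R n \<le> tau" using mult_left_mono[of "tau * R n" 1 tau] tau by (simp add: power2_eq_square mult.assoc)
    have "tau * X n \<le> tau * (E n + (c - 1) - p * r0 * Q n)" using X_le[of n] tau by (intro mult_left_mono) (auto simp: c_def)
    then have "S (Suc n) \<le> S n + tau * E n + tau * c"
      using t2 unfolding S_def E_step by (simp add: algebra_simps)
    also have "\<dots> \<le> (1 + tau) * S n + tau * c" using ES[of n] tau by (simp add: algebra_simps)
    also have "\<dots> \<le> (1 + tau) * ((1 + tau) ^ n * (e0 + real n * tau * c)) + tau * c"
      using IH tau by (intro add_right_mono mult_left_mono) auto
    also have "\<dots> \<le> (1 + tau) ^ Suc n * (e0 + real n * tau * c) + (1 + tau) ^ Suc n * (tau * c)"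
    proof -
      have "1 \<le> (1 + tau) ^ Suc n" using tau by (intro one_le_power) simp
      then have "1 * (tau * c) \<le> (1 + tau) ^ Suc n * (tau * c)" using tau c0 by (intro mult_right_mono) auto
      then show ?thesis by simp
    qed
    also have "\<dots> = (1 + tau) ^ Suc n * (e0 + real (Suc n) * tau * c)" by (simp add: algebra_simps)
    finally have 1: "S (Suc n) \<le> (1 + tau) ^ Suc n * (e0 + real (Suc n) * tau * c)" .
    have "(1 + tau) ^ Suc n \<le> exp tau ^ Suc n" using tau exp_ge_add_one_self[of tau] by (intro power_mono) auto
    also have "\<dots> = exp (real (Suc n) * tau)" by (rule exp_of_nat_mult[symmetric])
    also have "\<dots> \<le> exp T" using Suc.prems tau unfolding T[symmetric] by (simp del: of_nat_Suc)
    finally have 2: "(1 + tau) ^ Suc n \<le> exp T" .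
    have "real (Suc n) * tau \<le> T" using Suc.prems tau unfolding T[symmetric] by (simp del: of_nat_Suc)
    then have "e0 + real (Suc n) * tau * c \<le> e0 + T * c" using c0 mult_right_mono by auto
    with 2 have "(1 + tau) ^ Suc n * (e0 + real (Suc n) * tau * c) \<le> B"
      unfolding B_def by (rule mult_mono) (use e00 c0 tau in auto)
    with 1 show ?case by blast
  qed
  from this[OF n] have "S n \<le> B" by linarith
  then show ?thesis by (simp add: S_def)
qed

end

section \<open>Step functions in time\<close>

text \<open>For \<open>tau > 0\<close>, the Euler step current at time \<open>t\<close>: step
  \<open>n\<close> owns the times from \<open>n tau\<close>, included, to
  \<open>(n + 1) tau\<close>, excluded. At \<open>t = T\<close> the index is the number
  \<open>N\<close> of steps, and negative times get index 0.\<close>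

definition stp :: "real \<Rightarrow> real \<Rightarrow> nat" where "stp tau t = nat \<lfloor>t / tau\<rfloor>"
definition lift :: "real \<Rightarrow> (nat \<Rightarrow> real \<Rightarrow> real) \<Rightarrow> real \<times> real \<Rightarrow> real" where
  "lift tau x p = x (stp tau (fst p)) (snd p)"

lemma stp_iff:
  assumes "0 < tau" "0 \<le> t" shows "stp tau t = n \<longleftrightarrow> real n * tau \<le> t \<and> t < real (Suc n) * tau"
proof -
  have "0 \<le> t / tau" using assms by simp
  then have "stp tau t = n \<longleftrightarrow> \<lfloor>t / tau\<rfloor> = int n" by (auto simp: stp_def)
  also have "\<dots> \<longleftrightarrow> real n * tau \<le> t \<and> t < real (Suc n) * tau"
    using assms by (auto simp: floor_eq_iff pos_le_divide_eq pos_divide_less_eq algebra_simps)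
  finally show ?thesis .
qed

lemma stp_bounds:
  assumes "0 < tau" "0 \<le> t" shows "real (stp tau t) * tau \<le> t" "t < real (Suc (stp tau t)) * tau"
  using stp_iff[OF assms, of "stp tau t"] by auto

lemma stp_less:
  assumes tau: "0 < tau" and N: "real N * tau = T" and t: "0 \<le> t" "t < T" shows "stp tau t < N"
proof (rule ccontr)
  assume "\<not> ?thesis"
  then have "real N * tau \<le> real (stp tau t) * tau" using tau by (intro mult_right_mono) auto
  then show False using stp_bounds(1)[OF tau t(1)] t N by linarith
qed

lemma stp_le:
  assumes tau: "0 < tau" and N: "real N * tau = T" and t: "0 \<le> t" "t \<le> T" shows "stp tau t \<le> N"
proof (cases "t = T")
  case True
  then have "stp tau t = N" using stp_iff[OF tau t(1), of N] N tau by (simp add: distrib_right)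
  then show ?thesis by simp
next
  case False
  then show ?thesis using stp_less[OF tau N t(1)] t by simp
qed

lemma borel_stp [measurable]: "stp tau \<in> borel \<rightarrow>\<^sub>M count_space UNIV"
  unfolding stp_def[abs_def] by measurable

lemma borel_lift:
  assumes [measurable]: "\<And>n. x n \<in> Borel" shows "lift tau x \<in> Borel"
  unfolding lift_def[abs_def] by (rule measurable_compose_countable[where f="\<lambda>n p. x n (snd p)"]) measurable

lemma lift_cong_AE:
  assumes "0 < tau" "real N * tau = T" "\<And>n z. n < N \<Longrightarrow> P n z"
  shows "AE p in MM T. P (stp tau (fst p)) (snd p)"
  using AE_MM_fst[OF AE_tm_range] by eventually_elim (use assms stp_less in auto)

lemma tm_step_integral_prefix:
  fixes c :: "nat \<Rightarrow> real"
  assumes tau: "0 < tau" and N: "real N * tau = T" and t: "0 \<le> t" "t \<le> T"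
  shows "(LINT s|tm T. indicator {..<t} s * c (stp tau s))
    = tau * (\<Sum>i<stp tau t. c i) + (t - real (stp tau t) * tau) * c (stp tau t)"
proof -
  define P where "P t = (LINT s|tm T. indicator {..<t} s * c (stp tau s))" for t
  have "AE s in tm T. \<bar>c (stp tau s)\<bar> \<le> (\<Sum>i\<le>N. \<bar>c i\<bar>)"
    using AE_tm_range
  proof eventually_elim
    case (elim s)
    then show ?case using stp_le[OF tau N, of s] by (intro member_le_sum) auto
  qed
  then have i: "integrable (tm T) (\<lambda>s. c (stp tau s))" by (intro tm.integrable_const_bound) (simp, measurable)
  have step: "P b = P a + (b - a) * c n" if ab: "real n * tau \<le> a" "a \<le> b" "b \<le> real (Suc n) * tau" "b \<le> T" for a b n
  proof -
    have a0: "0 \<le> a" using tau by (intro order_trans[OF _ ab(1)]) simp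
    have "P b - P a = (LINT s|tm T. indicator {..<b} s * c (stp tau s) - indicator {..<a} s * c (stp tau s))"
      unfolding P_def by (rule Bochner_Integration.integral_diff[symmetric]; rule integrable_indicator_mult[OF i]) simp_all
    also have "\<dots> = (LINT s|lborel. c n * indicator {a..<b} s)"
    proof (subst tm_integral)
      show "(LINT s|lborel. indicator {0<..<T} s * (indicator {..<b} s * c (stp tau s) - indicator {..<a} s * c (stp tau s)))
        = (LINT s|lborel. c n * indicator {a..<b} s)"
      proof (rule integral_cong_AE)
        show "AE s in lborel. indicator {0<..<T} s * (indicator {..<b} s * c (stp tau s) - indicator {..<a} s * c (stp tau s)) = c n * indicator {a..<b} s"
          using AE_lborel_singleton[of 0]
        proof eventually_elim
          case (elim s)
          have "stp tau s = n" if "a \<le> s" "s < b" using that ab a0 by (subst stp_iff[OF tau]) auto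
          then show ?case using elim a0 ab by (auto simp: indicator_def)
        qed
      qed measurable
    qed measurable
    finally show ?thesis using ab by (simp add: algebra_simps)
  qed
  have P0: "P 0 = 0" unfolding P_def
    by (rule integral_eq_zero_AE) (use AE_tm_range in eventually_elim, simp)
  have Pn: "real n * tau \<le> T \<Longrightarrow> P (real n * tau) = tau * (\<Sum>i<n. c i)" for n
  proof (induction n)
    case (Suc n)
    have "real n * tau \<le> real (Suc n) * tau" using tau by (intro mult_right_mono) auto
    with Suc step[of n "real n * tau" "real (Suc n) * tau"] show ?case by (simp add: algebra_simps)
  qed (simp add: P0)
  note b = stp_bounds[OF tau t(1)]
  show ?thesis using step[OF order_refl b(1) less_imp_le[OF b(2)] t(2)] Pn[of "stp tau t"] b(1) t(2) unfolding P_def by simp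
qed

lemma tm_step_integral:
  fixes c :: "nat \<Rightarrow> real"
  assumes tau: "0 < tau" and N: "real N * tau = T"
  shows "(LINT s|tm T. c (stp tau s)) = tau * (\<Sum>i<N. c i)"
proof -
  have T: "0 \<le> T" using tau N by (metis less_imp_le mult_nonneg_nonneg of_nat_0_le_iff)
  have e: "stp tau T = N" using stp_iff[OF tau T, of N] N tau by (simp add: distrib_right)
  have "(LINT s|tm T. c (stp tau s)) = (LINT s|tm T. indicator {..<T} s * c (stp tau s))"
  proof (rule integral_cong_AE)
    show "AE s in tm T. c (stp tau s) = indicator {..<T} s * c (stp tau s)"
      using AE_tm_range by eventually_elim (auto simp: indicator_def)
  qed measurable
  then show ?thesis using tm_step_integral_prefix[OF tau N T order_refl, of c] e N by simp
qed

lemma finite_cper_bound: fixes x :: "nat \<Rightarrow> real \<Rightarrow> real" shows "(\<And>n. cper (x n)) \<Longrightarrow> \<exists>C. \<forall>n<N. \<forall>z. \<bar>x n z\<bar> \<le> C"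
proof (induction N)
  case (Suc N)
  then obtain C where C: "\<forall>n<N. \<forall>z. \<bar>x n z\<bar> \<le> C" by blast
  obtain D where D: "\<forall>z. \<bar>x N z\<bar> \<le> D" using cper_bounded[OF Suc.prems] by blast
  have "\<forall>n<Suc N. \<forall>z. \<bar>x n z\<bar> \<le> max C D"
    using C D by (auto simp: less_Suc_eq le_max_iff_disj)
  then show ?case by blast
qed simp

lemma lift_sqi:
  assumes tau: "0 < tau" and N: "real N * tau = T" and x: "\<And>n. cper (x n)"
  shows "sqi (MM T) (lift tau x)" "(LINT p|MM T. (lift tau x p)^2) = tau * (\<Sum>i<N. nsq (x i))"
proof -
  have m: "lift tau x \<in> borel_measurable (MM T)" by (rule borel_MMI[OF borel_lift[of x, OF cper_borel[OF x]]])
  obtain C where C: "\<forall>n<N. \<forall>z. \<bar>x n z\<bar> \<le> C" using finite_cper_bound[of x N, OF x] by blast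
  have "AE p in MM T. \<bar>lift tau x p\<bar> \<le> C"
    unfolding lift_def by (rule lift_cong_AE[OF tau N, where P="\<lambda>n z. \<bar>x n z\<bar> \<le> C"]) (use C in auto)
  from MMf.sqi_bounded[OF m this] show s: "sqi (MM T) (lift tau x)" .
  have i: "integrable (MM T) (\<lambda>p. (lift tau x p)^2)" by (rule sqiD(2)[OF s])
  have "(LINT p|MM T. (lift tau x p)^2) = (LINT t|tm T. nsq (x (stp tau t)))"
    unfolding MM_integral[OF i] by (simp add: lift_def ip_self)
  then show "(LINT p|MM T. (lift tau x p)^2) = tau * (\<Sum>i<N. nsq (x i))"
    using tm_step_integral[OF tau N, of "\<lambda>n. nsq (x n)"] by simp
qed

lemma lift_bound:
  assumes tau: "0 < tau" and N: "real N * tau = T" and x: "\<And>n. cper (x n)" and C: "\<And>n. n < N \<Longrightarrow> nsq (x n) \<le> C"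
  shows "(LINT p|MM T. (lift tau x p)^2) \<le> T * C"
proof -
  have "(\<Sum>i<N. nsq (x i)) \<le> (\<Sum>i<N. C)" by (rule sum_mono) (use C in auto)
  then have "tau * (\<Sum>i<N. nsq (x i)) \<le> tau * (real N * C)" using tau by (intro mult_left_mono) auto
  moreover have "tau * (real N * C) = (real N * tau) * C" by simp
  ultimately show ?thesis unfolding lift_sqi(2)[OF tau N x] N by simp
qed

text \<open>The primitive in \<open>t\<close> that vanishes at \<open>t = T\<close>: all test functions of the weak formulation are of this form.\<close>

definition tback :: "real \<Rightarrow> (real \<times> real \<Rightarrow> real) \<Rightarrow> real \<times> real \<Rightarrow> real" where
  "tback T w x = - (LINT s|tm T. indicator {fst x<..} s * w (s, snd x))"

lemma integral_tm_square_le: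
  assumes w: "sqi (tm T) w" and A: "A \<in> sets borel"
  shows "(LINT s|tm T. indicator A s * w s)^2 \<le> measure (tm T) A * (LINT s|tm T. (w s)^2)"
proof -
  have "sqi (tm T) (\<lambda>s. indicator A s :: real)" using A by (intro tm.sqi_bounded[where C=1]) (auto simp: indicator_def)
  from Cauchy_Schwarz_integral[OF this w]
  have "(LINT s|tm T. indicator A s * w s)^2 \<le> (LINT s|tm T. (indicator A s)^2) * (LINT s|tm T. (w s)^2)" .
  moreover have "(LINT s|tm T. (indicator A s :: real)^2) = (LINT s|tm T. indicator A s)"
    by (rule Bochner_Integration.integral_cong) (auto simp: indicator_def)
  ultimately show ?thesis by simp
qed

lemma integral_tm_square_le':
  assumes T: "0 < T" and w: "sqi (tm T) w" and A: "A \<in> sets borel"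
  shows "(LINT s|tm T. indicator A s * w s)^2 \<le> T * (LINT s|tm T. (w s)^2)"
proof -
  have "measure (tm T) A \<le> T" using tm.bounded_measure[of T A] T by (simp add: measure_tm)
  then show ?thesis by (intro order_trans[OF integral_tm_square_le[OF w A]] mult_right_mono) auto
qed

lemma sqi_MM_section: assumes "sqi (MM T) w" "w \<in> Borel" shows "AE z in cm. sqi (tm T) (\<lambda>t. w (t, z))"
proof -
  note [measurable] = assms(2)
  have "integrable (MM T) (\<lambda>x. (w x)^2)" using assms by auto
  from AE_MM_section'[OF this] show ?thesis
  proof eventually_elim
    case (elim z)
    have "(\<lambda>t. w (t, z)) \<in> borel_measurable (tm T)" by measurable
    then show ?case using elim by (simp add: sqi_def)
  qed
qed

lemma sqi_MM_section': assumes "sqi (MM T) w" "w \<in> Borel" shows "AE t in tm T. sqi cm (\<lambda>z. w (t, z))"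
proof -
  note [measurable] = assms(2)
  have "integrable (MM T) (\<lambda>x. (w x)^2)" using assms by auto
  from AE_MM_section[OF this] show ?thesis
  proof eventually_elim
    case (elim t)
    have "(\<lambda>z. w (t, z)) \<in> borel_measurable cm" by measurable
    then show ?case using elim by (simp add: sqi_def)
  qed
qed

lemma sqi_MM_snd:
  assumes g: "sqi cm g" shows "sqi (MM T) (\<lambda>p. g (snd p))"
  using borel_MMI[OF measurable_compose[OF borel_fst_snd(2) sqi_cm_borel[OF g]]] g integrable_MM_of_snd[of "\<lambda>z. (g z)^2"] by (simp add: sqi_def)

lemma time_integral:
  assumes w: "sqi (MM T) w" "w \<in> Borel" and A: "A \<in> sets borel"
  shows "sqi cm (\<lambda>z. LINT s|tm T. indicator A s * w (s, z))"
    and "(LINT z|cm. (LINT s|tm T. indicator A s * w (s, z))^2) \<le> measure (tm T) A * (LINT x|MM T. (w x)^2)"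
proof -
  let ?m = "measure (tm T) A" and ?I = "\<lambda>z. LINT s|tm T. indicator A s * w (s, z)"
  have iw: "integrable (MM T) (\<lambda>x. (w x)^2)" using w by auto
  have [measurable]: "w \<in> borel_measurable (borel \<Otimes>\<^sub>M borel)" using w(2) by (simp add: borel_prod)
  have m: "?I \<in> Borel" using A by measurable
  have i: "integrable cm (\<lambda>z. ?m * (LINT t|tm T. (w (t, z))^2))" by (intro integrable_mult_right integrable_MM_snd[OF iw])
  have le: "AE z in cm. (?I z)^2 \<le> ?m * (LINT t|tm T. (w (t, z))^2)"
    using sqi_MM_section[OF w] by eventually_elim (rule integral_tm_square_le[OF _ A])
  have "integrable cm (\<lambda>z. (?I z)^2)"
    by (rule Bochner_Integration.integrable_bound[OF i borel_cmI[OF borel_measurable_power[OF m]]]) (use le in eventually_elim, simp)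
  then show s: "sqi cm ?I" using borel_cmI[OF m] by (simp add: sqi_def)
  have "(LINT z|cm. (?I z)^2) \<le> (LINT z|cm. ?m * (LINT t|tm T. (w (t, z))^2))" by (rule integral_mono_AE[OF sqiD(2)[OF s] i le])
  then show "(LINT z|cm. (?I z)^2) \<le> ?m * (LINT x|MM T. (w x)^2)" using MM_integral'[OF iw] by simp
qed

lemma borel_tback: assumes w: "w \<in> Borel" shows "tback T w \<in> Borel"
proof -
  note [measurable] = w
  have [measurable]: "Measurable.pred (borel \<Otimes>\<^sub>M tm T) (\<lambda>(x :: real \<times> real, y). fst x < y)" by measurable
  have "(\<lambda>x. - (LINT y|tm T. (if fst x < y then 1 else 0) * w (y, snd x))) \<in> Borel"
    by measurable
  then show ?thesis by (simp add: tback_def[abs_def] indicator_def of_bool_def)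
qed

lemma
  assumes T: "0 < T" and w: "sqi (MM T) w" "w \<in> Borel"
  shows sqi_tprim: "sqi (MM T) (tprim T w)" and sqi_tback: "sqi (MM T) (tback T w)"
proof -
  let ?q = "\<lambda>x. T * (LINT s|tm T. (w (s, snd x))^2)"
  have wi: "integrable (MM T) (\<lambda>x. (w x)^2)" using w by auto
  have qi: "integrable (MM T) ?q"
    using integrable_MM_of_snd[OF integrable_MM_snd[OF wi]] by simp
  have s: "AE x in MM T. sqi (tm T) (\<lambda>t. w (t, snd x))" by (rule AE_MM_snd[OF sqi_MM_section[OF w]])
  have m1: "tprim T w \<in> borel_measurable (MM T)" by (rule borel_MMI, rule borel_tprim[OF w(2)])
  have m2: "tback T w \<in> borel_measurable (MM T)" by (rule borel_MMI, rule borel_tback[OF w(2)])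
  have "integrable (MM T) (\<lambda>x. (tprim T w x)^2)"
  proof (rule Bochner_Integration.integrable_bound[OF qi])
    show "AE x in MM T. norm ((tprim T w x)^2) \<le> norm (?q x)" using s
    proof eventually_elim
      case (elim x)
      have "(tprim T w x)^2 \<le> ?q x" unfolding tprim_def by (rule integral_tm_square_le'[OF T elim]) simp
      then show ?case by (simp only: real_norm_def) (smt (verit) zero_le_power2)
    qed
  qed (use m1 in measurable)
  then show "sqi (MM T) (tprim T w)" using m1 by (simp add: sqi_def)
  have "integrable (MM T) (\<lambda>x. (tback T w x)^2)"
  proof (rule Bochner_Integration.integrable_bound[OF qi])
    show "AE x in MM T. norm ((tback T w x)^2) \<le> norm (?q x)" using s
    proof eventually_elim
      case (elim x)
      have "(tback T w x)^2 \<le> ?q x" unfolding tback_def power2_minus by (rule integral_tm_square_le'[OF T elim]) simp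
      then show ?case by (simp only: real_norm_def) (smt (verit) zero_le_power2)
    qed
  qed (use m2 in measurable)
  then show "sqi (MM T) (tback T w)" using m2 by (simp add: sqi_def)
qed

text \<open>Fubini on the triangle, for almost every fixed \<open>z\<close>. It moves the time
  primitive of the increments onto the test function.\<close>

lemma tprim_tback:
  assumes T: "0 < T" and y: "sqi (MM T) y" "y \<in> Borel" and w: "sqi (MM T) w" "w \<in> Borel"
  shows "(LINT x|MM T. tprim T y x * w x) = - (LINT x|MM T. y x * tback T w x)"
proof -
  have i1: "integrable (MM T) (\<lambda>x. tprim T y x * w x)" by (rule sqi_mult_integrable[OF sqi_tprim[OF T y] w(1)])
  have i2: "integrable (MM T) (\<lambda>x. y x * tback T w x)" by (rule sqi_mult_integrable[OF y(1) sqi_tback[OF T w]])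
  have "(LINT x|MM T. tprim T y x * w x) = (LINT z|cm. LINT t|tm T. tprim T y (t, z) * w (t, z))"
    by (rule MM_integral'[OF i1])
  also have "\<dots> = (LINT z|cm. - (LINT t|tm T. y (t, z) * tback T w (t, z)))"
  proof (rule integral_cong_AE)
    show "AE z in cm. (LINT t|tm T. tprim T y (t, z) * w (t, z)) = - (LINT t|tm T. y (t, z) * tback T w (t, z))"
      using sqi_MM_section[OF y] sqi_MM_section[OF w]
    proof eventually_elim
      case (elim z)
      note f = tm_triangle_Fubini[OF tm.sqi_integrable[OF elim(1)] tm.sqi_integrable[OF elim(2)]]
      have "(LINT t|tm T. tprim T y (t, z) * w (t, z)) = (LINT t|tm T. w (t, z) * (LINT s|tm T. indicator {..<t} s * y (s, z)))"
        by (simp add: tprim_def mult.commute)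
      also have "\<dots> = (LINT s|tm T. y (s, z) * (LINT t|tm T. indicator {s<..} t * w (t, z)))" by (rule f)
      also have "\<dots> = - (LINT t|tm T. y (t, z) * tback T w (t, z))" by (simp add: tback_def)
      finally show ?case .
    qed
    show "(\<lambda>z. LINT t|tm T. tprim T y (t, z) * w (t, z)) \<in> borel_measurable cm"
      using borel_measurable_integrable[OF integrable_MM_snd[OF i1]] by simp
    show "(\<lambda>z. - (LINT t|tm T. y (t, z) * tback T w (t, z))) \<in> borel_measurable cm"
      using borel_measurable_integrable[OF integrable_MM_snd[OF i2]] by simp
  qed
  also have "\<dots> = - (LINT x|MM T. y x * tback T w x)" by (simp add: MM_integral'[OF i2])
  finally show ?thesis .
qed

text \<open>Summing the increments gives the primitive of \<open>lift tau y\<close>, except that the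
  primitive has already run through part of the current step; the last term removes that
  part.\<close>

lemma lift_recursion:
  assumes tau: "0 < tau" and N: "real N * tau = T" and step: "\<And>n z. x (Suc n) z = x n z + tau * y n z"
    and t: "0 \<le> t" "t \<le> T"
  shows "lift tau x (t, z) = x 0 z + tprim T (lift tau y) (t, z) - (t - real (stp tau t) * tau) * lift tau y (t, z)"
proof -
  have a: "x n z = x 0 z + tau * (\<Sum>i<n. y i z)" for n
    by (induction n) (auto simp: step algebra_simps)
  have b: "tprim T (lift tau y) (t, z) = tau * (\<Sum>i<stp tau t. y i z) + (t - real (stp tau t) * tau) * y (stp tau t) z"
    using tm_step_integral_prefix[OF tau N t, of "\<lambda>n. y n z"] by (simp add: tprim_def lift_def)
  have g: "lift tau x (t, z) = x (stp tau t) z" "lift tau y (t, z) = y (stp tau t) z" by (simp_all add: lift_def)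
  show ?thesis unfolding g b a[of "stp tau t"] by simp
qed

lemma tback_initial:
  assumes T: "0 < T" and w: "sqi (MM T) w" "w \<in> Borel"
  shows "sqi cm (\<lambda>z. tback T w (0, z))"
    and "pL2 g \<Longrightarrow> (LINT p|MM T. g (snd p) * w p) = - (LINT z|cm. g z * tback T w (0, z))"
proof -
  have drop: "(LINT s|tm T. indicator {0<..} s * w (s, z)) = (LINT s|tm T. w (s, z))" for z
    by (rule tm_integral_drop, rule borel_pair_section[OF w(2)]) simp_all
  have "sqi cm (\<lambda>z. - (LINT s|tm T. indicator {0<..} s * w (s, z)))" by (rule sqi_minus[OF time_integral(1)[OF w]]) simp
  then show "sqi cm (\<lambda>z. tback T w (0, z))" by (simp add: tback_def)
  assume g: "pL2 g"
  have sg: "sqi (MM T) (\<lambda>p. g (snd p))" using g by (intro sqi_MM_snd) (simp add: pL2_def)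
  have i2: "integrable (MM T) (\<lambda>p. g (snd p) * w p)" by (rule sqi_mult_integrable[OF sg w(1)])
  show "(LINT p|MM T. g (snd p) * w p) = - (LINT z|cm. g z * tback T w (0, z))"
    unfolding MM_integral'[OF i2] by (simp add: tback_def drop)
qed

text \<open>The discrete form of testing \<open>x_t = y\<close> with a function that vanishes at
  \<open>T\<close> and has time derivative \<open>w\<close>. The only error is the unfinished step
  in \<open>lift_recursion\<close>, pointwise at most \<open>tau |y|\<close>.\<close>

lemma lift_summation_by_parts:
  assumes tau: "0 < tau" and N: "real N * tau = T" and T: "0 < T"
    and x: "\<And>n. cper (x n)" and y: "\<And>n. cper (y n)" and step: "\<And>n z. x (Suc n) z = x n z + tau * y n z"
    and w: "sqi (MM T) w" "w \<in> Borel"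
    and Y: "\<And>n. n < N \<Longrightarrow> nsq (y n) \<le> C"
  shows "\<bar>- (LINT p|MM T. lift tau x p * w p) - (LINT z|cm. x 0 z * tback T w (0, z)) - (LINT p|MM T. lift tau y p * tback T w p)\<bar>
    \<le> tau * sqrt (T * C * (LINT p|MM T. (w p)^2))"
proof -
  have ly: "sqi (MM T) (lift tau y)" by (rule lift_sqi(1)[OF tau N, of y, OF y])
  have lyb: "lift tau y \<in> Borel" by (rule borel_lift[of y, OF cper_borel[OF y]])
  have lx: "sqi (MM T) (lift tau x)" by (rule lift_sqi(1)[OF tau N, of x, OF x])
  have lxb: "lift tau x \<in> Borel" by (rule borel_lift[of x, OF cper_borel[OF x]])
  have x0: "sqi (MM T) (\<lambda>p. x 0 (snd p))" by (rule sqi_MM_snd[OF cper_sqi[OF x]])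
  let ?e = "\<lambda>p. (lift tau x p - x 0 (snd p)) - tprim T (lift tau y) p"
  have e: "sqi (MM T) ?e" by (intro sqi_diff lx x0 sqi_tprim T ly lyb)
  have ae: "AE p in MM T. \<bar>?e p\<bar> \<le> tau * \<bar>lift tau y p\<bar>"
    using AE_MM_fst[OF AE_tm_range]
  proof eventually_elim
    case (elim p)
    have t: "0 \<le> fst p" "fst p \<le> T" using elim by auto
    have "?e p = - ((fst p - real (stp tau (fst p)) * tau) * lift tau y p)"
      using lift_recursion[where x=x and y=y, OF tau N step t, of "snd p"] by simp
    also have "\<bar>\<dots>\<bar> \<le> tau * \<bar>lift tau y p\<bar>"
      unfolding abs_minus_cancel abs_mult using stp_bounds[OF tau t(1)] by (intro mult_right_mono) (auto simp: distrib_right)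
    finally show ?case .
  qed
  have "\<bar>LINT p|MM T. ?e p * w p\<bar> \<le> (LINT p|MM T. \<bar>?e p * w p\<bar>)" by (rule integral_abs_bound)
  also have "\<dots> \<le> (LINT p|MM T. tau * \<bar>lift tau y p * w p\<bar>)"
  proof (rule integral_mono_AE)
    show "integrable (MM T) (\<lambda>p. \<bar>?e p * w p\<bar>)" by (intro integrable_abs sqi_mult_integrable[OF e w(1)])
    show "integrable (MM T) (\<lambda>p. tau * \<bar>lift tau y p * w p\<bar>)"
      by (intro integrable_mult_right integrable_abs sqi_mult_integrable[OF ly w(1)])
    show "AE p in MM T. \<bar>?e p * w p\<bar> \<le> tau * \<bar>lift tau y p * w p\<bar>"
      using ae
    proof eventually_elim
      case (elim p)
      show ?case unfolding abs_mult mult.assoc[symmetric] by (rule mult_right_mono[OF elim abs_ge_zero])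
    qed
  qed
  also have "\<dots> \<le> tau * sqrt (T * C * (LINT p|MM T. (w p)^2))"
    using Cauchy_Schwarz_abs'[OF ly w(1) lift_bound[OF tau N y Y] order_refl] tau by simp
  finally have 1: "\<bar>LINT p|MM T. ?e p * w p\<bar> \<le> tau * sqrt (T * C * (LINT p|MM T. (w p)^2))" .
  have i1: "integrable (MM T) (\<lambda>p. lift tau x p * w p)" by (rule sqi_mult_integrable[OF lx w(1)])
  have i2: "integrable (MM T) (\<lambda>p. x 0 (snd p) * w p)" by (rule sqi_mult_integrable[OF x0 w(1)])
  have i3: "integrable (MM T) (\<lambda>p. tprim T (lift tau y) p * w p)" by (rule sqi_mult_integrable[OF sqi_tprim[OF T ly lyb] w(1)])
  have 2: "(LINT p|MM T. ?e p * w p) = (LINT p|MM T. lift tau x p * w p) - (LINT p|MM T. x 0 (snd p) * w p) - (LINT p|MM T. tprim T (lift tau y) p * w p)"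
    unfolding left_diff_distrib using i1 i2 i3 by simp
  have 3: "(LINT p|MM T. x 0 (snd p) * w p) = - (LINT z|cm. x 0 z * tback T w (0, z))" by (rule tback_initial(2)[OF T w cper_pL2[OF x]])
  show ?thesis using 1 unfolding 2 3 tprim_tback[OF T ly lyb w] by (simp add: abs_minus_commute algebra_simps)
qed

text \<open>
  \<open>k\<close> is the derivative in \<open>z\<close> of \<open>e\<close>. The vanishing mean of \<open>k\<close> on almost every time slice expresses
  the periodicity of \<open>e\<close>.
\<close>

definition zpair :: "real \<Rightarrow> (real \<times> real \<Rightarrow> real) \<Rightarrow> (real \<times> real \<Rightarrow> real) \<Rightarrow> bool" where
  "zpair T e k \<longleftrightarrow> e \<in> Borel \<and> k \<in> Borel \<and> sqi (MM T) e \<and> sqi (MM T) k \<and>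
     (AE t in tm T. (LINT z|cm. k (t, z)) = 0) \<and> (\<exists>c. AE x in MM T. e x = c (fst x) + zprim k x)"

lemma C1_primitive:
  fixes Y :: "real \<Rightarrow> real"
  assumes "\<And>z. (Y has_real_derivative Y' z) (at z)" "cper Y'" "periodic1 Y" "0 \<le> z" "z \<le> 1"
  shows "Y z = Y 0 + (LINT y|cm. indicator {..<z} y * Y' y)" "(LINT y|cm. Y' y) = 0"
proof -
  show "Y z = Y 0 + (LINT y|cm. indicator {..<z} y * Y' y)"
    unfolding cm_eq_tm using tm_FTC(2)[OF assms(1) cper_continuous[OF assms(2)] assms(4,5)] by simp
  have "(LINT y|tm 1. indicator {0<..} y * Y' y) = Y 1 - Y 0"
    by (rule tm_FTC(1)[OF assms(1) cper_continuous[OF assms(2)]]) auto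
  moreover have "Y 1 = Y 0" using assms(3)[unfolded periodic1_def, rule_format, of 0] by simp
  ultimately show "(LINT y|cm. Y' y) = 0"
    using tm_integral_drop[OF cper_borel[OF assms(2)], of 1] by (simp add: cm_eq_tm)
qed

definition prm :: "(real \<Rightarrow> real) \<Rightarrow> real \<Rightarrow> real" where
  "prm k z = (LINT y|cm. indicator {..<z} y * k y)"

lemma borel_prm: "integrable cm k \<Longrightarrow> prm k \<in> Borel"
  unfolding prm_def[abs_def] cm_eq_tm by (rule borel_primitive)

text \<open>The zero means say that both primitives return to their starting values after one
  period, so no boundary term remains and the constants \<open>c\<close> and \<open>c'\<close> drop
  out.\<close>

lemma slice_IBP:
  assumes b: "integrable cm b" "(LINT z|cm. b z) = 0" and k: "integrable cm k" "(LINT z|cm. k z) = 0"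
    and a: "a \<in> Borel" "AE z in cm. a z = c + prm b z" and e: "e \<in> Borel" "AE z in cm. e z = c' + prm k z"
  shows "(LINT z|cm. b z * e z) = - (LINT z|cm. a z * k z)"
proof -
  have bb: "b \<in> Borel" using borel_measurable_integrable[OF b(1)] by simp
  have kb: "k \<in> Borel" using borel_measurable_integrable[OF k(1)] by simp
  have 1: "(LINT z|cm. b z * e z) = (LINT z|cm. b z * (c' + prm k z))"
  proof (rule integral_cong_AE)
    show "AE z in cm. b z * e z = b z * (c' + prm k z)" using e(2) by eventually_elim simp
  qed (rule borel_cmI, intro borel_measurable_times bb e(1) borel_measurable_add borel_measurable_const borel_prm[OF k(1)])+
  have 2: "(LINT z|cm. a z * k z) = (LINT z|cm. (c + prm b z) * k z)"
  proof (rule integral_cong_AE)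
    show "AE z in cm. a z * k z = (c + prm b z) * k z" using a(2) by eventually_elim simp
  qed (rule borel_cmI, intro borel_measurable_times kb a(1) borel_measurable_add borel_measurable_const borel_prm[OF b(1)])+
  show ?thesis unfolding 1 2 unfolding prm_def cm_eq_tm
    by (rule prim_IBP) (use b k in \<open>simp_all add: cm_eq_tm[symmetric]\<close>)
qed

lemma zpair_slices:
  assumes "zpair T e k"
  shows "e \<in> Borel" "k \<in> Borel" "sqi (MM T) e" "sqi (MM T) k"
    "AE t in tm T. sqi cm (\<lambda>z. e (t, z)) \<and> sqi cm (\<lambda>z. k (t, z)) \<and> (LINT z|cm. k (t, z)) = 0 \<and>
       (\<exists>c. AE z in cm. e (t, z) = c + prm (\<lambda>z. k (t, z)) z)"
proof -
  show b: "e \<in> Borel" "k \<in> Borel" "sqi (MM T) e" "sqi (MM T) k"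
    using assms by (auto simp: zpair_def)
  obtain c where c: "AE x in MM T. e x = c (fst x) + zprim k x" using assms by (auto simp: zpair_def)
  have z: "AE t in tm T. (LINT z|cm. k (t, z)) = 0" using assms by (simp add: zpair_def)
  show "AE t in tm T. sqi cm (\<lambda>z. e (t, z)) \<and> sqi cm (\<lambda>z. k (t, z)) \<and> (LINT z|cm. k (t, z)) = 0 \<and>
       (\<exists>c. AE z in cm. e (t, z) = c + prm (\<lambda>z. k (t, z)) z)"
    using z AE_MM_D[OF c] sqi_MM_section'[OF b(3,1)] sqi_MM_section'[OF b(4,2)]
  proof eventually_elim
    case (elim t)
    have "AE z in cm. e (t, z) = c t + prm (\<lambda>z. k (t, z)) z"
      using elim(2) by eventually_elim (simp add: zprim_def prm_def)
    then show ?case using elim by blast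
  qed
qed

text \<open>Both partners are given by primitives only, so the identity is available for step
  functions, for weak limits and for all test functions of the weak formulation alike.\<close>

lemma zpair_IBP:
  assumes a: "zpair T a b" and e: "zpair T e k"
  shows "(LINT x|MM T. b x * e x) = - (LINT x|MM T. a x * k x)"
proof -
  note A = zpair_slices[OF a] and E = zpair_slices[OF e]
  have i1: "integrable (MM T) (\<lambda>x. b x * e x)" by (rule sqi_mult_integrable[OF A(4) E(3)])
  have i2: "integrable (MM T) (\<lambda>x. a x * k x)" by (rule sqi_mult_integrable[OF A(3) E(4)])
  have "(LINT t|tm T. LINT z|cm. b (t, z) * e (t, z)) = (LINT t|tm T. - (LINT z|cm. a (t, z) * k (t, z)))"
  proof (rule integral_cong_AE)
    show "AE t in tm T. (LINT z|cm. b (t, z) * e (t, z)) = - (LINT z|cm. a (t, z) * k (t, z))"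
      using A(5) E(5)
    proof eventually_elim
      case (elim t)
      obtain c c' where c: "AE z in cm. a (t, z) = c + prm (\<lambda>z. b (t, z)) z" "AE z in cm. e (t, z) = c' + prm (\<lambda>z. k (t, z)) z"
        using elim by blast
      show ?case
        by (rule slice_IBP[OF _ _ _ _ borel_pair_section[OF A(1)] c(1) borel_pair_section[OF E(1)] c(2)])
           (use elim cm.sqi_integrable in auto)
    qed
    show "(\<lambda>t. LINT z|cm. b (t, z) * e (t, z)) \<in> borel_measurable (tm T)"
      using borel_measurable_integrable[OF integrable_MM_fst[OF i1]] by simp
    show "(\<lambda>t. - (LINT z|cm. a (t, z) * k (t, z))) \<in> borel_measurable (tm T)"
      using borel_measurable_integrable[OF integrable_MM_fst[OF i2]] by simp
  qed
  then show ?thesis unfolding MM_integral[OF i1] MM_integral[OF i2] by simp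
qed

lemma zpair_lift:
  assumes tau: "0 < tau" and N: "real N * tau = T"
    and Y: "\<And>n z. (Y n has_real_derivative Y' n z) (at z)" and cY: "\<And>n. cper (Y n)" "\<And>n. cper (Y' n)"
  shows "zpair T (lift tau Y) (lift tau Y')"
proof -
  note C1 = C1_primitive[OF Y cY(2) cper_periodic[OF cY(1)]]
  have "AE x in MM T. lift tau Y x = Y (stp tau (fst x)) 0 + zprim (lift tau Y') x"
    using AE_MM_snd[OF AE_cm_range] by eventually_elim (simp add: lift_def zprim_def C1(1)[symmetric])
  then have "\<exists>c. AE x in MM T. lift tau Y x = c (fst x) + zprim (lift tau Y') x" by (rule exI[where x="\<lambda>t. Y (stp tau t) 0"])
  then show ?thesis unfolding zpair_def
    using lift_sqi(1)[OF tau N cY(1)] lift_sqi(1)[OF tau N cY(2)] borel_lift[OF cper_borel[OF cY(1)]] borel_lift[OF cper_borel[OF cY(2)]] C1(2)[of 0]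
    by (simp add: lift_def)
qed

lemma lift_IBP:
  assumes tau: "0 < tau" and N: "real N * tau = T"
    and Y: "\<And>n z. (Y n has_real_derivative Y' n z) (at z)" and cY: "\<And>n. cper (Y n)" "\<And>n. cper (Y' n)"
    and zp: "zpair T e k"
  shows "(LINT p|MM T. lift tau Y' p * e p) = - (LINT p|MM T. lift tau Y p * k p)"
  by (rule zpair_IBP[OF zpair_lift[OF tau N Y cY] zp])

section \<open>Linearity, contraction and accuracy of averages\<close>

lemma cper_tm_integrable:
  assumes "cper g" shows "integrable (tm d) (\<lambda>s. g (z + s))"
proof -
  obtain C where C: "\<forall>z. \<bar>g z\<bar> \<le> C" using cper_bounded[OF assms] by blast
  have "(\<lambda>s. g (z + s)) \<in> Borel"
    by (rule measurable_compose[OF _ cper_borel[OF assms]]) simp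
  then show ?thesis
    by (intro tm.integrable_const_bound[where B=C] borel_tmI) (use C in auto)
qed

lemma Av_diff: "cper f \<Longrightarrow> cper g \<Longrightarrow> Av d (\<lambda>z. f z - g z) = (\<lambda>z. Av d f z - Av d g z)"
  by (auto simp: Av_def fun_eq_iff cper_tm_integrable diff_divide_distrib)
lemma Av_add_scaled: "cper f \<Longrightarrow> cper g \<Longrightarrow> Av d (\<lambda>z. f z + c * g z) = (\<lambda>z. Av d f z + c * Av d g z)"
  by (auto simp: Av_def fun_eq_iff cper_tm_integrable add_divide_distrib)

lemma Av_ip_le: assumes "cper g" "0 < d" "d \<le> 1" shows "nsq (Av d g) \<le> nsq g"
  using Av_contract(2)[OF cper_pL2[OF assms(1)] assms(2,3)] by (simp add: ip_self)

lemma Am_eq_shift: "Am d g z = Av d (\<lambda>y. g (- y)) (- z)"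
  by (simp add: Am_def Av_def)

text \<open>By duality: the squared norm of \<open>Am g\<close> is the inner product of
  \<open>Av (Am g)\<close> with \<open>g\<close>, and \<open>Av\<close> is a contraction.\<close>

lemma Am_ip_le: assumes g: "cper g" and d: "0 < d" "d \<le> 1" shows "nsq (Am d g) \<le> nsq g"
proof -
  have "nsq (Am d g) = ip (Av d (Am d g)) g"
    using Av_adjoint[OF cper_pL2[OF cper_Am[OF g d(1)]] g d] by (simp add: ip_def)
  also have "\<dots> \<le> sqrt (nsq (Am d g) * nsq g)"
    using ip_CS[OF cper_Av[OF cper_Am[OF g d(1)] d(1)] g Av_ip_le[OF cper_Am[OF g d(1)] d] order_refl] by simp
  finally have 1: "nsq (Am d g) \<le> sqrt (nsq (Am d g) * nsq g)" .
  show ?thesis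
  proof (cases "nsq (Am d g) = 0")
    case True then show ?thesis using ip_nonneg[of g] by simp
  next
    case False
    then have pos: "0 < nsq (Am d g)" using ip_nonneg[of "Am d g"] by simp
    have "(nsq (Am d g))^2 \<le> (sqrt (nsq (Am d g) * nsq g))^2"
      using 1 ip_nonneg by (intro power_mono)
    then have "nsq (Am d g) * nsq (Am d g) \<le> nsq (Am d g) * nsq g"
      using ip_nonneg by (simp add: power2_eq_square)
    then show ?thesis using pos by simp
  qed
qed

text \<open>Cauchy-Schwarz is used twice, for the increment of \<open>H\<close> as an integral of
  \<open>g\<close> and for the average over the window. The right side is kept local to the window,
  so that integration over \<open>z\<close> supplies a second factor \<open>d\<close> in
  \<open>avg_diff\<close>.\<close>

lemma avg_diff_pointwise:
  assumes H: "\<And>z. (H has_real_derivative g z) (at z)" and cH: "cper H" and cg: "cper g" and d: "0 < d" "d \<le> 1"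
  shows "(H z - Av d H z)^2 \<le> d * (LINT y|tm d. (g (z + y))^2)"
proof -
  let ?Q = "LINT y|tm d. (g (z + y))^2"
  have s: "sqi (tm d) (\<lambda>y. g (z + y))" by (rule pL2_section(1)[OF cper_pL2[OF cg] d])
  have c: "continuous_on UNIV (\<lambda>s. g (z + s))"
    by (rule continuous_on_compose2[OF cper_continuous[OF cg]]) (auto intro: continuous_intros)
  have D: "((\<lambda>s. H (z + s)) has_real_derivative g (z + s)) (at s)" for s
  proof -
    have "((\<lambda>s. z + s) has_real_derivative 1) (at s)" by (auto intro!: derivative_eq_intros)
    from DERIV_chain2[OF H this] show ?thesis by simp
  qed
  have pt: "(H z - H (z + s))^2 \<le> d * ?Q" if "0 \<le> s" "s \<le> d" for s
  proof -
    have "(LINT y|tm d. indicator {..<s} y * g (z + y)) = H (z + s) - H (z + 0)" by (rule tm_FTC(2)[OF D c that])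
    then have "(H z - H (z + s))^2 = (LINT y|tm d. indicator {..<s} y * g (z + y))^2" by (simp add: power2_commute)
    also have "\<dots> \<le> d * ?Q" by (rule integral_tm_square_le'[OF d(1) s]) simp
    finally show ?thesis .
  qed
  have i: "integrable (tm d) (\<lambda>s. H (z + s))" by (rule cper_tm_integrable[OF cH])
  have sH: "sqi (tm d) (\<lambda>s. H z - H (z + s))"
    by (intro sqi_diff tm.sqi_const pL2_section(1)[OF cper_pL2[OF cH] d])
  have "H z - Av d H z = (LINT s|tm d. H z - H (z + s)) / d"
    using d i by (simp add: Av_def measure_tm diff_divide_distrib)
  then have "(H z - Av d H z)^2 = (LINT s|tm d. (H z - H (z + s)) * 1)^2 / d^2" by (simp add: power_divide)
  also have "\<dots> \<le> ((LINT s|tm d. (H z - H (z + s))^2) * (LINT s|tm d. 1^2)) / d^2"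
    by (intro divide_right_mono Cauchy_Schwarz_integral sH) auto
  also have "(LINT s|tm d. (1::real)^2) = d" using d by (simp add: measure_tm)
  also have "((LINT s|tm d. (H z - H (z + s))^2) * d) / d^2 \<le> (d * (d * ?Q) * d) / d^2"
  proof (intro divide_right_mono mult_right_mono)
    have "(LINT s|tm d. (H z - H (z + s))^2) \<le> (LINT s|tm d. d * ?Q)"
    proof (rule integral_mono_AE)
      show "AE s in tm d. (H z - H (z + s))^2 \<le> d * ?Q"
        using AE_tm_range by eventually_elim (use pt in auto)
    qed (use sH in auto)
    also have "\<dots> = d * (d * ?Q)" using d by (simp add: measure_tm)
    finally show "(LINT s|tm d. (H z - H (z + s))^2) \<le> d * (d * ?Q)" .
  qed (use d in auto)
  also have "\<dots> = d * ?Q" using d by (simp add: power2_eq_square)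
  finally show ?thesis .
qed

lemma avg_diff:
  assumes H: "\<And>z. (H has_real_derivative g z) (at z)" and cH: "cper H" and cg: "cper g" and d: "0 < d" "d \<le> 1"
  shows "nsq (\<lambda>z. H z - Av d H z) \<le> d^2 * nsq g"
proof -
  interpret Q: pair_sigma_finite cm "tm d" ..
  have i: "integrable cm (\<lambda>z. d * (LINT y|tm d. (g (z + y))^2))"
    using Q.integrable_fst'[OF pL2_shift_prod(1)[OF cper_pL2[OF cg], of d]] by simp
  have "(LINT z|cm. (H z - Av d H z)^2) \<le> (LINT z|cm. d * (LINT y|tm d. (g (z + y))^2))"
    by (rule integral_mono[OF cper_integrable[OF cper_power[OF cper_diff[OF cH cper_Av[OF cH d(1)]]]] i])
       (rule avg_diff_pointwise[OF H cH cg d])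
  also have "\<dots> = d * (d * (LINT z|cm. (g z)^2))"
    using d by (simp add: pL2_shift_prod(2)[OF cper_pL2[OF cg]] measure_tm)
  finally show ?thesis by (simp add: ip_self power2_eq_square mult.assoc)
qed

lemma avg2_diff:
  assumes H: "\<And>z. (H has_real_derivative g z) (at z)" and cH: "cper H" and cg: "cper g" and d: "0 < d" "d \<le> 1"
  shows "nsq (\<lambda>z. H z - Av d (Av d H) z) \<le> 4 * d^2 * nsq g"
proof -
  let ?A = "\<lambda>z. H z - Av d H z" and ?B = "\<lambda>z. Av d H z - Av d (Av d H) z"
  have cA: "cper ?A" by (rule cper_diff[OF cH cper_Av[OF cH d(1)]])
  have cB: "cper ?B" by (rule cper_diff[OF cper_Av[OF cH d(1)] cper_Av[OF cper_Av[OF cH d(1)] d(1)]])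
  have "?B = Av d ?A" by (rule Av_diff[OF cH cper_Av[OF cH d(1)], symmetric])
  then have "nsq ?B \<le> nsq ?A" using Av_ip_le[OF cA d] by simp
  moreover have "nsq ?A \<le> d^2 * nsq g" by (rule avg_diff[OF H cH cg d])
  moreover have "nsq (\<lambda>z. H z - Av d (Av d H) z) \<le> 2 * nsq ?A + 2 * nsq ?B"
    using ip_square_sum_le[OF cA cB] by simp
  moreover have "4 * d^2 * nsq g = 4 * (d^2 * nsq g)" by simp
  ultimately show ?thesis by linarith
qed

lemma Av_sup_le: assumes "cper h" "0 < d" "d \<le> 1" "nsq h \<le> a" shows "\<bar>Av d h z\<bar> \<le> sqrt (a / d)"
proof -
  have "(Av d h z)^2 \<le> nsq h / d" using Av_square_le(2)[OF cper_pL2[OF assms(1)] assms(2,3)] by (simp add: ip_self)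
  also have "\<dots> \<le> a / d" using assms by (simp add: divide_right_mono)
  finally show ?thesis by (metis real_sqrt_abs real_sqrt_le_iff)
qed

section \<open>Strong convergence\<close>

text \<open>Two averages have two tasks: one turns an \<open>L2\<close> bound into a uniform bound,
  the other turns a \<open>z\<close>-derivative into a difference quotient of fixed width.\<close>

definition mo :: "real \<Rightarrow> (real \<Rightarrow> real) \<Rightarrow> real \<Rightarrow> real" where "mo d H = Av d (Av d H)"

lemma cper_mo: "cper H \<Longrightarrow> 0 < d \<Longrightarrow> cper (mo d H)" unfolding mo_def by (intro cper_Av)

lemma mo_bound: assumes H: "cper H" and d: "0 < d" "d \<le> 1" and a: "nsq H \<le> a" shows "\<bar>mo d H z\<bar> \<le> sqrt (a / d)"
  unfolding mo_def by (rule Av_sup_le[OF cper_Av[OF H d(1)] d order_trans[OF Av_ip_le[OF H d] a]])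

lemma mo_Lipschitz:
  assumes H: "cper H" and d: "0 < d" "d \<le> 1" and a: "nsq H \<le> a"
  shows "\<bar>mo d H z - mo d H y\<bar> \<le> 2 * sqrt (a / d) / d * \<bar>z - y\<bar>"
proof -
  have D: "(mo d H has_real_derivative Dp d (Av d H) x) (at x within UNIV)" for x
    using Av_deriv(1)[OF cper_continuous[OF cper_Av[OF H d(1)]] d(1), of x] by (simp add: mo_def)
  have B: "norm (Dp d (Av d H) x) \<le> 2 * sqrt (a / d) / d" for x
  proof -
    have "\<bar>Av d H (x + d) - Av d H x\<bar> \<le> 2 * sqrt (a / d)"
      using Av_sup_le[OF H d a, of "x + d"] Av_sup_le[OF H d a, of x] by linarith
    then show ?thesis using d by (simp add: Dp_def divide_right_mono)
  qed
  show ?thesis using field_differentiable_bound[OF convex_UNIV D B, of z y] by simp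
qed

text \<open>The inner average removes the derivative from \<open>Y'\<close> and leaves
  \<open>Dp d Y\<close>. The factor \<open>4 / d^2\<close> is the cost of this quotient, the further
  \<open>1 / d\<close> that of the supremum.\<close>

lemma mo_deriv_bound:
  assumes Y: "\<And>z. (Y has_real_derivative Y' z) (at z)" and cY: "cper Y" and cY': "cper Y'" and d: "0 < d" "d \<le> 1"
  shows "\<bar>mo d Y' z\<bar> \<le> sqrt (4 / d ^ 3) * sqrt (nsq Y)"
proof -
  have "Av d Y' = Dp d Y" using Av_antideriv(1)[OF Y cper_continuous[OF cY'] d(1)] by (auto simp: Dp_def fun_eq_iff)
  then have "mo d Y' z = Av d (Dp d Y) z" by (simp add: mo_def)
  also have "\<bar>\<dots>\<bar> \<le> sqrt (4 / d^2 * nsq Y / d)" by (rule Av_sup_le[OF cper_Dp[OF cY] d ip_Dp_le[OF cY d(1)]])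
  also have "4 / d^2 * nsq Y / d = (4 / d ^ 3) * nsq Y" by (simp add: power2_eq_square power3_eq_cube)
  finally show ?thesis by (simp only: real_sqrt_mult)
qed

text \<open>
  The data of the compactness argument: \<open>g\<close> is the derivative of \<open>H\<close> in \<open>z\<close>, and the increments of \<open>H\<close> in
  time are derivatives of \<open>Y\<close>.
\<close>

definition cpt :: "real \<Rightarrow> real \<Rightarrow> real \<Rightarrow> nat \<Rightarrow> (nat \<Rightarrow> real \<Rightarrow> real) \<Rightarrow> (nat \<Rightarrow> real \<Rightarrow> real) \<Rightarrow>
    (nat \<Rightarrow> real \<Rightarrow> real) \<Rightarrow> (nat \<Rightarrow> real \<Rightarrow> real) \<Rightarrow> bool" where
  "cpt T C tau N H g Y Y' \<longleftrightarrow> 0 < tau \<and> real N * tau = T \<and>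
     (\<forall>n. cper (H n) \<and> cper (g n) \<and> cper (Y n) \<and> cper (Y' n)) \<and>
     (\<forall>n z. (H n has_real_derivative g n z) (at z)) \<and> (\<forall>n z. (Y n has_real_derivative Y' n z) (at z)) \<and>
     (\<forall>n z. H (Suc n) z = H n z + tau * Y' n z) \<and> (\<forall>n\<le>N. nsq (H n) \<le> C) \<and>
     tau * (\<Sum>n<N. nsq (g n)) \<le> C \<and> tau * (\<Sum>n<N. nsq (Y n)) \<le> C"

text \<open>Hoelder continuity in time with exponent 1/2: after smoothing, an increment is bounded
  by the norm of \<open>Y\<close>, and Cauchy-Schwarz over the steps turns the sum of these norms
  into the square root of the elapsed time.\<close>

lemma mo_time:
  assumes c: "cpt T C tau N H g Y Y'" and d: "0 < d" "d \<le> 1" and ab: "a \<le> b" "b \<le> N"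
  shows "\<bar>mo d (H b) z - mo d (H a) z\<bar> \<le> sqrt (4 / d ^ 3) * sqrt C * sqrt (real (b - a) * tau)"
proof -
  have tau: "0 < tau" and cp: "\<And>n. cper (H n)" "\<And>n. cper (Y n)" "\<And>n. cper (Y' n)"
    and DY: "\<And>n z. (Y n has_real_derivative Y' n z) (at z)"
    and st: "\<And>n z. H (Suc n) z = H n z + tau * Y' n z"
    and CY: "tau * (\<Sum>n<N. nsq (Y n)) \<le> C" using c by (auto simp: cpt_def)
  have step: "mo d (H (Suc n)) z = mo d (H n) z + tau * mo d (Y' n) z" for n
  proof -
    have e: "H (Suc n) = (\<lambda>z. H n z + tau * Y' n z)" by (simp add: fun_eq_iff st)
    show ?thesis unfolding mo_def e Av_add_scaled[OF cp(1) cp(3)]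
      by (simp add: Av_add_scaled[OF cper_Av[OF cp(1) d(1)] cper_Av[OF cp(3) d(1)]])
  qed
  have tel: "mo d (H (a + n)) z - mo d (H a) z = tau * (\<Sum>i<n. mo d (Y' (a + i)) z)" for n
    by (induction n) (auto simp: step algebra_simps)
  define n where "n = b - a"
  have b: "b = a + n" using ab by (simp add: n_def)
  let ?K = "sqrt (4 / d ^ 3)"
  have "\<bar>\<Sum>i<n. mo d (Y' (a + i)) z\<bar> \<le> (\<Sum>i<n. ?K * sqrt (nsq (Y (a + i))))"
    by (rule order_trans[OF sum_abs sum_mono]) (rule mo_deriv_bound[OF DY cp(2) cp(3) d])
  also have "\<dots> = ?K * (\<Sum>i<n. sqrt (nsq (Y (a + i))))" by (rule sum_distrib_left[symmetric])
  finally have 1: "\<bar>\<Sum>i<n. mo d (Y' (a + i)) z\<bar> \<le> ?K * (\<Sum>i<n. sqrt (nsq (Y (a + i))))" .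
  have 2: "(tau * (\<Sum>i<n. sqrt (nsq (Y (a + i)))))^2 \<le> C * (real n * tau)"
  proof -
    have "(\<Sum>i<n. sqrt (nsq (Y (a + i))))^2 \<le> (\<Sum>i<n. (sqrt (nsq (Y (a + i))))^2) * card {..<n}"
      by (rule sum_squared_le_sum_of_squares)
    also have "(\<Sum>i<n. (sqrt (nsq (Y (a + i))))^2) = (\<Sum>i<n. nsq (Y (a + i)))"
      by (simp add: ip_nonneg)
    also have "\<dots> = (\<Sum>i\<in>{a..<a + n}. nsq (Y i))"
      using sum.shift_bounds_nat_ivl[of "\<lambda>i. nsq (Y i)" 0 a n] by (simp add: atLeast0LessThan add.commute)
    also have "(\<Sum>i\<in>{a..<a + n}. nsq (Y i)) * card {..<n} \<le> (\<Sum>i<N. nsq (Y i)) * card {..<n}"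
      by (intro mult_right_mono sum_mono2) (use ab b in \<open>auto simp: ip_nonneg\<close>)
    finally have "(\<Sum>i<n. sqrt (nsq (Y (a + i))))^2 \<le> (\<Sum>i<N. nsq (Y i)) * real n" by simp
    then have "tau^2 * (\<Sum>i<n. sqrt (nsq (Y (a + i))))^2 \<le> tau^2 * ((\<Sum>i<N. nsq (Y i)) * real n)"
      by (rule mult_left_mono) simp
    also have "\<dots> = (tau * (\<Sum>i<N. nsq (Y i))) * (real n * tau)" by (simp add: power2_eq_square)
    also have "\<dots> \<le> C * (real n * tau)" using CY tau by (intro mult_right_mono) auto
    finally show ?thesis by (simp add: power_mult_distrib)
  qed
  have "tau * (\<Sum>i<n. sqrt (nsq (Y (a + i)))) \<le> sqrt (C * (real n * tau))"
    by (rule real_le_rsqrt[OF 2])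
  then have 3: "tau * (\<Sum>i<n. sqrt (nsq (Y (a + i)))) \<le> sqrt C * sqrt (real n * tau)" by (simp only: real_sqrt_mult)
  have "\<bar>mo d (H b) z - mo d (H a) z\<bar> = tau * \<bar>\<Sum>i<n. mo d (Y' (a + i)) z\<bar>" unfolding b tel using tau by (simp add: abs_mult)
  also have "\<dots> \<le> tau * (?K * (\<Sum>i<n. sqrt (nsq (Y (a + i)))))" using 1 tau by (intro mult_left_mono) auto
  also have "\<dots> = ?K * (tau * (\<Sum>i<n. sqrt (nsq (Y (a + i)))))" by simp
  also have "\<dots> \<le> ?K * (sqrt C * sqrt (real n * tau))" using 3 d by (intro mult_left_mono) auto
  finally show ?thesis by (simp add: n_def mult.assoc)
qed

text \<open>The step indices of \<open>t\<close> and \<open>s\<close> differ by at most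
  \<open>|t - s| / tau + 1\<close>. Hence the summand \<open>tau\<close> under the root: step
  functions are equicontinuous only up to one step.\<close>

lemma mo_equicontinuous:
  assumes c: "cpt T C tau N H g Y Y'" and d: "0 < d" "d \<le> 1"
    and t: "0 \<le> t" "t \<le> T" and s: "0 \<le> s" "s \<le> T"
  shows "\<bar>lift tau (\<lambda>n. mo d (H n)) (t, z) - lift tau (\<lambda>n. mo d (H n)) (s, y)\<bar>
    \<le> sqrt (4 / d ^ 3) * sqrt C * sqrt (\<bar>t - s\<bar> + tau) + 2 * sqrt (C / d) / d * \<bar>z - y\<bar>"
proof -
  have tau: "0 < tau" and N: "real N * tau = T" and cp: "\<And>n. cper (H n)" and CH: "\<And>n. n \<le> N \<Longrightarrow> nsq (H n) \<le> C"
    using c by (auto simp: cpt_def)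
  have C0: "0 \<le> C" using CH[of 0] ip_nonneg[of "H 0"] by simp
  let ?a = "stp tau t" and ?b = "stp tau s"
  have n: "?a \<le> N" "?b \<le> N" using stp_le[OF tau N t] stp_le[OF tau N s] by auto
  have K0: "0 \<le> sqrt (4 / d ^ 3) * sqrt C" using d C0 by simp
  \<comment> \<open>Truncated subtraction makes the left side 0 if the indices come in the other
    order, so one claim serves both cases below.\<close>
  have gap: "real (b' - a') * tau \<le> \<bar>t - s\<bar> + tau"
    if "(a' = ?a \<and> b' = ?b) \<or> (a' = ?b \<and> b' = ?a)" for a' b' :: nat
  proof (cases "a' \<le> b'")
    case True
    then have "real (b' - a') * tau = real b' * tau - real a' * tau" by (simp add: left_diff_distrib of_nat_diff)
    then show ?thesis
      using that stp_bounds[OF tau t(1)] stp_bounds[OF tau s(1)] by (auto simp: distrib_right)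
  next
    case False then show ?thesis using tau by simp
  qed
  have 1: "\<bar>mo d (H ?a) z - mo d (H ?b) z\<bar> \<le> sqrt (4 / d ^ 3) * sqrt C * sqrt (\<bar>t - s\<bar> + tau)"
  proof (cases "?a \<le> ?b")
    case True
    have "\<bar>mo d (H ?b) z - mo d (H ?a) z\<bar> \<le> sqrt (4 / d ^ 3) * sqrt C * sqrt (real (?b - ?a) * tau)"
      by (rule mo_time[OF c d True n(2)])
    also have "\<dots> \<le> sqrt (4 / d ^ 3) * sqrt C * sqrt (\<bar>t - s\<bar> + tau)"
      by (intro mult_left_mono real_sqrt_le_mono gap K0) simp
    finally show ?thesis by (simp add: abs_minus_commute)
  next
    case False
    then have "?b \<le> ?a" by simp
    have "\<bar>mo d (H ?a) z - mo d (H ?b) z\<bar> \<le> sqrt (4 / d ^ 3) * sqrt C * sqrt (real (?a - ?b) * tau)"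
      by (rule mo_time[OF c d \<open>?b \<le> ?a\<close> n(1)])
    also have "\<dots> \<le> sqrt (4 / d ^ 3) * sqrt C * sqrt (\<bar>t - s\<bar> + tau)"
      by (intro mult_left_mono real_sqrt_le_mono gap K0) simp
    finally show ?thesis .
  qed
  have 2: "\<bar>mo d (H ?b) z - mo d (H ?b) y\<bar> \<le> 2 * sqrt (C / d) / d * \<bar>z - y\<bar>"
    by (rule mo_Lipschitz[OF cp d CH[OF n(2)]])
  show ?thesis using 1 2 unfolding lift_def by simp
qed

text \<open>The theorem of Arzela and Ascoli along an ultrafilter: the values converge at the
  finitely many points of a net, and the modulus controls the remaining points. The functions may
  jump by an amount governed by \<open>tau k\<close>, so the estimate is made for those
  \<open>k\<close> whose \<open>tau k\<close> is below the mesh of the net; this is part of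
  \<open>E\<close>.\<close>

lemma ultra_uniform_Cauchy:
  fixes w :: "nat \<Rightarrow> real \<times> real \<Rightarrow> real"
  assumes F: "ultra F" and S: "compact S" and bd: "\<And>k x. x \<in> S \<Longrightarrow> \<bar>w k x\<bar> \<le> C"
    and eq: "\<And>k x y. x \<in> S \<Longrightarrow> y \<in> S \<Longrightarrow> \<bar>w k x - w k y\<bar> \<le> K * sqrt (\<bar>fst x - fst y\<bar> + tau k) + L * \<bar>snd x - snd y\<bar>"
    and tau: "tau \<longlonglongrightarrow> 0" and K: "0 \<le> K" "0 \<le> L" and e: "0 < e"
  shows "\<exists>E. eventually E F \<and> (\<forall>k m. E k \<longrightarrow> E m \<longrightarrow> (\<forall>x\<in>S. \<bar>w k x - w m x\<bar> \<le> e))"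
proof -
  \<comment> \<open>Four errors of this size add up: from \<open>x\<close> to the net point for each
    of the two functions, and from each value there to the limit.\<close>
  define e4 where "e4 = e * inverse 4"
  have e4: "0 < e4" "4 * e4 = e" using e by (auto simp: e4_def)
  have "((\<lambda>\<theta>. K * sqrt (\<theta> + \<theta>) + L * \<theta>) \<longlongrightarrow> K * sqrt (0 + 0) + L * 0) (at_right 0)"
    by (intro tendsto_intros)
  then have "\<forall>\<^sub>F \<theta> in at_right 0. K * sqrt (\<theta> + \<theta>) + L * \<theta> < e4" by (rule order_tendstoD(2)) (use e4 in simp)
  moreover have "\<forall>\<^sub>F \<theta> in at_right 0. (0::real) < \<theta>" by (simp add: eventually_at_right_less)
  ultimately have "\<forall>\<^sub>F \<theta> in at_right 0. 0 < \<theta> \<and> K * sqrt (\<theta> + \<theta>) + L * \<theta> < e4" by eventually_elim simp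
  from eventually_happens'[OF trivial_limit_at_right_real this]
  obtain \<theta> where \<theta>: "0 < \<theta>" "K * sqrt (\<theta> + \<theta>) + L * \<theta> < e4" by blast
  obtain P where P: "finite P" "P \<subseteq> S" "S \<subseteq> (\<Union>x\<in>P. ball x \<theta>)"
  proof -
    have "seq_compact S" using S by (simp add: compact_eq_seq_compact_metric)
    from seq_compact_imp_totally_bounded[OF this] \<theta>(1)
    have "\<exists>P. finite P \<and> P \<subseteq> S \<and> S \<subseteq> (\<Union>x\<in>P. ball x \<theta>)" by simp
    then show ?thesis using that by (elim exE conjE)
  qed
  have "\<exists>l. ((\<lambda>k. w k x) \<longlongrightarrow> l) F" if "x \<in> P" for x
    by (rule ultra_convergent[OF F, of "\<lambda>k. w k x" C]) (rule bd[OF subsetD[OF P(2) that]])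
  then have "\<forall>x\<in>P. \<exists>l. ((\<lambda>k. w k x) \<longlongrightarrow> l) F" by simp
  from bchoice[OF this] obtain l where l: "\<And>x. x \<in> P \<Longrightarrow> ((\<lambda>k. w k x) \<longlongrightarrow> l x) F" by auto
  define E where "E k \<longleftrightarrow> tau k < \<theta> \<and> (\<forall>x\<in>P. \<bar>w k x - l x\<bar> < e4)" for k
  have "eventually (\<lambda>k. tau k < \<theta>) F"
    using order_tendstoD(2)[OF ultra_tendsto[OF F tau] \<theta>(1)] .
  moreover have "eventually (\<lambda>k. \<forall>x\<in>P. \<bar>w k x - l x\<bar> < e4) F"
  proof (rule eventually_ball_finite[OF P(1)], rule ballI)
    fix x assume "x \<in> P"
    from tendstoD[OF l[OF this] e4(1)] show "eventually (\<lambda>k. \<bar>w k x - l x\<bar> < e4) F" by (simp add: dist_real_def)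
  qed
  ultimately have ev: "eventually E F" unfolding E_def by (rule eventually_conj)
  have near: "\<bar>w k x - w k q\<bar> \<le> e4" if "E k" "x \<in> S" "q \<in> P" "dist q x < \<theta>" for k x q
  proof -
    have d1: "\<bar>fst x - fst q\<bar> \<le> \<theta>" "\<bar>snd x - snd q\<bar> \<le> \<theta>"
      using that(4) dist_fst_le[of q x] dist_snd_le[of q x] by (auto simp: dist_real_def abs_minus_commute)
    have "\<bar>w k x - w k q\<bar> \<le> K * sqrt (\<bar>fst x - fst q\<bar> + tau k) + L * \<bar>snd x - snd q\<bar>"
      using eq that(2) subsetD[OF P(2) that(3)] by blast
    also have "\<dots> \<le> K * sqrt (\<theta> + \<theta>) + L * \<theta>"
      using d1 that(1) K by (intro add_mono mult_left_mono real_sqrt_le_mono) (auto simp: E_def)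
    finally show ?thesis using \<theta>(2) by simp
  qed
  have "\<bar>w k x - w m x\<bar> \<le> e" if EE: "E k" "E m" and xS: "x \<in> S" for k m x
  proof -
    obtain q where q: "q \<in> P" "dist q x < \<theta>" using P(3) xS by auto
    have "\<bar>w k q - l q\<bar> < e4" "\<bar>w m q - l q\<bar> < e4" using EE q by (auto simp: E_def)
    then show ?thesis
      using near[OF EE(1) xS q] near[OF EE(2) xS q] e4(2) unfolding abs_le_iff abs_less_iff by argo
  qed
  with ev show ?thesis by blast
qed

lemma lift_diff: "lift tau (\<lambda>n z. x n z - y n z) p = lift tau x p - lift tau y p" by (simp add: lift_def)

text \<open>Here \<open>q\<close> is \<open>d^2 C\<close>; the inequality for the square of a sum,
  applied twice, leads to \<open>24 q + e / 2\<close>.\<close>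

lemma three_term_bound:
  fixes a q x e :: real
  assumes "a \<le> 2 * (4 * q) + 2 * (2 * (e * inverse 8) + 2 * (4 * q))" "24 * q < e * inverse 2"
  shows "a \<le> e"
  using assms by (simp add: field_simps)

text \<open>Compactness in the manner of Aubin and Lions. Smoothing with a fixed width changes each
  function by at most \<open>4 d^2 C\<close> in squared norm, uniformly in \<open>k\<close>, and the
  smoothed functions are uniformly Cauchy; hence the sequence is Cauchy in \<open>L2\<close> along
  \<open>F\<close>. A Cauchy family with a weak limit converges to it strongly.\<close>

theorem strong_convergence:
  fixes H :: "nat \<Rightarrow> nat \<Rightarrow> real \<Rightarrow> real"
  assumes F: "ultra F" and T: "0 < T" and c: "\<And>k. cpt T C (tau k) (N k) (H k) (g k) (Y k) (Y' k)" and tau0: "tau \<longlonglongrightarrow> 0"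
    and w: "wconv F (MM T) (\<lambda>k. lift (tau k) (H k)) h"
  shows "((\<lambda>k. LINT p|MM T. (lift (tau k) (H k) p - h p)^2) \<longlongrightarrow> 0) F"
proof -
  have tau: "\<And>k. 0 < tau k" and N: "\<And>k. real (N k) * tau k = T" and cp: "\<And>k n. cper (H k n)" "\<And>k n. cper (g k n)"
    and CH: "\<And>k n. n \<le> N k \<Longrightarrow> nsq (H k n) \<le> C" and Cg: "\<And>k. tau k * (\<Sum>n<N k. nsq (g k n)) \<le> C"
    and DH: "\<And>k n z. (H k n has_real_derivative g k n z) (at z)"
    using c by (auto simp: cpt_def)
  have C0: "0 \<le> C" using CH[of 0 0] ip_nonneg[of "H 0 0"] by simp
  have sL: "sqi (MM T) (lift (tau k) (H k))" for k by (rule lift_sqi(1)[OF tau[of k] N[of k], of "H k", OF cp(1)])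
  have h: "sqi (MM T) h" using w by (simp add: wconv_def)
  have key: "\<exists>E. eventually E F \<and> (\<forall>k m. E k \<longrightarrow> E m \<longrightarrow> (LINT p|MM T. (lift (tau k) (H k) p - lift (tau m) (H m) p)^2) \<le> e)"
    if e: "0 < e" for e
  proof -
    \<comment> \<open>The two smoothing errors enter with total weight \<open>24 d^2 C\<close>, so
      the width \<open>d\<close> is chosen to bring this below \<open>e / 2\<close>.\<close>
    have "((\<lambda>d. 24 * d^2 * C) \<longlongrightarrow> 24 * 0^2 * C) (at_right 0)" by (intro tendsto_intros)
    then have "\<forall>\<^sub>F d in at_right 0. 24 * d^2 * C < e * inverse 2" by (rule order_tendstoD(2)) (use e in simp)
    moreover have "\<forall>\<^sub>F d in at_right 0. (0::real) < d" by (simp add: eventually_at_right_less)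
    moreover have "\<forall>\<^sub>F d in at_right 0. (d::real) < 1" by (rule order_tendstoD(2)[OF tendsto_ident_at]) simp
    ultimately have "\<forall>\<^sub>F d in at_right 0. (0::real) < d \<and> d < 1 \<and> 24 * d^2 * C < e * inverse 2" by eventually_elim simp
    from eventually_happens'[OF trivial_limit_at_right_real this]
    obtain d where d: "0 < d" "d < 1" and dC: "24 * d^2 * C < e * inverse 2" by blast
    have d1: "d \<le> 1" using d by simp
    \<comment> \<open>With this tolerance the squared norm of the difference of the smoothed
      functions is at most \<open>T r^2 = e / 8\<close>.\<close>
    define r where "r = sqrt (e * inverse 8 / T)"
    have r: "0 < r" "r^2 = e * inverse 8 / T" using e T by (auto simp: r_def)
    define m where "m k n = mo d (H k n)" for k n
    have cm: "cper (m k n)" for k n unfolding m_def by (rule cper_mo[OF cp(1) d(1)])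
    have sm: "sqi (MM T) (lift (tau k) (m k))" for k by (rule lift_sqi(1)[OF tau[of k] N[of k], of "m k", OF cm])
    have K0: "0 \<le> sqrt (4 / d ^ 3) * sqrt C" "0 \<le> 2 * sqrt (C / d) / d" using d C0 by auto
    have bd: "\<bar>lift (tau k) (m k) x\<bar> \<le> sqrt (C / d)" if "x \<in> {0..T} \<times> {0..1}" for k x
      unfolding lift_def m_def
      by (rule mo_bound[OF cp(1) d(1) d1 CH[OF stp_le[OF tau N]]]) (use that in auto)
    have eqc: "\<bar>lift (tau k) (m k) x - lift (tau k) (m k) y\<bar>
        \<le> (sqrt (4 / d ^ 3) * sqrt C) * sqrt (\<bar>fst x - fst y\<bar> + tau k) + (2 * sqrt (C / d) / d) * \<bar>snd x - snd y\<bar>"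
      if "x \<in> {0..T} \<times> {0..1}" "y \<in> {0..T} \<times> {0..1}" for k x y
      using mo_equicontinuous[OF c[of k] d(1) d1, of "fst x" "fst y" "snd x" "snd y"] that
      unfolding m_def by auto
    obtain E where E: "eventually E F" and Eb: "\<And>k l x. E k \<Longrightarrow> E l \<Longrightarrow> x \<in> {0..T} \<times> {0..1} \<Longrightarrow> \<bar>lift (tau k) (m k) x - lift (tau l) (m l) x\<bar> \<le> r"
      using ultra_uniform_Cauchy[OF F compact_Times[OF compact_Icc compact_Icc] bd eqc tau0 K0 r(1)] by blast
    have dm: "(LINT p|MM T. (lift (tau k) (H k) p - lift (tau k) (m k) p)^2) \<le> 4 * d^2 * C" for k
    proof -
      have cx: "cper (\<lambda>z. H k n z - m k n z)" for n by (rule cper_diff[OF cp(1) cm])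
      have "(LINT p|MM T. (lift (tau k) (H k) p - lift (tau k) (m k) p)^2)
        = tau k * (\<Sum>n<N k. nsq (\<lambda>z. H k n z - m k n z))"
        using lift_sqi(2)[OF tau[of k] N[of k], of "\<lambda>n z. H k n z - m k n z", OF cx] by (simp add: lift_diff)
      also have "\<dots> \<le> tau k * (\<Sum>n<N k. 4 * d^2 * nsq (g k n))"
        using tau[of k] unfolding m_def mo_def
        by (intro mult_left_mono sum_mono avg2_diff[OF DH cp(1) cp(2) d(1) d1]) auto
      also have "\<dots> = 4 * d^2 * (tau k * (\<Sum>n<N k. nsq (g k n)))" by (simp add: sum_distrib_left mult.left_commute)
      also have "\<dots> \<le> 4 * d^2 * C" by (rule mult_left_mono[OF Cg]) simp
      finally show ?thesis .
    qed
    have "(LINT p|MM T. (lift (tau k) (H k) p - lift (tau l) (H l) p)^2) \<le> e" if "E k" "E l" for k l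
    proof -
      let ?a = "\<lambda>p. lift (tau k) (H k) p - lift (tau k) (m k) p"
      let ?b = "\<lambda>p. lift (tau k) (m k) p - lift (tau l) (m l) p"
      let ?c = "\<lambda>p. lift (tau l) (m l) p - lift (tau l) (H l) p"
      have sa: "sqi (MM T) ?a" and sb: "sqi (MM T) ?b" and sc: "sqi (MM T) ?c" by (intro sqi_diff sL sm)+
      have b: "(LINT p|MM T. (?b p)^2) \<le> T * r^2"
      proof -
        have "(LINT p|MM T. (?b p)^2) \<le> (LINT p|MM T. r^2)"
        proof (rule integral_mono_AE)
          show "integrable (MM T) (\<lambda>p. (?b p)^2)" by (rule sqiD(2)[OF sb])
          show "AE p in MM T. (?b p)^2 \<le> r^2"
            using AE_MM_fst[OF AE_tm_range] AE_MM_snd[OF AE_cm_range]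
          proof eventually_elim
            case (elim p)
            then have "p \<in> {0..T} \<times> {0..1}" by (cases p) auto
            from Eb[OF that this] have "\<bar>?b p\<bar> \<le> r" .
            then show ?case by (metis abs_ge_zero power2_abs power_mono)
          qed
        qed simp
        also have "\<dots> = T * r^2"
        proof -
          have "(LINT p|MM T. r^2) = (LINT t|tm T. LINT z|cm. r^2)" by (rule MM_integral) simp
          then show ?thesis using T by (simp add: measure_tm)
        qed
        finally show ?thesis .
      qed
      have c': "(LINT p|MM T. (?c p)^2) \<le> 4 * d^2 * C" using dm[of l] by (simp add: power2_commute)
      have A1: "(LINT p|MM T. (?a p + (?b p + ?c p))^2) \<le> 2 * (LINT p|MM T. (?a p)^2) + 2 * (LINT p|MM T. (?b p + ?c p)^2)"
        by (rule integral_square_sum_le[OF sa sqi_add[OF sb sc]])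
      have A2: "(LINT p|MM T. (?b p + ?c p)^2) \<le> 2 * (LINT p|MM T. (?b p)^2) + 2 * (LINT p|MM T. (?c p)^2)"
        by (rule integral_square_sum_le[OF sb sc])
      have 1: "(LINT p|MM T. (?a p + (?b p + ?c p))^2) \<le> 2 * (4 * d^2 * C) + 2 * (2 * (T * r^2) + 2 * (4 * d^2 * C))"
        using A1 A2 dm[of k] b c' by argo
      have Tr: "T * r^2 = e * inverse 8" using T unfolding r(2) by simp
      define q where "q = d^2 * C"
      have q4: "4 * d^2 * C = 4 * q" "24 * d^2 * C = 24 * q" by (simp_all add: q_def)
      have "(LINT p|MM T. (?a p + (?b p + ?c p))^2) \<le> e"
      proof -
        from three_term_bound[OF 1[unfolded Tr q4] dC[unfolded q4]] show ?thesis by simp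
      qed
      then show ?thesis by simp
    qed
    with E show ?thesis by blast
  qed
  show ?thesis
  proof (rule tendstoI)
    fix e :: real assume e: "0 < e"
    obtain E where E: "eventually E F" and Eb: "\<And>k l. E k \<Longrightarrow> E l \<Longrightarrow> (LINT p|MM T. (lift (tau k) (H k) p - lift (tau l) (H l) p)^2) \<le> e * inverse 2"
      using key[of "e * inverse 2"] e by auto
    have "(LINT p|MM T. (lift (tau k) (H k) p - h p)^2) \<le> e * inverse 2" if k: "E k" for k
    proof -
      let ?d = "\<lambda>p. lift (tau k) (H k) p - h p"
      let ?I = "LINT p|MM T. (?d p)^2"
      have sd: "sqi (MM T) ?d" by (rule sqi_diff[OF sL h])
      \<comment> \<open>\<open>k\<close> is fixed and \<open>l\<close> runs along \<open>F\<close>: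
        weak convergence turns the inner product into the squared distance \<open>?I\<close> to
        \<open>h\<close>, whereas Cauchy-Schwarz bounds it by the geometric mean of
        \<open>e / 2\<close> and \<open>?I\<close>.\<close>
      have "((\<lambda>l. (LINT p|MM T. lift (tau k) (H k) p * ?d p) - (LINT p|MM T. lift (tau l) (H l) p * ?d p))
         \<longlongrightarrow> (LINT p|MM T. lift (tau k) (H k) p * ?d p) - (LINT p|MM T. h p * ?d p)) F"
        using w sd unfolding wconv_def by (intro tendsto_diff tendsto_const) blast
      moreover have "(LINT p|MM T. lift (tau k) (H k) p * ?d p) - (LINT p|MM T. h p * ?d p) = ?I"
      proof -
        have "?I = (LINT p|MM T. lift (tau k) (H k) p * ?d p - h p * ?d p)"
          by (rule Bochner_Integration.integral_cong) (auto simp: power2_eq_square algebra_simps)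
        then show ?thesis using sqi_mult_integrable[OF sL sd] sqi_mult_integrable[OF h sd] by simp
      qed
      ultimately have lim: "((\<lambda>l. (LINT p|MM T. lift (tau k) (H k) p * ?d p) - (LINT p|MM T. lift (tau l) (H l) p * ?d p)) \<longlongrightarrow> ?I) F" by simp
      have ub: "(LINT p|MM T. lift (tau k) (H k) p * ?d p) - (LINT p|MM T. lift (tau l) (H l) p * ?d p) \<le> sqrt (e * inverse 2 * ?I)" if l: "E l" for l
      proof -
        have "(LINT p|MM T. lift (tau k) (H k) p * ?d p) - (LINT p|MM T. lift (tau l) (H l) p * ?d p)
          = (LINT p|MM T. (lift (tau k) (H k) p - lift (tau l) (H l) p) * ?d p)"
          unfolding left_diff_distrib[of "lift (tau k) (H k) _" "lift (tau l) (H l) _"]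
          by (rule Bochner_Integration.integral_diff[symmetric]; rule sqi_mult_integrable[OF sL sd])
        also have "\<dots> \<le> sqrt (e * inverse 2 * ?I)"
          using Cauchy_Schwarz_abs[OF sqi_diff[OF sL sL] sd Eb[OF k l] order_refl] by linarith
        finally show ?thesis .
      qed
      have "?I \<le> sqrt (e * inverse 2 * ?I)"
        by (rule tendsto_upperbound[OF lim eventually_mono[OF E ub] ultra_not_bot[OF F]])
      moreover have "0 \<le> ?I" by simp
      ultimately have "?I^2 \<le> (sqrt (e * inverse 2 * ?I))^2" by (intro power_mono)
      then have "?I * ?I \<le> e * inverse 2 * ?I" using e by (simp add: power2_eq_square)
      then show ?thesis using \<open>0 \<le> ?I\<close> e by (cases "?I = 0") auto
    qed
    note half = this
    have e2: "e * inverse 2 < e" using e by simp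
    have "\<bar>LINT p|MM T. (lift (tau k) (H k) p - h p)^2\<bar> < e" if k: "E k" for k
      by (subst abs_of_nonneg[OF Bochner_Integration.integral_nonneg[OF zero_le_power2]]) (rule le_less_trans[OF half[OF k] e2])
    then show "\<forall>\<^sub>F k in F. dist (LINT p|MM T. (lift (tau k) (H k) p - h p)^2) 0 < e"
      by (intro eventually_mono[OF E]) (simp add: dist_real_def)
  qed
qed

section \<open>Weak convergence of products, coefficients and averages\<close>

definition ttest :: "(real \<Rightarrow> real) \<Rightarrow> (real \<Rightarrow> real) \<Rightarrow> real \<times> real \<Rightarrow> real" where
  "ttest f g x = f (fst x) * g (snd x)"

lemma ttest_bounded:
  assumes "tbump T f" "cbump g"
  shows "\<exists>B. \<forall>x. \<bar>ttest f g x\<bar> \<le> B"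
proof -
  obtain C where C: "\<forall>t. \<bar>f t\<bar> \<le> C" using tbump_bounded[OF assms(1)] by blast
  obtain D where D: "\<forall>z. \<bar>g z\<bar> \<le> D" using cbump_bdd[OF assms(2)] by blast
  have "\<bar>ttest f g x\<bar> \<le> C * D" for x
    unfolding ttest_def abs_mult using C D order_trans[OF abs_ge_zero, of "f (fst x)" C]
    by (intro mult_mono) (auto intro: order_trans[OF abs_ge_zero])
  then show ?thesis by blast
qed

lemma borel_ttest: assumes "tbump T f" "cbump g" shows "ttest f g \<in> Borel"
  unfolding ttest_def[abs_def]
  by (intro borel_measurable_times measurable_compose[OF borel_fst_snd(1) tbump_borel[OF assms(1)]]
      measurable_compose[OF borel_fst_snd(2) cbump_borel[OF assms(2)]])

lemma sqi_of_bounded: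
  assumes "b \<in> Borel" "\<And>x. \<bar>b x\<bar> \<le> (B::real)" shows "sqi (MM T) b"
  by (rule MMf.sqi_bounded[OF borel_MMI[OF assms(1)] AE_I2[OF assms(2)]])

lemma sqi_ttest: assumes "tbump T f" "cbump g" shows "sqi (MM S) (ttest f g)"
proof -
  obtain B where "\<forall>x. \<bar>ttest f g x\<bar> \<le> B" using ttest_bounded[OF assms] by blast
  then show ?thesis using sqi_of_bounded[OF borel_ttest[OF assms], of B] by blast
qed

lemma sqi_MM_borel: "sqi (MM T) w \<Longrightarrow> w \<in> Borel"
  using sqiD(1)[of "MM T" w] by (simp add: measurable_cong_sets[OF sets_MM refl])

lemma wconvD: "wconv F M x X \<Longrightarrow> sqi M \<phi> \<Longrightarrow> ((\<lambda>k. LINT z|M. x k z * \<phi> z) \<longlongrightarrow> (LINT z|M. X z * \<phi> z)) F"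
  by (simp add: wconv_def)
lemma wconv_sqi: "wconv F M x X \<Longrightarrow> sqi M X" by (simp add: wconv_def)

lemma wconv_cong_AE:
  assumes w: "wconv F (MM T) x X" and Y: "Y \<in> Borel" "AE z in MM T. X z = Y z"
  shows "wconv F (MM T) x Y"
proof -
  have X: "sqi (MM T) X" by (rule wconv_sqi[OF w])
  have s: "sqi (MM T) Y" by (rule sqi_cong_AE[OF X borel_MMI[OF Y(1)] Y(2)])
  have "(LINT z|MM T. X z * \<phi> z) = (LINT z|MM T. Y z * \<phi> z)" if "sqi (MM T) \<phi>" for \<phi>
  proof (rule integral_cong_AE)
    show "(\<lambda>z. X z * \<phi> z) \<in> borel_measurable (MM T)" "(\<lambda>z. Y z * \<phi> z) \<in> borel_measurable (MM T)"
      using X s that by (auto simp: sqi_def)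
    show "AE z in MM T. X z * \<phi> z = Y z * \<phi> z" using Y(2) by eventually_elim simp
  qed
  then show ?thesis using w s unfolding wconv_def by simp
qed

text \<open>Boundedness provides some weak limit, and the tests identify it with \<open>X\<close> by
  the fundamental lemma. Convergence on smooth tensor products thus suffices, and square
  integrability of \<open>X\<close> is obtained on the way.\<close>

theorem wconv_by_tests:
  assumes F: "ultra F" and b: "bddL2 (MM T) x" and X: "integrable (MM T) X"
    and t: "\<And>f g. tbump T f \<Longrightarrow> cbump g \<Longrightarrow> ((\<lambda>k. LINT z|MM T. x k z * ttest f g z) \<longlongrightarrow> (LINT z|MM T. X z * ttest f g z)) F"
  shows "wconv F (MM T) x X"
proof -
  obtain X' where X': "wconv F (MM T) x X'" using MMf.weak_limit_exists[OF F b] by blast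
  have s: "sqi (MM T) X'" by (rule wconv_sqi[OF X'])
  have i': "integrable (MM T) X'" by (rule MMf.sqi_integrable[OF s])
  have "AE z in MM T. X' z - X z = 0"
  proof (rule fundamental_lemma)
    show "integrable (MM T) (\<lambda>z. X' z - X z)" using i' X by simp
    fix f g assume f: "tbump T f" and g: "cbump g"
    obtain B where B: "\<forall>x. \<bar>ttest f g x\<bar> \<le> B" using ttest_bounded[OF f g] by blast
    have eq: "(LINT z|MM T. X' z * ttest f g z) = (LINT z|MM T. X z * ttest f g z)"
      by (rule tendsto_unique[OF ultra_not_bot[OF F] wconvD[OF X' sqi_ttest[OF f g]] t[OF f g]])
    have "integrable (MM T) (\<lambda>z. X' z * ttest f g z)" "integrable (MM T) (\<lambda>z. X z * ttest f g z)"
      by (rule integrable_times_bounded[of _ _ _ B]; use i' X B borel_MMI[OF borel_ttest[OF f g]] in auto)+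
    then have "(LINT z|MM T. (X' z - X z) * ttest f g z) = 0" unfolding left_diff_distrib using eq by simp
    then show "(LINT x|MM T. (X' x - X x) * (f (fst x) * g (snd x))) = 0" by (simp add: ttest_def)
  qed
  then have "AE z in MM T. X' z = X z" by eventually_elim simp
  moreover have "X \<in> Borel"
    using borel_measurable_integrable[OF X] by (simp add: measurable_cong_sets[OF sets_MM refl])
  ultimately show ?thesis by (intro wconv_cong_AE[OF X'])
qed

lemma L2_dominated:
  assumes \<phi>: "sqi (MM T) \<phi>" and a: "\<And>k. a k \<in> Borel" "b \<in> Borel"
    and A: "\<And>k z. \<bar>a k z\<bar> \<le> (A::real)" "\<And>z. \<bar>b z\<bar> \<le> A" and lim: "AE z in MM T. (\<lambda>k. a k z) \<longlonglongrightarrow> b z"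
  shows "(\<lambda>k. LINT z|MM T. ((a k z - b z) * \<phi> z)^2) \<longlonglongrightarrow> 0"
proof -
  have [measurable]: "\<phi> \<in> Borel" by (rule sqi_MM_borel[OF \<phi>])
  note [measurable] = a
  have "(\<lambda>k. LINT z|MM T. ((a k z - b z) * \<phi> z)^2) \<longlonglongrightarrow> (LINT z|MM T. 0)"
  proof (rule integral_dominated_convergence[where w="\<lambda>z. (2 * A)^2 * (\<phi> z)^2"])
    show "integrable (MM T) (\<lambda>z. (2 * A)^2 * (\<phi> z)^2)" using \<phi> by auto
    show "AE z in MM T. (\<lambda>k. ((a k z - b z) * \<phi> z)^2) \<longlonglongrightarrow> 0"
      using lim
    proof eventually_elim
      case (elim z)
      have "(\<lambda>k. ((a k z - b z) * \<phi> z)^2) \<longlonglongrightarrow> ((b z - b z) * \<phi> z)^2" by (intro tendsto_intros elim)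
      then show ?case by simp
    qed
    show "AE z in MM T. norm (((a k z - b z) * \<phi> z)^2) \<le> (2 * A)^2 * (\<phi> z)^2" for k
    proof (rule AE_I2)
      fix z
      have "\<bar>a k z - b z\<bar> \<le> 2 * A" using A(1)[of k z] A(2)[of z] by linarith
      then have "(a k z - b z)^2 \<le> (2 * A)^2" by (metis abs_ge_zero power2_abs power_mono)
      then show "norm (((a k z - b z) * \<phi> z)^2) \<le> (2 * A)^2 * (\<phi> z)^2"
        by (simp add: power_mult_distrib mult_right_mono)
    qed
  qed measurable
  then show ?thesis by simp
qed

lemma tendsto_bounded_times_L2:
  assumes F: "F \<noteq> bot" and x: "bddL2 (MM T) x" and y: "\<And>k. sqi (MM T) (y k)" and lim: "((\<lambda>k. LINT z|MM T. (y k z)^2) \<longlongrightarrow> 0) F"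
  shows "((\<lambda>k. LINT z|MM T. x k z * y k z) \<longlongrightarrow> 0) F"
proof -
  obtain C where C: "0 \<le> C" "\<And>k. (LINT z|MM T. (x k z)^2) \<le> C" using bddL2_bound[OF x] by blast
  have "((\<lambda>k. sqrt C * sqrt (LINT z|MM T. (y k z)^2)) \<longlongrightarrow> sqrt C * sqrt 0) F" by (intro tendsto_intros lim)
  then have z: "((\<lambda>k. sqrt C * sqrt (LINT z|MM T. (y k z)^2)) \<longlongrightarrow> 0) F" by simp
  show ?thesis
  proof (rule Lim_null_comparison[OF _ z], rule always_eventually, rule allI)
    fix k show "norm (LINT z|MM T. x k z * y k z) \<le> sqrt C * sqrt (LINT z|MM T. (y k z)^2)"
      using sqi_CS_sqrt[OF bddL2_sqi[OF x] y C(2)] by simp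
  qed
qed

lemma tendsto_weak_times_strong:
  assumes F: "ultra F" and x: "bddL2 (MM T) x" and w: "wconv F (MM T) x X" and y: "\<And>k. sqi (MM T) (y k)" "sqi (MM T) Y"
    and lim: "((\<lambda>k. LINT z|MM T. (y k z - Y z)^2) \<longlongrightarrow> 0) F"
  shows "((\<lambda>k. LINT z|MM T. x k z * y k z) \<longlongrightarrow> (LINT z|MM T. X z * Y z)) F"
proof -
  have sd: "sqi (MM T) (\<lambda>z. y k z - Y z)" for k by (rule sqi_diff[OF y])
  have "(LINT z|MM T. x k z * Y z) + (LINT z|MM T. x k z * (y k z - Y z)) = (LINT z|MM T. x k z * y k z)" for k
    using sqi_mult_integrable[OF bddL2_sqi[OF x] y(1)] sqi_mult_integrable[OF bddL2_sqi[OF x] y(2)] by (simp add: right_diff_distrib)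
  with tendsto_add[OF wconvD[OF w y(2)] tendsto_bounded_times_L2[OF ultra_not_bot[OF F] x sd lim]]
  show ?thesis by simp
qed

text \<open>The coefficients are moved to the test function; there dominated convergence makes
  \<open>a k \<phi>\<close> converge strongly, and weak times strong converges.\<close>

lemma wconv_mult_bounded:
  assumes F: "ultra F" and x: "bddL2 (MM T) x" and w: "wconv F (MM T) x X"
    and a: "\<And>k. a k \<in> Borel" "b \<in> Borel"
    and A: "\<And>k z. \<bar>a k z\<bar> \<le> (A::real)" "\<And>z. \<bar>b z\<bar> \<le> A" and lim: "AE z in MM T. (\<lambda>k. a k z) \<longlonglongrightarrow> b z"
  shows "wconv F (MM T) (\<lambda>k z. a k z * x k z) (\<lambda>z. b z * X z)"
proof -
  have X: "sqi (MM T) X" by (rule wconv_sqi[OF w])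
  have "((\<lambda>k. LINT z|MM T. a k z * x k z * \<phi> z) \<longlongrightarrow> (LINT z|MM T. b z * X z * \<phi> z)) F" if \<phi>: "sqi (MM T) \<phi>" for \<phi>
  proof -
    have sb: "sqi (MM T) (\<lambda>z. b z * \<phi> z)" by (rule sqi_bounded_mult[OF \<phi> borel_MMI[OF a(2)] AE_I2[OF A(2)]])
    have sa: "sqi (MM T) (\<lambda>z. a k z * \<phi> z)" for k by (rule sqi_bounded_mult[OF \<phi> borel_MMI[OF a(1)] AE_I2[OF A(1)]])
    have e: "a k z * x k z * \<phi> z = x k z * (a k z * \<phi> z)" "b z * X z * \<phi> z = X z * (b z * \<phi> z)" for k z by simp_all
    show ?thesis unfolding e
      by (rule tendsto_weak_times_strong[OF F x w sa sb])
         (use ultra_tendsto[OF F L2_dominated[OF \<phi> a A lim]] in \<open>simp add: left_diff_distrib\<close>)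
  qed
  moreover have "sqi (MM T) (\<lambda>z. b z * X z)" by (rule sqi_bounded_mult[OF X borel_MMI[OF a(2)] AE_I2[OF A(2)]])
  ultimately show ?thesis unfolding wconv_def by blast
qed

lemma wconv_bounded_pointwise:
  assumes F: "ultra F" and a: "\<And>k. a k \<in> Borel" "b \<in> Borel"
    and A: "\<And>k z. \<bar>a k z\<bar> \<le> (A::real)" "\<And>z. \<bar>b z\<bar> \<le> A" and lim: "AE z in MM T. (\<lambda>k. a k z) \<longlonglongrightarrow> b z"
  shows "wconv F (MM T) a b"
proof -
  have "wconv F (MM T) (\<lambda>k z. 1) (\<lambda>z. 1)" by (simp add: wconv_def)
  moreover have "bddL2 (MM T) (\<lambda>k z. 1)" by (auto simp: bddL2_def)
  ultimately show ?thesis using wconv_mult_bounded[OF F _ _ a A lim, of "\<lambda>k z. 1" "\<lambda>z. 1"] by simp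
qed

lemma wconv_diff:
  assumes "wconv F M x X" "wconv F M y Y" "\<And>k. sqi M (x k)" "\<And>k. sqi M (y k)"
  shows "wconv F M (\<lambda>k z. x k z - y k z) (\<lambda>z. X z - Y z)"
  unfolding wconv_def
proof (intro conjI allI impI)
  show "sqi M (\<lambda>z. X z - Y z)" by (rule sqi_diff[OF wconv_sqi[OF assms(1)] wconv_sqi[OF assms(2)]])
  fix \<phi> assume \<phi>: "sqi M \<phi>"
  have "((\<lambda>k. (LINT z|M. x k z * \<phi> z) - (LINT z|M. y k z * \<phi> z)) \<longlongrightarrow> (LINT z|M. X z * \<phi> z) - (LINT z|M. Y z * \<phi> z)) F"
    by (intro tendsto_diff wconvD[OF assms(1) \<phi>] wconvD[OF assms(2) \<phi>])
  then show "((\<lambda>k. LINT z|M. (x k z - y k z) * \<phi> z) \<longlongrightarrow> (LINT z|M. (X z - Y z) * \<phi> z)) F"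
    unfolding left_diff_distrib
    using sqi_mult_integrable[OF assms(3) \<phi>] sqi_mult_integrable[OF assms(4) \<phi>]
      sqi_mult_integrable[OF wconv_sqi[OF assms(1)] \<phi>] sqi_mult_integrable[OF wconv_sqi[OF assms(2)] \<phi>] by simp
qed

lemma strong_weak_product:
  assumes F: "ultra F" and x: "bddL2 (MM T) x" and w: "wconv F (MM T) x X"
    and H: "\<And>k. sqi (MM T) (H k)" "sqi (MM T) h" and s: "((\<lambda>k. LINT z|MM T. (H k z - h z)^2) \<longlongrightarrow> 0) F"
    and b: "b \<in> Borel" "\<And>z. \<bar>b z\<bar> \<le> (B::real)"
  shows "((\<lambda>k. LINT z|MM T. (H k z * x k z) * b z) \<longlongrightarrow> (LINT z|MM T. (h z * X z) * b z)) F"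
proof -
  have X: "sqi (MM T) X" by (rule wconv_sqi[OF w])
  have B: "AE z in MM T. \<bar>b z\<bar> \<le> B" using b(2) by simp
  have sb: "sqi (MM T) (\<lambda>z. b z * h z)" by (rule sqi_bounded_mult[OF H(2) borel_MMI[OF b(1)] B])
  have sH: "sqi (MM T) (\<lambda>z. b z * H k z)" for k by (rule sqi_bounded_mult[OF H(1) borel_MMI[OF b(1)] B])
  have sd: "sqi (MM T) (\<lambda>z. b z * (H k z - h z))" for k
    using sqi_diff[OF sH[of k] sb] by (simp add: right_diff_distrib)
  have l0: "((\<lambda>k. LINT z|MM T. (b z * (H k z - h z))^2) \<longlongrightarrow> 0) F"
  proof (rule Lim_null_comparison)
    show "((\<lambda>k. B^2 * (LINT z|MM T. (H k z - h z)^2)) \<longlongrightarrow> 0) F" using tendsto_mult[OF tendsto_const[of "B^2"] s] by simp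
    show "\<forall>\<^sub>F k in F. norm (LINT z|MM T. (b z * (H k z - h z))^2) \<le> B^2 * (LINT z|MM T. (H k z - h z)^2)"
    proof (rule always_eventually, rule allI)
      fix k
      have "(LINT z|MM T. (b z * (H k z - h z))^2) \<le> (LINT z|MM T. B^2 * (H k z - h z)^2)"
      proof (rule integral_mono)
        fix z
        have "(b z)^2 \<le> B^2" using b(2)[of z] by (metis abs_ge_zero order_trans power2_abs power_mono)
        then show "(b z * (H k z - h z))^2 \<le> B^2 * (H k z - h z)^2" unfolding power_mult_distrib by (rule mult_right_mono) simp
      qed (use sd[of k] sqi_diff[OF H(1)[of k] H(2)] in auto)
      then show "norm (LINT z|MM T. (b z * (H k z - h z))^2) \<le> B^2 * (LINT z|MM T. (H k z - h z)^2)" by simp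
    qed
  qed
  have e: "H k z * x k z * b z = x k z * (b z * H k z)" "h z * X z * b z = X z * (b z * h z)" for k z by simp_all
  show ?thesis unfolding e
    by (rule tendsto_weak_times_strong[OF F x w sH sb]) (use l0 in \<open>simp add: right_diff_distrib\<close>)
qed

text \<open>A strongly and a weakly convergent factor give convergence of the product against
  bounded tests. The separate \<open>L2\<close> bound of the products extends this to tests in
  \<open>L2\<close>, as required by the \<open>z\<close>-derivatives of the test functions.\<close>

lemma wconv_product:
  assumes F: "ultra F" and x: "bddL2 (MM T) x" and w: "wconv F (MM T) x X"
    and H: "\<And>k. sqi (MM T) (H k)" "sqi (MM T) h" and s: "((\<lambda>k. LINT z|MM T. (H k z - h z)^2) \<longlongrightarrow> 0) F"
    and b: "bddL2 (MM T) (\<lambda>k z. H k z * x k z)"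
  shows "wconv F (MM T) (\<lambda>k z. H k z * x k z) (\<lambda>z. h z * X z)"
proof (rule wconv_by_tests[OF F b sqi_mult_integrable[OF H(2) wconv_sqi[OF w]]])
  fix f g assume f: "tbump T f" and g: "cbump g"
  obtain B where B: "\<And>x. \<bar>ttest f g x\<bar> \<le> B" using ttest_bounded[OF f g] by blast
  show "((\<lambda>k. LINT z|MM T. (H k z * x k z) * ttest f g z) \<longlongrightarrow> (LINT z|MM T. (h z * X z) * ttest f g z)) F"
    by (rule strong_weak_product[OF F x w H s borel_ttest[OF f g] B])
qed

lemma Av_tendsto_bounded:
  assumes g: "cper g" and d: "\<And>k. 0 < d k" "d \<longlonglongrightarrow> 0"
  shows "(\<lambda>k. Av (d k) g z) \<longlonglongrightarrow> g z" "(\<lambda>k. Am (d k) g z) \<longlonglongrightarrow> g z"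
proof -
  obtain G where G: "\<And>x. (G has_real_derivative g x) (at x)" using continuous_antideriv[OF cper_continuous[OF g]] by blast
  have lim: "((\<lambda>h. (G (z + h) - G z) / h) \<longlongrightarrow> g z) (at 0)" using G[of z] by (simp add: DERIV_def)
  have nz: "d k \<noteq> 0" for k using d(1)[of k] by simp
  have f1: "filterlim d (at 0) sequentially" unfolding filterlim_at using d(2) nz by simp
  have f2: "filterlim (\<lambda>k. - d k) (at 0) sequentially"
    unfolding filterlim_at using tendsto_minus[OF d(2)] nz by simp
  show "(\<lambda>k. Av (d k) g z) \<longlonglongrightarrow> g z"
    using filterlim_compose[OF lim f1] by (simp add: Av_antideriv(1)[OF G cper_continuous[OF g] d(1)])
  have "(G z - G (z - d k)) / d k = (G (z + - d k) - G z) / (- d k)" for k by (simp add: minus_divide_left[symmetric] diff_divide_distrib)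
  then show "(\<lambda>k. Am (d k) g z) \<longlonglongrightarrow> g z"
    using filterlim_compose[OF lim f2] by (simp add: Av_antideriv(2)[OF G cper_continuous[OF g] d(1)])
qed

lemma Am_abs_le: "cper g \<Longrightarrow> 0 < d \<Longrightarrow> (\<And>z. \<bar>g z\<bar> \<le> C) \<Longrightarrow> \<bar>Am d g z\<bar> \<le> C"
  and Av_abs_le: "cper g \<Longrightarrow> 0 < d \<Longrightarrow> (\<And>z. \<bar>g z\<bar> \<le> C) \<Longrightarrow> \<bar>Av d g z\<bar> \<le> C"
proof -
  assume g: "cper g" and d: "0 < d" and C: "\<And>z. \<bar>g z\<bar> \<le> C"
  have "cper (\<lambda>y. g (- y))"
  proof -
    have "g (- (z + 1)) = g (- z)" for z
      using cper_periodic[OF g, unfolded periodic1_def, rule_format, of "- z - 1"] by simp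
    then show ?thesis unfolding cper_def periodic1_def
      by (auto intro!: continuous_on_compose2[OF cper_continuous[OF g]] continuous_intros)
  qed
  note b = cper_borel[OF this]
  show "\<bar>Am d g z\<bar> \<le> C" unfolding Am_eq_shift abs_le_iff
    using Av_bounds[OF b, of "-C" C d "-z"] C d by (auto simp: abs_le_iff minus_le_iff)
  show "\<bar>Av d g z\<bar> \<le> C" unfolding abs_le_iff
    using Av_bounds[OF cper_borel[OF g], of "-C" C d z] C d by (auto simp: abs_le_iff minus_le_iff)
qed

lemma cbump_cper: "cbump g \<Longrightarrow> cper g"
  by (simp add: cbump_def cper_def periodic1_def smooth_continuous)

lemma lift_ttest_adjoint:
  assumes tau: "0 < tau" and N: "real N * tau = T" and x: "\<And>n. cper (x n)" "\<And>n. cper (y n)"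
    and f: "tbump T f" and g: "cper g" "cper g'"
    and adj: "\<And>n. (LINT z|cm. x n z * g z) = (LINT z|cm. y n z * g' z)"
  shows "(LINT p|MM T. lift tau x p * (f (fst p) * g (snd p))) = (LINT p|MM T. lift tau y p * (f (fst p) * g' (snd p)))"
proof -
  obtain C where C: "\<And>t. \<bar>f t\<bar> \<le> C" using tbump_bounded[OF f] by blast
  obtain D where D: "\<And>t. \<bar>g t\<bar> \<le> D" using cper_bounded[OF g(1)] by blast
  obtain D' where D': "\<And>t. \<bar>g' t\<bar> \<le> D'" using cper_bounded[OF g(2)] by blast
  have i1: "integrable (MM T) (\<lambda>p. lift tau x p * (f (fst p) * g (snd p)))"
    by (rule integrable_MM_test[OF MMf.sqi_integrable[OF lift_sqi(1)[OF tau N, of x, OF x(1)]] tbump_borel[OF f] cper_borel[OF g(1)] C D])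
  have i2: "integrable (MM T) (\<lambda>p. lift tau y p * (f (fst p) * g' (snd p)))"
    by (rule integrable_MM_test[OF MMf.sqi_integrable[OF lift_sqi(1)[OF tau N, of y, OF x(2)]] tbump_borel[OF f] cper_borel[OF g(2)] C D'])
  have "(LINT z|cm. lift tau x (t, z) * (f t * g z)) = (LINT z|cm. lift tau y (t, z) * (f t * g' z))" for t
  proof -
    have "(LINT z|cm. lift tau x (t, z) * (f t * g z)) = (LINT z|cm. f t * (x (stp tau t) z * g z))"
      by (rule Bochner_Integration.integral_cong) (auto simp: lift_def)
    also have "\<dots> = (LINT z|cm. f t * (y (stp tau t) z * g' z))" by (simp add: adj)
    also have "\<dots> = (LINT z|cm. lift tau y (t, z) * (f t * g' z))"
      by (rule Bochner_Integration.integral_cong) (auto simp: lift_def)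
    finally show ?thesis .
  qed
  then show ?thesis unfolding MM_integral[OF i1] MM_integral[OF i2] by simp
qed

lemma lift_bddL2:
  assumes tau: "\<And>k. 0 < tau k" and N: "\<And>k. real (N k) * tau k = T" and x: "\<And>k n. cper (x k n)"
    and C: "\<And>k. tau k * (\<Sum>n<N k. nsq (x k n)) \<le> C"
  shows "bddL2 (MM T) (\<lambda>k. lift (tau k) (x k))"
  unfolding bddL2_def
proof (intro conjI allI exI)
  fix k
  show "sqi (MM T) (lift (tau k) (x k))" by (rule lift_sqi(1)[OF tau N, of "x k", OF x])
  show "(LINT p|MM T. (lift (tau k) (x k) p)^2) \<le> C" using lift_sqi(2)[OF tau N, of "x k", OF x] C by simp
qed

lemma wconv_test_modified:
  assumes F: "ultra F" and x: "bddL2 (MM T) x" and w: "wconv F (MM T) x X"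
    and f: "tbump T f" and g: "cper g" and gk: "\<And>k. cper (gk k)" "\<And>k z. \<bar>gk k z\<bar> \<le> D" and lim: "\<And>z. (\<lambda>k. gk k z) \<longlonglongrightarrow> g z"
  shows "((\<lambda>k. LINT p|MM T. x k p * (f (fst p) * gk k (snd p))) \<longlongrightarrow> (LINT p|MM T. X p * (f (fst p) * g (snd p)))) F"
proof -
  obtain C where C: "\<And>t. \<bar>f t\<bar> \<le> C" using tbump_bounded[OF f] by blast
  have D: "\<bar>g z\<bar> \<le> D" for z
    by (rule LIMSEQ_le_const2[OF tendsto_rabs[OF lim]]) (use gk(2) in auto)
  have bk: "(\<lambda>p. gk k (snd p)) \<in> borel_measurable (borel :: (real \<times> real) measure)" for k
    by (rule measurable_compose[OF borel_fst_snd(2) cper_borel[OF gk(1)]])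
  have b: "(\<lambda>p. g (snd p)) \<in> borel_measurable (borel :: (real \<times> real) measure)"
    by (rule measurable_compose[OF borel_fst_snd(2) cper_borel[OF g]])
  have bf: "(\<lambda>p. f (fst p)) \<in> borel_measurable (borel :: (real \<times> real) measure)"
    by (rule measurable_compose[OF borel_fst_snd(1) tbump_borel[OF f]])
  have sf: "sqi (MM T) (\<lambda>p. f (fst p))" by (rule sqi_of_bounded[OF bf]) (rule C)
  have "wconv F (MM T) (\<lambda>k p. gk k (snd p) * x k p) (\<lambda>p. g (snd p) * X p)"
    by (rule wconv_mult_bounded[OF F x w bk b gk(2) D AE_I2[OF lim]])
  from wconvD[OF this sf] show ?thesis by (simp add: mult.commute mult.left_commute)
qed

text \<open>Averages of vanishing width do not change a weak limit: the adjoint average acts on a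
  smooth test function and converges to it pointwise and boundedly.\<close>

lemma wconv_Av_Am:
  assumes F: "ultra F" and tau: "\<And>k. 0 < tau k" and N: "\<And>k. real (N k) * tau k = T"
    and d: "\<And>k. 0 < d k" "\<And>k. d k \<le> 1" "d \<longlonglongrightarrow> 0"
    and x: "\<And>k n. cper (x k n)" and C: "\<And>k. tau k * (\<Sum>n<N k. nsq (x k n)) \<le> C"
    and w: "wconv F (MM T) (\<lambda>k. lift (tau k) (x k)) X"
  shows "wconv F (MM T) (\<lambda>k. lift (tau k) (\<lambda>n. Av (d k) (x k n))) X"
    "wconv F (MM T) (\<lambda>k. lift (tau k) (\<lambda>n. Am (d k) (x k n))) X"
    "bddL2 (MM T) (\<lambda>k. lift (tau k) (\<lambda>n. Av (d k) (x k n)))"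
    "bddL2 (MM T) (\<lambda>k. lift (tau k) (\<lambda>n. Am (d k) (x k n)))"
proof -
  have bx: "bddL2 (MM T) (\<lambda>k. lift (tau k) (x k))" by (rule lift_bddL2[OF tau N x C])
  have iX: "integrable (MM T) X" by (rule MMf.sqi_integrable[OF wconv_sqi[OF w]])
  have cv: "cper (Av (d k) (x k n))" for k n by (rule cper_Av[OF x d(1)])
  have cm': "cper (Am (d k) (x k n))" for k n by (rule cper_Am[OF x d(1)])
  have "tau k * (\<Sum>n<N k. nsq (Av (d k) (x k n))) \<le> tau k * (\<Sum>n<N k. nsq (x k n))" for k
    using tau[of k] by (intro mult_left_mono sum_mono Av_ip_le[OF x d(1,2)]) simp
  from order_trans[OF this C] show b1: "bddL2 (MM T) (\<lambda>k. lift (tau k) (\<lambda>n. Av (d k) (x k n)))"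
    by (rule lift_bddL2[OF tau N cv])
  have "tau k * (\<Sum>n<N k. nsq (Am (d k) (x k n))) \<le> tau k * (\<Sum>n<N k. nsq (x k n))" for k
    using tau[of k] by (intro mult_left_mono sum_mono Am_ip_le[OF x d(1,2)]) simp
  from order_trans[OF this C] show b2: "bddL2 (MM T) (\<lambda>k. lift (tau k) (\<lambda>n. Am (d k) (x k n)))"
    by (rule lift_bddL2[OF tau N cm'])
  show "wconv F (MM T) (\<lambda>k. lift (tau k) (\<lambda>n. Av (d k) (x k n))) X"
  proof (rule wconv_by_tests[OF F b1 iX])
    fix f g assume f: "tbump T f" and g: "cbump g"
    note cg = cbump_cper[OF g]
    obtain D where D: "\<And>t. \<bar>g t\<bar> \<le> D" using cper_bounded[OF cg] by blast
    have "(LINT p|MM T. lift (tau k) (\<lambda>n. Av (d k) (x k n)) p * (f (fst p) * g (snd p)))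
      = (LINT p|MM T. lift (tau k) (x k) p * (f (fst p) * Am (d k) g (snd p)))" for k
      by (rule lift_ttest_adjoint[OF tau N cv x f cg cper_Am[OF cg d(1)] Av_adjoint[OF cper_pL2[OF x] cg d(1,2)]])
    moreover have "((\<lambda>k. LINT p|MM T. lift (tau k) (x k) p * (f (fst p) * Am (d k) g (snd p))) \<longlongrightarrow> (LINT p|MM T. X p * (f (fst p) * g (snd p)))) F"
      by (rule wconv_test_modified[OF F bx w f cg cper_Am[OF cg d(1)] Am_abs_le[OF cg d(1) D] Av_tendsto_bounded(2)[OF cg d(1,3)]])
    ultimately show "((\<lambda>k. LINT z|MM T. lift (tau k) (\<lambda>n. Av (d k) (x k n)) z * ttest f g z) \<longlongrightarrow> (LINT z|MM T. X z * ttest f g z)) F"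
      by (simp add: ttest_def)
  qed
  show "wconv F (MM T) (\<lambda>k. lift (tau k) (\<lambda>n. Am (d k) (x k n))) X"
  proof (rule wconv_by_tests[OF F b2 iX])
    fix f g assume f: "tbump T f" and g: "cbump g"
    note cg = cbump_cper[OF g]
    obtain D where D: "\<And>t. \<bar>g t\<bar> \<le> D" using cper_bounded[OF cg] by blast
    have adj: "(LINT z|cm. Am (d k) (x k n) z * g z) = (LINT z|cm. x k n z * Av (d k) g z)" for k n
      using Av_adjoint[OF cper_pL2[OF cg] x d(1,2), of k k n] by (simp add: mult.commute)
    have "(LINT p|MM T. lift (tau k) (\<lambda>n. Am (d k) (x k n)) p * (f (fst p) * g (snd p)))
      = (LINT p|MM T. lift (tau k) (x k) p * (f (fst p) * Av (d k) g (snd p)))" for k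
      by (rule lift_ttest_adjoint[OF tau N cm' x f cg cper_Av[OF cg d(1)] adj])
    moreover have "((\<lambda>k. LINT p|MM T. lift (tau k) (x k) p * (f (fst p) * Av (d k) g (snd p))) \<longlongrightarrow> (LINT p|MM T. X p * (f (fst p) * g (snd p)))) F"
      by (rule wconv_test_modified[OF F bx w f cg cper_Av[OF cg d(1)] Av_abs_le[OF cg d(1) D] Av_tendsto_bounded(1)[OF cg d(1,3)]])
    ultimately show "((\<lambda>k. LINT z|MM T. lift (tau k) (\<lambda>n. Am (d k) (x k n)) z * ttest f g z) \<longlongrightarrow> (LINT z|MM T. X z * ttest f g z)) F"
      by (simp add: ttest_def)
  qed
qed

section \<open>Bounds for the nonlinear terms that are uniform in the step sizes\<close>

lemma C1_sup:
  fixes w :: "real \<Rightarrow> real"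
  assumes D: "\<And>z. (w has_real_derivative w' z) (at z)" and c: "cper w" "cper w'"
  shows "(w z)^2 \<le> 2 * nsq w + 2 * nsq w'"
proof -
  have *: "(w z)^2 \<le> 2 * nsq w + 2 * nsq w'" if z: "0 \<le> z" "z \<le> 1" for z
  proof -
    note C = C1_primitive(1)[OF D c(2) cper_periodic[OF c(1)]]
    have "AE z in cm. w z = w 0 + (LINT y|cm. indicator {..<z} y * w' y)"
      using AE_cm_range by eventually_elim (rule C, auto)
    from prim_sup_bound[OF cper_sqi[OF c(2)] cper_sqi[OF c(1)] this, of z]
    show ?thesis unfolding C[OF z, symmetric] ip_self .
  qed
  have "w z = w (frac z + of_int \<lfloor>z\<rfloor>)" by (simp add: frac_def)
  also have "\<dots> = w (frac z)" by (rule periodic1_int[OF cper_periodic[OF c(1)]])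
  finally show ?thesis using *[of "frac z"] frac_lt_1[of z] by (simp add: less_imp_le)
qed

text \<open>The bound is linear in the squared norm of \<open>w'\<close>. For \<open>w = A h\<close>
  this quantity is summable in time by the dissipation, while the bounds \<open>a\<close> and
  \<open>b\<close> hold uniformly in time.\<close>

lemma C1_mult_le:
  assumes D: "\<And>z. (w has_real_derivative w' z) (at z)" and c: "cper w" "cper w'" "cper v"
    and b: "nsq w \<le> a" "nsq v \<le> b"
  shows "nsq (\<lambda>z. w z * v z) \<le> (2 * a + 2 * nsq w') * b"
proof -
  let ?s = "2 * nsq w + 2 * nsq w'"
  have s: "0 \<le> ?s" using ip_nonneg[of w] ip_nonneg[of w'] by simp
  have "\<bar>w z\<bar> \<le> sqrt ?s" for z
    using C1_sup[OF D c(1,2), of z] by (metis real_sqrt_abs real_sqrt_le_iff)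
  from ip_bounded_mult_le[OF c(1,3) this]
  have "nsq (\<lambda>z. w z * v z) \<le> ?s * nsq v" using s by (simp add: real_sqrt_pow2)
  also have "\<dots> \<le> (2 * a + 2 * nsq w') * b"
    using b s ip_nonneg[of v] ip_nonneg[of w'] by (intro mult_mono) auto
  finally show ?thesis .
qed

context scheme begin

lemma Av_H_deriv: "(AH n l has_real_derivative DH n l z) (at z)"
  by (rule Av_deriv(1)[OF cper_continuous[OF cper_st(1)] d(1)])

lemma Av_U_deriv: "(Av d (U n) has_real_derivative DU n z) (at z)"
  by (rule Av_deriv(1)[OF cper_continuous[OF cper_st(3)] d(1)])

lemma Am_G_deriv: "(Am d (gG n l) has_real_derivative yH n l z) (at z)"
  using Av_deriv(2)[OF cper_continuous[OF cper_y(3)] d(1)] by (simp add: yH_def YH_def gG_def)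

text \<open>In contrast to \<open>residual_bounds\<close> no power of \<open>1/d\<close> occurs,
  because the supremum of \<open>A h\<close> is controlled by its derivative \<open>D h\<close>
  instead of by averaging. These bounds survive the limit.\<close>

lemma product_bounds:
  assumes B: "E n \<le> B"
  defines "q l \<equiv> nsq (DH n l)"
  shows "nsq (\<lambda>z. AH n l z * V n z) \<le> (2 * (B / p) + 2 * q l) * (2 * B)"
    and "nsq (\<lambda>z. AH n l z * AH n l z) \<le> (2 * (B / p) + 2 * q l) * (B / p)"
    and "nsq (gG n l) \<le> 4 * (r1^2 * q l) + 4 * ((2 * (B / p) + 2 * q l) * (2 * B)) + 2 * (r1 * J)^2"
proof -
  note b = E_parts[OF B]
  have a: "nsq (AH n l) \<le> B / p"
    by (rule order_trans[OF Av_ip_le[OF cper_st(1) d] b(1)])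
  show 1: "nsq (\<lambda>z. AH n l z * V n z) \<le> (2 * (B / p) + 2 * q l) * (2 * B)"
    unfolding q_def by (rule C1_mult_le[OF Av_H_deriv cper_D(4) cper_D(1) cper_st(2) a b(2)])
  show "nsq (\<lambda>z. AH n l z * AH n l z) \<le> (2 * (B / p) + 2 * q l) * (B / p)"
    unfolding q_def by (rule C1_mult_le[OF Av_H_deriv cper_D(4) cper_D(1) cper_D(4) a a])
  have rz: "\<bar>r z\<bar> \<le> r1" for z using rb[of z] r0 by simp
  have c1: "cper (\<lambda>z. r z * DH n l z)" "cper (\<lambda>z. AH n l z * V n z)" "cper (\<lambda>z. r z * j n l z)"
    by (intro cper_mult cr cj cper_D cper_st)+
  have 2: "nsq (\<lambda>z. r z * DH n l z) \<le> r1^2 * q l"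
    unfolding q_def by (rule ip_bounded_mult_le[OF cr cper_D(1) rz])
  have "\<bar>r z * j n l z\<bar> \<le> r1 * J" for z
    unfolding abs_mult by (intro mult_mono rz jb) (use order_trans[OF abs_ge_zero rz[of z]] in auto)
  then have 3: "nsq (\<lambda>z. r z * j n l z) \<le> (r1 * J)^2" by (rule ip_const_le[OF c1(3)])
  have "nsq (gG n l) \<le> 2 * nsq (\<lambda>z. r z * DH n l z - AH n l z * V n z)
    + 2 * nsq (\<lambda>z. r z * j n l z)"
    unfolding gG_def G_def[abs_def] by (rule ip_square_diff_le[OF cper_diff[OF c1(1,2)] c1(3)])
  then show "nsq (gG n l) \<le> 4 * (r1^2 * q l) + 4 * ((2 * (B / p) + 2 * q l) * (2 * B)) + 2 * (r1 * J)^2"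
    using ip_square_diff_le[OF c1(1,2)] 1 2 3 by argo
qed

lemma U_sum: "U n z = u0 z + tau * (\<Sum>i<n. V i z)"
  by (induction n) (auto simp: zero step algebra_simps)

lemma U_bound:
  assumes V: "\<And>i. i < N \<Longrightarrow> nsq (V i) \<le> C" and N: "real N * tau = T" and n: "n \<le> N"
  shows "nsq (U n) \<le> 2 * nsq u0 + 2 * (T^2 * C)"
proof -
  have cs: "cper (\<lambda>z. \<Sum>i<n. V i z)" by (intro cper_sum cper_st) auto
  have C0: "0 \<le> C" if "0 < N" using V[OF that] ip_nonneg[of "V 0"] by linarith
  have nT: "real n * tau \<le> T" "0 \<le> real n * tau" using n tau N[symmetric] by auto
  have "nsq (\<lambda>z. \<Sum>i<n. V i z) = (LINT z|cm. (\<Sum>i<n. V i z)^2)" by (rule ip_self)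
  also have "\<dots> \<le> (LINT z|cm. real n * (\<Sum>i<n. (V i z)^2))"
  proof (rule integral_mono)
    show "(\<Sum>i<n. V i z)^2 \<le> real n * (\<Sum>i<n. (V i z)^2)" for z
      using sum_squared_le_sum_of_squares[of "\<lambda>i. V i z" "{..<n}"] by (simp add: mult.commute)
  qed (intro cper_integrable cper_power cs cper_mult cper_const cper_sum cper_st finite_lessThan)+
  also have "\<dots> = real n * (\<Sum>i<n. nsq (V i))"
    by (simp add: ip_self cper_integrable[OF cper_power[OF cper_st(2)]])
  also have "\<dots> \<le> real n * (\<Sum>i<n. C)" using V n by (intro mult_left_mono sum_mono) auto
  finally have 1: "nsq (\<lambda>z. \<Sum>i<n. V i z) \<le> real n * (real n * C)" by simp
  have "nsq (\<lambda>z. tau * (\<Sum>i<n. V i z)) \<le> tau^2 * nsq (\<lambda>z. \<Sum>i<n. V i z)"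
    by (rule ip_bounded_mult_le[OF cper_const cs]) (use tau in simp)
  also have "\<dots> \<le> tau^2 * (real n * (real n * C))" using 1 by (rule mult_left_mono) simp
  also have "\<dots> = (real n * tau)^2 * C" by (simp add: power2_eq_square)
  also have "\<dots> \<le> T^2 * C"
  proof (cases "n = 0")
    case True
    then show ?thesis using C0 N by (cases "N = 0") auto
  next
    case False
    then show ?thesis using nT C0 n by (intro mult_right_mono power_mono) auto
  qed
  finally have 2: "nsq (\<lambda>z. tau * (\<Sum>i<n. V i z)) \<le> T^2 * C" .
  have "U n = (\<lambda>z. u0 z + tau * (\<Sum>i<n. V i z))" using U_sum[of n] by (auto simp: fun_eq_iff)
  then show ?thesis using ip_square_sum_le[OF cu0 cper_mult[OF cper_const cs, of tau]] 2 by simp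
qed

end

section \<open>Properties inherited by weak limits\<close>

lemma cper_cbump_deriv: assumes "cbump g" shows "cper (deriv g)" "\<And>z. (g has_real_derivative deriv g z) (at z)"
proof -
  have s: "smooth_on UNIV g" and p: "\<And>z. g (z + 1) = g z" using assms by (auto simp: cbump_def)
  show D: "(g has_real_derivative deriv g z) (at z)" for z by (rule smooth_deriv(1)[OF s])
  have "deriv g (z + 1) = deriv g z" for z
  proof -
    have "((\<lambda>y. g (y + 1)) has_real_derivative deriv g (z + 1)) (at z)" by (rule DERIV_shift[THEN iffD1, OF D])
    then show ?thesis using DERIV_unique[OF D] by (simp add: p)
  qed
  then show "cper (deriv g)" using smooth_continuous[OF smooth_deriv(2)[OF s]] by (simp add: cper_def periodic1_def)
qed

lemma C1_IBP:
  assumes x: "\<And>z. (x has_real_derivative x' z) (at z)" "cper x" "cper x'"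
    and g: "\<And>z. (g has_real_derivative g' z) (at z)" "cper g" "cper g'"
  shows "(LINT z|cm. x' z * g z) = - (LINT z|cm. x z * g' z)"
proof -
  have D: "((\<lambda>z. x z * g z) has_real_derivative x' z * g z + x z * g' z) (at z)" for z
    using DERIV_mult[OF x(1) g(1), of z] by (simp add: mult.commute add.commute)
  have c: "cper (\<lambda>z. x' z * g z)" "cper (\<lambda>z. x z * g' z)" by (intro cper_mult x g)+
  have "(LINT z|cm. x' z * g z + x z * g' z) = 0"
    by (rule C1_primitive(2)[OF D cper_add[OF c] cper_periodic[OF cper_mult[OF x(2) g(2)]], of 0]) simp_all
  then show ?thesis by (simp add: cper_integrable[OF c(1)] cper_integrable[OF c(2)])
qed

text \<open>Integration by parts against smooth tests passes to weak limits, and \<open>zrep\<close>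
  recovers from it the representation by a primitive and the zero mean.\<close>

lemma wconv_zpair:
  assumes F: "ultra F" and T: "0 < T" and tau: "\<And>k. 0 < tau k" and N: "\<And>k. real (N k) * tau k = T"
    and x: "\<And>k n. cper (x k n)" "\<And>k n. cper (x' k n)" and D: "\<And>k n z. (x k n has_real_derivative x' k n z) (at z)"
    and w: "wconv F (MM T) (\<lambda>k. lift (tau k) (x k)) X" "wconv F (MM T) (\<lambda>k. lift (tau k) (x' k)) X'"
  shows "zpair T X X'"
proof -
  have s: "sqi (MM T) X" "sqi (MM T) X'" by (rule wconv_sqi[OF w(1)], rule wconv_sqi[OF w(2)])
  have t: "(LINT x|MM T. X x * (f (fst x) * deriv g (snd x))) = - (LINT x|MM T. X' x * (f (fst x) * g (snd x)))"
    if f: "tbump T f" and g: "cbump g" for f g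
  proof -
    note dg = cper_cbump_deriv[OF g] and cg = cbump_cper[OF g]
    have adj: "(LINT z|cm. x k n z * deriv g z) = (LINT z|cm. (- x' k n z) * g z)" for k n
      using C1_IBP[OF D x dg(2) cg dg(1)] by simp
    have m: "lift tau (\<lambda>n z. - y n z) p = - lift tau y p" for y p tau by (simp add: lift_def)
    have e: "(LINT p|MM T. lift (tau k) (x k) p * (f (fst p) * deriv g (snd p)))
      = - (LINT p|MM T. lift (tau k) (x' k) p * (f (fst p) * g (snd p)))" for k
      using lift_ttest_adjoint[OF tau N x(1) cper_minus[OF x(2)] f dg(1) cg adj, of k] by (simp add: m)
    obtain C where C: "\<And>t. \<bar>f t\<bar> \<le> C" using tbump_bounded[OF f] by blast
    obtain D1 where D1: "\<And>t. \<bar>deriv g t\<bar> \<le> D1" using cper_bounded[OF dg(1)] by blast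
    have bf: "(\<lambda>p. f (fst p)) \<in> borel_measurable (borel :: (real \<times> real) measure)"
      by (rule measurable_compose[OF borel_fst_snd(1) tbump_borel[OF f]])
    have bg: "(\<lambda>p. deriv g (snd p)) \<in> borel_measurable (borel :: (real \<times> real) measure)"
      by (rule measurable_compose[OF borel_fst_snd(2) cper_borel[OF dg(1)]])
    have "\<bar>f (fst p) * deriv g (snd p)\<bar> \<le> C * D1" for p :: "real \<times> real"
      unfolding abs_mult by (intro mult_mono C D1) (use order_trans[OF abs_ge_zero C] in auto)
    then have s1: "sqi (MM T) (\<lambda>p. f (fst p) * deriv g (snd p))"
      by (rule sqi_of_bounded[OF borel_measurable_times[OF bf bg]])
    have s2: "sqi (MM T) (\<lambda>p. f (fst p) * g (snd p))" using sqi_ttest[OF f g, of T] by (simp only: ttest_def[abs_def])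
    show ?thesis
      by (rule tendsto_unique[OF ultra_not_bot[OF F] wconvD[OF w(1) s1]])
         (unfold e, rule tendsto_minus[OF wconvD[OF w(2) s2]])
  qed
  have i: "integrable (MM T) X" "integrable (MM T) X'" by (rule MMf.sqi_integrable[OF s(1)], rule MMf.sqi_integrable[OF s(2)])
  show ?thesis unfolding zpair_def
    using zrep[OF i T t] s sqi_MM_borel[OF s(1)] sqi_MM_borel[OF s(2)] by blast
qed

text \<open>The test is \<open>X\<close> itself, cut off to the set \<open>A\<close> of times at
  which the bound fails. By Cauchy-Schwarz the integral of \<open>X^2\<close> over these times is at
  most \<open>C\<close> times the measure of \<open>A\<close>, whereas each slice contributes more
  than \<open>C\<close>; so \<open>A\<close> is a null set.\<close>

lemma wconv_slice_bound:
  assumes F: "ultra F" and T: "0 < T" and tau: "\<And>k. 0 < tau k" and N: "\<And>k. real (N k) * tau k = T"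
    and x: "\<And>k n. cper (x k n)" and C: "\<And>k n. n < N k \<Longrightarrow> nsq (x k n) \<le> C"
    and w: "wconv F (MM T) (\<lambda>k. lift (tau k) (x k)) X"
  shows "AE t in tm T. (LINT z|cm. (X (t, z))^2) \<le> C"
proof -
  have s: "sqi (MM T) X" by (rule wconv_sqi[OF w])
  have b: "X \<in> Borel" by (rule sqi_MM_borel[OF s])
  have iX: "integrable (MM T) (\<lambda>p. (X p)^2)" using s by auto
  define A where "A = {t. (LINT z|cm. (X (t, z))^2) > C}"
  have mA: "A \<in> sets borel"
  proof -
    have "(\<lambda>t. LINT z|cm. (X (t, z))^2) \<in> Borel"
      using borel_measurable_integrable[OF integrable_MM_fst[OF iX]] by simp
    then show ?thesis unfolding A_def by measurable
  qed
  have mA2: "(\<lambda>p. indicator A (fst p) :: real) \<in> borel_measurable (borel :: (real \<times> real) measure)"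
    by (rule measurable_compose[OF borel_fst_snd(1) borel_measurable_indicator[OF mA]])
  let ?\<phi> = "\<lambda>p. indicator A (fst p) * X p"
  have s\<phi>: "sqi (MM T) ?\<phi>"
    by (rule sqi_bounded_mult[OF s borel_MMI[OF mA2], of 1]) (simp add: indicator_def)
  define m where "m = measure (tm T) A"
  define I where "I = (LINT p|MM T. X p * ?\<phi> p)"
  have I2: "I = (LINT p|MM T. (?\<phi> p)^2)"
    unfolding I_def by (rule Bochner_Integration.integral_cong) (auto simp: power2_eq_square indicator_def)
  have I0: "0 \<le> I" unfolding I2 by simp
  have C0: "0 \<le> C" using C[of 0 0] N[of 0] T ip_nonneg[of "x 0 0"] by (cases "N 0 = 0") auto
  have bk: "(LINT p|MM T. lift (tau k) (x k) p * ?\<phi> p) \<le> sqrt (C * m * I)" for k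
  proof -
    let ?x = "\<lambda>p. indicator A (fst p) * lift (tau k) (x k) p"
    have sl: "sqi (MM T) (lift (tau k) (x k))" by (rule lift_sqi(1)[OF tau N, of "x k", OF x])
    have sx: "sqi (MM T) ?x" by (rule sqi_bounded_mult[OF sl borel_MMI[OF mA2], of 1]) (simp add: indicator_def)
    have ix: "integrable (MM T) (\<lambda>p. (?x p)^2)" using sx by auto
    have "(LINT p|MM T. (?x p)^2) = (LINT t|tm T. LINT z|cm. (?x (t, z))^2)" by (rule MM_integral[OF ix])
    also have "\<dots> \<le> (LINT t|tm T. C * indicator A t)"
    proof (rule integral_mono_AE[OF integrable_MM_fst[OF ix]])
      show "integrable (tm T) (\<lambda>t. C * indicator A t :: real)" using mA by (intro integrable_mult_right integrable_real_indicator) (auto simp: less_top[symmetric])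
      show "AE t in tm T. (LINT z|cm. (?x (t, z))^2) \<le> C * indicator A t"
        using AE_tm_range
      proof eventually_elim
        case (elim t)
        have "(LINT z|cm. (x k (stp (tau k) t) z)^2) \<le> C"
          using C[OF stp_less[OF tau N, of t]] elim by (simp add: ip_self)
        then show ?case by (simp add: lift_def power_mult_distrib indicator_def)
      qed
    qed
    also have "\<dots> = C * m" using mA by (simp add: m_def)
    finally have "(LINT p|MM T. (?x p)^2) \<le> C * m" .
    from Cauchy_Schwarz_abs[OF sx s\<phi> this, of I]
    have "\<bar>LINT p|MM T. ?x p * ?\<phi> p\<bar> \<le> sqrt (C * m * I)" by (simp add: I2)
    moreover have "(LINT p|MM T. ?x p * ?\<phi> p) = (LINT p|MM T. lift (tau k) (x k) p * ?\<phi> p)"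
      by (rule Bochner_Integration.integral_cong) (auto simp: indicator_def)
    ultimately show ?thesis by simp
  qed
  have "I \<le> sqrt (C * m * I)"
    unfolding I_def[symmetric]
    by (rule tendsto_upperbound[OF wconvD[OF w s\<phi>, folded I_def] always_eventually ultra_not_bot[OF F]]) (simp add: bk)
  then have "I^2 \<le> (sqrt (C * m * I))^2" using I0 by (intro power_mono)
  then have "I * I \<le> (C * m) * I" using I0 C0 by (simp add: power2_eq_square m_def)
  then have ICm: "I \<le> C * m" using I0 C0 by (cases "I = 0") (auto simp: m_def)
  let ?g = "\<lambda>t. indicator A t * ((LINT z|cm. (X (t, z))^2) - C)"
  have iA: "integrable (tm T) (\<lambda>t. indicator A t * (LINT z|cm. (X (t, z))^2))"
    by (rule integrable_indicator_mult[OF integrable_MM_fst[OF iX]]) (use mA in simp)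
  have iC: "integrable (tm T) (\<lambda>t. indicator A t * C)"
    using mA by (intro integrable_mult_left integrable_real_indicator) (auto simp: less_top[symmetric])
  have ig: "integrable (tm T) ?g" unfolding right_diff_distrib by (rule Bochner_Integration.integrable_diff[OF iA iC])
  have g0: "0 \<le> ?g t" for t by (simp add: indicator_def A_def)
  have "(LINT t|tm T. ?g t) = (LINT t|tm T. indicator A t * (LINT z|cm. (X (t, z))^2)) - (LINT t|tm T. indicator A t * C)"
    unfolding right_diff_distrib by (rule Bochner_Integration.integral_diff[OF iA iC])
  moreover have "(LINT t|tm T. indicator A t * C) = C * m" using mA by (simp add: m_def mult.commute)
  moreover have "I = (LINT t|tm T. indicator A t * (LINT z|cm. (X (t, z))^2))"
  proof -
    have ip: "integrable (MM T) (\<lambda>p. (?\<phi> p)^2)" using s\<phi> by auto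
    show ?thesis unfolding I2 MM_integral[OF ip] by (rule Bochner_Integration.integral_cong) (auto simp: indicator_def)
  qed
  ultimately have "(LINT t|tm T. ?g t) \<le> 0" using ICm by (simp add: m_def mult.commute)
  moreover have "0 \<le> (LINT t|tm T. ?g t)" using g0 by simp
  ultimately have "(LINT t|tm T. ?g t) = 0" by simp
  with integral_nonneg_eq_0_iff_AE[OF ig] g0 have "AE t in tm T. ?g t = 0" by simp
  then show ?thesis
  proof eventually_elim
    case (elim t)
    then show ?case by (cases "t \<in> A") (auto simp: A_def)
  qed
qed

lemma tendsto_of_bound:
  fixes a b e :: "nat \<Rightarrow> real"
  assumes "\<And>k. \<bar>a k - b k\<bar> \<le> e k" "(e \<longlongrightarrow> 0) F" "(b \<longlongrightarrow> c) F" shows "(a \<longlongrightarrow> c) F"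
proof -
  have "((\<lambda>k. a k - b k) \<longlongrightarrow> 0) F" by (rule Lim_null_comparison[OF _ assms(2)]) (simp add: assms(1))
  from tendsto_add[OF this assms(3)] show ?thesis by simp
qed

section \<open>Passage to the limit\<close>

text \<open>A sequence of schemes with \<open>d\<close> tending to 0 and coefficients and sources
  converging almost everywhere. In \<open>small\<close>, the condition on \<open>KR\<close> is the
  one of \<open>energy_bound\<close>; those on \<open>KH\<close> and \<open>KV\<close> make the
  error in \<open>lift_summation_by_parts\<close> vanish although these constants may grow.
  \<open>K\<close> bounds \<open>f\<close>, and \<open>e0\<close> bounds all initial energies. For
  the initial velocities, weak convergence is asked.\<close>

locale schemes =
  fixes Fi :: "nat filter" and T p r0 r1 \<nu>0 \<nu>1 J K e0 B :: real
    and d tau :: "nat \<Rightarrow> real" and N :: "nat \<Rightarrow> nat" and rk \<nu>k :: "nat \<Rightarrow> real \<Rightarrow> real"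
    and jk :: "nat \<Rightarrow> nat \<Rightarrow> 2 \<Rightarrow> real \<Rightarrow> real" and fk :: "nat \<Rightarrow> nat \<Rightarrow> real \<Rightarrow> real"
    and h0 :: "2 \<Rightarrow> real \<Rightarrow> real" and v0 :: "nat \<Rightarrow> real \<Rightarrow> real" and u0 :: "real \<Rightarrow> real"
    and r \<nu> :: "real \<Rightarrow> real" and j :: "2 \<Rightarrow> real \<times> real \<Rightarrow> real" and f :: "real \<times> real \<Rightarrow> real" and u1 :: "real \<Rightarrow> real"
  assumes Fi: "ultra Fi" and T: "0 < T"
    and sch: "\<And>k. scheme (d k) (tau k) p r0 r1 \<nu>0 \<nu>1 J K (rk k) (\<nu>k k) (jk k) (fk k) h0 (v0 k) u0"
    and N: "\<And>k. real (N k) * tau k = T" and d0: "d \<longlonglongrightarrow> 0"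
    and B_def: "B = exp T * (e0 + T * (2 * p * r1 * J^2 + K^2 + 1))"
    and E0: "\<And>k. p * (\<Sum>l\<in>UNIV. nsq (h0 l)) + (1/2) * nsq (v0 k)
      + (1/2) * nsq (\<lambda>z. \<nu>k k z * Dp (d k) u0 z) \<le> e0"
    and small: "\<And>k. tau k * scheme.KR (d k) p r1 \<nu>1 J K B \<le> 1" "\<And>k. tau k \<le> d k"
      "\<And>k. tau k * sqrt (scheme.KH (d k) p r1 J B) \<le> d k" "\<And>k. tau k * sqrt (scheme.KV (d k) p \<nu>1 K B) \<le> d k"
    and br: "r \<in> Borel" "\<And>z. \<bar>r z\<bar> \<le> r1" "AE x in MM T. (\<lambda>k. rk k (snd x)) \<longlonglongrightarrow> r (snd x)"
    and b\<nu>: "\<nu> \<in> Borel" "\<And>z. \<bar>\<nu> z\<bar> \<le> \<nu>1" "AE x in MM T. (\<lambda>k. \<nu>k k (snd x)) \<longlonglongrightarrow> \<nu> (snd x)"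
    and bj: "\<And>l. j l \<in> Borel" "\<And>l x. \<bar>j l x\<bar> \<le> J"
      "\<And>l. AE x in MM T. (\<lambda>k. lift (tau k) (\<lambda>n. jk k n l) x) \<longlonglongrightarrow> j l x"
    and bf: "f \<in> Borel" "\<And>x. \<bar>f x\<bar> \<le> K" "AE x in MM T. (\<lambda>k. lift (tau k) (fk k) x) \<longlonglongrightarrow> f x"
    and u1: "\<And>w. sqi cm w \<Longrightarrow> ((\<lambda>k. LINT z|cm. v0 k z * w z) \<longlongrightarrow> (LINT z|cm. u1 z * w z)) Fi"
begin

sublocale S: scheme "d k" "tau k" p r0 r1 \<nu>0 \<nu>1 J K "rk k" "\<nu>k k" "jk k" "fk k" h0 "v0 k" u0 for k
  by (rule sch)

abbreviation "lf k \<equiv> lift (tau k)"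

abbreviation "Ah k l \<equiv> lf k (\<lambda>n. S.AH k n l)"
abbreviation "NU k \<equiv> lf k (\<lambda>n. Am (d k) (S.FU k n))"

lemma e_start: "S.E k 0 \<le> e0" using E0[of k] unfolding S.E_def S.zero .

lemma energy: "n \<le> N k \<Longrightarrow> S.E k n + p * r0 * (tau k * (\<Sum>i<n. S.Q k i)) \<le> B"
  using S.energy_bound[OF e_start[of k] N[of k], of n] small(1)[of k] unfolding B_def by blast

lemma Q_nonneg: "0 \<le> S.Q k i" unfolding S.Q_def by (intro sum_nonneg ip_nonneg)

lemma E_le: assumes "n \<le> N k" shows "S.E k n \<le> B"
proof -
  have "0 \<le> p * r0 * (tau k * (\<Sum>i<n. S.Q k i))"
    using S.p S.r0 S.tau[of k] by (intro mult_nonneg_nonneg sum_nonneg Q_nonneg) auto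
  then show ?thesis using energy[OF assms] by linarith
qed

lemma B0: "0 \<le> B" using S.E_parts(5)[OF E_le[of 0]] by simp

lemma Dsum: "tau k * (\<Sum>n<N k. nsq (S.DH k n l)) \<le> B / (p * r0)"
proof -
  have "0 \<le> S.E k (N k)" unfolding S.E_def using S.p by (intro add_nonneg_nonneg mult_nonneg_nonneg sum_nonneg ip_nonneg) auto
  then have "p * r0 * (tau k * (\<Sum>i<N k. S.Q k i)) \<le> B" using energy[of "N k" k] by simp
  then have 1: "tau k * (\<Sum>i<N k. S.Q k i) \<le> B / (p * r0)" using S.p S.r0 by (simp add: pos_le_divide_eq mult.commute)
  have "tau k * (\<Sum>n<N k. nsq (S.DH k n l)) \<le> tau k * (\<Sum>i<N k. S.Q k i)"
    using S.tau[of k] unfolding S.Q_def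
    by (intro mult_left_mono sum_mono member_le_sum ip_nonneg) auto
  with 1 show ?thesis by linarith
qed

definition "D0 = B / (p * r0)"

lemma sum_const: assumes "\<And>n. n < N k \<Longrightarrow> x n \<le> C" shows "tau k * (\<Sum>n<N k. x n) \<le> T * C"
proof -
  have "(\<Sum>n<N k. x n) \<le> (\<Sum>n<N k. C)" by (rule sum_mono) (use assms in auto)
  then have "tau k * (\<Sum>n<N k. x n) \<le> tau k * (real (N k) * C)" using S.tau[of k] by (intro mult_left_mono) auto
  also have "\<dots> = T * C" using N[of k] by (simp add: mult.commute mult.left_commute)
  finally show ?thesis .
qed

text \<open>Converts bounds on single steps that are affine in \<open>nsq (S.DH k n l)\<close> into
  bounds over the whole time interval, by the dissipation estimate \<open>Dsum\<close>.\<close>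

lemma sum_affine:
  assumes x: "\<And>n. n < N k \<Longrightarrow> x n \<le> a + b * nsq (S.DH k n l)" and b: "0 \<le> b"
  shows "tau k * (\<Sum>n<N k. x n) \<le> T * a + b * D0"
proof -
  let ?q = "\<lambda>n. nsq (S.DH k n l)"
  have "tau k * (\<Sum>n<N k. x n - b * ?q n) \<le> T * a" by (rule sum_const) (use x in \<open>simp add: algebra_simps\<close>)
  moreover have "tau k * (\<Sum>n<N k. x n - b * ?q n) = tau k * (\<Sum>n<N k. x n) - b * (tau k * (\<Sum>n<N k. ?q n))"
    by (simp add: sum_subtractf sum_distrib_left right_diff_distrib mult.left_commute)
  moreover have "b * (tau k * (\<Sum>n<N k. ?q n)) \<le> b * D0" unfolding D0_def by (rule mult_left_mono[OF Dsum b])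
  ultimately show ?thesis by linarith
qed

lemma H_ip: "n \<le> N k \<Longrightarrow> nsq (S.H k n l) \<le> B / p" by (rule S.E_parts(1)[OF E_le])
lemma V_ip: "n \<le> N k \<Longrightarrow> nsq (S.V k n) \<le> 2 * B" by (rule S.E_parts(2)[OF E_le])
lemma q_ip: "n \<le> N k \<Longrightarrow> nsq (S.DU k n) \<le> 2 * B / \<nu>0^2" by (rule S.E_parts(4)[OF E_le])

definition "CG = T * (4 * ((2 * (B / p)) * (2 * B)) + 2 * (r1 * J)^2) + (4 * r1^2 + 4 * (2 * (2 * B))) * D0"

lemma G_sum: "tau k * (\<Sum>n<N k. nsq (S.gG k n l)) \<le> CG"
  unfolding CG_def
proof (rule sum_affine)
  fix n assume "n < N k"
  then have "S.E k n \<le> B" by (intro E_le) simp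
  from S.product_bounds(3)[OF this, of l]
  show "nsq (S.gG k n l) \<le> 4 * ((2 * (B / p)) * (2 * B)) + 2 * (r1 * J)^2
      + (4 * r1^2 + 4 * (2 * (2 * B))) * nsq (S.DH k n l)"
    by (simp add: distrib_left distrib_right algebra_simps)
qed (use B0 in simp)

lemma HV_sum: "tau k * (\<Sum>n<N k. nsq (\<lambda>z. S.AH k n l z * S.V k n z))
    \<le> T * ((2 * (B / p)) * (2 * B)) + (2 * (2 * B)) * D0"
proof (rule sum_affine)
  fix n assume "n < N k"
  then have "S.E k n \<le> B" by (intro E_le) simp
  from S.product_bounds(1)[OF this, of l]
  show "nsq (\<lambda>z. S.AH k n l z * S.V k n z)
    \<le> (2 * (B / p)) * (2 * B) + (2 * (2 * B)) * nsq (S.DH k n l)"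
    by (simp add: algebra_simps)
qed (use B0 in simp)

lemma HH_sum: "tau k * (\<Sum>n<N k. nsq (\<lambda>z. S.AH k n l z * S.AH k n l z))
    \<le> T * ((2 * (B / p)) * (B / p)) + (2 * (B / p)) * D0"
proof (rule sum_affine)
  fix n assume "n < N k"
  then have "S.E k n \<le> B" by (intro E_le) simp
  note 1 = S.product_bounds(2)[OF this, of l]
  have "(2 * c + 2 * x) * c = (2 * c) * c + (2 * c) * x" for c x :: real by (simp add: algebra_simps)
  from 1[unfolded this]
  show "nsq (\<lambda>z. S.AH k n l z * S.AH k n l z)
    \<le> (2 * (B / p)) * (B / p) + (2 * (B / p)) * nsq (S.DH k n l)" .
qed (use B0 S.p in simp)

lemma bddL2s:
  "bddL2 (MM T) (\<lambda>k. lf k (\<lambda>n. S.H k n l))"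
  "bddL2 (MM T) (\<lambda>k. lf k (\<lambda>n. S.DH k n l))"
  "bddL2 (MM T) (\<lambda>k. lf k (S.V k))"
  "bddL2 (MM T) (\<lambda>k. lf k (\<lambda>n. S.DU k n))"
  "bddL2 (MM T) (\<lambda>k. lf k (S.U k))"
proof -
  show "bddL2 (MM T) (\<lambda>k. lf k (\<lambda>n. S.H k n l))"
    by (rule lift_bddL2[OF S.tau N S.cper_st(1) sum_const[OF H_ip[OF less_imp_le]]])
  show "bddL2 (MM T) (\<lambda>k. lf k (\<lambda>n. S.DH k n l))"
    by (rule lift_bddL2[OF S.tau N S.cper_D(1) Dsum])
  show "bddL2 (MM T) (\<lambda>k. lf k (S.V k))"
    by (rule lift_bddL2[OF S.tau N S.cper_st(2) sum_const[OF V_ip[OF less_imp_le]]])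
  show "bddL2 (MM T) (\<lambda>k. lf k (\<lambda>n. S.DU k n))"
    by (rule lift_bddL2[OF S.tau N S.cper_D(3) sum_const[OF q_ip[OF less_imp_le]]])
  show "bddL2 (MM T) (\<lambda>k. lf k (S.U k))"
    by (rule lift_bddL2[OF S.tau N S.cper_st(3) sum_const[OF S.U_bound[OF V_ip[OF less_imp_le] N less_imp_le]]])
qed

definition h where "h l = (SOME X. wconv Fi (MM T) (\<lambda>k. lf k (\<lambda>n. S.H k n l)) X)"
definition g where "g l = (SOME X. wconv Fi (MM T) (\<lambda>k. lf k (\<lambda>n. S.DH k n l)) X)"
definition v where "v = (SOME X. wconv Fi (MM T) (\<lambda>k. lf k (S.V k)) X)"
definition q where "q = (SOME X. wconv Fi (MM T) (\<lambda>k. lf k (\<lambda>n. S.DU k n)) X)"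
text \<open>The displacement is built from the limit velocity, so that \<open>u_t = v\<close> and
  the initial value hold by construction; \<open>wU\<close> shows that it is also the weak limit of
  the discrete displacements.\<close>

definition u where "u x = u0 (snd x) + tprim T v x"

lemma wh: "wconv Fi (MM T) (\<lambda>k. lf k (\<lambda>n. S.H k n l)) (h l)"
  unfolding h_def by (rule someI_ex[OF MMf.weak_limit_exists[OF Fi bddL2s(1)]])
lemma wg: "wconv Fi (MM T) (\<lambda>k. lf k (\<lambda>n. S.DH k n l)) (g l)"
  unfolding g_def by (rule someI_ex[OF MMf.weak_limit_exists[OF Fi bddL2s(2)]])
lemma wv: "wconv Fi (MM T) (\<lambda>k. lf k (S.V k)) v"
  unfolding v_def by (rule someI_ex[OF MMf.weak_limit_exists[OF Fi bddL2s(3)]])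
lemma wq: "wconv Fi (MM T) (\<lambda>k. lf k (\<lambda>n. S.DU k n)) q"
  unfolding q_def by (rule someI_ex[OF MMf.weak_limit_exists[OF Fi bddL2s(4)]])

lemmas hs = wconv_sqi[OF wh] and gs = wconv_sqi[OF wg] and vs = wconv_sqi[OF wv] and qs = wconv_sqi[OF wq]

lemmas wAh = wconv_Av_Am(1)[OF Fi S.tau N S.d d0 S.cper_st(1) sum_const[OF H_ip[OF less_imp_le]] wh]
  and bAh = wconv_Av_Am(3)[OF Fi S.tau N S.d d0 S.cper_st(1) sum_const[OF H_ip[OF less_imp_le]] wh]

lemma tau0: "tau \<longlonglongrightarrow> 0"
  by (rule tendsto_sandwich[OF _ _ tendsto_const d0]) (use S.tau small(2) in \<open>auto intro!: always_eventually less_imp_le\<close>)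

text \<open>The compactness theorem is applied to \<open>A h\<close>, whose exact derivative is
  \<open>D h\<close>. The rate of \<open>A h\<close> is \<open>A (yH)\<close>; since
  \<open>yH\<close> is the derivative of \<open>Am G\<close>, this rate is the derivative of
  \<open>A (Am G)\<close>, whose norm is at most that of \<open>G\<close>.\<close>

lemma strong_h: "((\<lambda>k. LINT x|MM T. (Ah k l x - h l x)^2) \<longlongrightarrow> 0) Fi"
proof (rule strong_convergence[OF Fi T _ tau0 wAh])
  fix k
  let ?C = "max (B / p) (max D0 CG)"
  have Y: "cper (Am (d k) (S.gG k n l))" for n by (rule cper_Am[OF S.cper_y(3) S.d(1)])
  have e: "Av (d k) (S.yH k n l) z = Dp (d k) (Am (d k) (S.gG k n l)) z" for n z
    unfolding Av_antideriv(1)[OF S.Am_G_deriv cper_continuous[OF S.cper_y(1)] S.d(1)] Dp_def ..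
  have st: "Av (d k) (S.H k (Suc n) l) z = S.AH k n l z + tau k * Dp (d k) (Am (d k) (S.gG k n l)) z" for n z
    unfolding S.step Av_add_scaled[OF S.cper_st(1) S.cper_y(1)] e ..
  have 1: "nsq (S.AH k n l) \<le> ?C" if "n \<le> N k" for n
    using order_trans[OF Av_ip_le[OF S.cper_st(1) S.d] H_ip[OF that]] by (simp add: le_max_iff_disj)
  have 2: "tau k * (\<Sum>n<N k. nsq (S.DH k n l)) \<le> ?C"
    using Dsum[of k l, folded D0_def] by (simp add: le_max_iff_disj)
  have "nsq (Av (d k) (Am (d k) (S.gG k n l))) \<le> nsq (S.gG k n l)" for n
    by (rule order_trans[OF Av_ip_le[OF Y S.d] Am_ip_le[OF S.cper_y(3) S.d]])
  then have "tau k * (\<Sum>n<N k. nsq (Av (d k) (Am (d k) (S.gG k n l)))) \<le> tau k * (\<Sum>n<N k. nsq (S.gG k n l))"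
    using S.tau[of k] by (intro mult_left_mono sum_mono) auto
  then have 3: "tau k * (\<Sum>n<N k. nsq (Av (d k) (Am (d k) (S.gG k n l)))) \<le> ?C"
    using G_sum[of k l] by (simp add: le_max_iff_disj)
  show "cpt T ?C (tau k) (N k) (\<lambda>n. S.AH k n l) (\<lambda>n. S.DH k n l)
    (\<lambda>n. Av (d k) (Am (d k) (S.gG k n l))) (\<lambda>n. Dp (d k) (Am (d k) (S.gG k n l)))"
    unfolding cpt_def
    by (intro conjI allI impI S.tau N S.cper_D cper_Av Y S.d cper_Dp S.Av_H_deriv st 1 2 3
        Av_deriv(1)[OF cper_continuous[OF Y]])
qed

lemma sAh: "sqi (MM T) (Ah k l)" by (rule bddL2_sqi[OF bAh])

definition \<Gamma> where "\<Gamma> l x = (r (snd x) * g l x - h l x * v x) - r (snd x) * j l x"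

lemma lift_borels: "(\<lambda>x. rk k (snd x)) \<in> borel_measurable (borel :: (real \<times> real) measure)"
   "(\<lambda>x. \<nu>k k (snd x)) \<in> borel_measurable (borel :: (real \<times> real) measure)"
   "(\<lambda>x. r (snd x)) \<in> borel_measurable (borel :: (real \<times> real) measure)"
   "(\<lambda>x. \<nu> (snd x)) \<in> borel_measurable (borel :: (real \<times> real) measure)"
   "lf k (\<lambda>n. jk k n l) \<in> Borel" "lf k (fk k) \<in> Borel"
  by (rule measurable_compose[OF borel_fst_snd(2) cper_borel[OF S.cr]] measurable_compose[OF borel_fst_snd(2) cper_borel[OF S.c\<nu>]]
     measurable_compose[OF borel_fst_snd(2) br(1)] measurable_compose[OF borel_fst_snd(2) b\<nu>(1)]
     borel_lift[of "\<lambda>n. jk k n l", OF cper_borel[OF S.cj]] borel_lift[of "fk k", OF cper_borel[OF S.cf]])+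

lemma rk_abs: "\<bar>rk k z\<bar> \<le> r1" using S.rb[of k z] S.r0 by simp
lemma \<nu>k_abs: "\<bar>\<nu>k k z\<bar> \<le> \<nu>1" using S.\<nu>b[of k z] S.\<nu>0 by simp

lemma wHV: "wconv Fi (MM T) (\<lambda>k x. Ah k l x * lf k (S.V k) x) (\<lambda>x. h l x * v x)"
proof (rule wconv_product[OF Fi bddL2s(3) wv sAh hs strong_h])
  have "bddL2 (MM T) (\<lambda>k. lf k (\<lambda>n z. S.AH k n l z * S.V k n z))"
    by (rule lift_bddL2[OF S.tau N cper_mult[OF S.cper_D(4) S.cper_st(2)] HV_sum])
  then show "bddL2 (MM T) (\<lambda>k x. Ah k l x * lf k (S.V k) x)"
    by (simp only: lift_def[abs_def])
qed

lemma wHH: "wconv Fi (MM T) (\<lambda>k x. Ah k l x * Ah k l x) (\<lambda>x. h l x * h l x)"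
proof (rule wconv_product[OF Fi bAh wAh sAh hs strong_h])
  have "bddL2 (MM T) (\<lambda>k. lf k (\<lambda>n z. S.AH k n l z * S.AH k n l z))"
    by (rule lift_bddL2[OF S.tau N cper_mult[OF S.cper_D(4) S.cper_D(4)] HH_sum])
  then show "bddL2 (MM T) (\<lambda>k x. Ah k l x * Ah k l x)"
    by (simp only: lift_def[abs_def])
qed

lemma wrj: "wconv Fi (MM T) (\<lambda>k x. rk k (snd x) * lf k (\<lambda>n. jk k n l) x) (\<lambda>x. r (snd x) * j l x)"
proof (rule wconv_bounded_pointwise[OF Fi])
  have J0: "0 \<le> J" using bj(2)[of 1 undefined] by linarith
  have r10: "0 \<le> r1" using br(2)[of 0] by linarith
  show "\<bar>rk k (snd x) * lf k (\<lambda>n. jk k n l) x\<bar> \<le> r1 * J" for k x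
    unfolding abs_mult lift_def by (intro mult_mono rk_abs S.jb r10) simp
  show "\<bar>r (snd x) * j l x\<bar> \<le> r1 * J" for x
    unfolding abs_mult by (intro mult_mono br(2) bj(2) r10) simp
  show "AE x in MM T. (\<lambda>k. rk k (snd x) * lf k (\<lambda>n. jk k n l) x) \<longlonglongrightarrow> r (snd x) * j l x"
    using br(3) bj(3)[of l] by eventually_elim (rule tendsto_mult)
qed (intro borel_measurable_times lift_borels bj(1))+

lemma wrg: "wconv Fi (MM T) (\<lambda>k x. rk k (snd x) * lf k (\<lambda>n. S.DH k n l) x) (\<lambda>x. r (snd x) * g l x)"
  by (rule wconv_mult_bounded[OF Fi bddL2s(2) wg lift_borels(1,3) rk_abs br(2,3)])

lemma wG: "wconv Fi (MM T) (\<lambda>k. lf k (\<lambda>n. S.gG k n l)) (\<Gamma> l)"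
proof -
  have s1: "sqi (MM T) (\<lambda>x. rk k (snd x) * lf k (\<lambda>n. S.DH k n l) x)" for k
    by (rule sqi_bounded_mult[OF bddL2_sqi[OF bddL2s(2)] borel_MMI[OF lift_borels(1)] AE_I2[OF rk_abs]])
  have s2: "sqi (MM T) (\<lambda>x. Ah k l x * lf k (S.V k) x)" for k
    using lift_sqi(1)[OF S.tau N cper_mult[OF S.cper_D(4) S.cper_st(2)]] by (simp only: lift_def[abs_def])
  have s3: "sqi (MM T) (\<lambda>x. rk k (snd x) * lf k (\<lambda>n. jk k n l) x)" for k
    by (rule sqi_bounded_mult[OF lift_sqi(1)[OF S.tau N S.cj] borel_MMI[OF lift_borels(1)] AE_I2[OF rk_abs]])
  have "lf k (\<lambda>n. S.gG k n l) = (\<lambda>x. (rk k (snd x) * lf k (\<lambda>n. S.DH k n l) x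
      - Ah k l x * lf k (S.V k) x) - rk k (snd x) * lf k (\<lambda>n. jk k n l) x)" for k
    by (simp add: lift_def[abs_def] S.gG_def S.G_def)
  then show ?thesis unfolding \<Gamma>_def[abs_def]
    using wconv_diff[OF wconv_diff[OF wrg wHV s1 s2] wrj sqi_diff[OF s1 s2] s3] by simp
qed

lemmas wAG = wconv_Av_Am(2)[OF Fi S.tau N S.d d0 S.cper_y(3) G_sum wG]

lemma wN: "wconv Fi (MM T) (\<lambda>k. NU k) (\<lambda>x. (\<nu> (snd x))^2 * q x)"
proof -
  have 1: "tau k * (\<Sum>n<N k. nsq (S.FU k n)) \<le> T * ((\<nu>1^2)^2 * (2 * B / \<nu>0^2))" for k
  proof (rule sum_const)
    fix n assume n: "n < N k"
    have "nsq (S.FU k n) \<le> (\<nu>1^2)^2 * nsq (S.DU k n)"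
      by (rule ip_bounded_mult_le[OF cper_power[OF S.c\<nu>] S.cper_D(3)]) (metis \<nu>k_abs abs_ge_zero power2_abs power_mono power_abs)
    also have "\<dots> \<le> (\<nu>1^2)^2 * (2 * B / \<nu>0^2)" by (rule mult_left_mono[OF q_ip[OF less_imp_le[OF n]]]) simp
    finally show "nsq (S.FU k n) \<le> (\<nu>1^2)^2 * (2 * B / \<nu>0^2)" .
  qed
  have 2: "wconv Fi (MM T) (\<lambda>k x. (\<nu>k k (snd x))^2 * lf k (\<lambda>n. S.DU k n) x) (\<lambda>x. (\<nu> (snd x))^2 * q x)"
  proof (rule wconv_mult_bounded[OF Fi bddL2s(4) wq, of _ _ "\<nu>1^2"])
    show "\<bar>(\<nu>k k (snd x))^2\<bar> \<le> \<nu>1^2" "\<bar>(\<nu> (snd x))^2\<bar> \<le> \<nu>1^2" for k and x :: "real \<times> real"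
      using power_mono[OF \<nu>k_abs abs_ge_zero, of k "snd x" 2] power_mono[OF b\<nu>(2) abs_ge_zero, of "snd x" 2] by simp_all
    show "AE x in MM T. (\<lambda>k. (\<nu>k k (snd x))^2) \<longlonglongrightarrow> (\<nu> (snd x))^2" using b\<nu>(3) by eventually_elim (rule tendsto_power)
  qed (intro borel_measurable_power lift_borels)+
  have "wconv Fi (MM T) (\<lambda>k. lf k (\<lambda>n z. (\<nu>k k z)^2 * S.DU k n z)) (\<lambda>x. (\<nu> (snd x))^2 * q x)"
    using 2 by (simp only: lift_def[abs_def])
  from wconv_Av_Am(2)[OF Fi S.tau N S.d d0 S.cper_D(7) 1 this] show ?thesis .
qed

end

text \<open>
  Here \<open>g\<close>, \<open>v\<close> and \<open>q\<close> stand for \<open>h_z\<close>, \<open>u_t\<close> and \<open>u_z\<close>; the test function is \<open>tback T w\<close>, so that \<open>w\<close> and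
  \<open>k\<close> are its derivatives in \<open>t\<close> and \<open>z\<close>.
\<close>

definition weak_form where
  "weak_form T p r \<nu> j f h0 u0 u1 h g v q \<longleftrightarrow>
     (\<forall>l::2. zpair T (h l) (g l)) \<and> sqi (MM T) v \<and> zpair T (\<lambda>x. u0 (snd x) + tprim T v x) q \<and>
     (\<exists>C. \<forall>l. AE t in tm T. (LINT z|cm. (h l (t, z))^2) \<le> C) \<and>
     (\<forall>l w k. sqi (MM T) w \<and> zpair T (tback T w) k \<longrightarrow>
        - (LINT x|MM T. h l x * w x) - (LINT z|cm. h0 l z * tback T w (0, z))
        = - (LINT x|MM T. ((r (snd x) * g l x - h l x * v x) - r (snd x) * j l x) * k x) \<and>
          integrable (MM T) (\<lambda>x. h l x * v x * k x)) \<and>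
     (\<forall>w k. sqi (MM T) w \<and> zpair T (tback T w) k \<longrightarrow>
        - (LINT x|MM T. v x * w x) - (LINT z|cm. u1 z * tback T w (0, z))
        = - (LINT x|MM T. (\<nu> (snd x))^2 * q x * k x) + p * (\<Sum>l\<in>(UNIV :: 2 set). LINT x|MM T. h l x * h l x * k x)
          + (LINT x|MM T. f x * tback T w x) \<and>
          (\<forall>l. integrable (MM T) (\<lambda>x. h l x * h l x * k x)))"

context schemes begin

text \<open>The limit of \<open>lift_summation_by_parts\<close>, in a form that serves all three
  unknowns; \<open>small\<close> makes the Euler error vanish.\<close>

lemma balance:
  assumes x: "\<And>k n. cper (x k n)" and y: "\<And>k n. cper (y k n)" and step: "\<And>k n z. x k (Suc n) z = x k n z + tau k * y k n z"
    and w: "sqi (MM T) w" and Y: "\<And>k n. n < N k \<Longrightarrow> nsq (y k n) \<le> Y k"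
    and small: "((\<lambda>k. tau k * sqrt (Y k)) \<longlongrightarrow> 0) Fi"
    and I0: "((\<lambda>k. LINT z|cm. x k 0 z * tback T w (0, z)) \<longlongrightarrow> I0) Fi"
    and L: "((\<lambda>k. LINT x|MM T. lf k (y k) x * tback T w x) \<longlongrightarrow> L) Fi"
  shows "((\<lambda>k. LINT z|MM T. lf k (x k) z * w z) \<longlongrightarrow> - I0 - L) Fi"
proof -
  let ?W = "LINT x|MM T. (w x)^2"
  have b: "\<bar>(LINT z|MM T. lf k (x k) z * w z) - (- (LINT z|cm. x k 0 z * tback T w (0, z)) - (LINT z|MM T. lf k (y k) z * tback T w z))\<bar>
    \<le> tau k * sqrt (Y k) * sqrt (T * ?W)" for k
  proof -
    have "tau k * sqrt (T * Y k * ?W) = tau k * sqrt (Y k) * sqrt (T * ?W)" by (simp add: real_sqrt_mult)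
    with lift_summation_by_parts[where x="x k" and y="y k", OF S.tau N T x y step w sqi_MM_borel[OF w] Y]
    show ?thesis by (simp add: abs_le_iff)
  qed
  have e: "((\<lambda>k. tau k * sqrt (Y k) * sqrt (T * ?W)) \<longlongrightarrow> 0) Fi" using tendsto_mult_left_zero[OF small] .
  show ?thesis by (rule tendsto_of_bound[OF b e]) (intro tendsto_diff tendsto_minus I0 L)
qed

lemma small_lim: assumes "\<And>k. tau k * sqrt (Y k) \<le> d k" "\<And>k. 0 \<le> Y k" shows "((\<lambda>k. tau k * sqrt (Y k)) \<longlongrightarrow> 0) Fi"
proof (rule ultra_tendsto[OF Fi], rule tendsto_sandwich[OF _ _ tendsto_const d0])
  show "eventually (\<lambda>k. 0 \<le> tau k * sqrt (Y k)) sequentially" using mult_nonneg_nonneg[OF less_imp_le[OF S.tau] real_sqrt_ge_zero[OF assms(2)]] by (simp add: always_eventually)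
  show "eventually (\<lambda>k. tau k * sqrt (Y k) \<le> d k) sequentially" using assms(1) by (auto intro!: always_eventually)
qed

lemma KH_nonneg: "0 \<le> scheme.KH (d k) p r1 J B"
  using order_trans[OF ip_nonneg S.residual_bounds(1)[OF E_le[of 0]]] by simp
lemma KV_nonneg: "0 \<le> scheme.KV (d k) p \<nu>1 K B"
  using order_trans[OF ip_nonneg S.residual_bounds(2)[OF E_le[of 0]]] by simp

lemma h_balance:
  assumes w: "sqi (MM T) w" and zp: "zpair T (tback T w) k"
  shows "- (LINT x|MM T. h l x * w x) - (LINT z|cm. h0 l z * tback T w (0, z)) = - (LINT x|MM T. \<Gamma> l x * k x)"
proof -
  have sk: "sqi (MM T) k" using zp by (simp add: zpair_def)
  have L: "((\<lambda>m. LINT x|MM T. lf m (\<lambda>n. S.yH m n l) x * tback T w x) \<longlongrightarrow> - (LINT x|MM T. \<Gamma> l x * k x)) Fi"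
  proof -
    \<comment> \<open>The discrete divergence is an exact \<open>z\<close>-derivative, of
      \<open>Am G\<close>, so it can be moved to a test function that is not smooth.\<close>
    have "(LINT x|MM T. lf m (\<lambda>n. S.yH m n l) x * tback T w x) = - (LINT x|MM T. lf m (\<lambda>n. Am (d m) (S.gG m n l)) x * k x)" for m
      by (rule lift_IBP[OF S.tau N S.Am_G_deriv cper_Am[OF S.cper_y(3) S.d(1)] S.cper_y(1) zp])
    then show ?thesis using tendsto_minus[OF wconvD[OF wAG sk]] by simp
  qed
  have "((\<lambda>m. LINT z|MM T. lf m (\<lambda>n. S.H m n l) z * w z) \<longlongrightarrow> - (LINT z|cm. h0 l z * tback T w (0, z)) - (- (LINT x|MM T. \<Gamma> l x * k x))) Fi"
  proof (rule balance[OF S.cper_st(1) S.cper_y(1) _ w S.residual_bounds(1)[OF E_le[OF less_imp_le]] small_lim[OF small(3) KH_nonneg] _ L])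
    show "S.H m (Suc n) l z = S.H m n l z + tau m * S.yH m n l z" for m n z by (simp add: S.step)
    show "((\<lambda>m. LINT z|cm. S.H m 0 l z * tback T w (0, z)) \<longlongrightarrow> (LINT z|cm. h0 l z * tback T w (0, z))) Fi" by (simp add: S.zero)
  qed
  from tendsto_unique[OF ultra_not_bot[OF Fi] wconvD[OF wh w] this] show ?thesis by simp
qed

lemma v_balance:
  assumes w: "sqi (MM T) w" and zp: "zpair T (tback T w) k"
  shows "- (LINT x|MM T. v x * w x) - (LINT z|cm. u1 z * tback T w (0, z))
    = - (LINT x|MM T. (\<nu> (snd x))^2 * q x * k x) + p * (\<Sum>l\<in>UNIV. LINT x|MM T. h l x * h l x * k x) + (LINT x|MM T. f x * tback T w x)"
proof -
  have sk: "sqi (MM T) k" using zp by (simp add: zpair_def)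
  have sb: "sqi (MM T) (tback T w)" using zp by (simp add: zpair_def)
  \<comment> \<open>\<open>Y\<close> is an antiderivative in \<open>z\<close> of the force without
    \<open>f\<close>: \<open>- Dm\<close> is the derivative of \<open>Am\<close>, and
    \<open>2 p NL\<close> is that of \<open>p |A h|^2\<close>. The \<open>z\<close>-derivative is
    thus on the test function before the limit is taken.\<close>
  define Y where "Y m n z = Am (d m) (S.FU m n) z - p * (\<Sum>l\<in>UNIV. S.AH m n l z * S.AH m n l z)" for m n z
  define Y' where "Y' m n z = - Dm (d m) (S.FU m n) z - 2 * p * S.NL m (S.H m n) z" for m n z
  have cA: "cper (\<lambda>z. S.AH m n l z * S.AH m n l z)" for m n l by (intro cper_mult S.cper_D)
  have cN: "cper (Am (d m) (S.FU m n))" for m n by (rule cper_Am[OF S.cper_D(7) S.d(1)])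
  have cY: "cper (Y m n)" for m n unfolding Y_def[abs_def] by (intro cper_diff cN cper_mult[OF cper_const] cper_sum cA) simp
  have cY': "cper (Y' m n)" for m n unfolding Y'_def[abs_def]
    by (intro cper_diff cper_minus cper_Dm S.cper_D cper_mult[OF cper_const] S.cper_NL S.cper_st)
  have DY: "(Y m n has_real_derivative Y' m n z) (at z)" for m n z
  proof -
    have 1: "(Am (d m) (S.FU m n) has_real_derivative - Dm (d m) (S.FU m n) z) (at z)"
      by (rule Av_deriv(2)[OF cper_continuous[OF S.cper_D(7)] S.d(1)])
    have 2: "((\<lambda>z. S.AH m n l z * S.AH m n l z) has_real_derivative 2 * (S.AH m n l z * S.DH m n l z)) (at z)" for l
      by (rule DERIV_cong[OF DERIV_mult[OF S.Av_H_deriv S.Av_H_deriv]]) simp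
    have 3: "((\<lambda>z. p * (\<Sum>l\<in>UNIV. S.AH m n l z * S.AH m n l z)) has_real_derivative p * (\<Sum>l\<in>UNIV. 2 * (S.AH m n l z * S.DH m n l z))) (at z)"
      by (intro DERIV_cmult DERIV_sum 2)
    have e: "p * (\<Sum>l\<in>UNIV. 2 * (S.AH m n l z * S.DH m n l z)) = 2 * p * S.NL m (S.H m n) z"
      unfolding S.NL_def by (simp add: sum_distrib_left mult.assoc mult.left_commute)
    show ?thesis unfolding Y_def[abs_def] Y'_def using DERIV_diff[OF 1 3] unfolding e .
  qed
  have yV: "S.yV m n z = Y' m n z + fk m n z" for m n z by (simp add: S.yV_def S.YV_def Y'_def)
  have sY': "sqi (MM T) (lf m (Y' m))" for m by (rule lift_sqi(1)[OF S.tau N cY'])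
  have sf: "sqi (MM T) (lf m (fk m))" for m by (rule lift_sqi(1)[OF S.tau N S.cf])
  have wf: "wconv Fi (MM T) (\<lambda>m. lf m (fk m)) f"
    by (rule wconv_bounded_pointwise[OF Fi lift_borels(6) bf(1) _ bf(2,3)]) (simp add: lift_def S.fb)
  have a: "(LINT x|MM T. lf m (S.yV m) x * tback T w x) = (LINT x|MM T. lf m (Y' m) x * tback T w x) + (LINT x|MM T. lf m (fk m) x * tback T w x)" for m
  proof -
    have "lf m (S.yV m) x = lf m (Y' m) x + lf m (fk m) x" for x by (simp add: lift_def yV)
    then show ?thesis using sqi_mult_integrable[OF sY' sb] sqi_mult_integrable[OF sf sb] by (simp add: distrib_right)
  qed
  have b: "(LINT x|MM T. lf m (Y' m) x * tback T w x) = - (LINT x|MM T. lf m (Y m) x * k x)" for m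
    by (rule lift_IBP[OF S.tau N DY cY cY' zp])
  have sN: "sqi (MM T) (NU m)" for m
    by (rule lift_sqi(1)[OF S.tau N cN])
  have sA: "sqi (MM T) (\<lambda>x. Ah m l x * Ah m l x)" for m l
    using lift_sqi(1)[OF S.tau N cA] by (simp only: lift_def[abs_def])
  have c: "(LINT x|MM T. lf m (Y m) x * k x) = (LINT x|MM T. NU m x * k x)
     - p * (\<Sum>l\<in>UNIV. LINT x|MM T. Ah m l x * Ah m l x * k x)" for m
  proof -
    note i1 = sqi_mult_integrable[OF sN sk, of m] and i2 = sqi_mult_integrable[OF sA sk, of m]
    have "lf m (Y m) x * k x = NU m x * k x
      - p * (\<Sum>l\<in>UNIV. Ah m l x * Ah m l x * k x)" for x
      by (simp add: lift_def Y_def left_diff_distrib sum_distrib_right mult.assoc)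
    then show ?thesis using i1 i2 by simp
  qed
  have L: "((\<lambda>m. LINT x|MM T. lf m (S.yV m) x * tback T w x) \<longlongrightarrow>
     - ((LINT x|MM T. (\<nu> (snd x))^2 * q x * k x) - p * (\<Sum>l\<in>UNIV. LINT x|MM T. h l x * h l x * k x)) + (LINT x|MM T. f x * tback T w x)) Fi"
    unfolding a b c
    by (intro tendsto_add tendsto_minus tendsto_diff tendsto_mult tendsto_const tendsto_sum wconvD[OF wN sk] wconvD[OF wHH sk] wconvD[OF wf sb])
  have "((\<lambda>m. LINT z|MM T. lf m (S.V m) z * w z) \<longlongrightarrow> - (LINT z|cm. u1 z * tback T w (0, z)) -
     (- ((LINT x|MM T. (\<nu> (snd x))^2 * q x * k x) - p * (\<Sum>l\<in>UNIV. LINT x|MM T. h l x * h l x * k x)) + (LINT x|MM T. f x * tback T w x))) Fi"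
  proof (rule balance[OF S.cper_st(2) S.cper_y(2) _ w S.residual_bounds(2)[OF E_le[OF less_imp_le]] small_lim[OF small(4) KV_nonneg] _ L])
    show "S.V m (Suc n) z = S.V m n z + tau m * S.yV m n z" for m n z by (simp add: S.step)
    show "((\<lambda>m. LINT z|cm. S.V m 0 z * tback T w (0, z)) \<longlongrightarrow> (LINT z|cm. u1 z * tback T w (0, z))) Fi"
      unfolding S.zero by (rule u1[OF tback_initial(1)[OF T w sqi_MM_borel[OF w]]])
  qed
  from tendsto_unique[OF ultra_not_bot[OF Fi] wconvD[OF wv w] this] show ?thesis by simp
qed

lemma su0: "sqi (MM T) (\<lambda>x. u0 (snd x))" by (rule sqi_MM_snd[OF cper_sqi[OF S.cu0]])

text \<open>The equation \<open>u_t = v\<close> passes to the limit like the other two, with the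
  displacement as \<open>x\<close> and the velocity as \<open>y\<close> in
  \<open>balance\<close>.\<close>

lemma wU: "wconv Fi (MM T) (\<lambda>k. lf k (S.U k)) u"
  unfolding wconv_def
proof (intro conjI allI impI)
  note vb = sqi_MM_borel[OF vs]
  have st: "sqi (MM T) (tprim T v)" by (rule sqi_tprim[OF T vs vb])
  show "sqi (MM T) u" unfolding u_def[abs_def] by (rule sqi_add[OF su0 st])
  fix w assume w: "sqi (MM T) w"
  note wb = sqi_MM_borel[OF w]
  have B2: "((\<lambda>k. tau k * sqrt (2 * B)) \<longlongrightarrow> 0) Fi"
    by (rule ultra_tendsto[OF Fi tendsto_mult_left_zero[OF tau0]])
  have "((\<lambda>m. LINT z|MM T. lf m (S.U m) z * w z) \<longlongrightarrow> - (LINT z|cm. u0 z * tback T w (0, z)) - (LINT x|MM T. v x * tback T w x)) Fi"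
  proof (rule balance[OF S.cper_st(3) S.cper_st(2) _ w V_ip[OF less_imp_le] B2 _ wconvD[OF wv sqi_tback[OF T w wb]]])
    show "S.U m (Suc n) z = S.U m n z + tau m * S.V m n z" for m n z by (simp add: S.step)
    show "((\<lambda>m. LINT z|cm. S.U m 0 z * tback T w (0, z)) \<longlongrightarrow> (LINT z|cm. u0 z * tback T w (0, z))) Fi" by (simp add: S.zero)
  qed
  moreover have "(LINT x|MM T. u x * w x) = - (LINT z|cm. u0 z * tback T w (0, z)) - (LINT x|MM T. v x * tback T w x)"
  proof -
    have "(LINT x|MM T. u x * w x) = (LINT x|MM T. u0 (snd x) * w x) + (LINT x|MM T. tprim T v x * w x)"
      unfolding u_def distrib_right
      by (rule Bochner_Integration.integral_add[OF sqi_mult_integrable[OF su0 w] sqi_mult_integrable[OF st w]])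
    then show ?thesis
      unfolding tback_initial(2)[OF T w wb cper_pL2[OF S.cu0]] tprim_tback[OF T vs vb w wb] by simp
  qed
  ultimately show "((\<lambda>m. LINT z|MM T. lf m (S.U m) z * w z) \<longlongrightarrow> (LINT x|MM T. u x * w x)) Fi" by simp
qed

lemma zpair_u: "zpair T u q"
proof -
  have "tau k * (\<Sum>n<N k. nsq (S.U k n)) \<le> T * (2 * nsq u0 + 2 * (T^2 * (2 * B)))" for k
    by (rule sum_const[OF S.U_bound[OF V_ip[OF less_imp_le] N less_imp_le]])
  note wAU = wconv_Av_Am(1)[OF Fi S.tau N S.d d0 S.cper_st(3) this wU]
  show ?thesis by (rule wconv_zpair[OF Fi T S.tau N cper_Av[OF S.cper_st(3) S.d(1)] S.cper_D(3) S.Av_U_deriv wAU wq])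
qed

lemma zpair_h: "zpair T (h l) (g l)"
  by (rule wconv_zpair[OF Fi T S.tau N S.cper_D(4) S.cper_D(1) S.Av_H_deriv wAh wg])

theorem limit_weak_form: "weak_form T p r \<nu> j f h0 u0 u1 h g v q"
  unfolding weak_form_def
proof (intro conjI allI impI; (elim conjE)?)
  show "zpair T (h l) (g l)" for l by (rule zpair_h)
  show "sqi (MM T) v" by (rule vs)
  show "zpair T (\<lambda>x. u0 (snd x) + tprim T v x) q" using zpair_u unfolding u_def[abs_def] .
  show "\<exists>C. \<forall>l. AE t in tm T. (LINT z|cm. (h l (t, z))^2) \<le> C"
    using wconv_slice_bound[OF Fi T S.tau N S.cper_st(1) H_ip[OF less_imp_le] wh] by blast
next
  fix l w k assume w: "sqi (MM T) w" and zp: "zpair T (tback T w) k"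
  show "- (LINT x|MM T. h l x * w x) - (LINT z|cm. h0 l z * tback T w (0, z))
        = - (LINT x|MM T. ((r (snd x) * g l x - h l x * v x) - r (snd x) * j l x) * k x)"
    using h_balance[OF w zp] unfolding \<Gamma>_def .
  show "integrable (MM T) (\<lambda>x. h l x * v x * k x)"
    using sqi_mult_integrable[OF wconv_sqi[OF wHV]] zp by (simp add: zpair_def)
next
  fix w k assume w: "sqi (MM T) w" and zp: "zpair T (tback T w) k"
  show "- (LINT x|MM T. v x * w x) - (LINT z|cm. u1 z * tback T w (0, z))
        = - (LINT x|MM T. (\<nu> (snd x))^2 * q x * k x) + p * (\<Sum>l\<in>(UNIV :: 2 set). LINT x|MM T. h l x * h l x * k x)
          + (LINT x|MM T. f x * tback T w x)" by (rule v_balance[OF w zp])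
  show "integrable (MM T) (\<lambda>x. h l x * h l x * k x)" for l
    using sqi_mult_integrable[OF wconv_sqi[OF wHH]] zp by (simp add: zpair_def)
qed

end

section \<open>Approximation of the data\<close>

lemma average_near:
  fixes \<phi> :: "real \<Rightarrow> real"
  assumes m: "\<phi> \<in> Borel" and b: "\<And>s. \<bar>\<phi> s\<bar> \<le> B" and d: "0 < d"
    and near: "\<And>s. 0 < s \<Longrightarrow> s < d \<Longrightarrow> \<bar>\<phi> s - c\<bar> \<le> e"
  shows "\<bar>(LINT s|tm d. \<phi> s) / d - c\<bar> \<le> e"
proof -
  have i: "integrable (tm d) \<phi>" by (rule tm.integrable_const_bound[where B=B, OF AE_I2 borel_tmI[OF m]]) (simp add: b)
  have e: "(LINT s|tm d. \<phi> s) - c * d = (LINT s|tm d. \<phi> s - c)"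
    using i d by (simp add: measure_tm)
  have "\<bar>LINT s|tm d. \<phi> s - c\<bar> \<le> (LINT s|tm d. \<bar>\<phi> s - c\<bar>)" by (rule integral_abs_bound)
  also have "\<dots> \<le> (LINT s|tm d. e)"
  proof (rule integral_mono_AE)
    show "AE s in tm d. \<bar>\<phi> s - c\<bar> \<le> e" using AE_tm_range by eventually_elim (use near in blast)
  qed (use i in auto)
  also have "\<dots> = e * d" using d by (simp add: measure_tm)
  finally have "\<bar>(LINT s|tm d. \<phi> s) - c * d\<bar> \<le> e * d" unfolding e .
  then have "\<bar>((LINT s|tm d. \<phi> s) - c * d) / d\<bar> \<le> e" using d by (simp add: pos_divide_le_eq)
  then show ?thesis using d by (simp add: diff_divide_distrib)
qed

lemma Av_near:
  assumes m: "g \<in> Borel" and b: "\<And>s. \<bar>g s\<bar> \<le> B" and d: "0 < d"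
    and near: "\<And>s. 0 < s \<Longrightarrow> s < d \<Longrightarrow> \<bar>g (z + s) - c\<bar> \<le> e"
  shows "\<bar>Av d g z - c\<bar> \<le> e"
  unfolding Av_def by (rule average_near[OF _ b d near]) (rule measurable_compose[OF _ m], simp)

lemma Av_tendsto:
  assumes m: "g \<in> Borel" and b: "\<And>s. \<bar>g s\<bar> \<le> B" and d: "\<And>k. 0 < d k" "d \<longlonglongrightarrow> 0" and c: "isCont g z"
  shows "(\<lambda>k. Av (d k) g z) \<longlonglongrightarrow> g z"
proof (rule tendstoI)
  fix e :: real assume "0 < e"
  then obtain e' where e': "0 < e'" "e' < e" using dense by blast
  from c obtain \<delta> where \<delta>: "0 < \<delta>" "\<And>y. \<bar>y - z\<bar> < \<delta> \<Longrightarrow> \<bar>g y - g z\<bar> < e'"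
    using e' unfolding continuous_at_eps_delta dist_real_def by blast
  have "\<forall>\<^sub>F k in sequentially. d k < \<delta>" by (rule order_tendstoD(2)[OF d(2) \<delta>(1)])
  then show "\<forall>\<^sub>F k in sequentially. dist (Av (d k) g z) (g z) < e"
  proof eventually_elim
    case (elim k)
    have "\<bar>Av (d k) g z - g z\<bar> \<le> e'"
      by (rule Av_near[OF m b d(1)]) (rule less_imp_le[OF \<delta>(2)], use elim in auto)
    then show ?case using e' by (simp add: dist_real_def)
  qed
qed

text \<open>Mean over the \<open>n\<close>-th Euler step at fixed \<open>z\<close>. Followed by
  \<open>Av\<close> it yields means over small boxes, which replace point values of the
  sources.\<close>

definition cell :: "real \<Rightarrow> (real \<times> real \<Rightarrow> real) \<Rightarrow> nat \<Rightarrow> real \<Rightarrow> real" where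
  "cell tau \<phi> n y = (LINT s|tm tau. \<phi> (real n * tau + s, y)) / tau"

lemma cell_near:
  assumes m: "\<phi> \<in> Borel" and b: "\<And>s. \<bar>\<phi> s\<bar> \<le> B" and d: "0 < tau"
    and near: "\<And>s. 0 < s \<Longrightarrow> s < tau \<Longrightarrow> \<bar>\<phi> (real n * tau + s, y) - c\<bar> \<le> e"
  shows "\<bar>cell tau \<phi> n y - c\<bar> \<le> e"
  unfolding cell_def by (rule average_near[OF borel_pair_section[OF m] b d near]) simp_all

lemma cell_props:
  assumes m: "\<phi> \<in> Borel" and b: "\<And>s. \<bar>\<phi> s\<bar> \<le> B" and d: "0 < tau" and per: "\<And>t z. \<phi> (t, z + 1) = \<phi> (t, z)"
  shows "cell tau \<phi> n \<in> Borel" "\<bar>cell tau \<phi> n y\<bar> \<le> B" "periodic1 (cell tau \<phi> n)"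
proof -
  have [measurable]: "\<phi> \<in> borel_measurable (borel \<Otimes>\<^sub>M borel)" using m by (simp add: borel_prod)
  show "cell tau \<phi> n \<in> Borel" unfolding cell_def[abs_def] by measurable
  show "\<bar>cell tau \<phi> n y\<bar> \<le> B" using cell_near[OF m b d, of n y 0 B] b by simp
  show "periodic1 (cell tau \<phi> n)" by (simp add: periodic1_def cell_def per)
qed

lemma bounded_cper_Av:
  assumes m: "g \<in> Borel" and b: "\<And>s. \<bar>g s\<bar> \<le> B" and p: "periodic1 g" and d: "0 < d" "d \<le> 1"
  shows "cper (Av d g)" "\<bar>Av d g z\<bar> \<le> B"
proof -
  have "sqi cm g" by (rule cm.sqi_bounded[where C=B, OF borel_cmI[OF m]]) (simp add: b)
  then show "cper (Av d g)" using continuous_Av[OF _ d] m p by (simp add: pL2_def)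
  show "\<bar>Av d g z\<bar> \<le> B" using Av_near[OF m b d(1), of z 0 B] b by simp
qed

text \<open>The box of averaging lies within distance \<open>tau + d\<close> of \<open>x\<close>, so
  continuity at the single point \<open>x\<close> suffices.\<close>

lemma box_tendsto:
  assumes m: "\<phi> \<in> Borel" and b: "\<And>s. \<bar>\<phi> s\<bar> \<le> B" and per: "\<And>t z. \<phi> (t, z + 1) = \<phi> (t, z)"
    and d: "\<And>k. 0 < d k" "d \<longlonglongrightarrow> 0" and tau: "\<And>k. 0 < tau k" "tau \<longlonglongrightarrow> 0"
    and c: "isCont \<phi> x" and t: "0 < fst x"
  shows "(\<lambda>k. lift (tau k) (\<lambda>n. Av (d k) (cell (tau k) \<phi> n)) x) \<longlonglongrightarrow> \<phi> x"
proof (rule tendstoI)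
  fix e :: real assume "0 < e"
  then obtain e' where e': "0 < e'" "e' < e" using dense by blast
  from c obtain \<delta> where \<delta>: "0 < \<delta>" "\<And>y. dist y x < \<delta> \<Longrightarrow> \<bar>\<phi> y - \<phi> x\<bar> < e'"
    using e' unfolding continuous_at_eps_delta dist_real_def by blast
  have "(\<lambda>k. tau k + d k) \<longlonglongrightarrow> 0" using tendsto_add[OF tau(2) d(2)] by simp
  then have "\<forall>\<^sub>F k in sequentially. tau k + d k < \<delta>" by (rule order_tendstoD(2)[OF _ \<delta>(1)])
  then show "\<forall>\<^sub>F k in sequentially. dist (lift (tau k) (\<lambda>n. Av (d k) (cell (tau k) \<phi> n)) x) (\<phi> x) < e"
  proof eventually_elim
    case (elim k)
    let ?n = "stp (tau k) (fst x)"
    have "\<bar>Av (d k) (cell (tau k) \<phi> ?n) (snd x) - \<phi> x\<bar> \<le> e'"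
    proof (rule Av_near[OF cell_props(1)[OF m b tau(1) per] cell_props(2)[OF m b tau(1) per] d(1)])
      fix s assume s: "0 < s" "s < d k"
      show "\<bar>cell (tau k) \<phi> ?n (snd x + s) - \<phi> x\<bar> \<le> e'"
      proof (rule cell_near[OF m b tau(1)])
        fix s' assume s': "0 < s'" "s' < tau k"
        have "\<bar>real ?n * tau k + s' - fst x\<bar> < tau k"
          using stp_bounds[OF tau(1), of "fst x" k] t s' by (auto simp: distrib_right abs_if)
        moreover have "dist (real ?n * tau k + s', snd x + s) x \<le> \<bar>real ?n * tau k + s' - fst x\<bar> + \<bar>s\<bar>"
          unfolding dist_prod_def by (rule order_trans[OF sqrt_sum_squares_le_sum_abs]) (simp add: dist_real_def)
        ultimately have "dist (real ?n * tau k + s', snd x + s) x < \<delta>" using elim s by linarith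
        from \<delta>(2)[OF this] show "\<bar>\<phi> (real ?n * tau k + s', snd x + s) - \<phi> x\<bar> \<le> e'" by simp
      qed
    qed
    then show ?case using e' by (simp add: dist_real_def lift_def)
  qed
qed

text \<open>Weak convergence on the circle is reduced to that on the cylinder, where a dense set of tests is available.\<close>

lemma Av_weak:
  assumes F: "ultra F" and g: "pL2 g" and d: "\<And>k. 0 < d k" "\<And>k. d k \<le> 1" "d \<longlonglongrightarrow> 0" and w: "sqi cm w"
  shows "((\<lambda>k. LINT z|cm. Av (d k) g z * w z) \<longlongrightarrow> (LINT z|cm. g z * w z)) F"
proof -
  have one: "integrable (tm 1) (\<lambda>_. 1::real)" by simp
  have I1: "(LINT x|MM 1. b (snd x)) = (LINT z|cm. b z)" if "integrable cm b" for b :: "real \<Rightarrow> real"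
    using MM_prod_integral[OF one that] by (simp add: measure_tm)
  note sq = sqi_MM_snd[where T=1]
  have gs: "sqi cm g" using g by (simp add: pL2_def)
  have as: "sqi cm (Av (d k) g)" for k using Av_contract(1)[OF g d(1,2)] by (simp add: pL2_def)
  have b: "bddL2 (MM 1) (\<lambda>k x. Av (d k) g (snd x))"
    unfolding bddL2_def
  proof (intro conjI allI exI)
    show "sqi (MM 1) (\<lambda>x. Av (d k) g (snd x))" for k by (rule sq[OF as])
    show "(LINT x|MM 1. (Av (d k) g (snd x))^2) \<le> (LINT z|cm. (g z)^2)" for k
      using I1[of "\<lambda>z. (Av (d k) g z)^2"] as[of k] Av_contract(2)[OF g d(1,2)] by (simp add: sqi_def)
  qed
  have wc: "wconv F (MM 1) (\<lambda>k x. Av (d k) g (snd x)) (\<lambda>x. g (snd x))"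
  proof (rule wconv_by_tests[OF F b MMf.sqi_integrable[OF sq[OF gs]]])
    fix a c assume a: "tbump 1 a" and c: "cbump c"
    note cc = cbump_cper[OF c]
    obtain D where D: "\<And>z. \<bar>c z\<bar> \<le> D" using cper_bounded[OF cc] by blast
    have e: "(LINT x|MM 1. b (snd x) * ttest a c x) = (LINT t|tm 1. a t) * (LINT z|cm. b z * c z)" if "sqi cm b" for b
      using MM_prod_integral[OF tbump_integrable[OF a] sqi_mult_integrable[OF that cper_sqi[OF cc]]]
      by (simp add: ttest_def mult.left_commute mult.commute)
    have gb: "g \<in> Borel" using g by (simp add: pL2_def)
    have "(\<lambda>k. LINT z|cm. g z * Am (d k) c z) \<longlonglongrightarrow> (LINT z|cm. g z * c z)"
    proof (rule integral_dominated_convergence[where w="\<lambda>z. \<bar>g z\<bar> * D"])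
      show "integrable cm (\<lambda>z. \<bar>g z\<bar> * D)" using cm.sqi_integrable[OF gs] by simp
      show "AE z in cm. (\<lambda>k. g z * Am (d k) c z) \<longlonglongrightarrow> g z * c z"
        by (rule AE_I2, rule tendsto_mult[OF tendsto_const Av_tendsto_bounded(2)[OF cc d(1,3)]])
      show "AE z in cm. norm (g z * Am (d k) c z) \<le> \<bar>g z\<bar> * D" for k
        by (rule AE_I2) (simp add: abs_mult mult_left_mono[OF Am_abs_le[OF cc d(1) D]])
      show "(\<lambda>z. g z * c z) \<in> borel_measurable cm" by (rule borel_cmI, rule borel_measurable_times[OF gb cper_borel[OF cc]])
      show "(\<lambda>z. g z * Am (d k) c z) \<in> borel_measurable cm" for k
        by (rule borel_cmI, rule borel_measurable_times[OF gb cper_borel[OF cper_Am[OF cc d(1)]]])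
    qed
    then have "((\<lambda>k. LINT z|cm. Av (d k) g z * c z) \<longlongrightarrow> (LINT z|cm. g z * c z)) F"
      unfolding Av_adjoint[OF g cc d(1,2)] by (rule ultra_tendsto[OF F])
    then show "((\<lambda>k. LINT z|MM 1. Av (d k) g (snd z) * ttest a c z) \<longlongrightarrow> (LINT z|MM 1. g (snd z) * ttest a c z)) F"
      unfolding e[OF gs] e[OF as] by (rule tendsto_mult[OF tendsto_const])
  qed
  have "((\<lambda>k. LINT x|MM 1. Av (d k) g (snd x) * w (snd x)) \<longlongrightarrow> (LINT x|MM 1. g (snd x) * w (snd x))) F"
    by (rule wconvD[OF wc sq[OF w]])
  then show ?thesis
    unfolding I1[OF sqi_mult_integrable[OF gs w]] I1[OF sqi_mult_integrable[OF as w]] .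
qed

text \<open>One number \<open>X\<close> that dominates the whole list reduces the conditions to a
  single one, and the Archimedean property gives an integer number of steps.\<close>

lemma small_step:
  assumes "0 < T" "0 < (d::real)"
  shows "\<exists>N::nat. \<exists>tau>0. real N * tau = T \<and> (\<forall>x\<in>set xs. tau * x \<le> d)"
proof -
  define X where "X = 1 + (\<Sum>x\<leftarrow>xs. \<bar>x\<bar>)"
  have s0: "0 \<le> (\<Sum>x\<leftarrow>xs. \<bar>x\<bar>)" by (rule sum_list_nonneg) auto
  have X: "0 < X" using s0 by (simp add: X_def)
  have xX: "x \<le> X" if "x \<in> set xs" for x
  proof -
    have "\<bar>x\<bar> \<le> (\<Sum>x\<leftarrow>xs. \<bar>x\<bar>)" using that by (intro member_le_sum_list) auto
    then show ?thesis by (simp add: X_def)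
  qed
  obtain N :: nat where N: "T * X / d < real N" using reals_Archimedean2 by blast
  have N0: "0 < real N" using N assms X by (meson divide_pos_pos less_trans mult_pos_pos)
  have "T / real N * x \<le> d" if "x \<in> set xs" for x
  proof -
    have "T / real N * x \<le> T / real N * X" using xX[OF that] assms N0 by (intro mult_left_mono) auto
    also have "\<dots> \<le> d" using N assms N0 by (simp add: pos_divide_less_eq pos_divide_le_eq mult.commute)
    finally show ?thesis .
  qed
  then show ?thesis using N0 assms by (intro exI[of _ N] exI[of _ "T / real N"]) auto
qed

text \<open>The order of the choices is essential: \<open>e0\<close> and \<open>B\<close> come from
  the data alone; then the width \<open>d k\<close> is fixed, and the number of steps is taken so
  large that \<open>tau k\<close> beats the constants belonging to \<open>d k\<close> and
  \<open>B\<close>.\<close>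

theorem weak_form_exists:
  fixes h0 :: "2 \<Rightarrow> real \<Rightarrow> real" and j :: "2 \<Rightarrow> real \<times> real \<Rightarrow> real"
  assumes T: "0 < T" and p: "0 < p" and r0: "0 < r0" and \<nu>0: "0 < \<nu>0"
    and r: "r \<in> Borel" "periodic1 r" "\<And>z. r0 \<le> r z" "\<And>z. r z \<le> r1" "AE z in cm. isCont r z"
    and \<nu>: "\<nu> \<in> Borel" "periodic1 \<nu>" "\<And>z. \<nu>0 \<le> \<nu> z" "\<And>z. \<nu> z \<le> \<nu>1" "AE z in cm. isCont \<nu> z"
    and j: "\<And>l. j l \<in> Borel" "\<And>l x. \<bar>j l x\<bar> \<le> J" "\<And>l t z. j l (t, z + 1) = j l (t, z)" "\<And>l. AE x in MM T. isCont (j l) x"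
    and f: "f \<in> Borel" "\<And>x. \<bar>f x\<bar> \<le> K" "\<And>t z. f (t, z + 1) = f (t, z)" "AE x in MM T. isCont f x"
    and h0: "\<And>l. cper (h0 l)" and u0: "cper u0" "\<And>d. 0 < d \<Longrightarrow> d \<le> 1 \<Longrightarrow> nsq (Dp d u0) \<le> W" and u1: "pL2 u1"
  shows "\<exists>h g v q. weak_form T p r \<nu> j f h0 u0 u1 h g v q"
proof -
  obtain Fi where Fi: "ultra Fi" using ex_ultra by blast
  define d where "d k = 1 / real (Suc k)" for k
  have d: "0 < d k" "d k \<le> 1" for k by (auto simp: d_def)
  have d0: "d \<longlonglongrightarrow> 0" unfolding d_def[abs_def] using LIMSEQ_inverse_real_of_nat by (simp add: divide_inverse)
  have rb: "\<bar>r z\<bar> \<le> r1" "\<bar>\<nu> z\<bar> \<le> \<nu>1" for z using r(3,4)[of z] \<nu>(3,4)[of z] r0 \<nu>0 by auto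
  \<comment> \<open>A bound of the initial energies for all widths at once: averaging does not
    increase the norm of \<open>u1\<close>, and the difference quotients of \<open>u0\<close> are
    bounded by \<open>W\<close>.\<close>
  define e0 where "e0 = p * (\<Sum>l\<in>UNIV. nsq (h0 l)) + (1/2) * (LINT z|cm. (u1 z)^2) + (1/2) * (\<nu>1^2 * W)"
  define B where "B = exp T * (e0 + T * (2 * p * r1 * J^2 + K^2 + 1))"
  \<comment> \<open>The entry 1 of the list gives \<open>tau k \<le> d k\<close>, so
    \<open>tau\<close> tends to 0; since \<open>d k \<le> 1\<close>, the entry with
    \<open>KR\<close> gives the condition of the energy estimate.\<close>
  have "\<exists>N::nat. \<exists>tau>0. real N * tau = T \<and> (\<forall>x\<in>set [scheme.KR (d k) p r1 \<nu>1 J K B, 1, sqrt (scheme.KH (d k) p r1 J B), sqrt (scheme.KV (d k) p \<nu>1 K B)]. tau * x \<le> d k)" for k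
    by (rule small_step[OF T d(1)])
  then obtain N tau where tau: "\<And>k. 0 < tau k" and N: "\<And>k. real (N k) * tau k = T"
    and sm: "\<And>k. \<forall>x\<in>set [scheme.KR (d k) p r1 \<nu>1 J K B, 1, sqrt (scheme.KH (d k) p r1 J B), sqrt (scheme.KV (d k) p \<nu>1 K B)]. tau k * x \<le> d k"
    by metis
  have smalls: "tau k * scheme.KR (d k) p r1 \<nu>1 J K B \<le> 1" "tau k \<le> d k"
      "tau k * sqrt (scheme.KH (d k) p r1 J B) \<le> d k" "tau k * sqrt (scheme.KV (d k) p \<nu>1 K B) \<le> d k" for k
    using sm[of k] d(2)[of k] by auto
  have tau0: "tau \<longlonglongrightarrow> 0"
    by (rule tendsto_sandwich[OF _ _ tendsto_const d0]) (use tau smalls(2) in \<open>auto intro!: always_eventually less_imp_le\<close>)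
  have cu1: "cper (Av (d k) u1)" for k by (rule continuous_Av[OF u1 d])
  have cr: "cper (Av (d k) r)" for k by (rule bounded_cper_Av(1)[OF r(1) rb(1) r(2) d])
  have cn: "cper (Av (d k) \<nu>)" for k by (rule bounded_cper_Av(1)[OF \<nu>(1) rb(2) \<nu>(2) d])
  note cj = cell_props[OF j(1,2) tau j(3)] and cf = cell_props[OF f(1,2) tau f(3)]
  interpret L: schemes Fi T p r0 r1 \<nu>0 \<nu>1 J K e0 B d tau N "\<lambda>k. Av (d k) r" "\<lambda>k. Av (d k) \<nu>"
    "\<lambda>k n l. Av (d k) (cell (tau k) (j l) n)" "\<lambda>k n. Av (d k) (cell (tau k) f n)" h0 "\<lambda>k. Av (d k) u1" u0 r \<nu> j f u1
  proof (rule schemes.intro)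
    show "scheme (d k) (tau k) p r0 r1 \<nu>0 \<nu>1 J K (Av (d k) r) (Av (d k) \<nu>) (\<lambda>n l. Av (d k) (cell (tau k) (j l) n)) (\<lambda>n. Av (d k) (cell (tau k) f n)) h0 (Av (d k) u1) u0" for k
    proof
      show "r0 \<le> Av (d k) r z" "Av (d k) r z \<le> r1" for z using Av_bounds[OF r(1,3,4) d(1)] by auto
      show "\<nu>0 \<le> Av (d k) \<nu> z" "Av (d k) \<nu> z \<le> \<nu>1" for z using Av_bounds[OF \<nu>(1,3,4) d(1)] by auto
      show "cper (Av (d k) (cell (tau k) (j l) n))" "\<bar>Av (d k) (cell (tau k) (j l) n) z\<bar> \<le> J" for n l z
        by (rule bounded_cper_Av[OF cj d])+
      show "cper (Av (d k) (cell (tau k) f n))" "\<bar>Av (d k) (cell (tau k) f n) z\<bar> \<le> K" for n z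
        by (rule bounded_cper_Av[OF cf d])+
    qed (rule d p r0 \<nu>0 cr cn h0 cu1 u0 tau)+
    show "p * (\<Sum>l\<in>UNIV. nsq (h0 l)) + (1/2) * nsq (Av (d k) u1)
      + (1/2) * nsq (\<lambda>z. Av (d k) \<nu> z * Dp (d k) u0 z) \<le> e0" for k
    proof -
      have 1: "nsq (Av (d k) u1) \<le> (LINT z|cm. (u1 z)^2)" unfolding ip_self by (rule Av_contract(2)[OF u1 d])
      have "nsq (\<lambda>z. Av (d k) \<nu> z * Dp (d k) u0 z) \<le> \<nu>1^2 * nsq (Dp (d k) u0)"
        by (rule ip_bounded_mult_le[OF cn cper_Dp[OF u0(1)] bounded_cper_Av(2)[OF \<nu>(1) rb(2) \<nu>(2) d]])
      also have "\<dots> \<le> \<nu>1^2 * W" by (rule mult_left_mono[OF u0(2)[OF d]]) simp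
      finally show ?thesis using 1 unfolding e0_def by argo
    qed
    show "AE x in MM T. (\<lambda>k. Av (d k) r (snd x)) \<longlonglongrightarrow> r (snd x)"
      using AE_MM_snd[OF r(5)] by eventually_elim (rule Av_tendsto[OF r(1) rb(1) d(1) d0])
    show "AE x in MM T. (\<lambda>k. Av (d k) \<nu> (snd x)) \<longlonglongrightarrow> \<nu> (snd x)"
      using AE_MM_snd[OF \<nu>(5)] by eventually_elim (rule Av_tendsto[OF \<nu>(1) rb(2) d(1) d0])
    show "AE x in MM T. (\<lambda>k. lift (tau k) (\<lambda>n. Av (d k) (cell (tau k) (j l) n)) x) \<longlonglongrightarrow> j l x" for l
      using j(4)[of l] AE_MM_fst[OF AE_tm_range]
      by eventually_elim (rule box_tendsto[OF j(1,2,3) d(1) d0 tau tau0], auto)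
    show "AE x in MM T. (\<lambda>k. lift (tau k) (\<lambda>n. Av (d k) (cell (tau k) f n)) x) \<longlonglongrightarrow> f x"
      using f(4) AE_MM_fst[OF AE_tm_range]
      by eventually_elim (rule box_tendsto[OF f(1,2,3) d(1) d0 tau tau0], auto)
    show "((\<lambda>k. LINT z|cm. Av (d k) u1 z * w z) \<longlongrightarrow> (LINT z|cm. u1 z * w z)) Fi" if "sqi cm w" for w
      by (rule Av_weak[OF Fi u1 d d0 that])
  qed (rule Fi T N d0 B_def smalls r(1) rb \<nu>(1) j(1,2) f(1,2))+
  show ?thesis using L.limit_weak_form by blast
qed

section \<open>Squares and products in the weak formulation\<close>

lemma slice_square:
  assumes b: "sqi cm b" "(LINT z|cm. b z) = 0" and a: "sqi cm a" "AE z in cm. a z = c + prm b z"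
  shows "AE z in cm. (a z)^2 = c^2 + prm (\<lambda>z. 2 * (a z * b z)) z" "(LINT z|cm. 2 * (a z * b z)) = 0"
proof -
  have ib: "integrable cm b" by (rule cm.sqi_integrable[OF b(1)])
  have ab: "a \<in> Borel" by (rule sqi_cm_borel[OF a(1)])
  have bb: "b \<in> Borel" using borel_measurable_integrable[OF ib] by simp
  have pb: "prm b \<in> Borel" by (rule borel_prm[OF ib])
  have "(LINT z|cm. b z * a z) = - (LINT z|cm. a z * b z)" by (rule slice_IBP[OF ib b(2) ib b(2) ab a(2) ab a(2)])
  then show "(LINT z|cm. 2 * (a z * b z)) = 0" by (simp add: mult.commute)
  have iab: "integrable cm (\<lambda>z. a z * b z)" by (rule sqi_mult_integrable[OF a(1) b(1)])
  have "\<bar>prm b z\<bar> \<le> (LINT y|cm. \<bar>b y\<bar>)" for z unfolding prm_def by (rule abs_indicator_integral_le[OF ib]) simp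
  then have ipb: "integrable cm (\<lambda>z. b z * prm b z)" by (intro integrable_times_bounded[OF ib borel_cmI[OF pb]]) auto
  \<comment> \<open>The expansion of the square in terms of primitives: the linear term integrates
    \<open>2 c b\<close>, and the quadratic one is the product rule for \<open>prm b\<close> with
    itself.\<close>
  have eq: "c^2 + prm (\<lambda>z. 2 * (a z * b z)) z = (c + prm b z)^2" for z
  proof -
    have i1: "integrable cm (\<lambda>y. indicator {..<z} y * b y)" by (rule integrable_indicator_mult[OF ib]) simp
    have i2: "integrable cm (\<lambda>y. indicator {..<z} y * (b y * prm b y))" by (rule integrable_indicator_mult[OF ipb]) simp
    have "prm (\<lambda>z. 2 * (a z * b z)) z = (LINT y|cm. 2 * c * (indicator {..<z} y * b y) + 2 * (indicator {..<z} y * (b y * prm b y)))"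
      unfolding prm_def[of "\<lambda>z. 2 * (a z * b z)"]
    proof (rule integral_cong_AE)
      show "AE y in cm. indicator {..<z} y * (2 * (a y * b y)) = 2 * c * (indicator {..<z} y * b y) + 2 * (indicator {..<z} y * (b y * prm b y))"
        using a(2) by eventually_elim (simp add: algebra_simps)
      have iz: "indicator {..<z} \<in> Borel" by simp
      show "(\<lambda>y. indicator {..<z} y * (2 * (a y * b y))) \<in> borel_measurable cm"
        by (rule borel_cmI, intro borel_measurable_times iz ab bb borel_measurable_const)
      show "(\<lambda>y. 2 * c * (indicator {..<z} y * b y) + 2 * (indicator {..<z} y * (b y * prm b y))) \<in> borel_measurable cm"
        by (rule borel_cmI, intro borel_measurable_add borel_measurable_times iz pb bb borel_measurable_const)
    qed
    also have "\<dots> = 2 * c * prm b z + 2 * (LINT y|cm. indicator {..<z} y * (b y * prm b y))"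
      using i1 i2 by (simp add: prm_def)
    finally have A: "prm (\<lambda>z. 2 * (a z * b z)) z = 2 * c * prm b z + 2 * (LINT y|cm. indicator {..<z} y * (b y * prm b y))" .
    have "prm b z * prm b z = (LINT y|cm. indicator {..<z} y * (prm b y * b y)) + (LINT y|cm. indicator {..<z} y * (b y * prm b y))"
      unfolding prm_def cm_eq_tm by (rule tm_product_rule[OF ib[unfolded cm_eq_tm] ib[unfolded cm_eq_tm]])
    then have Bq: "prm b z * prm b z = 2 * (LINT y|cm. indicator {..<z} y * (b y * prm b y))" by (simp only: mult.commute[of "prm b _" "b _"] mult_2)
    show ?thesis unfolding A Bq[symmetric] by (simp add: power2_eq_square algebra_simps)
  qed
  show "AE z in cm. (a z)^2 = c^2 + prm (\<lambda>z. 2 * (a z * b z)) z"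
    unfolding eq using a(2) by eventually_elim simp
qed

text \<open>On a slice the squared supremum of \<open>e\<close> is bounded by the squared norms of
  \<open>e\<close> and \<open>k\<close>, which are integrable in time; \<open>a\<close> is bounded
  in \<open>L2\<close> uniformly in time. This gives a meaning to the cubic terms of the weak
  formulation.\<close>

lemma zpair_product_sqi:
  assumes a: "sqi (MM T) a" and C: "AE t in tm T. (LINT z|cm. (a (t, z))^2) \<le> C" and e: "zpair T e k"
  shows "sqi (MM T) (\<lambda>x. a x * e x)"
proof -
  note E = zpair_slices[OF e] and ab = sqi_MM_borel[OF a]
  have m: "(\<lambda>x. a x * e x) \<in> Borel" by (rule borel_measurable_times[OF ab E(1)])
  have ia: "integrable (MM T) (\<lambda>x. (a x)^2)" and ie: "integrable (MM T) (\<lambda>x. (e x)^2)" and ik: "integrable (MM T) (\<lambda>x. (k x)^2)"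
    using a E(3,4) by auto
  have im: "(\<lambda>x. (a x * e x)^2) \<in> borel_measurable (tm T \<Otimes>\<^sub>M cm)"
    using borel_MMI[OF borel_measurable_power[OF m]] by (simp add: MM_def)
  let ?s = "\<lambda>t. 2 * (LINT z|cm. (e (t, z))^2) + 2 * (LINT z|cm. (k (t, z))^2)"
  have slice: "AE t in tm T. integrable cm (\<lambda>z. (a (t, z) * e (t, z))^2) \<and> (LINT z|cm. (a (t, z) * e (t, z))^2) \<le> ?s t * C"
    using E(5) sqi_MM_section'[OF a ab] C
  proof eventually_elim
    case (elim t)
    obtain c where c: "AE z in cm. e (t, z) = c + prm (\<lambda>z. k (t, z)) z" using elim by blast
    have s: "(c + prm (\<lambda>z. k (t, z)) z)^2 \<le> ?s t" for z
      unfolding prm_def by (rule prim_sup_bound[OF _ _ c[unfolded prm_def]]) (use elim in auto)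
    have s2: "AE z in cm. (e (t, z))^2 \<le> ?s t" using c by eventually_elim (simp add: s)
    have ia': "integrable cm (\<lambda>z. (a (t, z))^2)" using elim(2) by auto
    have bd: "AE z in cm. (a (t, z) * e (t, z))^2 \<le> ?s t * (a (t, z))^2"
      using s2 by eventually_elim (simp add: power_mult_distrib mult.commute mult_left_mono)
    have i: "integrable cm (\<lambda>z. (a (t, z) * e (t, z))^2)"
    proof (rule Bochner_Integration.integrable_bound[OF integrable_mult_right[OF ia', of "?s t"]])
      show "(\<lambda>z. (a (t, z) * e (t, z))^2) \<in> borel_measurable cm"
        by (rule borel_cmI, rule borel_pair_section[OF borel_measurable_power[OF m]]) simp_all
      show "AE z in cm. norm ((a (t, z) * e (t, z))^2) \<le> norm (?s t * (a (t, z))^2)" using bd by eventually_elim simp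
    qed
    have "(LINT z|cm. (a (t, z) * e (t, z))^2) \<le> (LINT z|cm. ?s t * (a (t, z))^2)"
      by (rule integral_mono_AE[OF i integrable_mult_right[OF ia'] bd])
    also have "\<dots> = ?s t * (LINT z|cm. (a (t, z))^2)" by simp
    also have "\<dots> \<le> ?s t * C" by (rule mult_left_mono[OF elim(3)]) simp
    finally show ?case using i by simp
  qed
  have "integrable (tm T \<Otimes>\<^sub>M cm) (\<lambda>x. (a x * e x)^2)"
  proof (rule MM.Fubini_integrable[OF im])
    show "AE t in tm T. integrable cm (\<lambda>z. (a (t, z) * e (t, z))^2)" using slice by eventually_elim simp
    have iS: "integrable (tm T) (\<lambda>t. ?s t * C)"
      by (intro integrable_mult_left Bochner_Integration.integrable_add integrable_mult_right integrable_MM_fst ie ik)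
    have "(\<lambda>t. LINT z|cm. norm ((a (t, z) * e (t, z))^2)) \<in> borel_measurable (tm T)"
      using im by measurable
    then show "integrable (tm T) (\<lambda>t. LINT z|cm. norm ((a (t, z) * e (t, z))^2))"
    proof (rule Bochner_Integration.integrable_bound[OF iS])
      show "AE t in tm T. norm (LINT z|cm. norm ((a (t, z) * e (t, z))^2)) \<le> norm (?s t * C)"
        using slice
      proof eventually_elim
        case (elim t)
        have "0 \<le> (LINT z|cm. (a (t, z) * e (t, z))^2)" by simp
        with elim have "0 \<le> ?s t * C" by linarith
        with elim show ?case by simp
      qed
    qed
  qed
  then show ?thesis using borel_MMI[OF m] by (simp add: sqi_def MM_def)
qed

text \<open>Formally \<open>(a^2)_z e\<close> is integrated by parts. The product
  \<open>a b e\<close> is integrable because \<open>a e\<close> is in \<open>L2\<close>, and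
  \<open>a^2 k\<close> because \<open>a^2\<close> is; the identity is \<open>slice_IBP\<close> for
  the representation of \<open>a^2\<close> by a primitive.\<close>

lemma zpair_square_IBP:
  assumes a: "zpair T a b" and C: "AE t in tm T. (LINT z|cm. (a (t, z))^2) \<le> C" and e: "zpair T e k"
  shows "(LINT x|MM T. 2 * (a x * b x) * e x) = - (LINT x|MM T. (a x)^2 * k x)"
    "integrable (MM T) (\<lambda>x. 2 * (a x * b x) * e x)" "integrable (MM T) (\<lambda>x. (a x)^2 * k x)"
proof -
  note A = zpair_slices[OF a] and E = zpair_slices[OF e]
  have "integrable (MM T) (\<lambda>x. (a x * e x) * b x)" by (rule sqi_mult_integrable[OF zpair_product_sqi[OF A(3) C e] A(4)])
  then have "integrable (MM T) (\<lambda>x. 2 * ((a x * e x) * b x))" by simp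
  then show i1: "integrable (MM T) (\<lambda>x. 2 * (a x * b x) * e x)" by (simp only: ac_simps)
  have "integrable (MM T) (\<lambda>x. (a x * a x) * k x)" by (rule sqi_mult_integrable[OF zpair_product_sqi[OF A(3) C a] E(4)])
  then show i2: "integrable (MM T) (\<lambda>x. (a x)^2 * k x)" by (simp add: power2_eq_square)
  have "(LINT t|tm T. LINT z|cm. 2 * (a (t, z) * b (t, z)) * e (t, z)) = (LINT t|tm T. - (LINT z|cm. (a (t, z))^2 * k (t, z)))"
  proof (rule integral_cong_AE)
    show "AE t in tm T. (LINT z|cm. 2 * (a (t, z) * b (t, z)) * e (t, z)) = - (LINT z|cm. (a (t, z))^2 * k (t, z))"
      using A(5) E(5)
    proof eventually_elim
      case (elim t)
      obtain c c' where c: "AE z in cm. a (t, z) = c + prm (\<lambda>z. b (t, z)) z" "AE z in cm. e (t, z) = c' + prm (\<lambda>z. k (t, z)) z"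
        using elim by blast
      note sq = slice_square[OF _ _ _ c(1)]
      show ?case
      proof (rule slice_IBP[OF _ sq(2) _ _ _ sq(1) borel_pair_section[OF E(1)] c(2)])
        show "integrable cm (\<lambda>z. 2 * (a (t, z) * b (t, z)))"
          using sqi_mult_integrable[of cm "\<lambda>z. a (t, z)" "\<lambda>z. b (t, z)"] elim by simp
        show "(\<lambda>z. (a (t, z))^2) \<in> Borel" by (rule borel_pair_section[OF borel_measurable_power[OF A(1)]]) simp_all
      qed (use elim cm.sqi_integrable in auto)
    qed
    show "(\<lambda>t. LINT z|cm. 2 * (a (t, z) * b (t, z)) * e (t, z)) \<in> borel_measurable (tm T)"
      using borel_measurable_integrable[OF integrable_MM_fst[OF i1]] by simp
    show "(\<lambda>t. - (LINT z|cm. (a (t, z))^2 * k (t, z))) \<in> borel_measurable (tm T)"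
      using borel_measurable_integrable[OF integrable_MM_fst[OF i2]] by simp
  qed
  then show "(LINT x|MM T. 2 * (a x * b x) * e x) = - (LINT x|MM T. (a x)^2 * k x)"
    unfolding MM_integral[OF i1] MM_integral[OF i2] by simp
qed

section \<open>Weak derivatives and traces in time\<close>

definition d_t :: "(real \<times> real \<Rightarrow> real) \<Rightarrow> real \<times> real \<Rightarrow> real" where
  "d_t \<phi> x = deriv (\<lambda>s. \<phi> (s, snd x)) (fst x)"
definition d_z :: "(real \<times> real \<Rightarrow> real) \<Rightarrow> real \<times> real \<Rightarrow> real" where
  "d_z \<phi> x = deriv (\<lambda>y. \<phi> (fst x, y)) (snd x)"

lemma smooth_partial:
  fixes \<phi> :: "real \<times> real \<Rightarrow> real"
  assumes "smooth_on UNIV \<phi>"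
  shows "((\<lambda>s. \<phi> (s, z)) has_real_derivative d_t \<phi> (t, z)) (at t)" "((\<lambda>y. \<phi> (t, y)) has_real_derivative d_z \<phi> (t, z)) (at z)"
    "continuous_on UNIV (d_t \<phi>)" "continuous_on UNIV (d_z \<phi>)"
proof -
  have C: "Ck_on (Suc 0) UNIV \<phi>" using assms by (simp add: smooth_on_def)
  let ?D = "\<lambda>x. frechet_derivative \<phi> (at x)"
  have D: "(\<phi> has_derivative ?D x) (at x)" for x by (rule Ck_on_Suc_deriv[OF C])
  have B: "(1, 0) \<in> (Basis :: (real \<times> real) set)" "(0, 1) \<in> (Basis :: (real \<times> real) set)" by (auto simp: Basis_prod_def)
  have c: "continuous_on UNIV (\<lambda>x. ?D x (1, 0))" "continuous_on UNIV (\<lambda>x. ?D x (0, 1))" using C B by auto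
  have P: "((\<lambda>s. \<phi> (p s)) has_real_derivative ?D (p s) v) (at s)" if "(p has_derivative (\<lambda>h. h *\<^sub>R v)) (at s)" for p v s
  proof -
    have "((\<lambda>s. \<phi> (p s)) has_derivative (\<lambda>h. ?D (p s) (h *\<^sub>R v))) (at s)" by (rule has_derivative_compose[OF that D])
    moreover have "(\<lambda>h. ?D (p s) (h *\<^sub>R v)) = (*) (?D (p s) v)"
      by (simp add: fun_eq_iff linear_scale[OF has_derivative_linear[OF D]])
    ultimately show ?thesis by (simp add: has_field_derivative_def)
  qed
  have 1: "((\<lambda>s. \<phi> (s, z)) has_real_derivative ?D (t, z) (1, 0)) (at t)" for t z
    by (rule P) (auto intro!: derivative_eq_intros)
  have 2: "((\<lambda>y. \<phi> (t, y)) has_real_derivative ?D (t, z) (0, 1)) (at z)" for t z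
    by (rule P) (auto intro!: derivative_eq_intros)
  have e: "d_t \<phi> = (\<lambda>x. ?D x (1, 0))" "d_z \<phi> = (\<lambda>x. ?D x (0, 1))"
    using DERIV_imp_deriv[OF 1] DERIV_imp_deriv[OF 2] by (auto simp: d_t_def d_z_def fun_eq_iff)
  show "((\<lambda>s. \<phi> (s, z)) has_real_derivative d_t \<phi> (t, z)) (at t)" "((\<lambda>y. \<phi> (t, y)) has_real_derivative d_z \<phi> (t, z)) (at z)"
    "continuous_on UNIV (d_t \<phi>)" "continuous_on UNIV (d_z \<phi>)"
    unfolding e using 1 2 c by auto
qed

lemma continuous_sqi_MM:
  assumes "continuous_on UNIV (b :: real \<times> real \<Rightarrow> real)"
  shows "sqi (MM T) b" "\<exists>C. AE x in MM T. \<bar>b x\<bar> \<le> C"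
proof -
  have "compact (b ` ({0..T} \<times> {0..1}))"
    by (intro compact_continuous_image compact_Times) (auto intro: continuous_on_subset[OF assms])
  then have "bounded (b ` ({0..T} \<times> {0..1}))" by (rule compact_imp_bounded)
  then obtain C where C: "\<And>x. x \<in> {0..T} \<times> {0..1} \<Longrightarrow> \<bar>b x\<bar> \<le> C"
    unfolding bounded_iff real_norm_def by blast
  have "AE x in MM T. \<bar>b x\<bar> \<le> C"
    using AE_MM_fst[OF AE_tm_range] AE_MM_snd[OF AE_cm_range]
  proof eventually_elim
    case (elim x)
    then show ?case by (intro C) (auto simp: mem_Times_iff)
  qed
  then show "\<exists>C. AE x in MM T. \<bar>b x\<bar> \<le> C" "sqi (MM T) b"
    using MMf.sqi_bounded[OF borel_MMI[OF borel_measurable_continuous_onI[OF assms]]] by blast+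
qed

text \<open>Periodicity of a test function concerns \<open>0 < t < T\<close>; this covers almost
  every slice, which is what \<open>zpair\<close> asks for.\<close>

lemma zpair_test:
  assumes "test_function T \<phi>" shows "zpair T \<phi> (d_z \<phi>)"
proof -
  have s: "smooth_on UNIV \<phi>" and p: "periodic_z T \<phi>" using assms by (auto simp: test_function_def)
  note D = smooth_partial[OF s]
  have c: "continuous_on UNIV \<phi>" by (rule smooth_continuous[OF s])
  have cs: "continuous_on UNIV (\<lambda>y. d_z \<phi> (t, y))" for t
    by (rule continuous_on_compose2[OF D(4)]) (auto intro!: continuous_intros)
  have P: "\<phi> (t, z) = \<phi> (t, 0) + (LINT y|cm. indicator {..<z} y * d_z \<phi> (t, y))" if "0 \<le> z" "z \<le> 1" for t z
    using tm_FTC(2)[OF D(2) cs that] by (simp add: cm_eq_tm)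
  have Z: "AE t in tm T. (LINT z|cm. d_z \<phi> (t, z)) = 0"
    using AE_tm_range
  proof eventually_elim
    case (elim t)
    interpret q: periodic_fun_simple' "\<lambda>z. \<phi> (t, z)" using p elim by (auto simp: periodic_z_def)
    have "(LINT y|tm 1. indicator {0<..} y * d_z \<phi> (t, y)) = \<phi> (t, 1) - \<phi> (t, 0)" by (rule tm_FTC(1)[OF D(2) cs]) auto
    moreover have "\<phi> (t, 1) = \<phi> (t, 0)" using q.plus_1[of 0] by simp
    ultimately show ?case using tm_integral_drop[OF borel_measurable_continuous_onI[OF cs], of 1] by (simp add: cm_eq_tm)
  qed
  have "AE x in MM T. \<phi> x = \<phi> (fst x, 0) + zprim (d_z \<phi>) x"
    using AE_MM_snd[OF AE_cm_range]
  proof eventually_elim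
    case (elim x)
    then show ?case using P[of "snd x" "fst x"] by (simp add: zprim_def)
  qed
  then have "\<exists>c. AE x in MM T. \<phi> x = c (fst x) + zprim (d_z \<phi>) x" by (rule exI[where x="\<lambda>t. \<phi> (t, 0)"])
  then show ?thesis unfolding zpair_def
    by (intro conjI Z borel_measurable_continuous_onI[OF c] borel_measurable_continuous_onI[OF D(4)] continuous_sqi_MM(1)[OF c] continuous_sqi_MM(1)[OF D(4)])
qed

lemma tback_test:
  assumes "test_function T \<phi>" "0 \<le> t" "t \<le> T" shows "tback T (d_t \<phi>) (t, z) = \<phi> (t, z)"
proof -
  have s: "smooth_on UNIV \<phi>" using assms by (auto simp: test_function_def)
  note D = smooth_partial[OF s]
  have cs: "continuous_on UNIV (\<lambda>t. d_t \<phi> (t, z))"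
    by (rule continuous_on_compose2[OF D(3)]) (auto intro!: continuous_intros)
  have "\<phi> (T, z) = 0" using assms(1) by (auto simp: test_function_def)
  then show ?thesis using tm_FTC(1)[OF D(1) cs assms(2,3)] by (simp add: tback_def)
qed

lemma test_function_prod:
  assumes f: "tbump T f" and g: "cbump g"
  shows "test_function T (\<lambda>x. f (fst x) * g (snd x))"
    "d_t (\<lambda>x. f (fst x) * g (snd x)) x = deriv f (fst x) * g (snd x)"
    "d_z (\<lambda>x. f (fst x) * g (snd x)) x = f (fst x) * deriv g (snd x)"
proof -
  have sf: "smooth_on UNIV f" and sg: "smooth_on UNIV g" using f g by (auto simp: tbump_def cbump_def)
  have "smooth_on UNIV (\<lambda>x::real\<times>real. f (fst x) * g (snd x))"
    by (intro smooth_mult smooth_compose[OF sf] smooth_compose[OF sg] smooth_linear bounded_linear_fst bounded_linear_snd)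
  moreover have "periodic_z T (\<lambda>x. f (fst x) * g (snd x))"
    using g by (auto simp: periodic_z_def cbump_def intro!: periodic_fun_simple'.intro)
  moreover have "\<exists>a b. 0 < a \<and> b < T \<and> (\<forall>t z. t \<notin> {a..b} \<longrightarrow> f (fst (t, z)) * g (snd (t, z)) = 0)"
    using f by (fastforce simp: tbump_def)
  ultimately show "test_function T (\<lambda>x. f (fst x) * g (snd x))" by (simp add: test_function_def)
  show "d_t (\<lambda>x. f (fst x) * g (snd x)) x = deriv f (fst x) * g (snd x)"
    unfolding d_t_def fst_conv snd_conv by (rule DERIV_imp_deriv, rule DERIV_cmult_right, rule smooth_deriv(1)[OF sf])
  show "d_z (\<lambda>x. f (fst x) * g (snd x)) x = f (fst x) * deriv g (snd x)"
    unfolding d_z_def fst_conv snd_conv by (rule DERIV_imp_deriv, rule DERIV_cmult, rule smooth_deriv(1)[OF sg])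
qed

section \<open>Uniqueness and calculus of weak derivatives\<close>

lemma has_weak_dz_alt: "has_weak_dz T v w \<longleftrightarrow>
     integrable (lebesgue_on (cylinder T)) v \<and> integrable (lebesgue_on (cylinder T)) w \<and>
     (\<forall>\<phi>. test_function T \<phi> \<longrightarrow> (LINT x|lebesgue_on (cylinder T). v x * d_z \<phi> x) = - (LINT x|lebesgue_on (cylinder T). w x * \<phi> x))"
  by (simp add: has_weak_dz_def d_z_def case_prod_unfold)

lemma has_weak_dt_alt: "has_weak_dt T v w \<longleftrightarrow>
     integrable (lebesgue_on (cylinder T)) v \<and> integrable (lebesgue_on (cylinder T)) w \<and>
     (\<forall>\<phi>. test_function T \<phi> \<longrightarrow> (LINT x|lebesgue_on (cylinder T). v x * d_t \<phi> x) = - (LINT x|lebesgue_on (cylinder T). w x * \<phi> x))"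
  by (simp add: has_weak_dt_def d_t_def case_prod_unfold)

lemma cyl_product:
  fixes v :: "real \<times> real \<Rightarrow> real"
  assumes v: "integrable (lebesgue_on (cylinder T)) v" and v': "v' \<in> Borel" "AE x in MM T. v x = v' x"
    and b: "b \<in> Borel"
  shows "(LINT x|lebesgue_on (cylinder T). v x * b x) = (LINT x|MM T. v' x * b x)"
  by (rule integral_cyl_AE[OF borel_measurable_times[OF borel_measurable_integrable[OF v] borel_lebesgue_on[OF b]] borel_measurable_times[OF v'(1) b]])
     (use v'(2) in eventually_elim, simp)

lemma cyl_rep:
  fixes v :: "real \<times> real \<Rightarrow> real"
  assumes "integrable (lebesgue_on (cylinder T)) v"
  obtains v' where "v' \<in> Borel" "AE x in MM T. v x = v' x" "integrable (MM T) v'"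
proof -
  obtain v' where v': "v' \<in> Borel" "AE x in lebesgue_on (cylinder T). v x = v' x"
    using borel_rep_lebesgue_on[OF cylinder_borel borel_measurable_integrable[OF assms]] by blast
  have a: "AE x in MM T. v x = v' x" using v'(2) by (simp add: AE_cyl)
  show ?thesis using that[OF v'(1) a] integrable_cyl_AE[OF borel_measurable_integrable[OF assms] v'(1) a] assms by blast
qed

text \<open>The tensor products in the fundamental lemma are themselves test functions, so it
  applies to the difference of Borel representatives.\<close>

lemma weak_unique:
  assumes w: "integrable (lebesgue_on (cylinder T)) w1" "integrable (lebesgue_on (cylinder T)) w2"
    and e: "\<And>\<phi>. test_function T \<phi> \<Longrightarrow> (LINT x|lebesgue_on (cylinder T). w1 x * \<phi> x) = (LINT x|lebesgue_on (cylinder T). w2 x * \<phi> x)"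
  shows "AE x in MM T. w1 x = w2 x"
proof -
  obtain a where a: "a \<in> Borel" "AE x in MM T. w1 x = a x" "integrable (MM T) a" by (rule cyl_rep[OF w(1)])
  obtain b where b: "b \<in> Borel" "AE x in MM T. w2 x = b x" "integrable (MM T) b" by (rule cyl_rep[OF w(2)])
  have "AE x in MM T. a x - b x = 0"
  proof (rule fundamental_lemma)
    show "integrable (MM T) (\<lambda>x. a x - b x)" using a(3) b(3) by simp
    fix f g assume f: "tbump T f" and g: "cbump g"
    note t = test_function_prod(1)[OF f g]
    have m: "(\<lambda>x. f (fst x) * g (snd x)) \<in> borel_measurable (borel :: (real \<times> real) measure)"
      using borel_ttest[OF f g] by (simp only: ttest_def[abs_def])
    obtain C where C: "\<And>t. \<bar>f t\<bar> \<le> C" using tbump_bounded[OF f] by blast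
    obtain D where D: "\<And>t. \<bar>g t\<bar> \<le> D" using cbump_bdd[OF g] by blast
    note i = integrable_MM_test[OF a(3) tbump_borel[OF f] cbump_borel[OF g] C D] integrable_MM_test[OF b(3) tbump_borel[OF f] cbump_borel[OF g] C D]
    have "(LINT x|MM T. a x * (f (fst x) * g (snd x))) = (LINT x|MM T. b x * (f (fst x) * g (snd x)))"
      using e[OF t] unfolding cyl_product[OF w(1) a(1,2) m] cyl_product[OF w(2) b(1,2) m] .
    then show "(LINT x|MM T. (a x - b x) * (f (fst x) * g (snd x))) = 0"
      using i by (simp add: left_diff_distrib)
  qed
  with a(2) b(2) show ?thesis by eventually_elim simp
qed

lemma weak_dz_eq: assumes "has_weak_dz T v w" shows "has_weak_dz T v (weak_dz T v)" "AE x in MM T. weak_dz T v x = w x"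
proof -
  show h: "has_weak_dz T v (weak_dz T v)" unfolding weak_dz_def by (rule someI[of "has_weak_dz T v", OF assms])
  show "AE x in MM T. weak_dz T v x = w x"
    by (rule weak_unique) (use assms h in \<open>auto simp: has_weak_dz_alt\<close>)
qed

lemma weak_dt_eq: assumes "has_weak_dt T v w" shows "has_weak_dt T v (weak_dt T v)" "AE x in MM T. weak_dt T v x = w x"
proof -
  show h: "has_weak_dt T v (weak_dt T v)" unfolding weak_dt_def by (rule someI[of "has_weak_dt T v", OF assms])
  show "AE x in MM T. weak_dt T v x = w x"
    by (rule weak_unique) (use assms h in \<open>auto simp: has_weak_dt_alt\<close>)
qed

lemma has_weak_dzI:
  assumes "integrable (MM T) v" "integrable (MM T) w"
    "\<And>\<phi>. test_function T \<phi> \<Longrightarrow> (LINT x|MM T. v x * d_z \<phi> x) = - (LINT x|MM T. w x * \<phi> x)"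
  shows "has_weak_dz T v w"
proof -
  have b: "v \<in> Borel" "w \<in> Borel"
    using borel_measurable_integrable[OF assms(1)] borel_measurable_integrable[OF assms(2)] by simp_all
  have i: "integrable (lebesgue_on (cylinder T)) v" "integrable (lebesgue_on (cylinder T)) w"
    using assms(1,2) integrable_cyl[OF b(1)] integrable_cyl[OF b(2)] by simp_all
  show ?thesis unfolding has_weak_dz_alt
  proof (intro conjI allI impI i)
    fix \<phi> assume t: "test_function T \<phi>"
    note z = zpair_slices(1,2)[OF zpair_test[OF t]]
    show "(LINT x|lebesgue_on (cylinder T). v x * d_z \<phi> x) = - (LINT x|lebesgue_on (cylinder T). w x * \<phi> x)"
      unfolding integral_cyl[OF borel_measurable_times[OF b(1) z(2)]] integral_cyl[OF borel_measurable_times[OF b(2) z(1)]]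
      by (rule assms(3)[OF t])
  qed
qed

lemma has_weak_dz_zpair: assumes "zpair T v w" shows "has_weak_dz T v w"
proof (rule has_weak_dzI)
  show "integrable (MM T) v" "integrable (MM T) w" using zpair_slices(3,4)[OF assms] MMf.sqi_integrable by auto
  show "(LINT x|MM T. v x * d_z \<phi> x) = - (LINT x|MM T. w x * \<phi> x)" if "test_function T \<phi>" for \<phi>
    using zpair_IBP[OF assms zpair_test[OF that]] by simp
qed

lemma has_weak_dz_square:
  assumes z: "zpair T v w" and C: "AE t in tm T. (LINT z|cm. (v (t, z))^2) \<le> C"
  shows "has_weak_dz T (\<lambda>x. (v x)^2) (\<lambda>x. 2 * (v x * w x))"
proof (rule has_weak_dzI)
  note s = zpair_slices(3,4)[OF z]
  show "integrable (MM T) (\<lambda>x. (v x)^2)" using s by auto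
  show "integrable (MM T) (\<lambda>x. 2 * (v x * w x))" using sqi_mult_integrable[OF s] by simp
  show "(LINT x|MM T. (v x)^2 * d_z \<phi> x) = - (LINT x|MM T. 2 * (v x * w x) * \<phi> x)" if "test_function T \<phi>" for \<phi>
    using zpair_square_IBP(1)[OF z C zpair_test[OF that]] by simp
qed

lemma has_weak_dz_add:
  assumes "has_weak_dz T v w" "has_weak_dz T v' w'" shows "has_weak_dz T (\<lambda>x. v x + v' x) (\<lambda>x. w x + w' x)"
proof -
  obtain a where a: "a \<in> Borel" "AE x in MM T. v x = a x" "integrable (MM T) a" using cyl_rep assms(1) unfolding has_weak_dz_alt by blast
  obtain b where b: "b \<in> Borel" "AE x in MM T. w x = b x" "integrable (MM T) b" using cyl_rep assms(1) unfolding has_weak_dz_alt by blast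
  have *: "integrable (lebesgue_on (cylinder T)) (\<lambda>x. u x * e x)" if u: "integrable (lebesgue_on (cylinder T)) u" and e: "continuous_on UNIV e" for u e :: "real \<times> real \<Rightarrow> real"
  proof -
    obtain C where "AE x in MM T. \<bar>e x\<bar> \<le> C" using continuous_sqi_MM(2)[OF e] by blast
    then have "AE x in lebesgue_on (cylinder T). \<bar>e x\<bar> \<le> C" by (simp add: AE_cyl)
    then show ?thesis by (rule integrable_times_bounded[OF u borel_lebesgue_on[OF borel_measurable_continuous_onI[OF e]]])
  qed
  show ?thesis unfolding has_weak_dz_alt
  proof (intro conjI allI impI)
    fix \<phi> assume t: "test_function T \<phi>"
    then have s: "smooth_on UNIV \<phi>" by (simp add: test_function_def)
    note c = smooth_continuous[OF s] smooth_partial(4)[OF s]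
    show "(LINT x|lebesgue_on (cylinder T). (v x + v' x) * d_z \<phi> x) = - (LINT x|lebesgue_on (cylinder T). (w x + w' x) * \<phi> x)"
      using assms t *[OF _ c(1)] *[OF _ c(2)] unfolding has_weak_dz_alt distrib_right by simp
  qed (use assms in \<open>auto simp: has_weak_dz_alt\<close>)
qed

text \<open>A test function \<open>\<phi>\<close> vanishes at both ends. So it equals
  \<open>tback T (d_t \<phi>)\<close>, the part with \<open>u0\<close> drops out, and the rest is
  \<open>tprim_tback\<close>.\<close>

lemma has_weak_dt_tprim:
  assumes T: "0 < T" and v: "sqi (MM T) v" and u0: "pL2 u0"
  shows "has_weak_dt T (\<lambda>x. u0 (snd x) + tprim T v x) v"
proof -
  note vb = sqi_MM_borel[OF v]
  have s0: "sqi (MM T) (\<lambda>p. u0 (snd p))" using u0 by (intro sqi_MM_snd) (simp add: pL2_def)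
  have st: "sqi (MM T) (tprim T v)" by (rule sqi_tprim[OF T v vb])
  let ?u = "\<lambda>x. u0 (snd x) + tprim T v x"
  have su: "sqi (MM T) ?u" by (rule sqi_add[OF s0 st])
  note ub = sqi_MM_borel[OF su]
  show ?thesis unfolding has_weak_dt_alt
  proof (intro conjI allI impI)
    show "integrable (lebesgue_on (cylinder T)) ?u" "integrable (lebesgue_on (cylinder T)) v"
      using MMf.sqi_integrable[OF su] MMf.sqi_integrable[OF v] integrable_cyl[OF ub] integrable_cyl[OF vb] by simp_all
    fix \<phi> assume t: "test_function T \<phi>"
    then have s: "smooth_on UNIV \<phi>" by (simp add: test_function_def)
    have w: "sqi (MM T) (d_t \<phi>)" "d_t \<phi> \<in> Borel"
      using continuous_sqi_MM(1)[OF smooth_partial(3)[OF s]] borel_measurable_continuous_onI[OF smooth_partial(3)[OF s]] by auto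
    have \<phi>b: "\<phi> \<in> Borel" by (rule smooth_borel[OF s])
    have z: "\<phi> (0, z) = 0" for z using t by (auto simp: test_function_def)
    have "(LINT x|MM T. ?u x * d_t \<phi> x) = (LINT x|MM T. u0 (snd x) * d_t \<phi> x) + (LINT x|MM T. tprim T v x * d_t \<phi> x)"
      unfolding distrib_right by (rule Bochner_Integration.integral_add[OF sqi_mult_integrable[OF s0 w(1)] sqi_mult_integrable[OF st w(1)]])
    also have "\<dots> = - (LINT x|MM T. v x * tback T (d_t \<phi>) x)"
      unfolding tback_initial(2)[OF T w u0] tprim_tback[OF T v vb w] using T by (simp add: tback_test[OF t] z)
    also have "(LINT x|MM T. v x * tback T (d_t \<phi>) x) = (LINT x|MM T. v x * \<phi> x)"
    proof (rule integral_cong_AE)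
      show "AE x in MM T. v x * tback T (d_t \<phi>) x = v x * \<phi> x"
        using AE_MM_fst[OF AE_tm_range]
      proof eventually_elim
        case (elim x)
        then show ?case using tback_test[OF t, of "fst x" "snd x"] by simp
      qed
    qed (intro borel_MMI borel_measurable_times vb \<phi>b borel_tback[OF w(2)])+
    finally show "(LINT x|lebesgue_on (cylinder T). ?u x * d_t \<phi> x) = - (LINT x|lebesgue_on (cylinder T). v x * \<phi> x)"
      unfolding integral_cyl[OF borel_measurable_times[OF ub w(2)]] integral_cyl[OF borel_measurable_times[OF vb \<phi>b]] .
  qed
qed

section \<open>Lebesgue measurable functions and their Borel representatives\<close>

lemma lebesgue_on_AE_measurable:
  fixes f :: "'a::euclidean_space \<Rightarrow> real"
  assumes S: "S \<in> sets borel" and f: "f \<in> Borel" and e: "AE x in lebesgue_on S. g x = f x"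
  shows "g \<in> borel_measurable (lebesgue_on S)"
proof -
  have SL: "S \<in> sets lebesgue" using S by auto
  have "AE x in lebesgue. x \<in> S \<longrightarrow> g x = f x" using e SL by (simp add: AE_restrict_space_iff)
  then have ae: "AE x in lebesgue. (if x \<in> S then f x else 0) = (if x \<in> S then g x else 0)" by eventually_elim auto
  have "(\<lambda>x. if x \<in> S then f x else 0) \<in> Borel"
    using S f by (intro measurable_If_set) auto
  then have "(\<lambda>x. if x \<in> S then f x else 0) \<in> borel_measurable lebesgue"
    by (intro measurable_completion) simp
  from borel_measurable_AE[OF this ae] show ?thesis by (rule borel_measurable_if_D)
qed

lemma integral_lebesgue_on_eq:
  fixes f f' :: "'a::euclidean_space \<Rightarrow> real"
  assumes S: "S \<in> sets borel" and b: "f' \<in> Borel" and e: "AE x in density lborel (indicator S). f x = f' x"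
  shows "(LINT x|lebesgue_on S. f x) = (LINT x|density lborel (indicator S). f' x)"
  using e by (intro integral_lebesgue_on_AE[OF S lebesgue_on_AE_measurable[OF S b] b]) (simp_all add: AE_lebesgue_on_density[OF S])

lemma L2_on_rep:
  assumes S: "S \<in> sets borel" and L: "L2_on S f"
  obtains b where "sqi (density lborel (indicator S)) b" "b \<in> Borel" "AE x in density lborel (indicator S). f x = b x"
proof -
  have f: "f \<in> borel_measurable (lebesgue_on S)" "integrable (lebesgue_on S) (\<lambda>x. (f x)^2)" using L unfolding L2_on_def by blast+
  obtain b where b: "b \<in> Borel" "AE x in lebesgue_on S. f x = b x" using borel_rep_lebesgue_on[OF S f(1)] by blast
  have a: "AE x in density lborel (indicator S). f x = b x" using b(2) by (simp add: AE_lebesgue_on_density[OF S])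
  then have a2: "AE x in density lborel (indicator S). (f x)^2 = (b x)^2" by eventually_elim simp
  have "sqi (density lborel (indicator S)) b"
    using integrable_lebesgue_on_AE[OF S borel_measurable_power[OF f(1)] borel_measurable_power[OF b(1)] a2] f(2) b(1) by (simp add: sqi_def)
  from that[OF this b(1) a] show ?thesis .
qed

lemma L2_on_sqi:
  assumes S: "S \<in> sets borel" and s: "sqi (density lborel (indicator S)) b"
  shows "L2_on S b"
proof -
  have b: "b \<in> Borel" using s by (simp add: sqi_def)
  have "integrable (lebesgue_on S) (\<lambda>x. (b x)^2)"
    unfolding integrable_lebesgue_on_density[OF S borel_measurable_power[OF b]] using s by (simp add: sqi_def)
  then show ?thesis unfolding L2_on_def using borel_lebesgue_on[OF b] by blast
qed

lemmas integral_cyl_eq = integral_lebesgue_on_eq[of "cylinder T", folded MM_density, OF cylinder_borel] for T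
lemmas integral_circle_eq = integral_lebesgue_on_eq[of circle, folded cm_def, OF circle_borel]
lemmas L2_on_cyl_rep = L2_on_rep[of "cylinder T", folded MM_density, OF cylinder_borel] for T
lemmas L2_on_circle_rep = L2_on_rep[of circle, folded cm_def, OF circle_borel]
lemmas L2_on_cyl_sqi = L2_on_sqi[of "cylinder T", folded MM_density, OF cylinder_borel] for T
lemmas L2_on_circle_sqi = L2_on_sqi[of circle, folded cm_def, OF circle_borel]

lemma L2_norm_circle:
  assumes "b \<in> Borel" "AE x in cm. f x = b x"
  shows "L2_norm circle f = sqrt (LINT z|cm. (b z)^2)"
  unfolding L2_norm_def
  by (rule arg_cong[where f=sqrt], rule integral_circle_eq[OF borel_measurable_power[OF assms(1)]]) (use assms(2) in eventually_elim, simp)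

text \<open>A time primitive is Hoelder continuous with exponent 1/2 as a function with values in
  \<open>L2\<close>, by Cauchy-Schwarz on the interval between the two times.\<close>

lemma tprim_section:
  assumes w: "sqi (MM T) w" "w \<in> Borel"
  shows "sqi cm (\<lambda>z. tprim T w (t, z))"
    and "(LINT z|cm. (tprim T w (t, z) - tprim T w (s, z))^2) \<le> \<bar>t - s\<bar> * (LINT x|MM T. (w x)^2)"
proof -
  show s: "sqi cm (\<lambda>z. tprim T w (t, z))" for t unfolding tprim_def fst_conv snd_conv by (rule time_integral(1)[OF w]) simp
  have le: "(LINT z|cm. (tprim T w (t, z) - tprim T w (s, z))^2) \<le> (t - s) * (LINT x|MM T. (w x)^2)" if st: "s \<le> t" for s t
  proof -
    let ?I = "\<lambda>z. LINT y|tm T. indicator {s..<t} y * w (y, z)"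
    have "(LINT z|cm. (tprim T w (t, z) - tprim T w (s, z))^2) = (LINT z|cm. (?I z)^2)"
    proof (rule integral_cong_AE)
      show "AE z in cm. (tprim T w (t, z) - tprim T w (s, z))^2 = (?I z)^2"
        using sqi_MM_section[OF w]
      proof eventually_elim
        case (elim z)
        have "tprim T w (t, z) - tprim T w (s, z) = (LINT y|tm T. indicator {..<t} y * w (y, z) - indicator {..<s} y * w (y, z))"
          unfolding tprim_def fst_conv snd_conv
          by (rule Bochner_Integration.integral_diff[symmetric]; rule integrable_indicator_mult[OF tm.sqi_integrable[OF elim]]) simp_all
        also have "\<dots> = ?I z" by (rule Bochner_Integration.integral_cong) (use st in \<open>auto simp: indicator_def\<close>)
        finally show ?case by simp
      qed
    qed (use sqi_diff[OF s[of t] s[of s]] time_integral(1)[OF w, of "{s..<t}"] in \<open>auto simp: sqi_def\<close>)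
    also have "\<dots> \<le> measure (tm T) {s..<t} * (LINT x|MM T. (w x)^2)" by (rule time_integral(2)[OF w]) simp
    also have "\<dots> \<le> (t - s) * (LINT x|MM T. (w x)^2)"
    proof (rule mult_right_mono)
      have "emeasure (tm T) {s..<t} \<le> emeasure lborel {s..<t}" by (subst emeasure_tm) (auto intro!: emeasure_mono)
      then show "measure (tm T) {s..<t} \<le> t - s" using st by (simp add: measure_def enn2real_leI)
    qed simp
    finally show ?thesis .
  qed
  show "(LINT z|cm. (tprim T w (t, z) - tprim T w (s, z))^2) \<le> \<bar>t - s\<bar> * (LINT x|MM T. (w x)^2)"
    using le[of s t] le[of t s] by (cases "s \<le> t") (auto simp: power2_commute)
qed

text \<open>The representative \<open>d(z) + \<integral>\<^sub>0\<^sup>t w\<close> is the one that is continuous in time.\<close>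

locale time_rep =
  fixes T :: real and d :: "real \<Rightarrow> real" and w \<eta> :: "real \<times> real \<Rightarrow> real"
  assumes T: "0 < T" and d: "sqi cm d" and w: "sqi (MM T) w" and \<eta>: "AE x in MM T. \<eta> x = d (snd x) + tprim T w x"
begin

definition "\<rho> t z = d z + tprim T w (t, z)"

lemma wb: "w \<in> Borel" by (rule sqi_MM_borel[OF w])

lemma \<rho>_sqi: "sqi cm (\<rho> t)" unfolding \<rho>_def[abs_def] by (intro sqi_add d tprim_section(1)[OF w wb])
lemma \<rho>_borel: "\<rho> t \<in> Borel" by (rule sqi_cm_borel[OF \<rho>_sqi])
lemma \<rho>_diff: "(LINT z|cm. (\<rho> t z - \<rho> s z)^2) \<le> \<bar>t - s\<bar> * (LINT x|MM T. (w x)^2)"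
  using tprim_section(2)[OF w wb] by (simp add: \<rho>_def)

lemma trace_exists: assumes "s \<in> {0..T}" shows "has_time_trace T \<eta> s (\<rho> s)"
  unfolding has_time_trace_def
proof (intro exI[of _ "\<lambda>x. \<rho> (fst x) (snd x)"] conjI ballI)
  show "AE x in lebesgue_on (cylinder T). \<rho> (fst x) (snd x) = \<eta> x" unfolding AE_cyl using \<eta> by eventually_elim (simp add: \<rho>_def)
  show "L2_on circle (\<lambda>z. \<rho> (fst (t, z)) (snd (t, z)))" for t using L2_on_circle_sqi[OF \<rho>_sqi] by simp
  show "AE z in lebesgue_on circle. \<rho> (fst (s, z)) (snd (s, z)) = \<rho> s z" by simp
  fix t
  have n: "L2_norm circle (\<lambda>z. \<rho> \<tau> z - \<rho> t z) \<le> sqrt (\<bar>\<tau> - t\<bar> * (LINT x|MM T. (w x)^2))" for \<tau>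
    unfolding L2_norm_circle[OF borel_measurable_diff[OF \<rho>_borel \<rho>_borel] AE_I2[OF refl]] using \<rho>_diff by simp
  have "((\<lambda>\<tau>. sqrt (\<bar>\<tau> - t\<bar> * (LINT x|MM T. (w x)^2))) \<longlongrightarrow> sqrt (\<bar>t - t\<bar> * (LINT x|MM T. (w x)^2))) (at t within {0..T})"
    by (intro tendsto_intros)
  then have z: "((\<lambda>\<tau>. sqrt (\<bar>\<tau> - t\<bar> * (LINT x|MM T. (w x)^2))) \<longlongrightarrow> 0) (at t within {0..T})" by simp
  show "((\<lambda>\<tau>. L2_norm circle (\<lambda>z. \<rho> (fst (\<tau>, z)) (snd (\<tau>, z)) - \<rho> (fst (t, z)) (snd (t, z)))) \<longlongrightarrow> 0) (at t within {0..T})"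
    unfolding fst_conv snd_conv
    by (rule tendsto_sandwich[OF always_eventually always_eventually tendsto_const z]) (use n in \<open>auto simp: L2_norm_def\<close>)
qed

text \<open>A set of times of full measure is dense, also at the end points of
  \<open>[0, T]\<close>, where only one side is available.\<close>

lemma dense_time:
  assumes P: "AE t in tm T. P t" and s: "s \<in> {0..T}" and e: "0 < e"
  shows "\<exists>t. P t \<and> 0 \<le> t \<and> t \<le> T \<and> t \<noteq> s \<and> \<bar>t - s\<bar> < e"
proof (rule ccontr)
  assume n: "\<not> ?thesis"
  \<comment> \<open>The interval is placed to the right of \<open>s\<close>, except for
    \<open>s = T\<close>, where it lies to the left.\<close>
  define a b where "a = (if s < T then s else max 0 (s - e))" and "b = (if s < T then min T (s + e) else s)"
  have ab: "a < b" "0 \<le> a" "b \<le> T" using s e T by (auto simp: a_def b_def)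
  have sub: "\<not> P t" if "a < t" "t < b" for t
  proof -
    have "0 \<le> t \<and> t \<le> T \<and> t \<noteq> s \<and> \<bar>t - s\<bar> < e"
      using that s unfolding a_def b_def by (cases "s < T") auto
    then show ?thesis using n by blast
  qed
  have "AE t in tm T. t \<notin> {a<..<b}" using P by eventually_elim (use sub in auto)
  then have "emeasure (tm T) {a<..<b} = 0" by (subst (asm) AE_iff_measurable[of "{a<..<b}"]) auto
  moreover have "{a<..<b} \<inter> {0<..<T} = {a<..<b}" using ab by auto
  ultimately show False using ab by (simp add: emeasure_tm)
qed

text \<open>Two representatives that are continuous in time agree on almost every slice. The times
  of these slices are dense, so both continuity statements can be used at times close to
  \<open>s\<close>.\<close>

lemma trace_unique:
  assumes tr: "has_time_trace T \<eta> s g" and s: "s \<in> {0..T}" shows "AE z in cm. g z = \<rho> s z"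
proof -
  obtain v where v: "AE x in lebesgue_on (cylinder T). v x = \<eta> x" "\<And>t. t \<in> {0..T} \<Longrightarrow> L2_on circle (\<lambda>z. v (t, z))"
    "((\<lambda>\<tau>. L2_norm circle (\<lambda>z. v (\<tau>, z) - v (s, z))) \<longlongrightarrow> 0) (at s within {0..T})" "AE z in lebesgue_on circle. v (s, z) = g z"
    using tr s unfolding has_time_trace_def by blast
  obtain b where b: "sqi cm b" "b \<in> Borel" "AE x in cm. v (s, x) = b x" by (rule L2_on_circle_rep[OF v(2)[OF s]])
  have "AE x in MM T. v x = \<rho> (fst x) (snd x)" using v(1)[unfolded AE_cyl] \<eta> by eventually_elim (simp add: \<rho>_def)
  then have good: "AE t in tm T. AE z in cm. v (t, z) = \<rho> t z" using AE_MM_D by fastforce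
  let ?K = "LINT x|MM T. (w x)^2"
  let ?I = "LINT z|cm. (\<rho> s z - b z)^2"
  have bound: "?I \<le> e^2 * (2 * ?K + 2)" if e: "0 < e" for e :: real
  proof -
    have "\<forall>\<^sub>F \<tau> in at s within {0..T}. L2_norm circle (\<lambda>z. v (\<tau>, z) - v (s, z)) < e" by (rule order_tendstoD(2)[OF v(3) e])
    then obtain \<delta> where \<delta>: "0 < \<delta>" "\<And>\<tau>. \<tau> \<in> {0..T} \<Longrightarrow> \<tau> \<noteq> s \<Longrightarrow> dist \<tau> s < \<delta> \<Longrightarrow> L2_norm circle (\<lambda>z. v (\<tau>, z) - v (s, z)) < e"
      unfolding eventually_at by auto
    \<comment> \<open>A time distance below \<open>e^2\<close> makes the error from
      \<open>\<rho>_diff\<close> of order \<open>e^2\<close> in the squared norm, the same order as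
      the error from the trace.\<close>
    obtain \<tau> where \<tau>: "AE z in cm. v (\<tau>, z) = \<rho> \<tau> z" "0 \<le> \<tau>" "\<tau> \<le> T" "\<tau> \<noteq> s" "\<bar>\<tau> - s\<bar> < min \<delta> (e^2)"
      using dense_time[OF good s, of "min \<delta> (e^2)"] \<delta>(1) e by auto
    have "AE z in cm. v (\<tau>, z) - v (s, z) = \<rho> \<tau> z - b z" using \<tau>(1) b(3) by eventually_elim simp
    then have n: "L2_norm circle (\<lambda>z. v (\<tau>, z) - v (s, z)) = sqrt (LINT z|cm. (\<rho> \<tau> z - b z)^2)"
      by (rule L2_norm_circle[OF borel_measurable_diff[OF \<rho>_borel b(2)]])
    have "sqrt (LINT z|cm. (\<rho> \<tau> z - b z)^2) < e" using \<delta>(2)[of \<tau>] \<tau> unfolding n by (simp add: dist_real_def)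
    then have "(sqrt (LINT z|cm. (\<rho> \<tau> z - b z)^2))^2 \<le> e^2" by (intro power_mono) auto
    then have 1: "(LINT z|cm. (\<rho> \<tau> z - b z)^2) \<le> e^2" by simp
    have "(LINT z|cm. (\<rho> s z - \<rho> \<tau> z)^2) \<le> \<bar>s - \<tau>\<bar> * ?K" by (rule \<rho>_diff)
    also have "\<dots> \<le> e^2 * ?K" using \<tau>(5) by (intro mult_right_mono) (auto simp: abs_minus_commute)
    finally have 2: "(LINT z|cm. (\<rho> s z - \<rho> \<tau> z)^2) \<le> e^2 * ?K" .
    have "?I \<le> 2 * (LINT z|cm. (\<rho> s z - \<rho> \<tau> z)^2) + 2 * (LINT z|cm. (\<rho> \<tau> z - b z)^2)"
      using integral_square_sum_le[OF sqi_diff[OF \<rho>_sqi \<rho>_sqi] sqi_diff[OF \<rho>_sqi b(1)], of s \<tau> \<tau>] by simp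
    then show ?thesis using 1 2 by (simp add: distrib_left)
  qed
  have I0: "0 \<le> ?I" by simp
  have "?I \<le> 0"
  proof (rule tendsto_lowerbound)
    have "((\<lambda>e. e^2 * (2 * ?K + 2)) \<longlongrightarrow> 0^2 * (2 * ?K + 2)) (at_right 0)" by (intro tendsto_intros)
    then show "((\<lambda>e. e^2 * (2 * ?K + 2)) \<longlongrightarrow> 0) (at_right 0)" by simp
    show "\<forall>\<^sub>F e in at_right 0. ?I \<le> e^2 * (2 * ?K + 2)"
      using eventually_at_right_less[of 0] by (rule eventually_mono) (rule bound)
  qed simp
  with I0 have "?I = 0" by (intro order_antisym)
  moreover have "integrable cm (\<lambda>z. (\<rho> s z - b z)^2)" using sqi_diff[OF \<rho>_sqi b(1)] by auto
  ultimately have "AE z in cm. (\<rho> s z - b z)^2 = 0" using integral_nonneg_eq_0_iff_AE[of cm "\<lambda>z. (\<rho> s z - b z)^2"] by simp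
  with b(3) v(4)[unfolded AE_circle] show ?thesis by eventually_elim simp
qed

end

text \<open>Brings an arbitrary test function into the form used in \<open>weak_form\<close>. By
  \<open>trep\<close> it is \<open>d + tprim T w\<close>. Uniqueness of traces turns its zero trace
  at \<open>T\<close> into the statement that \<open>d\<close> is minus the time integral of
  \<open>w\<close>, which makes it \<open>tback T w\<close>; the trace at 0 is identified in the
  same way.\<close>

lemma test_space_rep:
  assumes T: "0 < T" and \<eta>: "test_space T \<eta>"
  obtains w k where "sqi (MM T) w" "zpair T (tback T w) k" "AE x in MM T. \<eta> x = tback T w x"
    "AE x in MM T. weak_dt T \<eta> x = w x" "AE x in MM T. weak_dz T \<eta> x = k x"
    "AE z in cm. time_trace T \<eta> 0 z = tback T w (0, z)"
proof -
  have W: "L2_on (cylinder T) \<eta>" using \<eta> by (simp add: test_space_def W12_11_def W12_10_def)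
  obtain k0 where k0: "has_weak_dz T \<eta> k0" "L2_on (cylinder T) k0" using \<eta> by (auto simp: test_space_def W12_11_def W12_10_def)
  obtain w0 where w0: "has_weak_dt T \<eta> w0" "L2_on (cylinder T) w0" using \<eta> by (auto simp: test_space_def W12_11_def)
  obtain e where e: "sqi (MM T) e" "e \<in> Borel" "AE x in MM T. \<eta> x = e x" by (rule L2_on_cyl_rep[OF W])
  obtain k where k: "sqi (MM T) k" "k \<in> Borel" "AE x in MM T. k0 x = k x" by (rule L2_on_cyl_rep[OF k0(2)])
  obtain w where w: "sqi (MM T) w" "w \<in> Borel" "AE x in MM T. w0 x = w x" by (rule L2_on_cyl_rep[OF w0(2)])
  note ie = MMf.sqi_integrable[OF e(1)] and ik = MMf.sqi_integrable[OF k(1)] and iw = MMf.sqi_integrable[OF w(1)]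
  have i\<eta>: "integrable (lebesgue_on (cylinder T)) \<eta>" "integrable (lebesgue_on (cylinder T)) k0" "integrable (lebesgue_on (cylinder T)) w0"
    using k0(1) w0(1) by (auto simp: has_weak_dz_alt has_weak_dt_alt)
  have tz: "(LINT x|MM T. e x * (f (fst x) * deriv g (snd x))) = - (LINT x|MM T. k x * (f (fst x) * g (snd x)))"
    and tt: "(LINT x|MM T. e x * (deriv f (fst x) * g (snd x))) = - (LINT x|MM T. w x * (f (fst x) * g (snd x)))"
    if f: "tbump T f" and g: "cbump g" for f g
  proof -
    let ?\<phi> = "\<lambda>x. f (fst x) * g (snd x)"
    note t = test_function_prod[OF f g]
    have s: "smooth_on UNIV ?\<phi>" using t(1) by (simp add: test_function_def)
    note c = borel_measurable_continuous_onI[OF smooth_continuous[OF s]]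
      borel_measurable_continuous_onI[OF smooth_partial(3)[OF s]] borel_measurable_continuous_onI[OF smooth_partial(4)[OF s]]
    have "(LINT x|lebesgue_on (cylinder T). \<eta> x * d_z ?\<phi> x) = - (LINT x|lebesgue_on (cylinder T). k0 x * ?\<phi> x)"
      using k0(1) t(1) by (simp add: has_weak_dz_alt)
    then show "(LINT x|MM T. e x * (f (fst x) * deriv g (snd x))) = - (LINT x|MM T. k x * (f (fst x) * g (snd x)))"
      unfolding cyl_product[OF i\<eta>(1) e(2,3) c(3)] cyl_product[OF i\<eta>(2) k(2,3) c(1)] unfolding t(3) .
    have "(LINT x|lebesgue_on (cylinder T). \<eta> x * d_t ?\<phi> x) = - (LINT x|lebesgue_on (cylinder T). w0 x * ?\<phi> x)"
      using w0(1) t(1) by (simp add: has_weak_dt_alt)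
    then show "(LINT x|MM T. e x * (deriv f (fst x) * g (snd x))) = - (LINT x|MM T. w x * (f (fst x) * g (snd x)))"
      unfolding cyl_product[OF i\<eta>(1) e(2,3) c(2)] cyl_product[OF i\<eta>(3) w(2,3) c(1)] unfolding t(2) .
  qed
  note Z = zrep[OF ie ik T tz]
  obtain c where c: "AE x in MM T. e x = c (fst x) + zprim k x" using Z(2) by blast
  obtain d where d: "d \<in> Borel" "AE x in MM T. e x = d (snd x) + tprim T w x" using trep[OF ie iw T tt] by blast
  have st: "sqi (MM T) (tprim T w)" by (rule sqi_tprim[OF T w(1,2)])
  \<comment> \<open>\<open>trep\<close> yields only integrability of \<open>d\<close>. On the
    cylinder, however, \<open>d\<close> is a difference of two functions in \<open>L2\<close>, and
    integrating out \<open>t\<close> gives square integrability on the circle.\<close>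
  have sd: "sqi cm d"
  proof -
    have m: "(\<lambda>x. d (snd x)) \<in> borel_measurable (borel :: (real \<times> real) measure)" by (rule measurable_compose[OF borel_fst_snd(2) d(1)])
    have "AE x in MM T. e x - tprim T w x = d (snd x)" using d(2) by eventually_elim simp
    then have "sqi (MM T) (\<lambda>x. d (snd x))" by (rule sqi_cong_AE[OF sqi_diff[OF e(1) st] borel_MMI[OF m]])
    then have "integrable (MM T) (\<lambda>x. (d (snd x))^2)" by auto
    from integrable_MM_snd[OF this] have "integrable cm (\<lambda>z. T * (d z)^2)" using T by (simp add: measure_tm)
    then have "integrable cm (\<lambda>z. inverse T * (T * (d z)^2))" by (rule integrable_mult_right)
    then have "integrable cm (\<lambda>z. (d z)^2)" using T by (simp add: mult.assoc[symmetric])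
    then show ?thesis using borel_cmI[OF d(1)] by (simp add: sqi_def)
  qed
  have \<eta>d: "AE x in MM T. \<eta> x = d (snd x) + tprim T w x" using d(2) e(3) by eventually_elim simp
  interpret R: time_rep T d w \<eta> by standard (rule T sd w(1) \<eta>d)+
  have "has_time_trace T \<eta> T (\<lambda>_. 0)" using \<eta> by (simp add: test_space_def)
  from R.trace_unique[OF this] T have z: "AE z in cm. 0 = R.\<rho> T z" by simp
  have R: "AE z in cm. \<forall>t\<in>{0..T}. R.\<rho> t z = tback T w (t, z)"
    using z sqi_MM_section[OF w(1,2)]
  proof eventually_elim
    case (elim z)
    have iz: "integrable (tm T) (\<lambda>y. w (y, z))" by (rule tm.sqi_integrable[OF elim(2)])
    have "tprim T w (T, z) = (LINT y|tm T. w (y, z))"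
      unfolding tprim_def fst_conv snd_conv
    proof (rule integral_cong_AE)
      have wz: "(\<lambda>y. w (y, z)) \<in> Borel" by (rule borel_pair_section[OF w(2)]) simp_all
      show "(\<lambda>y. w (y, z)) \<in> borel_measurable (tm T)" by (rule borel_tmI[OF wz])
      show "(\<lambda>s. indicator {..<T} s * w (s, z)) \<in> borel_measurable (tm T)" by (rule borel_tmI[OF borel_measurable_times[OF _ wz]]) simp
      show "AE s in tm T. indicator {..<T} s * w (s, z) = w (s, z)" using AE_tm_range by eventually_elim simp
    qed
    then have dz: "d z = - (LINT y|tm T. w (y, z))" using elim(1) by (simp add: R.\<rho>_def)
    show ?case
    proof
      fix t
      show "R.\<rho> t z = tback T w (t, z)"
        unfolding R.\<rho>_def dz tback_def tprim_def fst_conv snd_conv integral_complement[OF iz] by simp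
    qed
  qed
  have \<eta>b: "AE x in MM T. \<eta> x = tback T w x"
    using \<eta>d AE_MM_snd[OF R] AE_MM_fst[OF AE_tm_range]
  proof eventually_elim
    case (elim x)
    then have "R.\<rho> (fst x) (snd x) = tback T w x" by simp
    then show ?case using elim(1) by (simp add: R.\<rho>_def)
  qed
  have "AE x in MM T. tback T w x = c (fst x) + zprim k x" using c e(3) \<eta>b by eventually_elim simp
  then have zp: "zpair T (tback T w) k"
    unfolding zpair_def using borel_tback[OF w(2)] k(1,2) sqi_tback[OF T w(1,2)] Z(1) by blast
  have "has_time_trace T \<eta> 0 (time_trace T \<eta> 0)" unfolding time_trace_def
    by (rule someI[of "has_time_trace T \<eta> 0", OF R.trace_exists]) (use T in simp)
  from R.trace_unique[OF this] T have "AE z in cm. time_trace T \<eta> 0 z = R.\<rho> 0 z" by simp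
  with R have tr: "AE z in cm. time_trace T \<eta> 0 z = tback T w (0, z)" by eventually_elim (use T in simp)
  have "AE x in MM T. weak_dt T \<eta> x = w x" using weak_dt_eq(2)[OF w0(1)] w(3) by eventually_elim simp
  moreover have "AE x in MM T. weak_dz T \<eta> x = k x" using weak_dz_eq(2)[OF k0(1)] k(3) by eventually_elim simp
  ultimately show ?thesis using that[OF w(1) zp \<eta>b _ _ tr] by blast
qed

section \<open>Existence of weak solutions\<close>

lemma periodic_frac: "periodic1 (\<lambda>z. f (frac z))" by (simp add: periodic1_def frac_1_eq)

lemma borel_frac: "f \<in> Borel \<Longrightarrow> (\<lambda>z::real. f (frac z)) \<in> Borel"
  by (rule measurable_compose[of frac borel borel]) (auto simp: frac_def[abs_def])

lemma frac_id: "0 \<le> z \<Longrightarrow> z < 1 \<Longrightarrow> frac z = z" by (simp add: frac_eq)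

lemma pL2_frac:
  assumes b: "sqi cm b" shows "pL2 (\<lambda>z. b (frac z))" "AE z in cm. b (frac z) = b z"
proof -
  have m: "(\<lambda>z. b (frac z)) \<in> Borel" by (rule borel_frac[OF sqi_cm_borel[OF b]])
  show e: "AE z in cm. b (frac z) = b z" using AE_cm_range by eventually_elim (simp add: frac_id)
  then have "AE z in cm. b z = b (frac z)" by eventually_elim simp
  from sqi_cong_AE[OF b borel_cmI[OF m] this] show "pL2 (\<lambda>z. b (frac z))" using m periodic_frac by (simp add: pL2_def)
qed

text \<open>The zero mean lets the primitive close up over a period. Its increment over a length
  \<open>d\<close> is \<open>d\<close> times an average of the periodic extension of
  \<open>w\<close>; this gives continuity with exponent 1/2 as well as a bound of the difference
  quotients that is uniform in \<open>d\<close>.\<close>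

lemma circle_primitive:
  fixes c :: real
  assumes w: "sqi cm w" and w0: "(LINT z|cm. w z) = 0"
  defines "U \<equiv> \<lambda>z. c + prm w (frac z)"
  shows "cper U" "\<And>d. 0 < d \<Longrightarrow> d \<le> 1 \<Longrightarrow> nsq (Dp d U) \<le> (LINT z|cm. (w z)^2)"
proof -
  let ?W = "\<lambda>z. w (frac z)"
  note W = pL2_frac[OF w]
  have Wb: "?W \<in> Borel" using W(1) by (simp add: pL2_def)
  have wb: "w \<in> Borel" by (rule sqi_cm_borel[OF w])
  have K: "(LINT z|cm. (?W z)^2) = (LINT z|cm. (w z)^2)"
  proof (rule integral_cong_AE)
    show "AE z in cm. (?W z)^2 = (w z)^2" using W(2) by eventually_elim simp
  qed (intro borel_cmI borel_measurable_power Wb wb)+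
  have U1: "periodic1 U" unfolding U_def by (rule periodic_frac)
  have P: "prm w z = seg ?W 0 z" if z: "0 \<le> z" "z \<le> 1" for z
  proof -
    have "prm w z = (LINT t|lborel. indicator {0<..<1} t * (indicator {..<z} t * w t))"
      unfolding prm_def cm_eq_tm by (rule tm_integral, rule borel_measurable_times[OF _ wb]) simp
    also have "\<dots> = seg ?W 0 z" unfolding seg_def
      by (rule Bochner_Integration.integral_cong) (use z in \<open>auto simp: indicator_def frac_id\<close>)
    finally show ?thesis .
  qed
  have P1: "seg ?W 0 1 = 0"
  proof -
    have "prm w 1 = (LINT z|cm. w z)" unfolding prm_def
    proof (rule integral_cong_AE)
      show "AE y in cm. indicator {..<1} y * w y = w y" using AE_cm_range by eventually_elim simp
      show "(\<lambda>y. indicator {..<1} y * w y) \<in> borel_measurable cm" by (rule borel_cmI, rule borel_measurable_times[OF _ wb]) simp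
    qed (rule borel_cmI[OF wb])
    then show ?thesis using P[of 1] w0 by simp
  qed
  \<comment> \<open>A window that reaches beyond 1 is split there; as the integral over the full
    period is 0, the primitive starts again from its value at 0.\<close>
  have id0: "U (z + d) - U z = d * Av d ?W z" if z: "0 \<le> z" "z < 1" and d: "0 < d" "d \<le> 1" for z d
  proof -
    have A: "d * Av d ?W z = seg ?W z (z + d)" unfolding Av_def seg_shift[OF Wb] using d by simp
    show ?thesis
    proof (cases "z + d < 1")
      case True
      then have "frac (z + d) = z + d" "frac z = z" using z d by (auto simp: frac_id)
      then show ?thesis unfolding A U_def using P[of z] P[of "z + d"] seg_add[OF W(1), of 0 z "z + d"] z d True by simp
    next
      case False
      have f: "frac (z + d) = z + d - 1" "frac z = z" using z d False by (auto simp: frac_unique_iff)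
      have sh: "seg ?W 1 (z + d) = seg ?W 0 (z + d - 1)"
        using seg_shift[OF Wb, of "z + d - 1" 1] seg_shift[OF Wb, of "z + d - 1" 0] by (simp add: frac_def)
      have "seg ?W z (z + d) = seg ?W z 1 + seg ?W 1 (z + d)" by (rule seg_add[OF W(1)]) (use z d False in auto)
      moreover have "seg ?W 0 1 = seg ?W 0 z + seg ?W z 1" by (rule seg_add[OF W(1)]) (use z in auto)
      ultimately show ?thesis unfolding A U_def f using P[of z] P[of "z + d - 1"] P1 sh z d False by simp
    qed
  qed
  have id: "U (z + d) - U z = d * Av d ?W z" if d: "0 < d" "d \<le> 1" for z d
  proof -
    have "U (frac z + d) - U (frac z) = d * Av d ?W (frac z)" by (rule id0[OF _ _ d]) (auto simp: frac_lt_1)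
    moreover have "U (frac z + d) = U (z + d)" using periodic1_int[OF U1, of "frac z + d" "\<lfloor>z\<rfloor>"] by (simp add: frac_def)
    moreover have "U (frac z) = U z" using periodic1_int[OF U1, of "frac z" "\<lfloor>z\<rfloor>"] by (simp add: frac_def)
    moreover have "Av d ?W (frac z) = Av d ?W z" using periodic1_int[OF Av_periodic(1)[OF periodic_frac[of w]], of d "frac z" "\<lfloor>z\<rfloor>"] by (simp add: frac_def)
    ultimately show ?thesis by simp
  qed
  have sq: "\<bar>U (z + d) - U z\<bar> \<le> sqrt (d * (LINT z|cm. (w z)^2))" if d: "0 < d" "d \<le> 1" for z d
  proof -
    have "(U (z + d) - U z)^2 = d^2 * (Av d ?W z)^2" unfolding id[OF d] by (simp add: power_mult_distrib)
    also have "\<dots> \<le> d^2 * ((LINT z|cm. (?W z)^2) / d)" by (rule mult_left_mono[OF Av_square_le(2)[OF W(1) d]]) simp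
    also have "\<dots> = d * (LINT z|cm. (w z)^2)" using d unfolding K by (simp add: power2_eq_square)
    finally show ?thesis by (rule real_le_rsqrt[of "\<bar>_\<bar>", unfolded power2_abs])
  qed
  show U: "cper U" unfolding cper_def using U1 continuous_of_sqrt_modulus[of 1 U, OF sq] by simp
  show "nsq (Dp d U) \<le> (LINT z|cm. (w z)^2)" if d: "0 < d" "d \<le> 1" for d
  proof -
    have "Dp d U = Av d ?W" using id[OF d] d by (simp add: Dp_def fun_eq_iff)
    then show ?thesis using Av_contract(2)[OF W(1) d] K by (simp add: ip_self)
  qed
qed

lemma periodic1_iff: "periodic_fun_simple' g \<longleftrightarrow> periodic1 g"
  by (simp add: periodic_fun_simple'_def periodic1_def)

text \<open>Functions of \<open>z\<close> alone are regarded as functions on the cylinder with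
  \<open>T = 1\<close>, so that \<open>zrep\<close> provides the primitive; a single good slice then
  gives the statement on the circle.\<close>

lemma W12_circle_rep:
  assumes "W12_circle u0"
  obtains U W where "cper U" "\<forall>d. 0 < d \<longrightarrow> d \<le> 1 \<longrightarrow> nsq (Dp d U) \<le> W" "AE z in cm. u0 z = U z"
proof -
  obtain w0 where w0: "has_weak_deriv_circle u0 w0" "L2_on circle w0" and L: "L2_on circle u0"
    using assms by (auto simp: W12_circle_def L2_circle_def)
  obtain b where b: "sqi cm b" "b \<in> Borel" "AE z in cm. u0 z = b z" by (rule L2_on_circle_rep[OF L])
  obtain w where w: "sqi cm w" "w \<in> Borel" "AE z in cm. w0 z = w z" by (rule L2_on_circle_rep[OF w0(2)])
  have ib: "integrable cm b" and iw: "integrable cm w" using b(1) w(1) by (auto intro: cm.sqi_integrable)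
  have iu: "u0 \<in> borel_measurable (lebesgue_on circle)" "w0 \<in> borel_measurable (lebesgue_on circle)" using L w0(2) by (auto simp: L2_on_def)
  have t: "(LINT z|cm. b z * deriv g z) = - (LINT z|cm. w z * g z)" if g: "cbump g" for g
  proof -
    note gb = cbump_borel[OF g] and gd = cper_borel[OF cper_cbump_deriv(1)[OF g]]
    have "(LINT z|lebesgue_on circle. u0 z * deriv g z) = - (LINT z|lebesgue_on circle. w0 z * g z)"
      using w0(1) g by (simp add: has_weak_deriv_circle_def cbump_def periodic_fun_simple'_def)
    moreover have "(LINT z|lebesgue_on circle. u0 z * deriv g z) = (LINT z|cm. b z * deriv g z)"
      by (rule integral_circle_eq[OF borel_measurable_times[OF b(2) gd]]) (use b(3) in eventually_elim, simp)
    moreover have "(LINT z|lebesgue_on circle. w0 z * g z) = (LINT z|cm. w z * g z)"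
      by (rule integral_circle_eq[OF borel_measurable_times[OF w(2) gb]]) (use w(3) in eventually_elim, simp)
    ultimately show ?thesis by simp
  qed
  have Z: "AE t in tm 1. (LINT z|cm. w (snd (t, z))) = 0"
    "\<exists>c\<in>Borel. AE x in MM 1. b (snd x) = c (fst x) + zprim (\<lambda>x. w (snd x)) x"
  proof -
    have "(LINT x|MM 1. b (snd x) * (f (fst x) * deriv g (snd x))) = - (LINT x|MM 1. w (snd x) * (f (fst x) * g (snd x)))"
      if f: "tbump 1 f" and g: "cbump g" for f g
    proof -
      note i = tbump_integrable[OF f, of 1]
        sqi_mult_integrable[OF b(1) cper_sqi[OF cper_cbump_deriv(1)[OF g]]] sqi_mult_integrable[OF w(1) cper_sqi[OF cbump_cper[OF g]]]
      show ?thesis using MM_prod_integral[OF i(1,2)] MM_prod_integral[OF i(1,3)] t[OF g] by (simp add: mult.left_commute)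
    qed
    from zrep[OF integrable_MM_of_snd[OF ib] integrable_MM_of_snd[OF iw] _ this]
    show "AE t in tm 1. (LINT z|cm. w (snd (t, z))) = 0"
      "\<exists>c\<in>Borel. AE x in MM 1. b (snd x) = c (fst x) + zprim (\<lambda>x. w (snd x)) x" by simp_all
  qed
  \<comment> \<open>\<open>tm 1\<close> is not the zero measure, so what holds for almost every
    \<open>t\<close> holds for some \<open>t\<close>.\<close>
  have ne: "\<exists>t. Q t" if "AE t in tm 1. Q t" for Q
    using AE_cm_const[of False] that unfolding cm_eq_tm by (metis (mono_tags, lifting) AE_mp AE_I2)
  have w0: "(LINT z|cm. w z) = 0" using ne[OF Z(1)] by simp
  obtain c where c: "AE x in MM 1. b (snd x) = c (fst x) + zprim (\<lambda>x. w (snd x)) x" using Z(2) by blast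
  obtain t where "AE z in cm. b (snd (t, z)) = c (fst (t, z)) + zprim (\<lambda>x. w (snd x)) (t, z)" using ne[OF AE_MM_D[OF c]] by blast
  then have bz: "AE z in cm. b z = c t + prm w z" by (simp add: zprim_def prm_def)
  note U = circle_primitive[OF w(1) w0, where c="c t"]
  have "AE z in cm. u0 z = c t + prm w (frac z)" using bz b(3) AE_cm_range by eventually_elim (simp add: frac_id)
  with U show ?thesis using that by blast
qed

lemma holder_continuous:
  assumes g: "holder_circle \<alpha> g" and a: "0 < \<alpha>" shows "cper g"
proof -
  obtain C where C: "\<And>x y. \<bar>g x - g y\<bar> \<le> C * \<bar>x - y\<bar> powr \<alpha>" and p: "periodic1 g"
    using g by (auto simp: holder_circle_def periodic1_iff)
  have "isCont g z" for z
    unfolding continuous_at Lim_null[of g]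
  proof (rule Lim_null_comparison)
    show "\<forall>\<^sub>F y in at z. norm (g y - g z) \<le> C * \<bar>y - z\<bar> powr \<alpha>" by (simp add: C)
    have "((\<lambda>y. C * \<bar>y - z\<bar> powr \<alpha>) \<longlongrightarrow> C * \<bar>z - z\<bar> powr \<alpha>) (at z)"
      by (intro tendsto_mult tendsto_const tendsto_powr2 tendsto_intros) (auto simp: a)
    then show "((\<lambda>y. C * \<bar>y - z\<bar> powr \<alpha>) \<longlongrightarrow> 0) (at z)" using a by simp
  qed
  then show ?thesis unfolding cper_def using p by (simp add: continuous_at_imp_continuous_on)
qed

section \<open>Piecewise smooth data\<close>

lemma break_points:
  shows countable_break_points: "countable (break_points M zs)" and closed_break_points: "closed (break_points M zs)"
    and break_points_shift: "z + 1 \<in> break_points M zs \<longleftrightarrow> z \<in> break_points M zs"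
proof -
  have e: "break_points M zs = (\<Union>k\<in>{1..M}. (\<lambda>y. zs k + y) ` \<int>)" by (auto simp: break_points_def Ints_def)
  show "countable (break_points M zs)" unfolding e by (intro countable_UN countable_image) (auto simp: Ints_def)
  show "closed (break_points M zs)" unfolding e by (intro closed_UN ballI closed_translation[OF closed_Ints]) auto
  have 1: "z + of_int m \<in> break_points M zs" if "z \<in> break_points M zs" for z m
    using that by (auto simp: break_points_def) (metis add.assoc of_int_add)
  show "z + 1 \<in> break_points M zs \<longleftrightarrow> z \<in> break_points M zs" using 1[of z 1] 1[of "z + 1" "-1"] by auto
qed

lemma smooth_on_isCont: "smooth_on S g \<Longrightarrow> x \<in> S \<Longrightarrow> isCont g x"
  by (auto simp: smooth_on_def dest!: spec[of _ "Suc 0"] intro: differentiable_imp_continuous_within)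

lemma AE_cm_countable: "countable P \<Longrightarrow> AE z in cm. z \<notin> P"
  unfolding AE_cm by (rule AE_mp[OF AE_not_in[OF countable_imp_null_set_lborel]]) auto

lemma piecewise_smooth_coefficient:
  assumes P: "countable P" and g: "piecewise_smooth P (g :: real \<Rightarrow> real)"
  shows "g \<in> Borel" "AE z in cm. isCont g z"
proof -
  have c: "isCont g z" if "z \<notin> P" for z using g that by (intro smooth_on_isCont[of "- P"]) (auto simp: piecewise_smooth_def)
  show "g \<in> Borel"
    by (rule borel_measurable_continuous_countable_exceptions[OF P]) (auto intro: continuous_at_imp_continuous_on c)
  show "AE z in cm. isCont g z" using AE_cm_countable[OF P] by eventually_elim (rule c)
qed

text \<open>Off the open set on which \<open>g\<close> is known to be continuous its value is
  replaced by 0. Then measurability, the bound and periodicity hold everywhere, and since the set is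
  open, continuity at its points is preserved.\<close>

lemma piecewise_smooth_source:
  fixes g :: "real \<times> real \<Rightarrow> real" assumes P: "countable P" "closed P" "\<And>z. z + 1 \<in> P \<longleftrightarrow> z \<in> P"
    and g: "\<forall>x\<in>{0<..<T} \<times> - P. isCont g x" "periodic_z T g" and B: "\<forall>t\<in>{0<..<T}. \<forall>z. \<bar>g (t, z)\<bar> \<le> B" "0 \<le> B"
  defines "G \<equiv> \<lambda>x. indicator ({0<..<T} \<times> - P) x * g x"
  shows "G \<in> Borel" "\<And>x. \<bar>G x\<bar> \<le> B" "\<And>t z. G (t, z + 1) = G (t, z)"
    "AE x in MM T. isCont G x" "AE x in MM T. g x = G x"
proof -
  have op: "open ({0<..<T} \<times> - P)" using P(2) by (intro open_Times) auto
  have cont: "continuous_on ({0<..<T} \<times> - P) g"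
    by (rule continuous_at_imp_continuous_on[OF g(1)])
  show "G \<in> Borel"
    using borel_measurable_continuous_on_indicator[OF _ cont] op by (simp add: G_def)
  show "\<bar>G x\<bar> \<le> B" for x using B by (cases x) (auto simp: G_def indicator_def)
  show "G (t, z + 1) = G (t, z)" for t z
    using g(2) P(3)[of z] by (auto simp: G_def indicator_def periodic_z_def periodic_fun_simple'_def)
  have in_W: "AE x in MM T. x \<in> {0<..<T} \<times> - P"
    using AE_MM_fst[OF AE_tm_range] AE_MM_snd[OF AE_cm_countable[OF P(1)]] by eventually_elim (auto simp: mem_Times_iff)
  show "AE x in MM T. g x = G x" using in_W by eventually_elim (simp add: G_def)
  show "AE x in MM T. isCont G x"
    using in_W
  proof eventually_elim
    case (elim x)
    have "\<forall>\<^sub>F y in nhds x. G y = g y" by (rule eventually_mono[OF eventually_nhds_in_open[OF op elim]]) (simp add: G_def)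
    then show ?case using isCont_cong bspec[OF g(1) elim] by blast
  qed
qed

section \<open>From the weak form to weak solutions\<close>

lemma zpair_cong:
  assumes z: "zpair T e k" and e': "e' \<in> Borel" "AE x in MM T. e x = e' x"
  shows "zpair T e' k"
proof -
  obtain c where c: "AE x in MM T. e x = c (fst x) + zprim k x" using z by (auto simp: zpair_def)
  have "AE x in MM T. e' x = c (fst x) + zprim k x" using c e'(2) by eventually_elim simp
  moreover have "sqi (MM T) e'" by (rule sqi_cong_AE[OF zpair_slices(3)[OF z] borel_MMI[OF e'(1)] e'(2)])
  ultimately show ?thesis using z e'(1) by (auto simp: zpair_def)
qed

text \<open>Weak limits are determined up to null sets of one period only, whereas the spaces of the
  statement ask for exact periodicity in \<open>z\<close>; so the values on one period are
  copied.\<close>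

definition periodize :: "(real \<times> real \<Rightarrow> real) \<Rightarrow> real \<times> real \<Rightarrow> real" where
  "periodize g x = g (fst x, frac (snd x))"

lemma periodize:
  assumes "g \<in> Borel"
  shows "periodize g \<in> Borel" "AE x in MM T. g x = periodize g x" "periodic_z S (periodize g)"
proof -
  have [measurable]: "g \<in> borel_measurable (borel \<Otimes>\<^sub>M borel)" using assms by (simp add: borel_prod)
  have [measurable]: "frac \<in> borel_measurable (borel :: real measure)" by (simp add: frac_def[abs_def])
  have "periodize g \<in> borel_measurable (borel \<Otimes>\<^sub>M borel)" unfolding periodize_def[abs_def] by measurable
  then show "periodize g \<in> Borel" by (simp add: borel_prod)
  show "AE x in MM T. g x = periodize g x" using AE_MM_snd[OF AE_cm_range] by eventually_elim (simp add: periodize_def frac_id)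
  show "periodic_z S (periodize g)" by (simp add: periodic_z_def periodic_fun_simple'_def periodize_def frac_1_eq)
qed

lemma W12_10_zpair:
  assumes "zpair T e k" "periodic_z T e" shows "W12_10 T e"
  unfolding W12_10_def
  using assms(2) L2_on_cyl_sqi[OF zpair_slices(3)[OF assms(1)]] L2_on_cyl_sqi[OF zpair_slices(4)[OF assms(1)]]
    has_weak_dz_zpair[OF assms(1)] by blast

lemma V2_zpair:
  assumes z: "zpair T e k" and p: "periodic_z T e" and C: "AE t in tm T. (LINT z|cm. (e (t, z))^2) \<le> C"
  shows "V2 T e"
proof -
  note s = zpair_slices(1,3)[OF z]
  have "AE t in tm T. L2_on circle (\<lambda>z. e (t, z)) \<and> L2_norm circle (\<lambda>z. e (t, z)) \<le> sqrt C"
    using C sqi_MM_section'[OF s(2,1)]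
  proof eventually_elim
    case (elim t)
    then show ?case using L2_on_circle_sqi[OF elim(2)] L2_norm_circle[OF sqi_cm_borel[OF elim(2)], of "\<lambda>z. e (t, z)"] by simp
  qed
  then show ?thesis unfolding V2_def AE_time using W12_10_zpair[OF z p] by blast
qed

text \<open>Passes to exactly periodic representatives, and then replaces the chosen weak
  derivatives and traces in the two identities by the concrete functions with which they agree
  almost everywhere. Only the term \<open>p (h^2)_z \<zeta>\<close> has a different form in
  \<open>weak_form\<close>, where the derivative is on the test function;
  \<open>zpair_square_IBP\<close> connects the two forms.\<close>

lemma weak_solution_of_weak_form:
  fixes h :: "2 \<Rightarrow> real \<times> real \<Rightarrow> real" and j :: "real \<times> real \<Rightarrow> real ^ 2" and h0 :: "real \<Rightarrow> real ^ 2"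
  assumes T: "0 < T" and W: "weak_form T p r \<nu> J F (\<lambda>l z. h0 z $ l) U u1' h g v q"
    and r: "r \<in> Borel" "\<And>z. \<bar>r z\<bar> \<le> r1" and \<nu>: "\<nu> \<in> Borel" "\<And>z. \<bar>\<nu> z\<bar> \<le> \<nu>1"
    and J: "\<And>l. J l \<in> Borel" "\<And>l x. \<bar>J l x\<bar> \<le> Jb" "\<And>l. AE x in MM T. j x $ l = J l x"
    and F: "F \<in> Borel" "AE x in MM T. f x = F x"
    and h0: "\<And>l. cper (\<lambda>z. h0 z $ l)" and U: "cper U" "AE z in cm. u0 z = U z"
    and u1: "u1' \<in> Borel" "AE z in cm. u1 z = u1' z"
  shows "\<exists>h u. weak_solution T r \<nu> p j f h0 u0 u1 h u"
proof -
  have zh0: "zpair T (h l) (g l)" and sv: "sqi (MM T) v" and zu0: "zpair T (\<lambda>x. U (snd x) + tprim T v x) q" for l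
    using W unfolding weak_form_def by blast+
  obtain C where C0: "\<And>l. AE t in tm T. (LINT z|cm. (h l (t, z))^2) \<le> C" using W unfolding weak_form_def by blast
  have Ih: "- (LINT x|MM T. h l x * w x) - (LINT z|cm. h0 z $ l * tback T w (0, z))
        = - (LINT x|MM T. ((r (snd x) * g l x - h l x * v x) - r (snd x) * J l x) * k x)"
      "integrable (MM T) (\<lambda>x. h l x * v x * k x)" if "sqi (MM T) w" "zpair T (tback T w) k" for l w k
    using W that unfolding weak_form_def by blast+
  have Iu: "- (LINT x|MM T. v x * w x) - (LINT z|cm. u1' z * tback T w (0, z))
        = - (LINT x|MM T. (\<nu> (snd x))^2 * q x * k x) + p * (\<Sum>l\<in>(UNIV :: 2 set). LINT x|MM T. h l x * h l x * k x)
          + (LINT x|MM T. F x * tback T w x)" if "sqi (MM T) w" "zpair T (tback T w) k" for w k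
    using W that unfolding weak_form_def by blast

  note hb = zpair_slices(1)[OF zh0] and gb = zpair_slices(2)[OF zh0] and sg = zpair_slices(4)[OF zh0]
    and qb = zpair_slices(2)[OF zu0] and sq = zpair_slices(4)[OF zu0] and vb = sqi_MM_borel[OF sv]
  have rb: "(\<lambda>x. r (snd x)) \<in> borel_measurable (borel :: (real \<times> real) measure)"
    and \<nu>b: "(\<lambda>x. \<nu> (snd x)) \<in> borel_measurable (borel :: (real \<times> real) measure)"
    by (rule measurable_compose[OF borel_fst_snd(2) r(1)], rule measurable_compose[OF borel_fst_snd(2) \<nu>(1)])
  define H where "H l = periodize (h l)" for l
  define V where "V = periodize v"
  \<comment> \<open>\<open>u\<close> is rebuilt from the periodic \<open>V\<close>, so that it
    remains exactly a time primitive and \<open>time_rep\<close> applies to it.\<close>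
  define u where "u x = U (snd x) + tprim T V x" for x
  note H = periodize[OF hb, folded H_def] and V = periodize[OF vb, folded V_def]
  have zh: "zpair T (H l) (g l)" for l by (rule zpair_cong[OF zh0 H(1,2)])
  have sV: "sqi (MM T) V" by (rule sqi_cong_AE[OF sv borel_MMI[OF V(1)] V(2)])
  have C: "AE t in tm T. (LINT z|cm. (H l (t, z))^2) \<le> C" for l
    using C0[of l]
  proof eventually_elim
    case (elim t)
    have "(LINT z|cm. (H l (t, z))^2) = (LINT z|cm. (h l (t, z))^2)"
    proof (rule integral_cong_AE)
      show "(\<lambda>z. (H l (t, z))^2) \<in> borel_measurable cm" "(\<lambda>z. (h l (t, z))^2) \<in> borel_measurable cm"
        by (rule borel_cmI[OF borel_measurable_power[OF borel_pair_section[OF H(1)]]], simp_all,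
            rule borel_cmI[OF borel_measurable_power[OF borel_pair_section[OF hb]]], simp_all)
      show "AE z in cm. (H l (t, z))^2 = (h l (t, z))^2" using AE_cm_range by eventually_elim (simp add: H_def periodize_def frac_id)
    qed
    with elim show ?case by simp
  qed
  have Vfrac: "tprim T V (t, z) = tprim T v (t, frac z)" for t z by (simp add: tprim_def V_def periodize_def)
  have "u \<in> Borel" unfolding u_def[abs_def]
    by (intro borel_measurable_add measurable_compose[OF borel_fst_snd(2)] borel_tprim V(1) cper_borel U(1))
  moreover have "AE x in MM T. U (snd x) + tprim T v x = u x"
    using AE_MM_snd[OF AE_cm_range] by eventually_elim (use Vfrac in \<open>auto simp: u_def frac_id\<close>)
  ultimately have zu: "zpair T u q" by (rule zpair_cong[OF zu0])
  have pu: "periodic_z T u"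
    using cper_periodic[OF U(1)] Vfrac by (simp add: periodic_z_def periodic_fun_simple'_def u_def periodic1_def frac_1_eq)
  have dtu: "has_weak_dt T u V" unfolding u_def[abs_def] by (rule has_weak_dt_tprim[OF T sV cper_pL2[OF U(1)]])
  have Wu: "W12_11 T u" unfolding W12_11_def using W12_10_zpair[OF zu pu] dtu L2_on_cyl_sqi[OF sV] by blast
  define hv :: "real \<times> real \<Rightarrow> real ^ 2" where "hv x = (\<chi> l. H l x)" for x
  have hv: "(\<lambda>x. hv x $ l) = H l" for l by (simp add: hv_def)
  have dsq: "has_weak_dz T (sq_norm2 hv) (\<lambda>x. 2 * (H 1 x * g 1 x) + 2 * (H 2 x * g 2 x))"
  proof -
    have "sq_norm2 hv = (\<lambda>x. (H 1 x)^2 + (H 2 x)^2)" by (simp add: sq_norm2_def hv_def fun_eq_iff)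
    then show ?thesis by (simp only:) (rule has_weak_dz_add[OF has_weak_dz_square[OF zh C] has_weak_dz_square[OF zh C]])
  qed
  interpret R: time_rep T U V u
    by standard (simp_all add: T sV u_def cper_sqi[OF U(1)])
  have tr: "has_time_trace T u 0 u0"
  proof -
    have "has_time_trace T u 0 (R.\<rho> 0)" by (rule R.trace_exists) (use T in simp)
    moreover have "AE z in lebesgue_on circle. R.\<rho> 0 z = u0 z"
    proof -
      have "tprim T V (0, z) = 0" for z
      proof -
        have "AE s in tm T. indicator {..<0} s * V (s, z) = 0" using AE_tm_range by eventually_elim simp
        then show ?thesis unfolding tprim_def fst_conv snd_conv by (rule integral_eq_zero_AE)
      qed
      note 0 = this
      show ?thesis unfolding AE_circle R.\<rho>_def using U(2) by eventually_elim (simp add: 0)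
    qed
    moreover have "AE z in lebesgue_on circle. x (0, z) = u0 z"
      if "AE z in lebesgue_on circle. x (0, z) = R.\<rho> 0 z" "AE z in lebesgue_on circle. R.\<rho> 0 z = u0 z" for x
      using that by eventually_elim simp
    ultimately show ?thesis unfolding has_time_trace_def by blast
  qed
  note dh = weak_dz_eq(2)[OF has_weak_dz_zpair[OF zh]] and du = weak_dz_eq(2)[OF has_weak_dz_zpair[OF zu]]
    and dtu' = weak_dt_eq(2)[OF dtu] and dsq' = weak_dz_eq(2)[OF dsq]
  have hid: "h_identity T r (\<lambda>x. j x $ l) (\<lambda>z. h0 z $ l) (\<lambda>x. hv x $ l) u \<eta>" if \<eta>: "test_space T \<eta>" for \<eta> l
  proof -
    obtain w k where w: "sqi (MM T) w" and z: "zpair T (tback T w) k" and e: "AE x in MM T. \<eta> x = tback T w x"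
      "AE x in MM T. weak_dt T \<eta> x = w x" "AE x in MM T. weak_dz T \<eta> x = k x"
      "AE z in cm. time_trace T \<eta> 0 z = tback T w (0, z)" by (rule test_space_rep[OF T \<eta>])
    note wb = sqi_MM_borel[OF w] and kb = zpair_slices(2)[OF z] and sk = zpair_slices(4)[OF z]
    have 1: "(LINT x|lebesgue_on (cylinder T). H l x * weak_dt T \<eta> x) = (LINT x|MM T. h l x * w x)"
      by (rule integral_cyl_eq, intro borel_measurable_times hb wb) (use H(2)[of l T] e(2) in eventually_elim, simp)
    have 2: "(LINT x|lebesgue_on (cylinder T). r (snd x) * weak_dz T (H l) x * weak_dz T \<eta> x) = (LINT x|MM T. r (snd x) * g l x * k x)"
      by (rule integral_cyl_eq, intro borel_measurable_times rb gb kb) (use dh[of l] e(3) in eventually_elim, simp)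
    have 3: "(LINT x|lebesgue_on (cylinder T). H l x * weak_dt T u x * weak_dz T \<eta> x) = (LINT x|MM T. h l x * v x * k x)"
      by (rule integral_cyl_eq, intro borel_measurable_times hb vb kb) (use H(2)[of l T] V(2)[of T] dtu' e(3) in eventually_elim, simp)
    have 4: "(LINT x|lebesgue_on (cylinder T). r (snd x) * j x $ l * weak_dz T \<eta> x) = (LINT x|MM T. r (snd x) * J l x * k x)"
      by (rule integral_cyl_eq, intro borel_measurable_times rb J(1) kb) (use J(3)[of l] e(3) in eventually_elim, simp)
    have 5: "(LINT z|lebesgue_on circle. h0 z $ l * time_trace T \<eta> 0 z) = (LINT z|cm. h0 z $ l * tback T w (0, z))"
      by (rule integral_circle_eq, intro borel_measurable_times cper_borel[OF h0] borel_pair_section[OF zpair_slices(1)[OF z]], simp_all)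
         (use e(4) in eventually_elim, simp)
    have srg: "integrable (MM T) (\<lambda>x. r (snd x) * g l x * k x)"
      by (rule sqi_mult_integrable[OF sqi_bounded_mult[OF sg borel_MMI[OF rb], of r1] sk]) (simp add: r(2))
    have srJ: "integrable (MM T) (\<lambda>x. r (snd x) * J l x * k x)"
    proof (rule sqi_mult_integrable[OF _ sk], rule sqi_bounded_mult)
      show "sqi (MM T) (J l)" by (rule sqi_of_bounded[OF J(1,2)])
    qed (auto intro: borel_MMI[OF rb] r(2))
    have "(LINT x|MM T. ((r (snd x) * g l x - h l x * v x) - r (snd x) * J l x) * k x)
      = (LINT x|MM T. (r (snd x) * g l x * k x - h l x * v x * k x) - r (snd x) * J l x * k x)"
      by (simp only: left_diff_distrib)
    also have "\<dots> = (LINT x|MM T. r (snd x) * g l x * k x) - (LINT x|MM T. h l x * v x * k x) - (LINT x|MM T. r (snd x) * J l x * k x)"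
      using srg srJ Ih(2)[OF w z, of l] by simp
    finally show ?thesis unfolding h_identity_def hv 1 2 3 4 5 using Ih(1)[OF w z, of l] by argo
  qed
  have uid: "u_identity T \<nu> p f u1 hv u \<eta>" if \<eta>: "test_space T \<eta>" for \<eta>
  proof -
    obtain w k where w: "sqi (MM T) w" and z: "zpair T (tback T w) k" and e: "AE x in MM T. \<eta> x = tback T w x"
      "AE x in MM T. weak_dt T \<eta> x = w x" "AE x in MM T. weak_dz T \<eta> x = k x"
      "AE z in cm. time_trace T \<eta> 0 z = tback T w (0, z)" by (rule test_space_rep[OF T \<eta>])
    note wb = sqi_MM_borel[OF w] and kb = zpair_slices(2)[OF z] and sk = zpair_slices(4)[OF z] and tb = zpair_slices(1)[OF z]
    have 1: "(LINT x|lebesgue_on (cylinder T). weak_dt T u x * weak_dt T \<eta> x) = (LINT x|MM T. v x * w x)"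
      by (rule integral_cyl_eq, intro borel_measurable_times vb wb) (use V(2)[of T] dtu' e(2) in eventually_elim, simp)
    have 2: "(LINT x|lebesgue_on (cylinder T). (\<nu> (snd x))^2 * weak_dz T u x * weak_dz T \<eta> x) = (LINT x|MM T. (\<nu> (snd x))^2 * q x * k x)"
      by (rule integral_cyl_eq, intro borel_measurable_times borel_measurable_power \<nu>b qb kb) (use du e(3) in eventually_elim, simp)
    have 3: "(LINT x|lebesgue_on (cylinder T). p * weak_dz T (sq_norm2 hv) x * \<eta> x)
      = (LINT x|MM T. p * (2 * (H 1 x * g 1 x) + 2 * (H 2 x * g 2 x)) * tback T w x)"
      by (rule integral_cyl_eq, intro borel_measurable_times borel_measurable_add borel_measurable_const H(1) gb tb)
         (use dsq' e(1) in eventually_elim, simp)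
    have 4: "(LINT x|lebesgue_on (cylinder T). f x * \<eta> x) = (LINT x|MM T. F x * tback T w x)"
      by (rule integral_cyl_eq, intro borel_measurable_times F(1) tb) (use F(2) e(1) in eventually_elim, simp)
    have 5: "(LINT z|lebesgue_on circle. u1 z * time_trace T \<eta> 0 z) = (LINT z|cm. u1' z * tback T w (0, z))"
      by (rule integral_circle_eq, intro borel_measurable_times u1(1) borel_pair_section[OF tb], simp_all)
         (use u1(2) e(4) in eventually_elim, simp)
    note S = zpair_square_IBP[OF zh C z]
    have hH: "(LINT x|MM T. (H l x)^2 * k x) = (LINT x|MM T. h l x * h l x * k x)" for l
    proof (rule integral_cong_AE)
      show "AE x in MM T. (H l x)^2 * k x = h l x * h l x * k x" using H(2)[of l T] by eventually_elim (simp add: power2_eq_square)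
    qed (rule borel_MMI, intro borel_measurable_times borel_measurable_power H(1) hb kb)+
    have "(LINT x|MM T. p * (2 * (H 1 x * g 1 x) + 2 * (H 2 x * g 2 x)) * tback T w x)
      = (LINT x|MM T. p * (2 * (H 1 x * g 1 x) * tback T w x + 2 * (H 2 x * g 2 x) * tback T w x))"
      by (simp only: distrib_right distrib_left mult.assoc)
    also have "\<dots> = p * ((LINT x|MM T. 2 * (H 1 x * g 1 x) * tback T w x) + (LINT x|MM T. 2 * (H 2 x * g 2 x) * tback T w x))"
      by (simp only: Bochner_Integration.integral_mult_right_zero Bochner_Integration.integral_add[OF S(2) S(2)])
    \<comment> \<open>Here the derivative passes from the squares to the test function, with a
      change of sign.\<close>
    also have "\<dots> = - (p * (\<Sum>l\<in>(UNIV :: 2 set). LINT x|MM T. h l x * h l x * k x))"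
      unfolding S(1) hH UNIV_2 by (simp add: algebra_simps)
    finally show ?thesis unfolding u_identity_def 1 2 3 4 5 using Iu[OF w z] by argo
  qed
  have "V2 T (\<lambda>x. hv x $ l)" for l unfolding hv by (rule V2_zpair[OF zh H(3) C])
  then have "weak_solution T r \<nu> p j f h0 u0 u1 hv u"
    unfolding weak_solution_def using Wu dsq tr hid uid by blast
  then show ?thesis by blast
qed

theorem theorem4p1:
  fixes T \<alpha> p r0 r1 \<nu>0 \<nu>1 :: real
    and M :: nat
    and zs :: "nat \<Rightarrow> real"
    and r \<nu> u0 u1 :: "real \<Rightarrow> real"
    and h0 :: "real \<Rightarrow> real ^ 2"
    and j :: "real \<times> real \<Rightarrow> real ^ 2"
    and f :: "real \<times> real \<Rightarrow> real"
  defines "P \<equiv> break_points M zs"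
  assumes "0 < T"
    and "0 < \<alpha>" and "\<alpha> < 1"
    and "\<forall>l. holder_circle \<alpha> (\<lambda>z. h0 z $ l)"
    and "W12_circle u0" and "L2_circle u1"
    and "strict_mono_on {1..M} zs" and "\<forall>k\<in>{1..M}. 0 < zs k \<and> zs k < 1"
    and "periodic_fun_simple' r" and "periodic_fun_simple' \<nu>"
    and "periodic_z T j" and "periodic_z T f"
    and "piecewise_smooth P r" and "piecewise_smooth P \<nu>"
    and "piecewise_smooth_z T P j" and "piecewise_smooth_z T P f"
    and "bounded (range r)" and "bounded (range \<nu>)"
    and "bounded (j ` ({0<..<T} \<times> UNIV))" and "bounded (f ` ({0<..<T} \<times> UNIV))"
    and "\<forall>x\<in>P. \<not> isCont r x" and "\<forall>x\<in>P. \<not> isCont \<nu> x"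
    and "\<forall>x\<in>P. \<exists>t\<in>{0<..<T}. \<not> isCont j (t, x)"
    and "\<forall>x\<in>P. \<exists>t\<in>{0<..<T}. \<not> isCont f (t, x)"
    and "0 < p"
    and "0 < r0" and "0 < \<nu>0" and "0 < r1" and "0 < \<nu>1"
    and "\<forall>z. r0 \<le> r z \<and> r z \<le> r1" and "\<forall>z. \<nu>0 \<le> \<nu> z \<and> \<nu> z \<le> \<nu>1"
  shows "\<exists>h u. weak_solution T r \<nu> p j f h0 u0 u1 h u"
proof -
  have r: "r \<in> Borel" "AE z in cm. isCont r z" and \<nu>: "\<nu> \<in> Borel" "AE z in cm. isCont \<nu> z"
    using piecewise_smooth_coefficient[OF countable_break_points] assms by (auto simp: P_def)
  have rb: "r0 \<le> r z" "r z \<le> r1" "\<nu>0 \<le> \<nu> z" "\<nu> z \<le> \<nu>1" for z using assms by auto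
  have per: "periodic1 r" "periodic1 \<nu>" using assms by (auto simp: periodic1_iff)
  obtain J where J: "\<forall>t\<in>{0<..<T}. \<forall>z. norm (j (t, z)) \<le> J" "0 \<le> J"
    using \<open>bounded (j ` _)\<close> unfolding bounded_pos by (fastforce intro: less_imp_le)
  obtain K where K: "\<forall>t\<in>{0<..<T}. \<forall>z. \<bar>f (t, z)\<bar> \<le> K" "0 \<le> K"
    using \<open>bounded (f ` _)\<close> unfolding bounded_pos by (fastforce intro: less_imp_le)
  \<comment> \<open>\<open>j\<close> and \<open>f\<close> are set to 0 off the open set on which
    they are smooth, which changes them on a null set of the cylinder only.\<close>
  let ?ind = "\<lambda>x. indicator ({0<..<T} \<times> - P) x :: real"
  have P: "countable P" "closed P" "\<And>z. z + 1 \<in> P \<longleftrightarrow> z \<in> P"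
    unfolding P_def by (rule countable_break_points closed_break_points break_points_shift)+
  note source = piecewise_smooth_source[OF P]
  have jc: "\<forall>x\<in>{0<..<T} \<times> - P. isCont (\<lambda>x. j x $ l) x" for l
    using smooth_on_isCont[of _ j] \<open>piecewise_smooth_z T P j\<close> by (auto simp: piecewise_smooth_z_def intro!: continuous_component)
  have fc: "\<forall>x\<in>{0<..<T} \<times> - P. isCont f x"
    using smooth_on_isCont \<open>piecewise_smooth_z T P f\<close> by (auto simp: piecewise_smooth_z_def)
  have jp: "periodic_z T (\<lambda>x. j x $ l)" for l
    using \<open>periodic_z T j\<close> by (auto simp: periodic_z_def periodic_fun_simple'_def)
  have jb: "\<forall>t\<in>{0<..<T}. \<forall>z. \<bar>j (t, z) $ l\<bar> \<le> J" for l
    using J(1) by (auto intro: order_trans[OF component_le_norm_cart])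
  note j' = source[OF jc jp jb J(2)] and f' = source[OF fc \<open>periodic_z T f\<close> K]
  have h0: "cper (\<lambda>z. h0 z $ l)" for l using holder_continuous assms by blast
  \<comment> \<open>The scheme starts from continuous data, so \<open>u0\<close> is replaced by its
    continuous representative; the initial condition is an equality almost everywhere.\<close>
  obtain U W where U: "cper U" "\<forall>d. 0 < d \<longrightarrow> d \<le> 1 \<longrightarrow> nsq (Dp d U) \<le> W" "AE z in cm. u0 z = U z"
    by (rule W12_circle_rep[OF \<open>W12_circle u0\<close>]) blast
  obtain b where b: "sqi cm b" "b \<in> Borel" "AE z in cm. u1 z = b z"
    using L2_on_circle_rep \<open>L2_circle u1\<close> unfolding L2_circle_def by blast
  note bf = pL2_frac[OF b(1)]
  have u1: "AE z in cm. u1 z = b (frac z)" using b(3) bf(2) by eventually_elim simp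
  obtain h g v q where W: "weak_form T p r \<nu> (\<lambda>l x. ?ind x * (j x $ l)) (\<lambda>x. ?ind x * f x) (\<lambda>l z. h0 z $ l) U (\<lambda>z. b (frac z)) h g v q"
  proof -
    have "\<exists>h g v q. weak_form T p r \<nu> (\<lambda>l x. ?ind x * (j x $ l)) (\<lambda>x. ?ind x * f x) (\<lambda>l z. h0 z $ l) U (\<lambda>z. b (frac z)) h g v q"
      by (rule weak_form_exists[OF \<open>0 < T\<close> \<open>0 < p\<close> \<open>0 < r0\<close> \<open>0 < \<nu>0\<close>, where J=J and K=K and W=W])
         (rule r \<nu> per rb j' f' h0 U(1) U(2)[rule_format] bf(1) | assumption)+
    then show ?thesis using that by blast
  qed
  have ab: "\<bar>r z\<bar> \<le> r1" "\<bar>\<nu> z\<bar> \<le> \<nu>1" for z using rb[of z] \<open>0 < r0\<close> \<open>0 < \<nu>0\<close> by auto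
  have "(\<lambda>z. b (frac z)) \<in> Borel" by (rule borel_frac[OF b(2)])
  then show ?thesis
    using weak_solution_of_weak_form[OF \<open>0 < T\<close> W r(1) ab(1) \<nu>(1) ab(2) j'(1,2,5) f'(1,5) h0 U(1,3) _ u1] by blast
qed

end
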